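(* Let $\Omega\subset\mathbb{R}^N$ ($N\ge 1$) be a bounded smooth domain and let $f:\Omega\times\mathbb{R}\to\mathbb{R}$ be a Carath\'eodory function satisfying: $(f_1)$ for a.e. $x\in\Omega$, $t\mapsto f(x,t)/t$ is increasing on $(0,\infty)$ and decreasing on $(-\infty,0)$; the limits $\alpha(x):=\lim_{t\to0}f(x,t)/t\ge 0$ and $\eta(x):=\lim_{|t|\to\infty}f(x,t)/t$ exist a.e. and $\alpha,\eta\in L^\infty(\Omega)$; $(f_2)$ $\lambda_m(\eta)<1<\lambda_1(\alpha)$ for some integer $m\ge1$. Suppose moreover that $$\operatorname*{ess\,inf}_{x\in\Omega}\beta(x)>\frac{|\eta|_\infty\,\tau^2}{2\lambda_1(\eta-\alpha)\,S(\Omega)^{N/2}},\qquad \tau:=\inf_{u\in\mathcal{S}_{\mathcal{A}}}t_u .$$ Then problem $-\Delta u=f(x,u)$ in $\Omega$, $u=0$ on $\partial\Omega$, has a weak solution $u\in\mathcal{N}$ with $I(u)=c_{\mathcal{N}}:=\inf_{v\in\mathcal{N}}I(v)$ (a ground state, at the level $c_{\mathcal N}=\inf_{v\in\mathcal{S}_{\mathcal A}}\max_{t>0}I(tv)$) which does not change sign (i.e. $u\ge0$ a.e. or $u\le0$ a.e.).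
   Context: $H_0^1(\Omega)$ carries the norm $\|u\|^2=\int_\Omega|\nabla u|^2dx$; $|\cdot|_p$ is the $L^p(\Omega)$ norm. For $\theta\in L^\infty(\Omega)$, $\lambda_1(\theta)<\lambda_2(\theta)<\cdots$ denote the (distinct) positive eigenvalues of $-\Delta u=\lambda\theta(x)u$ in $\Omega$, $u=0$ on $\partial\Omega$; by convention $\lambda_1(0)=\infty$. $F(x,t)=\int_0^tf(x,s)ds$, and $I(u)=\frac12\|u\|^2-\int_\Omega F(x,u)dx$ on $H_0^1(\Omega)$; weak solutions are critical points of $I$. $\mathcal{N}=\{u\in H_0^1(\Omega)\setminus\{0\}:\|u\|^2=\int_\Omega f(x,u)u\,dx\}$. $\mathcal{S}$ is the unit sphere of $H_0^1(\Omega)$, $\mathcal{A}=\{u\in H_0^1(\Omega):\|u\|^2<\int_\Omega\eta u^2dx\}$, $\mathcal{S}_{\mathcal A}=\mathcal S\cap\mathcal A$. For $u\in\mathcal A$, $t_u$ denotes the unique $t>0$ with $tu\in\mathcal N$. $\beta(x):=\lim_{|t|\to\infty}[\frac12 f(x,t)t-F(x,t)]\in(0,\infty]$. $1/S(\Omega)$ is the best constant of the Sobolev embedding $H_0^1(\Omega)\hookrightarrow L^{2^*}(\Omega)$, $2^*=2N/(N-2)$, i.e. $|u|_{2^*}^2\le S(\Omega)^{-1}\|u\|^2$.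
   Formalization: The statement is formalized for N ≥ 3 instead of N ≥ 1, because 2* = 2N/(N−2), and with it the Sobolev constant S(Ω) in the hypothesis, is undefined for N = 2 and gives the meaningless exponent −2 for N = 1. *)

theory Defs
  imports "HOL-Analysis.Analysis"
begin

definition pd :: "'n::finite \<Rightarrow> (real^'n \<Rightarrow> real) \<Rightarrow> real^'n \<Rightarrow> real" where
  "pd i g x = deriv (\<lambda>t. g (x + t *\<^sub>R axis i 1)) 0"

fun iter_pd :: "'n::finite list \<Rightarrow> (real^'n \<Rightarrow> real) \<Rightarrow> real^'n \<Rightarrow> real" where
  "iter_pd [] g = g"
| "iter_pd (i # is) g = pd i (iter_pd is g)"

definition smooth_on :: "(real^'n::finite) set \<Rightarrow> (real^'n \<Rightarrow> real) \<Rightarrow> bool" where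
  "smooth_on U g \<longleftrightarrow> (\<forall>is. continuous_on U (iter_pd is g) \<and>
      (\<forall>i. \<forall>x\<in>U. (\<lambda>t. iter_pd is g (x + t *\<^sub>R axis i 1)) differentiable (at 0)))"

definition cgrad :: "(real^'n::finite \<Rightarrow> real) \<Rightarrow> real^'n \<Rightarrow> real^'n" where
  "cgrad g x = (\<chi> i. pd i g x)"

definition smooth_bounded_domain :: "(real^'n::finite) set \<Rightarrow> bool" where
  "smooth_bounded_domain \<Omega> \<longleftrightarrow> open \<Omega> \<and> bounded \<Omega> \<and> connected \<Omega> \<and> \<Omega> \<noteq> {} \<and>
     (\<forall>p\<in>frontier \<Omega>. \<exists>U \<psi>. open U \<and> p \<in> U \<and> smooth_on U \<psi> \<and> cgrad \<psi> p \<noteq> 0 \<and>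
          \<Omega> \<inter> U = {x\<in>U. \<psi> x < 0})"

definition test_fun :: "(real^'n::finite) set \<Rightarrow> (real^'n \<Rightarrow> real) \<Rightarrow> bool" where
  "test_fun \<Omega> \<phi> \<longleftrightarrow> smooth_on UNIV \<phi> \<and> compact (closure {x. \<phi> x \<noteq> 0}) \<and>
      closure {x. \<phi> x \<noteq> 0} \<subseteq> \<Omega>"

abbreviation "L \<Omega> \<equiv> lebesgue_on \<Omega>"

definition L2 :: "(real^'n::finite) set \<Rightarrow> (real^'n \<Rightarrow> real) set" where
  "L2 \<Omega> = {u. u \<in> borel_measurable (L \<Omega>) \<and> integrable (L \<Omega>) (\<lambda>x. (u x)^2)}"

definition L2vec :: "(real^'n::finite) set \<Rightarrow> (real^'n \<Rightarrow> real^'n) set" where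
  "L2vec \<Omega> = {G. G \<in> borel_measurable (L \<Omega>) \<and> integrable (L \<Omega>) (\<lambda>x. (norm (G x))^2)}"

definition Linf :: "(real^'n::finite) set \<Rightarrow> (real^'n \<Rightarrow> real) set" where
  "Linf \<Omega> = {u. u \<in> borel_measurable (L \<Omega>) \<and> (\<exists>C. AE x in L \<Omega>. \<bar>u x\<bar> \<le> C)}"

definition has_weak_gradient :: "(real^'n::finite) set \<Rightarrow> (real^'n \<Rightarrow> real) \<Rightarrow> (real^'n \<Rightarrow> real^'n) \<Rightarrow> bool" where
  "has_weak_gradient \<Omega> u G \<longleftrightarrow> (\<forall>\<phi> i. test_fun \<Omega> \<phi> \<longrightarrow>
      integrable (L \<Omega>) (\<lambda>x. u x * pd i \<phi> x) \<and> integrable (L \<Omega>) (\<lambda>x. G x $ i * \<phi> x) \<and>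
      (LINT x|L \<Omega>. u x * pd i \<phi> x) = - (LINT x|L \<Omega>. G x $ i * \<phi> x))"

definition H01 :: "(real^'n::finite) set \<Rightarrow> (real^'n \<Rightarrow> real) set" where
  "H01 \<Omega> = {u. u \<in> L2 \<Omega> \<and> (\<exists>G. G \<in> L2vec \<Omega> \<and> has_weak_gradient \<Omega> u G \<and>
      (\<exists>\<phi>::nat \<Rightarrow> real^'n \<Rightarrow> real. (\<forall>k. test_fun \<Omega> (\<phi> k)) \<and>
         (\<lambda>k. LINT x|L \<Omega>. (\<phi> k x - u x)^2) \<longlonglongrightarrow> 0 \<and>
         (\<lambda>k. LINT x|L \<Omega>. (norm (cgrad (\<phi> k) x - G x))^2) \<longlonglongrightarrow> 0))}"

definition wgrad :: "(real^'n::finite) set \<Rightarrow> (real^'n \<Rightarrow> real) \<Rightarrow> real^'n \<Rightarrow> real^'n" where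
  "wgrad \<Omega> u = (SOME G. G \<in> L2vec \<Omega> \<and> has_weak_gradient \<Omega> u G)"

definition hnorm :: "(real^'n::finite) set \<Rightarrow> (real^'n \<Rightarrow> real) \<Rightarrow> real" where
  "hnorm \<Omega> u = sqrt (LINT x|L \<Omega>. (norm (wgrad \<Omega> u x))^2)"

definition is_zero :: "(real^'n::finite) set \<Rightarrow> (real^'n \<Rightarrow> real) \<Rightarrow> bool" where
  "is_zero \<Omega> u \<longleftrightarrow> (AE x in L \<Omega>. u x = 0)"

definition Lp_norm :: "(real^'n::finite) set \<Rightarrow> real \<Rightarrow> (real^'n \<Rightarrow> real) \<Rightarrow> real" where
  "Lp_norm \<Omega> p u = (LINT x|L \<Omega>. \<bar>u x\<bar> powr p) powr (1/p)"

definition Linf_norm :: "(real^'n::finite) set \<Rightarrow> (real^'n \<Rightarrow> real) \<Rightarrow> real" where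
  "Linf_norm \<Omega> u = Inf {c. AE x in L \<Omega>. \<bar>u x\<bar> \<le> c}"

definition ess_inf_ereal :: "(real^'n::finite) set \<Rightarrow> (real^'n \<Rightarrow> ereal) \<Rightarrow> ereal" where
  "ess_inf_ereal \<Omega> b = Sup {c. AE x in L \<Omega>. c \<le> b x}"

definition pos_eigs :: "(real^'n::finite) set \<Rightarrow> (real^'n \<Rightarrow> real) \<Rightarrow> real set" where
  "pos_eigs \<Omega> \<theta> = {lam. lam > 0 \<and> (\<exists>u\<in>H01 \<Omega>. \<not> is_zero \<Omega> u \<and>
     (\<forall>\<phi>\<in>H01 \<Omega>. (LINT x|L \<Omega>. wgrad \<Omega> u x \<bullet> wgrad \<Omega> \<phi> x) =
                  lam * (LINT x|L \<Omega>. \<theta> x * u x * \<phi> x)))}"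

text \<open>lambda_k(theta): the k-th smallest distinct positive eigenvalue (k >= 1), infinity if it does
  not exist (in particular lambda_1(0) = infinity).\<close>
definition eig :: "(real^'n::finite) set \<Rightarrow> (real^'n \<Rightarrow> real) \<Rightarrow> nat \<Rightarrow> ereal" where
  "eig \<Omega> \<theta> k = Inf (ereal ` {lam\<in>pos_eigs \<Omega> \<theta>. finite {\<mu>\<in>pos_eigs \<Omega> \<theta>. \<mu> \<le> lam} \<and>
                                   card {\<mu>\<in>pos_eigs \<Omega> \<theta>. \<mu> \<le> lam} = k})"

definition Fprim :: "(real^'n::finite \<Rightarrow> real \<Rightarrow> real) \<Rightarrow> real^'n \<Rightarrow> real \<Rightarrow> real" where
  "Fprim f x t = (LBINT s=0..t. f x s)"

definition Ifun :: "(real^'n::finite) set \<Rightarrow> (real^'n \<Rightarrow> real \<Rightarrow> real) \<Rightarrow> (real^'n \<Rightarrow> real) \<Rightarrow> real" where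
  "Ifun \<Omega> f u = (hnorm \<Omega> u)^2 / 2 - (LINT x|L \<Omega>. Fprim f x (u x))"

definition Nehari :: "(real^'n::finite) set \<Rightarrow> (real^'n \<Rightarrow> real \<Rightarrow> real) \<Rightarrow> (real^'n \<Rightarrow> real) set" where
  "Nehari \<Omega> f = {u\<in>H01 \<Omega>. \<not> is_zero \<Omega> u \<and> (hnorm \<Omega> u)^2 = (LINT x|L \<Omega>. f x (u x) * u x)}"

definition weak_solution :: "(real^'n::finite) set \<Rightarrow> (real^'n \<Rightarrow> real \<Rightarrow> real) \<Rightarrow> (real^'n \<Rightarrow> real) \<Rightarrow> bool" where
  "weak_solution \<Omega> f u \<longleftrightarrow> u \<in> H01 \<Omega> \<and> (\<forall>\<phi>\<in>H01 \<Omega>.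
      integrable (L \<Omega>) (\<lambda>x. f x (u x) * \<phi> x) \<and>
      (LINT x|L \<Omega>. wgrad \<Omega> u x \<bullet> wgrad \<Omega> \<phi> x) = (LINT x|L \<Omega>. f x (u x) * \<phi> x))"

definition Aset :: "(real^'n::finite) set \<Rightarrow> (real^'n \<Rightarrow> real) \<Rightarrow> (real^'n \<Rightarrow> real) set" where
  "Aset \<Omega> \<eta> = {u\<in>H01 \<Omega>. (hnorm \<Omega> u)^2 < (LINT x|L \<Omega>. \<eta> x * (u x)^2)}"

definition SA :: "(real^'n::finite) set \<Rightarrow> (real^'n \<Rightarrow> real) \<Rightarrow> (real^'n \<Rightarrow> real) set" where
  "SA \<Omega> \<eta> = {u\<in>Aset \<Omega> \<eta>. hnorm \<Omega> u = 1}"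

definition t_of :: "(real^'n::finite) set \<Rightarrow> (real^'n \<Rightarrow> real \<Rightarrow> real) \<Rightarrow> (real^'n \<Rightarrow> real) \<Rightarrow> real" where
  "t_of \<Omega> f u = (THE t. t > 0 \<and> (\<lambda>x. t * u x) \<in> Nehari \<Omega> f)"

definition beta :: "(real^'n::finite \<Rightarrow> real \<Rightarrow> real) \<Rightarrow> real^'n \<Rightarrow> ereal" where
  "beta f x = Lim at_infinity (\<lambda>t. ereal (f x t * t / 2 - Fprim f x t))"

definition crit_exp :: "'n::finite itself \<Rightarrow> real" where
  "crit_exp _ = 2 * real CARD('n) / (real CARD('n) - 2)"

definition sobolev_S :: "(real^'n::finite) set \<Rightarrow> real" where
  "sobolev_S \<Omega> = Inf {(hnorm \<Omega> u)^2 / (Lp_norm \<Omega> (crit_exp TYPE('n)) u)^2 | u.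
                         u \<in> H01 \<Omega> \<and> \<not> is_zero \<Omega> u}"

definition caratheodory :: "(real^'n::finite) set \<Rightarrow> (real^'n \<Rightarrow> real \<Rightarrow> real) \<Rightarrow> bool" where
  "caratheodory \<Omega> f \<longleftrightarrow> (\<forall>t. (\<lambda>x. f x t) \<in> borel_measurable (L \<Omega>)) \<and>
      (AE x in L \<Omega>. continuous_on UNIV (f x))"

end

theory Submission
  imports Defs "HOL-Complex_Analysis.Great_Picard"
begin

text \<open>On each ray the functional \<open>I\<close> is maximal exactly at the Nehari set, and a ray meets the Nehari set
  iff it is spanned by some \<open>u\<close> with \<open>|u|\<^sup>2 < \<integral>\<eta>u\<^sup>2\<close>. Normalise a minimising sequence: its \<open>L\<^sup>2\<close> limit \<open>v\<close>
  satisfies \<open>|v|\<^sup>2 \<le> 1 \<le> \<integral>\<eta>v\<^sup>2\<close> and \<open>I(sv) \<le> c\<close> for all \<open>s \<ge> 0\<close>. If the inequality is strict, the point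
  of the Nehari set on the ray of \<open>v\<close> is a minimiser. Otherwise \<open>v\<close> is resonant, and so is its
  positive or negative part; comparing the increasing function \<open>\<integral>(\<eta>u\<^sup>2/2 - F(x,u))\<close> along rays, this part
  would be a sign-definite extremal for \<open>\<eta>\<close>, which is impossible because \<open>\<lambda>\<^sub>m(\<eta>) < 1\<close>. A minimiser has one sign
  since the positive part of a sign-changing critical point projects onto the Nehari set at a lower level.\<close>

subsection \<open>Square integrable functions\<close>

text \<open>The obstacle is that the Nehari set is unbounded: along a minimising sequence the scales
  may tend to infinity, so only the directions converge. The nonlinear part of I is continuous for
  L2 convergence, and therefore the upper bounds along whole rays survive in the limit although the
  scales are lost. The ray of a limit v with |v|^2 equal to the weighted integral never meets the
  Nehari set, and this case has to be excluded. On such a ray I is the integral of \<eta>u^2/2 -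
  F(x,u). Where v is positive, the ray eventually exceeds every competitor of the same sign; where v
  vanishes, a competitor w gains at most K w^2/2 with K bounding |\<alpha>| + |\<eta>|. Lowering
  \<eta> by K off the set {v > 0} thus gives a weight whose quadratic form is dominated by the
  Dirichlet form and for which v is extremal. The strong maximum principle makes {v = 0} a null set,
  so the lowered weight is \<eta> itself, against an eigenvalue below 1. Since f(x,t) is only
  continuous in t, the Nehari set need not be a manifold, and criticality of minimisers comes from
  difference quotients along projected curves.\<close>

definition sqint :: "'a measure \<Rightarrow> ('a \<Rightarrow> 'b::euclidean_space) set" where
  "sqint M = {F \<in> borel_measurable M. integrable M (\<lambda>x. (norm (F x))^2)}"

definition l2n :: "'a measure \<Rightarrow> ('a \<Rightarrow> 'b::euclidean_space) \<Rightarrow> real" where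
  "l2n M F = sqrt (LINT x|M. (norm (F x))^2)"

lemma sqintD: "F \<in> sqint M \<Longrightarrow> F \<in> borel_measurable M"
  "F \<in> sqint M \<Longrightarrow> integrable M (\<lambda>x. (norm (F x))^2)"
  by (auto simp: sqint_def)

lemma l2n_nonneg [simp]: "0 \<le> l2n M F"
  by (simp add: l2n_def)

lemma l2n_power2: "(l2n M F)^2 = (LINT x|M. (norm (F x))^2)"
  by (simp add: l2n_def)

lemma sqint_inner:
  fixes F G :: "'a \<Rightarrow> 'b::euclidean_space"
  assumes "F \<in> sqint M" "G \<in> sqint M"
  shows "integrable M (\<lambda>x. F x \<bullet> G x)"
proof (rule Bochner_Integration.integrable_bound)
  show "integrable M (\<lambda>x. (norm (F x))^2 + (norm (G x))^2)"
    using assms by (auto simp: sqint_def)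
  show "(\<lambda>x. F x \<bullet> G x) \<in> borel_measurable M"
    using assms by (auto simp: sqint_def)
  show "AE x in M. norm (F x \<bullet> G x) \<le> norm ((norm (F x))^2 + (norm (G x))^2)"
  proof (rule AE_I2)
    fix x
    have "norm (F x \<bullet> G x) \<le> norm (F x) * norm (G x)"
      by (simp add: Cauchy_Schwarz_ineq2)
    also have "\<dots> \<le> (norm (F x))^2 + (norm (G x))^2"
      using sum_squares_bound[of "norm (F x)" "norm (G x)"]
        mult_nonneg_nonneg[OF norm_ge_zero[of "F x"] norm_ge_zero[of "G x"]] by linarith
    finally show "norm (F x \<bullet> G x) \<le> norm ((norm (F x))^2 + (norm (G x))^2)" by simp
  qed
qed

lemma sqint_mult:
  fixes u v :: "'a \<Rightarrow> real"
  assumes "u \<in> sqint M" "v \<in> sqint M"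
  shows "integrable M (\<lambda>x. u x * v x)"
  using sqint_inner[OF assms] by simp

lemma norm_add_sq: "(norm (a + b :: 'b::real_inner))^2 = (norm a)^2 + 2 * (a \<bullet> b) + (norm b)^2"
  by (simp add: power2_norm_eq_inner inner_add_left inner_add_right inner_commute)

lemma sqint_add:
  fixes F G :: "'a \<Rightarrow> 'b::euclidean_space"
  assumes "F \<in> sqint M" "G \<in> sqint M"
  shows "(\<lambda>x. F x + G x) \<in> sqint M"
  using assms sqint_inner[OF assms] by (auto simp: sqint_def norm_add_sq)

lemma sqint_scaleR:
  fixes F :: "'a \<Rightarrow> 'b::euclidean_space"
  assumes "F \<in> sqint M"
  shows "(\<lambda>x. c *\<^sub>R F x) \<in> sqint M"
  using assms by (auto simp: sqint_def power_mult_distrib)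

lemma sqint_cmult:
  fixes F :: "'a \<Rightarrow> real"
  assumes "F \<in> sqint M"
  shows "(\<lambda>x. c * F x) \<in> sqint M"
  using sqint_scaleR[OF assms, of c] by simp

lemma sqint_diff:
  fixes F G :: "'a \<Rightarrow> 'b::euclidean_space"
  assumes "F \<in> sqint M" "G \<in> sqint M"
  shows "(\<lambda>x. F x - G x) \<in> sqint M"
  using sqint_add[OF assms(1) sqint_scaleR[OF assms(2), of "-1"]] by simp

lemma sqint_AE_cong:
  fixes F G :: "'a \<Rightarrow> 'b::euclidean_space"
  assumes "F \<in> sqint M" "G \<in> borel_measurable M" "AE x in M. G x = F x"
  shows "G \<in> sqint M"
proof -
  have "integrable M (\<lambda>x. (norm (G x))^2) = integrable M (\<lambda>x. (norm (F x))^2)"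
    by (rule integrable_cong_AE) (use assms in \<open>auto simp: sqint_def\<close>)
  then show ?thesis using assms by (auto simp: sqint_def)
qed

lemma l2n_AE_cong:
  fixes F G :: "'a \<Rightarrow> 'b::euclidean_space"
  assumes "F \<in> borel_measurable M" "G \<in> borel_measurable M" "AE x in M. G x = F x"
  shows "l2n M G = l2n M F"
proof -
  have "(LINT x|M. (norm (G x))^2) = (LINT x|M. (norm (F x))^2)"
    by (rule integral_cong_AE) (use assms in auto)
  then show ?thesis by (simp add: l2n_def)
qed

lemma sqint_bounded_mult:
  fixes F :: "'a \<Rightarrow> 'b::euclidean_space"
  assumes "F \<in> sqint M" "g \<in> borel_measurable M" "AE x in M. \<bar>g x\<bar> \<le> C"
  shows "(\<lambda>x. g x *\<^sub>R F x) \<in> sqint M"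
proof -
  have "integrable M (\<lambda>x. (norm (g x *\<^sub>R F x))^2)"
  proof (rule Bochner_Integration.integrable_bound)
    show "integrable M (\<lambda>x. C^2 * (norm (F x))^2)"
      using assms by (auto simp: sqint_def)
    show "AE x in M. norm ((norm (g x *\<^sub>R F x))^2) \<le> norm (C^2 * (norm (F x))^2)"
      using assms(3)
    proof eventually_elim
      case (elim x)
      have "\<bar>g x\<bar>^2 \<le> C^2" using elim by (intro power_mono) auto
      then show ?case by (simp add: power_mult_distrib mult_right_mono)
    qed
  qed (use assms in \<open>auto simp: sqint_def\<close>)
  then show ?thesis using assms by (auto simp: sqint_def)
qed

lemma sqint_dominated:
  fixes F :: "'a \<Rightarrow> 'b::euclidean_space" and G :: "'a \<Rightarrow> 'c::euclidean_space"
  assumes "F \<in> sqint M" "G \<in> borel_measurable M" "AE x in M. norm (G x) \<le> norm (F x)"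
  shows "G \<in> sqint M" "l2n M G \<le> l2n M F"
proof -
  have le: "AE x in M. (norm (G x))^2 \<le> (norm (F x))^2"
    using assms(3) by eventually_elim (simp add: power_mono)
  have i: "integrable M (\<lambda>x. (norm (G x))^2)"
    by (rule Bochner_Integration.integrable_bound[OF sqintD(2)[OF assms(1)]])
      (use assms le in auto)
  then show "G \<in> sqint M" using assms by (auto simp: sqint_def)
  show "l2n M G \<le> l2n M F"
    unfolding l2n_def using integral_mono_AE[OF i sqintD(2)[OF assms(1)] le] by simp
qed

text \<open>A quadratic that is nonnegative on the line has nonpositive discriminant. The case
  \<open>c = 0\<close> is included because the forms it is applied to may degenerate; with
  \<open>a = 0\<close> the conclusion forces \<open>b = 0\<close>, which is how first-order
  conditions are read off later.\<close>

lemma quadratic_nonneg_discriminant: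
  fixes a b c :: real
  assumes "\<And>t. 0 \<le> a + 2 * t * b + t^2 * c" and "c \<ge> 0"
  shows "b^2 \<le> a * c"
proof (cases "c = 0")
  case True
  have "b = 0"
  proof (rule ccontr)
    assume "b \<noteq> 0"
    \<comment> \<open>The argument is chosen so that \<open>a + 2 * t * b\<close> equals -1.\<close>
    then show False using assms(1)[of "-(a+1)/(2*b)"] True by (simp add: field_simps)
  qed
  then show ?thesis using True by simp
next
  case False
  then have "c > 0" using assms(2) by simp
  have "0 \<le> (a + 2 * (-b/c) * b + (-b/c)^2 * c) * c"
    using assms(1)[of "-b/c"] \<open>c > 0\<close> by (intro mult_nonneg_nonneg) auto
  also have "\<dots> = a * c - b^2"
    using \<open>c > 0\<close> by (simp add: field_simps power2_eq_square)
  finally show ?thesis by simp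
qed

lemma l2n_scaleR: "l2n M (\<lambda>x. c *\<^sub>R F x) = \<bar>c\<bar> * l2n M F"
  by (simp add: l2n_def power_mult_distrib real_sqrt_mult)

lemma l2n_cmult: "l2n M (\<lambda>x. c * F x :: real) = \<bar>c\<bar> * l2n M F"
  using l2n_scaleR[of M c F] by simp

lemma l2n_add_sq:
  fixes F G :: "'a \<Rightarrow> 'b::euclidean_space"
  assumes "F \<in> sqint M" "G \<in> sqint M"
  shows "(l2n M (\<lambda>x. F x + G x))^2 = (l2n M F)^2 + 2 * (LINT x|M. F x \<bullet> G x) + (l2n M G)^2"
  using assms sqint_inner[OF assms] by (simp add: l2n_power2 norm_add_sq sqint_def)

lemma l2n_Cauchy_Schwarz:
  fixes F G :: "'a \<Rightarrow> 'b::euclidean_space"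
  assumes "F \<in> sqint M" "G \<in> sqint M"
  shows "\<bar>LINT x|M. F x \<bullet> G x\<bar> \<le> l2n M F * l2n M G"
proof -
  have "(LINT x|M. F x \<bullet> G x)^2 \<le> (l2n M F)^2 * (l2n M G)^2"
  proof (rule quadratic_nonneg_discriminant)
    fix t :: real
    have "0 \<le> (l2n M (\<lambda>x. F x + t *\<^sub>R G x))^2" by simp
    also have "\<dots> = (l2n M F)^2 + 2 * t * (LINT x|M. F x \<bullet> G x) + t^2 * (l2n M G)^2"
      using l2n_add_sq[OF assms(1) sqint_scaleR[OF assms(2)], of t]
      by (simp add: l2n_scaleR power_mult_distrib)
    finally show "0 \<le> (l2n M F)^2 + 2 * t * (LINT x|M. F x \<bullet> G x) + t^2 * (l2n M G)^2" .
  qed simp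
  then have "\<bar>LINT x|M. F x \<bullet> G x\<bar>^2 \<le> (l2n M F * l2n M G)^2"
    by (simp add: power_mult_distrib)
  then show ?thesis by (rule power2_le_imp_le) simp
qed

lemma l2n_Cauchy_Schwarz_real:
  fixes u v :: "'a \<Rightarrow> real"
  assumes "u \<in> sqint M" "v \<in> sqint M"
  shows "\<bar>LINT x|M. u x * v x\<bar> \<le> l2n M u * l2n M v"
  using l2n_Cauchy_Schwarz[OF assms] by simp

lemma l2n_triangle:
  fixes F G :: "'a \<Rightarrow> 'b::euclidean_space"
  assumes "F \<in> sqint M" "G \<in> sqint M"
  shows "l2n M (\<lambda>x. F x + G x) \<le> l2n M F + l2n M G"
proof (rule power2_le_imp_le)
  show "(l2n M (\<lambda>x. F x + G x))^2 \<le> (l2n M F + l2n M G)^2"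
    using l2n_add_sq[OF assms] l2n_Cauchy_Schwarz[OF assms]
    by (simp add: power2_sum)
qed simp

lemma l2n_minus_commute:
  "l2n M (\<lambda>x. F x - G x) = l2n M (\<lambda>x. G x - F x)"
  by (simp add: l2n_def norm_minus_commute)

lemma l2n_triangle_diff:
  fixes F G H :: "'a \<Rightarrow> 'b::euclidean_space"
  assumes "F \<in> sqint M" "G \<in> sqint M" "H \<in> sqint M"
  shows "l2n M (\<lambda>x. F x - H x) \<le> l2n M (\<lambda>x. F x - G x) + l2n M (\<lambda>x. G x - H x)"
  using l2n_triangle[OF sqint_diff[OF assms(1,2)] sqint_diff[OF assms(2,3)]] by simp

lemma l2n_le_add_diff:
  fixes F G :: "'a \<Rightarrow> 'b::euclidean_space"
  assumes "F \<in> sqint M" "G \<in> sqint M"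
  shows "l2n M F \<le> l2n M G + l2n M (\<lambda>x. F x - G x)"
  using l2n_triangle[OF assms(2) sqint_diff[OF assms]] by simp

lemma l2n_eq_0_iff:
  fixes F :: "'a \<Rightarrow> 'b::euclidean_space"
  assumes "F \<in> sqint M"
  shows "l2n M F = 0 \<longleftrightarrow> (AE x in M. F x = 0)"
proof -
  have "l2n M F = 0 \<longleftrightarrow> (LINT x|M. (norm (F x))^2) = 0" by (simp add: l2n_def)
  also have "\<dots> \<longleftrightarrow> (AE x in M. (norm (F x))^2 = 0)"
    by (rule integral_nonneg_eq_0_iff_AE) (use assms in \<open>auto simp: sqint_def\<close>)
  finally show ?thesis by simp
qed

lemma l2n_tendsto_iff:
  "((\<lambda>k. l2n M (F k)) \<longlonglongrightarrow> 0) \<longleftrightarrow> ((\<lambda>k. LINT x|M. (norm (F k x))^2) \<longlonglongrightarrow> 0)"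
proof
  assume "(\<lambda>k. l2n M (F k)) \<longlonglongrightarrow> 0"
  then have "(\<lambda>k. (l2n M (F k))^2) \<longlonglongrightarrow> 0^2" by (rule tendsto_power)
  then show "(\<lambda>k. LINT x|M. (norm (F k x))^2) \<longlonglongrightarrow> 0" by (simp add: l2n_power2)
next
  assume "(\<lambda>k. LINT x|M. (norm (F k x))^2) \<longlonglongrightarrow> 0"
  then have "(\<lambda>k. sqrt (LINT x|M. (norm (F k x))^2)) \<longlonglongrightarrow> sqrt 0" by (rule tendsto_real_sqrt)
  then show "(\<lambda>k. l2n M (F k)) \<longlonglongrightarrow> 0" by (simp add: l2n_def)
qed

lemma l2n_tendsto:
  fixes F :: "nat \<Rightarrow> 'a \<Rightarrow> 'b::euclidean_space"
  assumes "\<And>k. F k \<in> sqint M" "G \<in> sqint M" "(\<lambda>k. l2n M (\<lambda>x. F k x - G x)) \<longlonglongrightarrow> 0"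
  shows "(\<lambda>k. l2n M (F k)) \<longlonglongrightarrow> l2n M G"
proof (rule LIM_zero_cancel, rule Lim_null_comparison[OF _ assms(3)], rule always_eventually, rule allI)
  fix k
  show "norm (l2n M (F k) - l2n M G) \<le> l2n M (\<lambda>x. F k x - G x)"
    using l2n_le_add_diff[OF assms(1)[of k] assms(2)] l2n_le_add_diff[OF assms(2) assms(1)[of k]]
      l2n_minus_commute[of M "F k" G] by (simp add: abs_le_iff)
qed

lemma l2n_inner_tendsto:
  fixes F :: "nat \<Rightarrow> 'a \<Rightarrow> 'b::euclidean_space"
  assumes "\<And>k. F k \<in> sqint M" "G \<in> sqint M" "(\<lambda>k. l2n M (\<lambda>x. F k x - G x)) \<longlonglongrightarrow> 0"
    and "\<And>k. F' k \<in> sqint M" "G' \<in> sqint M" "(\<lambda>k. l2n M (\<lambda>x. F' k x - G' x)) \<longlonglongrightarrow> 0"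
  shows "(\<lambda>k. LINT x|M. F k x \<bullet> F' k x) \<longlonglongrightarrow> (LINT x|M. G x \<bullet> G' x)"
proof (rule LIM_zero_cancel, rule Lim_null_comparison)
  show "(\<lambda>k. l2n M (\<lambda>x. F k x - G x) * l2n M (F' k) + l2n M G * l2n M (\<lambda>x. F' k x - G' x)) \<longlonglongrightarrow> 0"
    using tendsto_add[OF tendsto_mult[OF assms(3) l2n_tendsto[OF assms(4-6)]]
        tendsto_mult[OF tendsto_const[of "l2n M G"] assms(6)]] by simp
  show "\<forall>\<^sub>F k in sequentially. norm ((LINT x|M. F k x \<bullet> F' k x) - (LINT x|M. G x \<bullet> G' x))
     \<le> l2n M (\<lambda>x. F k x - G x) * l2n M (F' k) + l2n M G * l2n M (\<lambda>x. F' k x - G' x)"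
  proof (rule always_eventually, rule allI)
    fix k
    have "(LINT x|M. F k x \<bullet> F' k x) - (LINT x|M. G x \<bullet> G' x)
        = (LINT x|M. (F k x - G x) \<bullet> F' k x) + (LINT x|M. G x \<bullet> (F' k x - G' x))"
      by (simp add: inner_diff_left inner_diff_right sqint_inner assms)
    then show "norm ((LINT x|M. F k x \<bullet> F' k x) - (LINT x|M. G x \<bullet> G' x))
     \<le> l2n M (\<lambda>x. F k x - G x) * l2n M (F' k) + l2n M G * l2n M (\<lambda>x. F' k x - G' x)"
      using l2n_Cauchy_Schwarz[OF sqint_diff[OF assms(1,2)] assms(4), of k k]
        l2n_Cauchy_Schwarz[OF assms(2) sqint_diff[OF assms(4,5)], of k]
      by simp
  qed
qed

section \<open>Almost everywhere subsequences, Fatou's lemma and completeness\<close>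

lemma l2_convergence_AE_subseq:
  fixes F :: "nat \<Rightarrow> 'a \<Rightarrow> 'b::euclidean_space"
  assumes "\<And>k. F k \<in> sqint M" "G \<in> sqint M" "(\<lambda>k. l2n M (\<lambda>x. F k x - G x)) \<longlonglongrightarrow> 0"
  obtains r where "strict_mono r" "AE x in M. (\<lambda>k. F (r k) x) \<longlonglongrightarrow> G x"
proof -
  have "\<exists>r::nat \<Rightarrow> nat. strict_mono r \<and> (AE x in M. (\<lambda>n. (norm (F (r n) x - G x))^2) \<longlonglongrightarrow> 0)"
    by (rule tendsto_L1_AE_subseq)
      (use assms sqint_diff[OF assms(1,2)] in \<open>auto simp: sqint_def l2n_tendsto_iff\<close>)
  then obtain r :: "nat \<Rightarrow> nat" where r: "strict_mono r"
    "AE x in M. (\<lambda>n. (norm (F (r n) x - G x))^2) \<longlonglongrightarrow> 0" by auto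
  have "AE x in M. (\<lambda>k. F (r k) x) \<longlonglongrightarrow> G x"
    using r(2)
  proof eventually_elim
    case (elim x)
    have "(\<lambda>n. sqrt ((norm (F (r n) x - G x))^2)) \<longlonglongrightarrow> sqrt 0"
      by (rule tendsto_real_sqrt[OF elim])
    then have "(\<lambda>n. F (r n) x - G x) \<longlonglongrightarrow> 0"
      by (simp add: tendsto_norm_zero_iff)
    then show ?case by (rule LIM_zero_cancel)
  qed
  with r(1) show ?thesis by (rule that)
qed

text \<open>Membership of the limit belongs to the conclusion, so that limits known only pointwise
  can be used. The bound is required from \<open>k0\<close> on because the tails of Cauchy sequences
  supply it in that form.\<close>

lemma l2_Fatou:
  fixes F :: "nat \<Rightarrow> 'a \<Rightarrow> 'b::euclidean_space"
  assumes "\<And>k. F k \<in> sqint M" "G \<in> borel_measurable M"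
    and "AE x in M. (\<lambda>k. F k x) \<longlonglongrightarrow> G x"
    and bd: "\<And>k. k \<ge> k0 \<Longrightarrow> l2n M (F k) \<le> B"
  shows "G \<in> sqint M" "l2n M G \<le> B"
proof -
  have B0: "B \<ge> 0" using bd[of k0] l2n_nonneg[of M "F k0"] by linarith
  have e1: "(\<integral>\<^sup>+x. ennreal ((norm (G x))^2) \<partial>M) = (\<integral>\<^sup>+x. liminf (\<lambda>k. ennreal ((norm (F k x))^2)) \<partial>M)"
  proof (rule nn_integral_cong_AE, use assms(3) in eventually_elim)
    case (elim x)
    have "(\<lambda>k. ennreal ((norm (F k x))^2)) \<longlonglongrightarrow> ennreal ((norm (G x))^2)"
      by (intro tendsto_ennrealI tendsto_intros elim)
    from lim_imp_Liminf[OF _ this] show ?case by simp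
  qed
  also have "\<dots> \<le> liminf (\<lambda>k. \<integral>\<^sup>+x. ennreal ((norm (F k x))^2) \<partial>M)"
    by (rule nn_integral_liminf) (use assms sqintD in \<open>auto intro!: measurable_compose[OF sqintD(1)[OF assms(1)]]\<close>)
  also have "\<dots> \<le> ennreal (B^2)"
  proof (rule Liminf_le)
    have "(\<integral>\<^sup>+x. ennreal ((norm (F k x))^2) \<partial>M) \<le> ennreal (B^2)" if "k \<ge> k0" for k
    proof -
      have "(\<integral>\<^sup>+x. ennreal ((norm (F k x))^2) \<partial>M) = ennreal (LINT x|M. (norm (F k x))^2)"
        by (rule nn_integral_eq_integral) (use sqintD(2)[OF assms(1)] in auto)
      also have "\<dots> \<le> ennreal (B^2)"
        using bd[OF that] by (simp add: l2n_power2[symmetric] power_mono ennreal_leI)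
      finally show ?thesis .
    qed
    then show "\<forall>\<^sub>F k in sequentially. (\<integral>\<^sup>+x. ennreal ((norm (F k x))^2) \<partial>M) \<le> ennreal (B^2)"
      unfolding eventually_sequentially by blast
  qed simp
  finally have le: "(\<integral>\<^sup>+x. ennreal ((norm (G x))^2) \<partial>M) \<le> ennreal (B^2)" .
  have i: "integrable M (\<lambda>x. (norm (G x))^2)"
    by (rule integrableI_bounded)
      (use assms le in \<open>auto simp: less_top[symmetric] top_unique dest: order_trans\<close>)
  then show "G \<in> sqint M" using assms by (simp add: sqint_def)
  have "(l2n M G)^2 \<le> B^2"
    using le nn_integral_eq_integral[OF i] by (simp add: l2n_power2)
  then show "l2n M G \<le> B" using B0 by (rule power2_le_imp_le)
qed

lemma (in finite_measure) integral_norm_le_l2n: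
  fixes F :: "'a \<Rightarrow> 'b::euclidean_space"
  assumes "F \<in> sqint M"
  shows "integrable M (\<lambda>x. norm (F x))" "(LINT x|M. norm (F x)) \<le> sqrt (measure M (space M)) * l2n M F"
proof -
  have 1: "(\<lambda>x. 1::real) \<in> sqint M" by (simp add: sqint_def)
  have 2: "(\<lambda>x. norm (F x)) \<in> sqint M" using assms by (auto simp: sqint_def)
  show "integrable M (\<lambda>x. norm (F x))" using sqint_inner[OF 1 2] by simp
  show "(LINT x|M. norm (F x)) \<le> sqrt (measure M (space M)) * l2n M F"
    using l2n_Cauchy_Schwarz[OF 1 2] by (simp add: l2n_def abs_le_iff)
qed

text \<open>Riesz-Fischer. The increments of a fast subsequence have geometrically decreasing L2
  norms; finiteness of the measure turns these into summable L1 norms, so the increments sum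
  absolutely almost everywhere. Fatou's lemma then bounds the distance of every late term to the
  limit, not only of those in the subsequence.\<close>

lemma (in finite_measure) l2_complete:
  fixes F :: "nat \<Rightarrow> 'a \<Rightarrow> 'b::euclidean_space"
  assumes F: "\<And>k. F k \<in> sqint M"
    and C: "\<And>e. e > 0 \<Longrightarrow> \<exists>N. \<forall>m\<ge>N. \<forall>n\<ge>N. l2n M (\<lambda>x. F m x - F n x) < e"
  obtains G where "G \<in> sqint M" "(\<lambda>k. l2n M (\<lambda>x. F k x - G x)) \<longlonglongrightarrow> 0"
proof -
  have "\<exists>N. \<forall>m\<ge>N. \<forall>n\<ge>N. l2n M (\<lambda>x. F m x - F n x) < (1/2)^k" for k
    using C[of "(1/2)^k"] by simp
  then obtain N where N: "\<And>k m n. m \<ge> N k \<Longrightarrow> n \<ge> N k \<Longrightarrow> l2n M (\<lambda>x. F m x - F n x) < (1/2)^k"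
    by metis
  \<comment> \<open>Partial sums with the extra 1 make the indices strictly increasing while keeping
    \<open>r k\<close> beyond \<open>N k\<close>.\<close>
  define r where "r k = (\<Sum>j\<le>k. N j + 1)" for k
  have rS: "r (Suc k) = r k + N (Suc k) + 1" for k by (simp add: r_def)
  have rN: "r k \<ge> N k" for k by (cases k) (auto simp: r_def)
  have r: "strict_mono r" by (rule strict_monoI_Suc) (simp add: rS)
  define d where "d k x = F (r (Suc k)) x - F (r k) x" for k x
  have dS: "d k \<in> sqint M" for k unfolding d_def by (rule sqint_diff) (rule F)+
  have dl: "l2n M (d k) \<le> (1/2)^k" for k
  proof -
    have "r (Suc k) \<ge> N k" using rN[of k] rS[of k] by linarith
    from N[OF this rN] show ?thesis unfolding d_def by (rule less_imp_le)
  qed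
  define A where "A = sqrt (measure M (space M))"
  have A0: "A \<ge> 0" by (simp add: A_def)
  have nd: "(\<integral>\<^sup>+x. ennreal (norm (d k x)) \<partial>M) \<le> ennreal (A * (1/2)^k)" for k
  proof -
    have "(\<integral>\<^sup>+x. ennreal (norm (d k x)) \<partial>M) = ennreal (LINT x|M. norm (d k x))"
      by (rule nn_integral_eq_integral) (use integral_norm_le_l2n[OF dS] in auto)
    also have "\<dots> \<le> ennreal (A * (1/2)^k)"
      using integral_norm_le_l2n(2)[OF dS[of k]] mult_left_mono[OF dl[of k] A0]
      unfolding A_def by (intro ennreal_leI) linarith
    finally show ?thesis .
  qed
  have "(\<integral>\<^sup>+x. (\<Sum>k. ennreal (norm (d k x))) \<partial>M) = (\<Sum>k. \<integral>\<^sup>+x. ennreal (norm (d k x)) \<partial>M)"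
    by (rule nn_integral_suminf) (use sqintD(1)[OF dS] in measurable)
  also have "\<dots> \<le> (\<Sum>k. ennreal (A * (1/2)^k))"
    by (intro suminf_le nd) auto
  also have "\<dots> = ennreal (\<Sum>k. A * (1/2)^k)"
    by (rule suminf_ennreal2) (use A0 in \<open>auto intro!: summable_mult summable_geometric\<close>)
  finally have fin: "(\<integral>\<^sup>+x. (\<Sum>k. ennreal (norm (d k x))) \<partial>M) \<noteq> \<infinity>"
    by (auto simp: top_unique)
  have "AE x in M. (\<Sum>k. ennreal (norm (d k x))) \<noteq> \<infinity>"
    by (rule nn_integral_PInf_AE[OF _ fin]) (use sqintD(1)[OF dS] in measurable)
  then have conv: "AE x in M. (\<lambda>k. F (r k) x) \<longlonglongrightarrow> lim (\<lambda>k. F (r k) x)"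
  proof eventually_elim
    case (elim x)
    then have "summable (\<lambda>k. norm (d k x))"
      by (intro summable_suminf_not_top) auto
    then have "summable (\<lambda>k. d k x)" by (rule summable_norm_cancel)
    then have "convergent (\<lambda>n. \<Sum>k<n. d k x)" by (simp add: summable_iff_convergent)
    moreover have "(\<Sum>k<n. d k x) = F (r n) x - F (r 0) x" for n
      by (induction n) (auto simp: d_def)
    ultimately have "convergent (\<lambda>n. F (r n) x - F (r 0) x)" by simp
    then obtain l where "(\<lambda>n. F (r n) x - F (r 0) x) \<longlonglongrightarrow> l" by (auto simp: convergent_def)
    then have "(\<lambda>n. F (r n) x - F (r 0) x + F (r 0) x) \<longlonglongrightarrow> l + F (r 0) x"
      by (intro tendsto_intros)
    then show ?case by (simp add: limI)
  qed
  define G where "G x = lim (\<lambda>k. F (r k) x)" for x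
  have Gm: "G \<in> borel_measurable M"
    unfolding G_def by (rule borel_measurable_lim_metric) (use sqintD(1)[OF F] in measurable)
  have key: "(\<lambda>x. F m x - G x) \<in> sqint M \<and> l2n M (\<lambda>x. F m x - G x) \<le> (1/2)^k" if "m \<ge> N k" for m k
  proof -
    have b: "l2n M (\<lambda>x. F m x - F (r j) x) \<le> (1/2)^k" if "j \<ge> k" for j
    proof -
      have "r j \<ge> N k"
        using rN[of k] strict_mono_less_eq[OF r, of k j] that by simp
      from N[OF \<open>m \<ge> N k\<close> this] show ?thesis by simp
    qed
    have c: "AE x in M. (\<lambda>j. F m x - F (r j) x) \<longlonglongrightarrow> F m x - G x"
      using conv unfolding G_def by eventually_elim (intro tendsto_intros)
    have m: "(\<lambda>x. F m x - G x) \<in> borel_measurable M"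
      using sqintD(1)[OF F] Gm by measurable
    show ?thesis
      using l2_Fatou[OF sqint_diff[OF F F] m c b] by blast
  qed
  have "(\<lambda>x. F (N 0) x - (F (N 0) x - G x)) \<in> sqint M"
    by (rule sqint_diff[OF F]) (use key[of 0 "N 0"] in simp)
  then have G: "G \<in> sqint M" by simp
  have "(\<lambda>k. l2n M (\<lambda>x. F k x - G x)) \<longlonglongrightarrow> 0"
  proof (rule LIMSEQ_I)
    fix e :: real assume "e > 0"
    obtain k where k: "(1/2::real)^k < e" using real_arch_pow_inv[OF \<open>e > 0\<close>, of "1/2"] by auto
    show "\<exists>no. \<forall>n\<ge>no. norm (l2n M (\<lambda>x. F n x - G x) - 0) < e"
      by (rule exI[of _ "N k"]) (use key k in force)
  qed
  with G show ?thesis by (rule that)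
qed

subsection \<open>Smooth functions\<close>

lemma has_pd:
  "(\<lambda>t. f (x + t *\<^sub>R axis i 1)) differentiable (at 0) \<Longrightarrow>
    ((\<lambda>t. f (x + t *\<^sub>R axis i 1)) has_real_derivative pd i f x) (at 0)"
  unfolding pd_def by (simp add: DERIV_deriv_iff_real_differentiable)

lemma pd_eqI:
  "((\<lambda>t. f (x + t *\<^sub>R axis i 1)) has_real_derivative d) (at 0) \<Longrightarrow> pd i f x = d"
  unfolding pd_def by (rule DERIV_imp_deriv)

text \<open>Smoothness is a greatest fixed point: a class closed under partial derivatives contains
  every iterated derivative of its members, so checking one level of regularity on the class is
  enough.\<close>

lemma smooth_on_UNIV_coinduct:
  assumes "g \<in> S"
    and "\<And>f. f \<in> S \<Longrightarrow> continuous_on UNIV f"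
    and "\<And>f i x. f \<in> S \<Longrightarrow> (\<lambda>t. f (x + t *\<^sub>R axis i 1)) differentiable (at 0)"
    and "\<And>f i. f \<in> S \<Longrightarrow> pd i f \<in> S"
  shows "smooth_on UNIV g"
proof -
  have "iter_pd is g \<in> S" for "is"
    by (induction "is") (use assms in auto)
  then show ?thesis
    unfolding smooth_on_def using assms(2,3) by blast
qed

lemma smooth_continuous: "smooth_on UNIV f \<Longrightarrow> continuous_on UNIV f"
  unfolding smooth_on_def by (metis iter_pd.simps(1))

lemma smooth_differentiable:
  "smooth_on UNIV f \<Longrightarrow> (\<lambda>t. f (x + t *\<^sub>R axis i 1)) differentiable (at 0)"
  unfolding smooth_on_def by (metis UNIV_I iter_pd.simps(1))

lemma iter_pd_pd: "iter_pd is (pd i f) = iter_pd (is @ [i]) f"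
  by (induction "is") auto

lemma smooth_pd: "smooth_on UNIV f \<Longrightarrow> smooth_on UNIV (pd i f)"
  unfolding smooth_on_def iter_pd_pd by blast

lemma smooth_iter_pd: "smooth_on UNIV f \<Longrightarrow> smooth_on UNIV (iter_pd is f)"
  by (induction "is") (auto intro: smooth_pd)

text \<open>To show that a function is smooth it suffices to find an algebra of functions containing it
  whose generators have their partial derivatives in the algebra.\<close>

inductive_set galg :: "(real^'n::finite \<Rightarrow> real) set \<Rightarrow> (real^'n \<Rightarrow> real) set" for B where
  base: "b \<in> B \<Longrightarrow> b \<in> galg B"
| const: "(\<lambda>x. c) \<in> galg B"
| add: "f \<in> galg B \<Longrightarrow> g \<in> galg B \<Longrightarrow> (\<lambda>x. f x + g x) \<in> galg B"
| mult: "f \<in> galg B \<Longrightarrow> g \<in> galg B \<Longrightarrow> (\<lambda>x. f x * g x) \<in> galg B"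

lemma galg_smooth:
  assumes f: "f \<in> galg B"
    and c: "\<And>b. b \<in> B \<Longrightarrow> continuous_on UNIV b"
    and d: "\<And>b i x. b \<in> B \<Longrightarrow> (\<lambda>t. b (x + t *\<^sub>R axis i 1)) differentiable (at 0)"
    and p: "\<And>b i. b \<in> B \<Longrightarrow> pd i b \<in> galg B"
  shows "smooth_on UNIV f"
proof (rule smooth_on_UNIV_coinduct[OF f])
  show "continuous_on UNIV g" if "g \<in> galg B" for g
    using that by induction (auto intro: c continuous_on_add continuous_on_mult)
  show D: "(\<lambda>t. g (x + t *\<^sub>R axis i 1)) differentiable (at 0)" if "g \<in> galg B" for g i x
    using that by induction (auto intro: d differentiable_add differentiable_mult)
  show "pd i g \<in> galg B" if "g \<in> galg B" for g i
    using that
  proof induction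
    case (base b)
    then show ?case by (rule p)
  next
    case (const c)
    have "pd i (\<lambda>x. c) = (\<lambda>x. 0)"
      by (rule ext, rule pd_eqI) (auto intro!: derivative_eq_intros)
    then show ?case by (simp add: galg.const)
  next
    case (add f g)
    have "pd i (\<lambda>x. f x + g x) = (\<lambda>x. pd i f x + pd i g x)"
      by (rule ext, rule pd_eqI) (rule DERIV_add[OF has_pd[OF D[OF add(1)]] has_pd[OF D[OF add(2)]]])
    then show ?case using add by (simp add: galg.add)
  next
    case (mult f g)
    have "pd i (\<lambda>x. f x * g x) = (\<lambda>x. pd i f x * g x + pd i g x * f x)"
      by (rule ext, rule pd_eqI)
        (use DERIV_mult[OF has_pd[OF D[OF mult(1)]] has_pd[OF D[OF mult(2)]]] in simp)
    then show ?case using mult by (simp add: galg.add galg.mult)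
  qed
qed

lemma galg_mono: "f \<in> galg B \<Longrightarrow> B \<subseteq> C \<Longrightarrow> f \<in> galg C"
  by (induction rule: galg.induct) (auto intro: galg.intros)

lemma galg_prod:
  "finite I \<Longrightarrow> (\<And>i. i \<in> I \<Longrightarrow> f i \<in> galg B) \<Longrightarrow> (\<lambda>x. \<Prod>i\<in>I. f i x) \<in> galg B"
  by (induction rule: finite_induct) (auto intro: galg.const galg.mult)

lemma galg_power: "f \<in> galg B \<Longrightarrow> (\<lambda>x. f x ^ n) \<in> galg B"
  by (induction n) (auto intro: galg.const galg.mult)

text \<open>Adjoining all iterated partial derivatives of the generators makes the set of generators
  closed under \<open>pd\<close>, as \<open>galg_smooth\<close> wants it.\<close>

lemma smooth_algebra:
  assumes S: "\<And>f. f \<in> S \<Longrightarrow> smooth_on UNIV f" and g: "g \<in> galg S"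
  shows "smooth_on UNIV g"
proof (rule galg_smooth)
  show "g \<in> galg {iter_pd is f |is f. f \<in> S}"
    by (rule galg_mono[OF g]) (force intro: exI[of _ "[]"])
  show "pd i b \<in> galg {iter_pd is f |is f. f \<in> S}" if b: "b \<in> {iter_pd is f |is f. f \<in> S}" for b i
  proof -
    obtain "is" f where "b = iter_pd is f" "f \<in> S" using b by blast
    then have "pd i b = iter_pd (i # is) f" "f \<in> S" by auto
    then show ?thesis by (blast intro: galg.base)
  qed
qed (use S in \<open>auto intro: smooth_continuous smooth_differentiable smooth_iter_pd\<close>)

lemma smooth_const: "smooth_on UNIV (\<lambda>x. c)"
  by (rule smooth_algebra[of "{}"]) (auto intro: galg.const)

lemma smooth_add:
  "smooth_on UNIV f \<Longrightarrow> smooth_on UNIV g \<Longrightarrow> smooth_on UNIV (\<lambda>x. f x + g x)"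
  by (rule smooth_algebra[of "{f, g}"]) (auto intro: galg.intros)

lemma smooth_mult:
  "smooth_on UNIV f \<Longrightarrow> smooth_on UNIV g \<Longrightarrow> smooth_on UNIV (\<lambda>x. f x * g x)"
  by (rule smooth_algebra[of "{f, g}"]) (auto intro: galg.intros)

lemma smooth_cmult: "smooth_on UNIV f \<Longrightarrow> smooth_on UNIV (\<lambda>x. c * f x)"
  by (rule smooth_mult[OF smooth_const])

lemma smooth_diff:
  "smooth_on UNIV f \<Longrightarrow> smooth_on UNIV g \<Longrightarrow> smooth_on UNIV (\<lambda>x. f x - g x)"
  using smooth_add[of f "\<lambda>x. -1 * g x"] smooth_cmult[of g "-1"] by simp

text \<open>The derivative of \<open>r\<close> is a polynomial in \<open>r\<close>, \<open>f\<close>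
  and the partial derivatives of \<open>f\<close>, so adjoining \<open>r\<close> to the derivatives
  of \<open>f\<close> keeps the algebra closed under differentiation. Reciprocals fit this pattern
  with \<open>c = -1\<close>, \<open>k = 2\<close>, and reciprocal square roots with
  \<open>c = -1/2\<close>, \<open>k = 3\<close>.\<close>

lemma galg_extend_smooth:
  fixes f r :: "real^'n::finite \<Rightarrow> real"
  assumes f: "smooth_on UNIV f" and c: "continuous_on UNIV r"
    and d: "\<And>x i. ((\<lambda>t. r (x + t *\<^sub>R axis i 1)) has_real_derivative c * r x ^ k * f x ^ l * pd i f x) (at 0)"
    and g: "g \<in> galg {f, r}"
  shows "smooth_on UNIV g"
proof -
  let ?B = "insert r {iter_pd is f |is. True}"
  have fB: "f \<in> ?B" and pB: "pd i f \<in> ?B" for i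
    by (force intro: exI[of _ "[]"]) (force intro: exI[of _ "[i]"])
  show ?thesis
  proof (rule galg_smooth)
    show "g \<in> galg ?B" by (rule galg_mono[OF g]) (use fB in auto)
    show "continuous_on UNIV b" if "b \<in> ?B" for b
      using that c f by (auto intro: smooth_continuous smooth_iter_pd)
    show "(\<lambda>t. b (x + t *\<^sub>R axis i 1)) differentiable (at 0)" if "b \<in> ?B" for b i x
      using that d[of x i] f
      by (auto intro: smooth_differentiable smooth_iter_pd simp: real_differentiable_def[of "\<lambda>t. r (x + t *\<^sub>R axis i 1)"])
    show "pd i b \<in> galg ?B" if b: "b \<in> ?B" for b i
    proof (cases "b = r")
      case True
      have "pd i r = (\<lambda>x. c * r x ^ k * f x ^ l * pd i f x)"
        by (rule ext, rule pd_eqI, rule d)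
      moreover have "(\<lambda>x. c * r x ^ k * f x ^ l * pd i f x) \<in> galg ?B"
        by (intro galg.mult galg.const galg_power galg.base pB fB) simp
      ultimately show ?thesis using True by simp
    next
      case False
      then obtain "is" where "b = iter_pd is f" using b by blast
      then have "pd i b = iter_pd (i # is) f" by simp
      then show ?thesis by (blast intro: galg.base)
    qed
  qed
qed

lemma smooth_inverse:
  assumes f: "smooth_on UNIV f" and nz: "\<And>x. f x \<noteq> 0"
  shows "smooth_on UNIV (\<lambda>x. inverse (f x))"
proof (rule galg_extend_smooth[OF f, where c = "-1" and k = 2 and l = 0 and r = "\<lambda>x. inverse (f x)"])
  show "continuous_on UNIV (\<lambda>x. inverse (f x))"
    using nz by (intro continuous_intros smooth_continuous f) auto
  show "((\<lambda>t. inverse (f (x + t *\<^sub>R axis i 1))) has_real_derivative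
     -1 * (inverse (f x))^2 * f x ^ 0 * pd i f x) (at 0)" for x i
    using DERIV_inverse_fun[OF has_pd[OF smooth_differentiable[OF f]], of x i] nz
    by (simp add: power2_eq_square mult_ac)
qed (auto intro: galg.base)

text \<open>The generator is the reciprocal root, since its derivative is polynomial in itself; the
  root is recovered as \<open>f\<close> times that generator.\<close>

lemma smooth_sqrt:
  assumes f: "smooth_on UNIV f" and pos: "\<And>x. f x > 0"
  shows "smooth_on UNIV (\<lambda>x. sqrt (f x))"
proof (rule galg_extend_smooth[OF f, where c = "-1/2" and k = 3 and l = 0 and r = "\<lambda>x. inverse (sqrt (f x))"])
  show "continuous_on UNIV (\<lambda>x. inverse (sqrt (f x)))"
    using pos by (intro continuous_intros smooth_continuous f) (auto simp: less_imp_neq[OF pos, symmetric])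
  show "((\<lambda>t. inverse (sqrt (f (x + t *\<^sub>R axis i 1)))) has_real_derivative
     -1/2 * (inverse (sqrt (f x)))^3 * f x ^ 0 * pd i f x) (at 0)" for x i
  proof -
    have s: "sqrt (f x) \<noteq> 0" "sqrt (f x) > 0" using pos[of x] by auto
    have "((\<lambda>t. sqrt (f (x + t *\<^sub>R axis i 1))) has_real_derivative
        inverse (sqrt (f x)) / 2 * pd i f x) (at 0)"
      by (rule DERIV_chain2[where f = sqrt])
        (use DERIV_real_sqrt pos has_pd[OF smooth_differentiable[OF f], of x i] in auto)
    moreover have "inverse (f x) = inverse (sqrt (f x)) * inverse (sqrt (f x))"
      using pos[of x] by (simp flip: inverse_mult_distrib)
    moreover note DERIV_inverse_fun[OF calculation(1)]
    ultimately show ?thesis using s by (simp add: power3_eq_cube mult_ac)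
  qed
  have "(\<lambda>x. f x * inverse (sqrt (f x))) \<in> galg {f, \<lambda>x. inverse (sqrt (f x))}"
    by (intro galg.mult galg.base) auto
  moreover have "f x * inverse (sqrt (f x)) = sqrt (f x)" for x
    using pos[of x] by (simp add: field_simps)
  ultimately show "(\<lambda>x. sqrt (f x)) \<in> galg {f, \<lambda>x. inverse (sqrt (f x))}" by simp
qed

section \<open>Bump functions on boxes\<close>

text \<open>The index makes the flat function exp(-1/t) part of a family that is closed under
  differentiation; \<open>exps 0\<close> is the function itself.\<close>

definition exps :: "nat \<Rightarrow> real \<Rightarrow> real" where
  "exps j t = (if t > 0 then inverse t ^ j * exp (- inverse t) else 0)"

lemma exps_tendsto: "(exps j \<longlongrightarrow> 0) (at_right 0)"
proof -
  have "((\<lambda>x::real. x ^ j / exp x) \<longlongrightarrow> 0) at_top" by (rule tendsto_power_div_exp_0)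
  then have "((\<lambda>x::real. inverse x ^ j / exp (inverse x)) \<longlongrightarrow> 0) (at_right 0)"
    by (rule filterlim_compose) (rule filterlim_inverse_at_top_right)
  then show ?thesis
    by (rule Lim_transform_eventually)
      (auto simp: exps_def eventually_at_filter exp_minus field_simps)
qed

lemma exps_DERIV:
  "(exps j has_real_derivative - real j * exps (Suc j) t + exps (Suc (Suc j)) t) (at t)"
proof -
  consider "t < 0" | "t = 0" | "t > 0" by linarith
  then show ?thesis
  proof cases
    case 1
    have "((\<lambda>t. 0) has_real_derivative 0) (at t)" by simp
    then have "(exps j has_real_derivative 0) (at t)"
      by (rule has_field_derivative_transform_within_open[of _ _ _ "{..<0}"])
        (use 1 in \<open>auto simp: exps_def\<close>)
    then show ?thesis using 1 by (simp add: exps_def)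
  next
    case 2
    have "((\<lambda>y. (exps j y - exps j 0) / (y - 0)) \<longlongrightarrow> 0) (at 0)"
      unfolding filterlim_at_split
    proof
      show "((\<lambda>y. (exps j y - exps j 0) / (y - 0)) \<longlongrightarrow> 0) (at_left 0)"
        by (rule tendsto_eventually) (auto simp: exps_def eventually_at_filter)
      \<comment> \<open>To the right of 0 the difference quotient is \<open>exps (Suc j)\<close>,
        which vanishes in the limit.\<close>
      show "((\<lambda>y. (exps j y - exps j 0) / (y - 0)) \<longlongrightarrow> 0) (at_right 0)"
        by (rule Lim_transform_eventually[OF exps_tendsto[of "Suc j"]])
          (auto simp: exps_def eventually_at_filter field_simps)
    qed
    then have "(exps j has_real_derivative 0) (at 0)" by (simp add: has_field_derivative_iff)
    then show ?thesis using 2 by (simp add: exps_def)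
  next
    case 3
    have T: "((\<lambda>t. inverse t ^ j * exp (- inverse t)) has_real_derivative
        - real j * exps (Suc j) t + exps (Suc (Suc j)) t) (at t)"
    proof -
      have alg: "real j * (- (a^2) * a ^ (j - Suc 0)) * E + E * a^2 * a ^ j
        = - real j * (a ^ Suc j * E) + a ^ Suc (Suc j) * E" for a E :: real
        by (cases j) (simp_all add: power2_eq_square algebra_simps)
      have i: "(inverse has_real_derivative - ((inverse t)^2)) (at t)"
        using DERIV_inverse[of t UNIV] 3 by (simp add: numeral_2_eq_2)
      have "((\<lambda>t. exp (- inverse t)) has_real_derivative exp (- inverse t) * (inverse t)^2) (at t)"
        using DERIV_fun_exp[OF DERIV_minus[OF i]] by simp
      from DERIV_mult[OF DERIV_power[OF i, of j] this]
      have "((\<lambda>t. inverse t ^ j * exp (- inverse t)) has_real_derivative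
          - real j * (inverse t ^ Suc j * exp (- inverse t)) + inverse t ^ Suc (Suc j) * exp (- inverse t)) (at t)"
        by (simp only: alg)
      then show ?thesis using 3 by (simp only: exps_def if_True)
    qed
    show ?thesis
      by (rule has_field_derivative_transform_within_open[OF T, of "{0<..}"])
        (use 3 in \<open>auto simp: exps_def\<close>)
  qed
qed

definition box_bump :: "real^'n::finite \<Rightarrow> real^'n \<Rightarrow> real^'n \<Rightarrow> real" where
  "box_bump a b x = (\<Prod>i\<in>UNIV. exps 0 (x $ i - a $ i) * exps 0 (b $ i - x $ i))"

lemma box_bump_pos: "box_bump a b x > 0 \<longleftrightarrow> x \<in> box a b"
  and box_bump_nonneg: "box_bump a b x \<ge> 0"
proof -
  have nn: "exps 0 t \<ge> 0" for t by (simp add: exps_def)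
  have pos: "exps 0 t > 0 \<longleftrightarrow> t > 0" for t by (simp add: exps_def)
  show n: "box_bump a b x \<ge> 0" unfolding box_bump_def by (intro prod_nonneg) (auto intro: nn mult_nonneg_nonneg)
  have "box_bump a b x > 0 \<longleftrightarrow> box_bump a b x \<noteq> 0" using n by linarith
  also have "\<dots> \<longleftrightarrow> (\<forall>i. exps 0 (x $ i - a $ i) > 0 \<and> exps 0 (b $ i - x $ i) > 0)"
    unfolding box_bump_def using nn by (auto simp: less_le)
  also have "\<dots> \<longleftrightarrow> x \<in> box a b" unfolding pos mem_box_cart by auto
  finally show "box_bump a b x > 0 \<longleftrightarrow> x \<in> box a b" .
qed

lemma box_bump_smooth: "smooth_on UNIV (box_bump a b :: real^'n::finite \<Rightarrow> real)"
proof -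
  \<comment> \<open>Affine arguments with an arbitrary slope \<open>s\<close> cover both faces of
    the box in each coordinate (slopes 1 and -1) and are reproduced by the chain rule.\<close>
  let ?e = "\<lambda>(j::nat) s c (i::'n) (x::real^'n). exps j (s * x $ i + c)"
  let ?B = "{?e j s c i |j s c i. True}"
  have D: "((\<lambda>t. ?e j s c i (x + t *\<^sub>R axis k 1)) has_real_derivative
      (- real j * ?e (Suc j) s c i x + ?e (Suc (Suc j)) s c i x) * (if k = i then s else 0)) (at 0)"
    for j s c i x k
  proof -
    have "((\<lambda>t. s * (x + t *\<^sub>R axis k 1) $ i + c) has_real_derivative (if k = i then s else 0)) (at 0)"
      by (auto intro!: derivative_eq_intros simp: axis_def)
    from DERIV_chain2[where f = "exps j", OF _ this] exps_DERIV show ?thesis by simp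
  qed
  have eB: "?e j s c i \<in> ?B" for j s c i by blast
  show ?thesis
  proof (rule galg_smooth)
    have "box_bump a b = (\<lambda>x. \<Prod>i\<in>UNIV. ?e 0 1 (- a $ i) i x * ?e 0 (-1) (b $ i) i x)"
      by (simp add: box_bump_def fun_eq_iff)
    moreover have "\<dots> \<in> galg ?B"
      by (intro galg_prod galg.mult)
        (simp, rule galg.base[OF eB[of 0 1]], rule galg.base[OF eB[of 0 "-1"]])
    ultimately show "box_bump a b \<in> galg ?B" by simp
    show "continuous_on UNIV f" if "f \<in> ?B" for f
    proof -
      have cE: "continuous_on A (exps j)" for j A
      proof (rule DERIV_continuous_on)
        fix t
        show "(exps j has_field_derivative - real j * exps (Suc j) t + exps (Suc (Suc j)) t) (at t within A)"
          by (rule has_field_derivative_at_within[OF exps_DERIV])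
      qed
      have "continuous_on UNIV (exps j \<circ> (\<lambda>x. s * x $ i + c))" for j s c and i :: 'n
        by (intro continuous_on_compose cE continuous_intros)
      then have "continuous_on UNIV (?e j s c i)" for j s c i
        by (simp only: o_def)
      then show ?thesis using that by blast
    qed
    show "(\<lambda>t. f (x + t *\<^sub>R axis i 1)) differentiable (at 0)" if "f \<in> ?B" for f i x
      using that D by (force simp: real_differentiable_def)
    show "pd k f \<in> galg ?B" if f: "f \<in> ?B" for f k
    proof -
      obtain j s c i where f: "f = ?e j s c i" using f by blast
      have "pd k f = (\<lambda>x. (- real j * ?e (Suc j) s c i x + ?e (Suc (Suc j)) s c i x) * (if k = i then s else 0))"
        unfolding f by (rule ext, rule pd_eqI, rule D)
      also have "\<dots> \<in> galg ?B"
        by (intro galg.mult galg.add galg.const galg.base[OF eB])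
      finally show ?thesis .
    qed
  qed
qed

section \<open>Total derivatives and gradients of smooth functions\<close>

lemma smooth_DERIV_line:
  assumes "smooth_on UNIV f"
  shows "((\<lambda>s. f (z + s *\<^sub>R axis j 1)) has_real_derivative pd j f (z + s *\<^sub>R axis j 1)) (at s)"
proof -
  have "((\<lambda>t. f ((z + s *\<^sub>R axis j 1) + t *\<^sub>R axis j 1)) has_real_derivative pd j f (z + s *\<^sub>R axis j 1)) (at 0)"
    by (rule has_pd[OF smooth_differentiable[OF assms]])
  then have "((\<lambda>t. f (z + (t + s) *\<^sub>R axis j 1)) has_real_derivative pd j f (z + s *\<^sub>R axis j 1)) (at 0)"
    by (simp add: algebra_simps)
  then show ?thesis
    using DERIV_shift[of "\<lambda>s. f (z + s *\<^sub>R axis j 1)" "pd j f (z + s *\<^sub>R axis j 1)" 0 s] by simp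
qed

text \<open>Continuous partial derivatives give total differentiability. The way from
  \<open>x\<close> to \<open>x + y\<close> is walked one axis at a time by induction over the finite
  set of coordinates already moved (\<open>yI\<close>), and each of the \<open>CARD('n)\<close> legs
  may contribute an error \<open>e' * norm y\<close>.\<close>

lemma smooth_has_derivative:
  fixes f :: "real^'n::finite \<Rightarrow> real"
  assumes f: "smooth_on UNIV f"
  shows "(f has_derivative (\<lambda>h. cgrad f x \<bullet> h)) (at x)"
  unfolding has_derivative_at_alt
proof (intro conjI allI impI)
  show "bounded_linear ((\<bullet>) (cgrad f x))" by (rule bounded_linear_inner_right)
  fix e :: real assume "e > 0"
  define e' where "e' = e / real CARD('n)"
  have e': "e' > 0" using \<open>e > 0\<close> by (simp add: e'_def)
  have "\<exists>d>0. \<forall>z. dist z x < d \<longrightarrow> \<bar>pd i f z - pd i f x\<bar> < e'" for i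
    using smooth_continuous[OF smooth_pd[OF f, of i]] e'
    by (auto simp: continuous_on_iff dist_real_def)
  then obtain d where d: "\<And>i. d i > 0" "\<And>i z. dist z x < d i \<Longrightarrow> \<bar>pd i f z - pd i f x\<bar> < e'" by metis
  define D where "D = Min (range d)"
  have D0: "D > 0" using d by (simp add: D_def)
  have D: "\<bar>pd i f z - pd i f x\<bar> < e'" if "dist z x < D" for i z
    by (rule d(2)) (use that Min_le[of "range d" "d i"] in \<open>simp add: D_def\<close>)
  show "\<exists>d>0. \<forall>y. norm (y - x) < d \<longrightarrow> norm (f y - f x - cgrad f x \<bullet> (y - x)) \<le> e * norm (y - x)"
  proof (intro exI conjI allI impI)
    show "D > 0" by fact
    fix w assume w: "norm (w - x) < D"
    define y where "y = w - x"
    define yI where "yI I = (\<chi> k. if k \<in> I then y $ k else 0)" for I :: "'n set"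
    have "\<bar>f (x + yI I) - f x - (\<Sum>i\<in>I. pd i f x * y $ i)\<bar> \<le> real (card I) * e' * norm y" if "finite I" for I
      using that
    proof induction
      case empty
      have "yI {} = 0" by (simp add: yI_def vec_eq_iff)
      then show ?case by simp
    next
      case (insert j I)
      have yins: "yI (insert j I) = yI I + (y $ j) *\<^sub>R axis j 1"
        using insert by (auto simp: yI_def vec_eq_iff axis_def)
      \<comment> \<open>Subtracting the linear part leaves a function whose derivative is the
        oscillation of \<open>pd j f\<close>, which the choice of \<open>D\<close> makes
        small.\<close>
      define g where "g s = f ((x + yI I) + s *\<^sub>R axis j 1) - s * pd j f x" for s
      have gD: "(g has_field_derivative pd j f ((x + yI I) + s *\<^sub>R axis j 1) - pd j f x) (at s within {- \<bar>y $ j\<bar>..\<bar>y $ j\<bar>})" for s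
        unfolding g_def
        by (rule has_field_derivative_at_within)
          (auto intro!: derivative_eq_intros smooth_DERIV_line[OF f])
      have "norm (g (y $ j) - g 0) \<le> e' * norm (y $ j - 0)"
      proof (rule field_differentiable_bound[OF _ gD])
        fix s assume s: "s \<in> {- \<bar>y $ j\<bar>..\<bar>y $ j\<bar>}"
        have "norm (yI I + s *\<^sub>R axis j 1) \<le> norm y"
          by (rule norm_le_componentwise_cart) (use s insert in \<open>auto simp: yI_def axis_def\<close>)
        also have "\<dots> < D" using w by (simp add: y_def)
        finally have "dist ((x + yI I) + s *\<^sub>R axis j 1) x < D" by (simp add: dist_norm add.assoc)
        then show "norm (pd j f ((x + yI I) + s *\<^sub>R axis j 1) - pd j f x) \<le> e'"
          using D by (simp add: less_imp_le)
      qed auto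
      also have "\<dots> \<le> e' * norm y"
        using e' component_le_norm_cart[of y j] by simp
      finally have "\<bar>f (x + yI (insert j I)) - f (x + yI I) - pd j f x * y $ j\<bar> \<le> e' * norm y"
        by (simp add: g_def yins algebra_simps)
      then show ?case using insert by (simp add: algebra_simps)
    qed
    from this[of UNIV] have "\<bar>f (x + yI UNIV) - f x - (\<Sum>i\<in>UNIV. pd i f x * y $ i)\<bar> \<le> e * norm y"
      by (simp add: e'_def)
    moreover have "yI UNIV = y" by (simp add: yI_def vec_eq_iff)
    moreover have "(\<Sum>i\<in>UNIV. pd i f x * y $ i) = cgrad f x \<bullet> y"
      by (simp add: inner_vec_def cgrad_def)
    ultimately show "norm (f w - f x - cgrad f x \<bullet> (w - x)) \<le> e * norm (w - x)"
      by (simp add: y_def)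
  qed
qed

lemma cgrad_eqI:
  fixes f :: "real^'n::finite \<Rightarrow> real"
  assumes "(f has_derivative (\<lambda>h. G \<bullet> h)) (at x)"
  shows "cgrad f x = G"
proof -
  have "pd i f x = G $ i" for i
  proof (rule pd_eqI)
    have "((\<lambda>t::real. x + t *\<^sub>R axis i 1) has_derivative (\<lambda>t. t *\<^sub>R axis i 1)) (at 0)"
      by (auto intro!: derivative_eq_intros)
    from has_derivative_compose[OF this, of f "\<lambda>h. G \<bullet> h"] assms
    have "((\<lambda>t. f (x + t *\<^sub>R axis i 1)) has_derivative (\<lambda>t. G \<bullet> (t *\<^sub>R axis i 1))) (at 0)" by simp
    then show "((\<lambda>t. f (x + t *\<^sub>R axis i 1)) has_real_derivative G $ i) (at 0)"
      by (simp add: has_field_derivative_def inner_axis mult_commute_abs)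
  qed
  then show ?thesis by (simp add: cgrad_def vec_eq_iff)
qed

lemma cgrad_continuous: "smooth_on UNIV f \<Longrightarrow> continuous_on UNIV (cgrad f)"
  unfolding cgrad_def by (intro continuous_on_vec_lambda smooth_continuous smooth_pd)

lemma cgrad_add:
  assumes "smooth_on UNIV f" "smooth_on UNIV g"
  shows "cgrad (\<lambda>x. f x + g x) x = cgrad f x + cgrad g x"
proof (rule cgrad_eqI)
  show "((\<lambda>x. f x + g x) has_derivative (\<lambda>h. (cgrad f x + cgrad g x) \<bullet> h)) (at x)"
    unfolding inner_add_left by (intro has_derivative_add smooth_has_derivative assms)
qed

lemma cgrad_mult:
  assumes "smooth_on UNIV f" "smooth_on UNIV g"
  shows "cgrad (\<lambda>x. f x * g x) x = f x *\<^sub>R cgrad g x + g x *\<^sub>R cgrad f x"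
proof (rule cgrad_eqI)
  have "(\<lambda>h. (f x *\<^sub>R cgrad g x + g x *\<^sub>R cgrad f x) \<bullet> h)
      = (\<lambda>h. f x * (cgrad g x \<bullet> h) + (cgrad f x \<bullet> h) * g x)"
    by (simp add: inner_add_left mult.commute[of "g x"])
  then show "((\<lambda>x. f x * g x) has_derivative
      (\<lambda>h. (f x *\<^sub>R cgrad g x + g x *\<^sub>R cgrad f x) \<bullet> h)) (at x)"
    by (simp only:) (intro has_derivative_mult smooth_has_derivative assms)
qed

lemma cgrad_chain:
  assumes "smooth_on UNIV f" "(\<phi> has_real_derivative d) (at (f x))"
  shows "cgrad (\<lambda>x. \<phi> (f x)) x = d *\<^sub>R cgrad f x"
proof (rule cgrad_eqI)
  have "(\<phi> has_derivative (\<lambda>h. d * h)) (at (f x))"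
    using assms(2) by (simp add: has_field_derivative_def)
  from has_derivative_compose[OF smooth_has_derivative[OF assms(1)] this]
  show "((\<lambda>x. \<phi> (f x)) has_derivative (\<lambda>h. (d *\<^sub>R cgrad f x) \<bullet> h)) (at x)" by simp
qed

subsection \<open>Test functions\<close>

lemma test_funD:
  assumes "test_fun \<Omega> \<phi>"
  shows "smooth_on UNIV \<phi>" "compact (closure {x. \<phi> x \<noteq> 0})" "closure {x. \<phi> x \<noteq> 0} \<subseteq> \<Omega>"
  using assms by (auto simp: test_fun_def)

lemma test_fun_support_mono:
  assumes "test_fun \<Omega> \<phi>" "smooth_on UNIV \<psi>" "\<And>x. \<phi> x = 0 \<Longrightarrow> \<psi> x = 0"
  shows "test_fun \<Omega> \<psi>"
proof -
  have sub: "closure {x. \<psi> x \<noteq> 0} \<subseteq> closure {x. \<phi> x \<noteq> 0}"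
    using assms(3) by (intro closure_mono) auto
  have "compact (closure {x. \<phi> x \<noteq> 0} \<inter> closure {x. \<psi> x \<noteq> 0})"
    using assms(1) by (intro compact_Int_closed) (auto simp: test_fun_def)
  moreover have "closure {x. \<phi> x \<noteq> 0} \<inter> closure {x. \<psi> x \<noteq> 0} = closure {x. \<psi> x \<noteq> 0}"
    using sub by blast
  ultimately show ?thesis using sub assms by (auto simp: test_fun_def)
qed

lemma test_fun_add:
  assumes "test_fun \<Omega> \<phi>" "test_fun \<Omega> \<psi>"
  shows "test_fun \<Omega> (\<lambda>x. \<phi> x + \<psi> x)"
proof -
  let ?K = "closure {x. \<phi> x \<noteq> 0} \<union> closure {x. \<psi> x \<noteq> 0}"
  have sub: "closure {x. \<phi> x + \<psi> x \<noteq> 0} \<subseteq> ?K"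
    unfolding closure_Un[symmetric] by (rule closure_mono) auto
  have "compact ?K" using assms by (auto simp: test_fun_def)
  then have "compact (?K \<inter> closure {x. \<phi> x + \<psi> x \<noteq> 0})"
    by (rule compact_Int_closed) simp
  moreover have "?K \<inter> closure {x. \<phi> x + \<psi> x \<noteq> 0} = closure {x. \<phi> x + \<psi> x \<noteq> 0}"
    using sub by blast
  moreover have "?K \<subseteq> \<Omega>" using assms by (auto simp: test_fun_def)
  moreover have "smooth_on UNIV (\<lambda>x. \<phi> x + \<psi> x)"
    by (rule smooth_add[OF test_funD(1)[OF assms(1)] test_funD(1)[OF assms(2)]])
  ultimately show ?thesis
    unfolding test_fun_def using order_trans[OF sub] by simp
qed

lemma test_fun_mult:
  "test_fun \<Omega> \<phi> \<Longrightarrow> smooth_on UNIV \<psi> \<Longrightarrow> test_fun \<Omega> (\<lambda>x. \<psi> x * \<phi> x)"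
  by (rule test_fun_support_mono[of \<Omega> \<phi>]) (simp_all add: smooth_mult test_funD(1))

lemma test_fun_cmult: "test_fun \<Omega> \<phi> \<Longrightarrow> test_fun \<Omega> (\<lambda>x. c * \<phi> x)"
  by (rule test_fun_mult[OF _ smooth_const])

lemma test_fun_zero: "test_fun \<Omega> (\<lambda>x. 0)"
  by (simp add: test_fun_def smooth_const)

lemma test_fun_outside: "test_fun \<Omega> \<phi> \<Longrightarrow> x \<notin> \<Omega> \<Longrightarrow> \<phi> x = 0"
  using closure_subset[of "{x. \<phi> x \<noteq> 0}"] by (auto simp: test_fun_def)

lemma test_fun_box_bump:
  assumes "cbox a b \<subseteq> \<Omega>"
  shows "test_fun \<Omega> (box_bump a b)"
proof -
  have "{x. box_bump a b x \<noteq> 0} = box a b"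
    using box_bump_pos[of a b] box_bump_nonneg[of a b] by (auto simp: less_le)
  moreover have "closure (box a b) \<subseteq> cbox a b"
    by (rule closure_minimal[OF box_subset_cbox closed_cbox])
  moreover have "compact (closure (box a b))" using bounded_box[of a b] by simp
  ultimately show ?thesis using assms by (auto simp: test_fun_def box_bump_smooth)
qed

section \<open>Integrals under translation and integration by parts\<close>

text \<open>Function spaces live on the completed measure restricted to \<Omega>, while translation
  invariance and Fubini are applied on \<open>lborel\<close>. Extension by zero is the bridge
  between the two.\<close>

lemma lebesgue_on_integral_borel:
  fixes f :: "real^'n::finite \<Rightarrow> 'b::euclidean_space"
  assumes f: "f \<in> borel_measurable borel" and O: "open \<Omega>" and z: "\<And>x. x \<notin> \<Omega> \<Longrightarrow> f x = 0"
  shows "integrable (L \<Omega>) f \<longleftrightarrow> integrable lborel f"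
    "(LINT x|L \<Omega>. f x) = (LINT x|lborel. f x)"
proof -
  have S: "\<Omega> \<inter> space lebesgue \<in> sets lebesgue" using O by auto
  have i: "(\<lambda>x. indicator \<Omega> x *\<^sub>R f x) = f" using z by (auto simp: indicator_def fun_eq_iff)
  show "integrable (L \<Omega>) f \<longleftrightarrow> integrable lborel f"
    using integrable_restrict_space[OF S, of f] f by (simp add: i integrable_completion)
  show "(LINT x|L \<Omega>. f x) = (LINT x|lborel. f x)"
    using integral_restrict_space[OF S, of f] f by (simp add: i integral_completion)
qed

lemma nn_integral_lborel_shift:
  fixes f :: "'a::euclidean_space \<Rightarrow> ennreal"
  assumes "f \<in> borel_measurable borel"
  shows "(\<integral>\<^sup>+x. f (x + c) \<partial>lborel) = (\<integral>\<^sup>+x. f x \<partial>lborel)"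
proof -
  have "(\<integral>\<^sup>+x. f x \<partial>lborel) = (\<integral>\<^sup>+x. f x \<partial>distr lborel borel ((+) c))"
    by (simp add: lborel_distr_plus)
  also have "\<dots> = (\<integral>\<^sup>+x. f (c + x) \<partial>lborel)"
    using assms by (subst nn_integral_distr) auto
  finally show ?thesis by (simp add: add.commute)
qed

lemma integral_lborel_shift:
  fixes f :: "'a::euclidean_space \<Rightarrow> real"
  assumes "f \<in> borel_measurable borel"
  shows "(LINT x|lborel. f (x + c)) = (LINT x|lborel. f x)"
    "integrable lborel (\<lambda>x. f (x + c)) = integrable lborel f"
proof -
  have "(LINT x|lborel. f x) = (LINT x|distr lborel borel ((+) c). f x)"
    by (simp add: lborel_distr_plus)
  also have "\<dots> = (LINT x|lborel. f (c + x))"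
    using assms by (subst integral_distr) auto
  finally show "(LINT x|lborel. f (x + c)) = (LINT x|lborel. f x)" by (simp add: add.commute)
  have "integrable lborel f = integrable (distr lborel borel ((+) c)) f"
    by (simp add: lborel_distr_plus)
  also have "\<dots> = integrable lborel (\<lambda>x. f (c + x))"
    using assms by (subst integrable_distr_eq) auto
  finally show "integrable lborel (\<lambda>x. f (x + c)) = integrable lborel f" by (simp add: add.commute)
qed

lemma integrable_lborel_compact_support:
  fixes f :: "'a::euclidean_space \<Rightarrow> 'b::{banach, second_countable_topology}"
  assumes "continuous_on UNIV f" "compact K" "\<And>x. x \<notin> K \<Longrightarrow> f x = 0"
  shows "integrable lborel f"
proof -
  have "integrable lborel (\<lambda>x. indicator K x *\<^sub>R f x)"
    using assms by (intro borel_integrable_compact) (auto intro: continuous_on_subset)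
  moreover have "(\<lambda>x. indicator K x *\<^sub>R f x) = f"
    using assms by (auto simp: indicator_def fun_eq_iff)
  ultimately show ?thesis by simp
qed

lemma continuous_compact_support_sqint:
  fixes F :: "real^'n::finite \<Rightarrow> 'b::euclidean_space"
  assumes F: "continuous_on UNIV F" and K: "compact K" "K \<subseteq> \<Omega>" "\<And>x. x \<notin> K \<Longrightarrow> F x = 0"
    and O: "open \<Omega>"
  shows "F \<in> sqint (L \<Omega>)"
proof -
  have m: "F \<in> borel_measurable borel" by (rule borel_measurable_continuous_onI[OF F])
  have "F \<in> borel_measurable lebesgue" using m by (simp add: measurable_completion)
  then have mL: "F \<in> borel_measurable (L \<Omega>)" by (rule measurable_restrict_space1)
  have "integrable lborel (\<lambda>x. (norm (F x))^2)"
    by (rule integrable_lborel_compact_support[OF _ K(1)])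
      (use F K in \<open>auto intro!: continuous_intros\<close>)
  then have "integrable (L \<Omega>) (\<lambda>x. (norm (F x))^2)"
    by (subst lebesgue_on_integral_borel) (use m O K in auto)
  with mL show ?thesis by (simp add: sqint_def)
qed

lemma pd_outside_support:
  assumes "x \<notin> closure {x. \<phi> x \<noteq> 0}"
  shows "pd i \<phi> x = 0"
proof (rule pd_eqI)
  let ?U = "- closure {x. \<phi> x \<noteq> 0}"
  have "open ((\<lambda>t. x + t *\<^sub>R axis i 1) -` ?U)"
    by (rule continuous_open_vimage) (auto intro!: continuous_intros)
  moreover have "0 \<in> (\<lambda>t. x + t *\<^sub>R axis i 1) -` ?U" using assms by simp
  moreover have "\<phi> (x + t *\<^sub>R axis i 1) = 0" if "t \<in> (\<lambda>t. x + t *\<^sub>R axis i 1) -` ?U" for t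
    using that closure_subset[of "{x. \<phi> x \<noteq> 0}"] by auto
  moreover have "((\<lambda>_. 0) has_real_derivative 0) (at 0)" by simp
  ultimately show "((\<lambda>t. \<phi> (x + t *\<^sub>R axis i 1)) has_real_derivative 0) (at 0)"
    using has_field_derivative_transform_within_open[of "\<lambda>_. 0" 0 0 "(\<lambda>t. x + t *\<^sub>R axis i 1) -` ?U"]
    by metis
qed

lemma test_fun_pd:
  assumes "test_fun \<Omega> \<phi>"
  shows "test_fun \<Omega> (pd i \<phi>)"
proof -
  have sub: "closure {x. pd i \<phi> x \<noteq> 0} \<subseteq> closure {x. \<phi> x \<noteq> 0}"
    by (rule closure_minimal) (use pd_outside_support in auto)
  have "compact (closure {x. \<phi> x \<noteq> 0} \<inter> closure {x. pd i \<phi> x \<noteq> 0})"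
    using test_funD[OF assms] by (intro compact_Int_closed) auto
  moreover have "closure {x. \<phi> x \<noteq> 0} \<inter> closure {x. pd i \<phi> x \<noteq> 0} = closure {x. pd i \<phi> x \<noteq> 0}"
    using sub by blast
  ultimately show ?thesis using sub test_funD[OF assms] by (auto simp: test_fun_def smooth_pd)
qed

lemma test_fun_sqint:
  assumes "test_fun \<Omega> \<phi>" "open \<Omega>"
  shows "\<phi> \<in> sqint (L \<Omega>)" "cgrad \<phi> \<in> sqint (L \<Omega>)"
proof -
  show "\<phi> \<in> sqint (L \<Omega>)"
    by (rule continuous_compact_support_sqint[OF smooth_continuous[OF test_funD(1)[OF assms(1)]]
        test_funD(2,3)[OF assms(1)] _ assms(2)])
      (use closure_subset[of "{x. \<phi> x \<noteq> 0}"] in auto)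
  show "cgrad \<phi> \<in> sqint (L \<Omega>)"
    by (rule continuous_compact_support_sqint[OF cgrad_continuous[OF test_funD(1)[OF assms(1)]]
        test_funD(2,3)[OF assms(1)] _ assms(2)])
      (use pd_outside_support[of _ \<phi>] in \<open>auto simp: cgrad_def vec_eq_iff\<close>)
qed

text \<open>By translation invariance every difference quotient of \<open>g\<close> has integral
  zero; dominated convergence hands this on to the derivative. All integrations by parts below rest
  on this fact.\<close>

lemma integral_pd_zero:
  fixes g :: "real^'n::finite \<Rightarrow> real"
  assumes g: "test_fun UNIV g"
  shows "(LINT x|lborel. pd i g x) = 0"
proof -
  let ?K = "closure {x. g x \<noteq> 0}"
  have sg: "smooth_on UNIV g" and K: "compact ?K" using test_funD[OF g] by auto
  have z: "g x = 0" if "x \<notin> ?K" for x using that closure_subset[of "{x. g x \<noteq> 0}"] by auto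
  have gm: "g \<in> borel_measurable borel"
    by (rule borel_measurable_continuous_onI[OF smooth_continuous[OF sg]])
  have pm: "pd i g \<in> borel_measurable borel"
    by (rule borel_measurable_continuous_onI[OF smooth_continuous[OF smooth_pd[OF sg]]])
  have "bounded (pd i g ` ?K)"
    by (rule compact_imp_bounded[OF compact_continuous_image[OF continuous_on_subset[OF smooth_continuous[OF smooth_pd[OF sg]]] K]]) auto
  then obtain B where B: "\<And>x. x \<in> ?K \<Longrightarrow> \<bar>pd i g x\<bar> \<le> B" "B > 0"
    by (auto simp: bounded_pos)
  have B: "\<bar>pd i g x\<bar> \<le> B" for x
    using B pd_outside_support[of x g i] by (cases "x \<in> ?K") auto
  obtain R where "\<forall>x\<in>?K. norm x \<le> R"
    using compact_imp_bounded[OF K] unfolding bounded_iff by metis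
  then have R: "?K \<subseteq> cball 0 R" by auto
  define t where "t n = inverse (real (Suc n))" for n
  have t: "t n > 0" "t n \<le> 1" for n by (simp_all add: t_def inverse_le_1_iff)
  define q where "q n x = (g (x + t n *\<^sub>R axis i 1) - g x) / t n" for n x
  have gi: "integrable lborel g"
    by (rule integrable_lborel_compact_support[OF smooth_continuous[OF sg] K z])
  have q0: "(LINT x|lborel. q n x) = 0" for n
    unfolding q_def using integral_lborel_shift[OF gm, of "t n *\<^sub>R axis i 1"] gi by simp
  \<comment> \<open>The steps \<open>t n\<close> are at most 1, so all the quotients are supported
    within distance 1 of the support of \<open>g\<close>; this explains the radius
    \<open>R + 1\<close>.\<close>
  have "(\<lambda>n. LINT x|lborel. q n x) \<longlonglongrightarrow> (LINT x|lborel. pd i g x)"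
  proof (rule integral_dominated_convergence[where w = "\<lambda>x. indicator (cball 0 (R + 1)) x * B"])
    show "integrable lborel (\<lambda>x::real^'n. indicator (cball 0 (R + 1)) x * B)"
      using emeasure_compact_finite[OF compact_cball, of "0::real^'n" "R+1"]
      by (intro integrable_mult_left integrable_real_indicator) auto
    show "AE x in lborel. (\<lambda>n. q n x) \<longlonglongrightarrow> pd i g x"
    proof (rule AE_I2)
      fix x
      have "((\<lambda>h. (g (x + h *\<^sub>R axis i 1) - g (x + 0 *\<^sub>R axis i 1)) / (h - 0)) \<longlongrightarrow> pd i g x) (at 0)"
        using has_pd[OF smooth_differentiable[OF sg], of x i] by (simp add: has_field_derivative_iff)
      moreover have "filterlim t (at 0) sequentially"
      proof -
        have "t \<longlonglongrightarrow> 0" unfolding t_def by (rule LIMSEQ_inverse_real_of_nat)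
        then show ?thesis using t by (simp add: filterlim_at less_imp_neq[symmetric])
      qed
      ultimately have "(\<lambda>n. (g (x + t n *\<^sub>R axis i 1) - g (x + 0 *\<^sub>R axis i 1)) / (t n - 0)) \<longlonglongrightarrow> pd i g x"
        by (rule filterlim_compose)
      then show "(\<lambda>n. q n x) \<longlonglongrightarrow> pd i g x" by (simp add: q_def)
    qed
    show "AE x in lborel. norm (q n x) \<le> indicator (cball 0 (R + 1)) x * B" for n
    proof (rule AE_I2)
      fix x
      show "norm (q n x) \<le> indicator (cball 0 (R + 1)) x * B"
      proof (cases "x \<in> cball 0 (R + 1)")
        case True
        have "norm (g (x + t n *\<^sub>R axis i 1) - g (x + 0 *\<^sub>R axis i 1)) \<le> B * norm (t n - 0)"
          by (rule field_differentiable_bound[of UNIV "\<lambda>s. g (x + s *\<^sub>R axis i 1)" "\<lambda>s. pd i g (x + s *\<^sub>R axis i 1)"])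
            (use smooth_DERIV_line[OF sg] B in auto)
        then show ?thesis using t[of n] True by (simp add: q_def field_simps)
      next
        case False
        have "norm (t n *\<^sub>R axis i (1::real) :: real^'n) \<le> 1" using t[of n] by simp
        then have "x + t n *\<^sub>R axis i 1 \<notin> cball 0 R" "x \<notin> cball 0 R"
          using False norm_triangle_ineq4[of "x + t n *\<^sub>R axis i 1" "t n *\<^sub>R axis i 1"] by auto
        then have "g (x + t n *\<^sub>R axis i 1) = 0" "g x = 0" using R z by blast+
        then show ?thesis using False by (simp add: q_def)
      qed
    qed
  qed (use gm pm in \<open>auto simp: q_def\<close>)
  then have "(\<lambda>n. 0) \<longlonglongrightarrow> (LINT x|lborel. pd i g x)" by (simp add: q0)
  then show ?thesis using LIMSEQ_unique[OF tendsto_const] by metis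
qed

lemma test_fun_mono: "test_fun \<Omega> \<phi> \<Longrightarrow> \<Omega> \<subseteq> \<Omega>' \<Longrightarrow> test_fun \<Omega>' \<phi>"
  by (auto simp: test_fun_def)

lemma pd_mult:
  assumes "smooth_on UNIV f" "smooth_on UNIV g"
  shows "pd i (\<lambda>x. f x * g x) x = f x * pd i g x + g x * pd i f x"
  using arg_cong[OF cgrad_mult[OF assms, of x], of "\<lambda>v. v $ i"] by (simp add: cgrad_def)

lemma integral_pd_zero_on:
  assumes "test_fun \<Omega> g" "open \<Omega>"
  shows "(LINT x|L \<Omega>. pd i g x) = 0"
proof -
  have "pd i g \<in> borel_measurable borel"
    by (rule borel_measurable_continuous_onI[OF smooth_continuous[OF smooth_pd[OF test_funD(1)[OF assms(1)]]]])
  then have "(LINT x|L \<Omega>. pd i g x) = (LINT x|lborel. pd i g x)"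
    by (rule lebesgue_on_integral_borel[OF _ assms(2)]) (rule test_fun_outside[OF test_fun_pd[OF assms(1)]])
  then show ?thesis using integral_pd_zero[OF test_fun_mono[OF assms(1)]] by simp
qed

lemma test_fun_weak_gradient:
  assumes \<phi>: "test_fun \<Omega> \<phi>" and O: "open \<Omega>"
  shows "has_weak_gradient \<Omega> \<phi> (cgrad \<phi>)"
  unfolding has_weak_gradient_def
proof (intro allI impI conjI)
  fix \<psi> i assume \<psi>: "test_fun \<Omega> \<psi>"
  have i1: "integrable (L \<Omega>) (\<lambda>x. \<phi> x * pd i \<psi> x)"
    by (rule sqint_mult) (use test_fun_sqint[OF \<phi> O] test_fun_sqint[OF test_fun_pd[OF \<psi>] O] in auto)
  have i2: "integrable (L \<Omega>) (\<lambda>x. pd i \<phi> x * \<psi> x)"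
    by (rule sqint_mult) (use test_fun_sqint[OF \<psi> O] test_fun_sqint[OF test_fun_pd[OF \<phi>] O] in auto)
  show "integrable (L \<Omega>) (\<lambda>x. \<phi> x * pd i \<psi> x)" by (fact i1)
  show "integrable (L \<Omega>) (\<lambda>x. cgrad \<phi> x $ i * \<psi> x)" using i2 by (simp add: cgrad_def)
  have "(LINT x|L \<Omega>. pd i (\<lambda>x. \<phi> x * \<psi> x) x) = 0"
    by (rule integral_pd_zero_on[OF test_fun_mult[OF \<psi> test_funD(1)[OF \<phi>]] O])
  moreover have "pd i (\<lambda>x. \<phi> x * \<psi> x) = (\<lambda>x. \<phi> x * pd i \<psi> x + pd i \<phi> x * \<psi> x)"
    using pd_mult[OF test_funD(1)[OF \<phi>] test_funD(1)[OF \<psi>]] by (auto simp: fun_eq_iff)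
  ultimately have "(LINT x|L \<Omega>. \<phi> x * pd i \<psi> x + pd i \<phi> x * \<psi> x) = 0" by simp
  then show "(LINT x|L \<Omega>. \<phi> x * pd i \<psi> x) = - (LINT x|L \<Omega>. cgrad \<phi> x $ i * \<psi> x)"
    using i1 i2 by (simp add: cgrad_def)
qed

lemma coordinate_smooth: "smooth_on UNIV (\<lambda>x::real^'n::finite. x $ i)"
proof (rule galg_smooth[of _ "{\<lambda>x. x $ i}"])
  have D: "((\<lambda>t. (x + t *\<^sub>R axis k 1) $ i) has_real_derivative axis k 1 $ i) (at 0)" for x :: "real^'n" and k
    by (auto intro!: derivative_eq_intros)
  show "(\<lambda>t. b (x + t *\<^sub>R axis k 1)) differentiable (at 0)" if "b \<in> {\<lambda>x. x $ i}" for b and x :: "real^'n" and k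
    using that D[of x k] by (auto simp: real_differentiable_def)
  show "pd k b \<in> galg {\<lambda>x. x $ i}" if "b \<in> {\<lambda>x. x $ i}" for b and k :: 'n
  proof -
    have "pd k b = (\<lambda>x. axis k 1 $ i)"
      using that by (auto intro!: ext pd_eqI D)
    then show ?thesis by (simp add: galg.const)
  qed
qed (auto intro: galg.base continuous_intros)

text \<open>The derivative of x_i \<phi>^2 in direction i is \<phi>^2 + 2 x_i \<phi> d_i\<phi> and
  integrates to zero. Bounding |x_i| by \<open>R\<close> and applying Cauchy-Schwarz leaves a factor
  |\<phi>| to cancel. Any single coordinate direction will do.\<close>

lemma Poincare_test_fun:
  fixes \<Omega> :: "(real^'n::finite) set"
  assumes \<phi>: "test_fun \<Omega> \<phi>" and O: "open \<Omega>" and R: "\<And>x. x \<in> \<Omega> \<Longrightarrow> norm x \<le> R" "R \<ge> 0"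
  shows "l2n (L \<Omega>) \<phi> \<le> 2 * R * l2n (L \<Omega>) (cgrad \<phi>)"
proof -
  obtain i :: 'n where True by simp
  note s = test_fun_sqint[OF \<phi> O] and sm = test_funD(1)[OF \<phi>]
  have cm: "(\<lambda>x. x $ i) \<in> borel_measurable (L \<Omega>)"
    by (rule measurable_restrict_space1, rule measurable_completion)
      (auto intro!: borel_measurable_continuous_onI continuous_intros)
  have bd: "AE x in L \<Omega>. \<bar>x $ i\<bar> \<le> R"
    by (rule AE_I2) (use R component_le_norm_cart order_trans in \<open>fastforce\<close>)
  have s1: "(\<lambda>x. x $ i * \<phi> x) \<in> sqint (L \<Omega>)" and s1n: "l2n (L \<Omega>) (\<lambda>x. x $ i * \<phi> x) \<le> R * l2n (L \<Omega>) \<phi>"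
  proof -
    show a: "(\<lambda>x. x $ i * \<phi> x) \<in> sqint (L \<Omega>)" using sqint_bounded_mult[OF s(1) cm bd] by simp
    have "l2n (L \<Omega>) (\<lambda>x. x $ i * \<phi> x) \<le> l2n (L \<Omega>) (\<lambda>x. R * \<phi> x)"
      by (rule sqint_dominated[OF sqint_cmult[OF s(1)] sqintD(1)[OF a]])
        (use bd in eventually_elim, use R in \<open>simp add: abs_mult mult_right_mono\<close>)
    then show "l2n (L \<Omega>) (\<lambda>x. x $ i * \<phi> x) \<le> R * l2n (L \<Omega>) \<phi>" using R by (simp add: l2n_cmult)
  qed
  have s2: "pd i \<phi> \<in> sqint (L \<Omega>)" by (rule test_fun_sqint[OF test_fun_pd[OF \<phi>] O])
  have "norm (pd i \<phi> x) \<le> norm (cgrad \<phi> x)" for x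
    using component_le_norm_cart[of "cgrad \<phi> x" i] by (simp add: cgrad_def)
  then have s2n: "l2n (L \<Omega>) (pd i \<phi>) \<le> l2n (L \<Omega>) (cgrad \<phi>)"
    by (intro sqint_dominated(2)[OF s(2) sqintD(1)[OF s2]] AE_I2)
  have sm2: "smooth_on UNIV (\<lambda>x. x $ i * \<phi> x)" by (rule smooth_mult[OF coordinate_smooth sm])
  have "(LINT x|L \<Omega>. pd i (\<lambda>x. (x $ i * \<phi> x) * \<phi> x) x) = 0"
    by (rule integral_pd_zero_on[OF test_fun_mult[OF \<phi> sm2] O])
  moreover have "pd i (\<lambda>x. (x $ i * \<phi> x) * \<phi> x) = (\<lambda>x. (\<phi> x)^2 + 2 * ((x $ i * \<phi> x) * pd i \<phi> x))"
  proof
    fix x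
    have 1: "pd i (\<lambda>x::real^'n. x $ i) x = 1"
      by (rule pd_eqI) (auto intro!: derivative_eq_intros simp: axis_def)
    show "pd i (\<lambda>x. (x $ i * \<phi> x) * \<phi> x) x = (\<phi> x)^2 + 2 * ((x $ i * \<phi> x) * pd i \<phi> x)"
      using pd_mult[OF sm2 sm, of i x] pd_mult[OF coordinate_smooth sm, of i i x] 1
      by (simp add: power2_eq_square algebra_simps)
  qed
  ultimately have "(LINT x|L \<Omega>. (\<phi> x)^2 + 2 * ((x $ i * \<phi> x) * pd i \<phi> x)) = 0"
    by (simp only:)
  moreover have "(LINT x|L \<Omega>. (\<phi> x)^2 + 2 * ((x $ i * \<phi> x) * pd i \<phi> x))
      = (LINT x|L \<Omega>. (\<phi> x)^2) + (LINT x|L \<Omega>. 2 * ((x $ i * \<phi> x) * pd i \<phi> x))"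
    by (rule Bochner_Integration.integral_add[OF _ integrable_mult_right[OF sqint_mult[OF s1 s2]]])
      (use sqintD(2)[OF s(1)] in simp)
  moreover have "(LINT x|L \<Omega>. 2 * ((x $ i * \<phi> x) * pd i \<phi> x))
      = 2 * (LINT x|L \<Omega>. (x $ i * \<phi> x) * pd i \<phi> x)"
    by (rule integral_mult_right_zero)
  moreover have "(l2n (L \<Omega>) \<phi>)^2 = (LINT x|L \<Omega>. (\<phi> x)^2)"
    by (simp add: l2n_power2)
  ultimately have "(l2n (L \<Omega>) \<phi>)^2 = - 2 * (LINT x|L \<Omega>. (x $ i * \<phi> x) * pd i \<phi> x)"
    by linarith
  also have "\<dots> \<le> 2 * (l2n (L \<Omega>) (\<lambda>x. x $ i * \<phi> x) * l2n (L \<Omega>) (pd i \<phi>))"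
    using l2n_Cauchy_Schwarz_real[OF s1 s2] by linarith
  also have "\<dots> \<le> 2 * ((R * l2n (L \<Omega>) \<phi>) * l2n (L \<Omega>) (cgrad \<phi>))"
    by (intro mult_left_mono mult_mono s1n s2n) (use R in auto)
  finally have "l2n (L \<Omega>) \<phi> * l2n (L \<Omega>) \<phi> \<le> l2n (L \<Omega>) \<phi> * (2 * R * l2n (L \<Omega>) (cgrad \<phi>))"
    by (simp add: power2_eq_square algebra_simps)
  then show ?thesis
  proof (cases "l2n (L \<Omega>) \<phi> = 0")
    case True
    then show ?thesis using R by simp
  next
    case False
    then have "l2n (L \<Omega>) \<phi> > 0" using l2n_nonneg[of "L \<Omega>" \<phi>] by linarith
    with \<open>l2n (L \<Omega>) \<phi> * l2n (L \<Omega>) \<phi> \<le> _\<close> show ?thesis by (simp add: mult_le_cancel_left_pos)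
  qed
qed

text \<open>If \<open>S\<close> is a bump function with \<open>{S > 0} = U\<close>, then the smooth functions \<open>S / (S + 1/k)\<close>
  increase to the indicator of \<open>U\<close>.\<close>

lemma integral_open_zero:
  fixes g :: "real^'n::finite \<Rightarrow> real"
  assumes O: "open \<Omega>" and g: "integrable (L \<Omega>) g"
    and z: "\<And>\<phi>. test_fun \<Omega> \<phi> \<Longrightarrow> (LINT x|L \<Omega>. g x * \<phi> x) = 0"
    and U: "open U" "U \<subseteq> \<Omega>"
  shows "(LINT x|L \<Omega>. g x * indicator U x) = 0"
proof -
  let ?F = "{box a b | a b. cbox a b \<subseteq> U}"
  \<comment> \<open>Lindelof reduces the cover to countably many boxes, so that finite sums of bumps
    exhaust \<open>U\<close>.\<close>
  obtain F' where F': "F' \<subseteq> ?F" "countable F'" "\<Union>F' = \<Union>?F"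
    using Lindelof[of ?F] by (auto simp: open_box)
  have UU: "\<Union>?F = U"
  proof
    show "\<Union>?F \<subseteq> U" using box_subset_cbox by blast
    show "U \<subseteq> \<Union>?F"
    proof
      fix x assume "x \<in> U"
      then obtain a b where "x \<in> box a b" "cbox a b \<subseteq> U"
        using open_contains_cbox[THEN iffD1, OF U(1)] by metis
      then show "x \<in> \<Union>?F" by blast
    qed
  qed
  show ?thesis
  proof (cases "F' = {}")
    case True
    then have "U = {}" using F' UU by simp
    then show ?thesis by simp
  next
    case False
    then obtain e :: "nat \<Rightarrow> (real^'n) set" where e: "range e = F'"
      using F'(2) by (metis range_from_nat_into)
    have "\<exists>a b. e n = box a b \<and> cbox a b \<subseteq> U" for n using e F'(1) by blast
    then obtain a b where ab: "\<And>n. e n = box (a n) (b n)" "\<And>n. cbox (a n) (b n) \<subseteq> U" by metis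
    have Ue: "U = (\<Union>n. box (a n) (b n))" using e F' UU ab by auto
    define S where "S k x = (\<Sum>n<k. box_bump (a n) (b n) x)" for k x
    have Stest: "test_fun \<Omega> (S k)" for k
    proof (induction k)
      case 0
      then show ?case by (simp add: S_def test_fun_zero)
    next
      case (Suc k)
      have "test_fun \<Omega> (\<lambda>x. S k x + box_bump (a k) (b k) x)"
        by (rule test_fun_add[OF Suc test_fun_box_bump]) (use ab U in blast)
      then show ?case by (simp add: S_def)
    qed
    have S0: "S k x \<ge> 0" for k x unfolding S_def by (intro sum_nonneg box_bump_nonneg)
    have Smono: "S k x \<le> S l x" if "k \<le> l" for k l x
      unfolding S_def by (rule sum_mono2) (use that box_bump_nonneg in auto)
    define \<phi> where "\<phi> k x = inverse (S k x + inverse (real (Suc k))) * S k x" for k x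
    have pos: "S k x + inverse (real (Suc k)) > 0" for k x using S0[of k x] by (simp add: add_nonneg_pos)
    have \<phi>test: "test_fun \<Omega> (\<phi> k)" for k
      unfolding \<phi>_def
      by (intro test_fun_mult[OF Stest] smooth_inverse smooth_add smooth_const test_funD(1)[OF Stest])
        (use pos in \<open>auto simp: less_imp_neq[symmetric]\<close>)
    have \<phi>01: "0 \<le> \<phi> k x" "\<phi> k x \<le> 1" for k x
      using S0[of k x] pos[of k x] by (auto simp: \<phi>_def field_simps simp del: of_nat_Suc)
    have lim: "(\<lambda>k. \<phi> k x) \<longlonglongrightarrow> indicator U x" for x
    proof (cases "x \<in> U")
      case True
      then obtain n where n: "x \<in> box (a n) (b n)" using Ue by blast
      define c where "c = S (Suc n) x"
      have c: "c > 0"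
      proof -
        have "box_bump (a n) (b n) x > 0" using n by (simp add: box_bump_pos)
        then show ?thesis using S0[of n x] by (simp add: c_def S_def)
      qed
      have ge: "1 - \<phi> k x \<le> inverse (real (Suc k)) / c" if "k \<ge> Suc n" for k
      proof -
        have cS: "c \<le> S k x" unfolding c_def by (rule Smono[OF that])
        have "1 - \<phi> k x = inverse (real (Suc k)) / (S k x + inverse (real (Suc k)))"
          using pos[of k x] by (simp add: \<phi>_def divide_inverse[symmetric] field_simps del: of_nat_Suc)
        also have "\<dots> \<le> inverse (real (Suc k)) / c"
          using c cS by (intro divide_left_mono) (auto simp: add_pos_nonneg add_increasing2 mult_pos_pos)
        finally show ?thesis .
      qed
      have "(\<lambda>k. inverse (real (Suc k)) / c) \<longlonglongrightarrow> 0 / c"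
        by (rule tendsto_divide[OF LIMSEQ_inverse_real_of_nat tendsto_const]) (use c in auto)
      then have "(\<lambda>k. inverse (real (Suc k)) / c) \<longlonglongrightarrow> 0" by simp
      then have "(\<lambda>k. 1 - \<phi> k x) \<longlonglongrightarrow> 0"
        by (rule Lim_null_comparison[rotated])
          (use ge \<phi>01 in \<open>auto simp: eventually_sequentially intro!: exI[of _ "Suc n"]\<close>)
      then have "(\<lambda>k. 1 - (1 - \<phi> k x)) \<longlonglongrightarrow> 1 - 0" by (intro tendsto_intros)
      then show ?thesis using True by simp
    next
      case False
      have "S k x = 0" for k
        unfolding S_def
      proof (rule sum.neutral, rule ballI)
        fix n
        have "\<not> box_bump (a n) (b n) x > 0" using False Ue by (auto simp: box_bump_pos)
        then show "box_bump (a n) (b n) x = 0" using box_bump_nonneg[of "a n" "b n" x] by linarith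
      qed
      then show ?thesis using False by (simp add: \<phi>_def)
    qed
    have "(\<lambda>k. LINT x|L \<Omega>. g x * \<phi> k x) \<longlonglongrightarrow> (LINT x|L \<Omega>. g x * indicator U x)"
    proof (rule integral_dominated_convergence[where w = "\<lambda>x. \<bar>g x\<bar>"])
      show "(\<lambda>x. g x * indicator U x) \<in> borel_measurable (L \<Omega>)"
      proof -
        have "indicator U \<in> borel_measurable lborel" using U by simp
        then have "(indicator U :: real^'n \<Rightarrow> real) \<in> borel_measurable (L \<Omega>)"
          by (intro measurable_restrict_space1 measurable_completion)
        then show ?thesis using g by measurable
      qed
      show "(\<lambda>x. g x * \<phi> k x) \<in> borel_measurable (L \<Omega>)" for k
        using g sqintD(1)[OF test_fun_sqint(1)[OF \<phi>test O, of k]] by measurable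
      show "integrable (L \<Omega>) (\<lambda>x. \<bar>g x\<bar>)" using g by simp
      show "AE x in L \<Omega>. (\<lambda>k. g x * \<phi> k x) \<longlonglongrightarrow> g x * indicator U x"
        by (intro AE_I2 tendsto_mult tendsto_const lim)
      show "AE x in L \<Omega>. norm (g x * \<phi> k x) \<le> \<bar>g x\<bar>" for k
      proof (rule AE_I2)
        fix x
        have "\<bar>g x\<bar> * \<bar>\<phi> k x\<bar> \<le> \<bar>g x\<bar> * 1" using \<phi>01[of k x] by (intro mult_left_mono) auto
        then show "norm (g x * \<phi> k x) \<le> \<bar>g x\<bar>" by (simp add: abs_mult)
      qed
    qed
    then have "(\<lambda>k. 0) \<longlonglongrightarrow> (LINT x|L \<Omega>. g x * indicator U x)" by (simp add: z[OF \<phi>test])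
    then show ?thesis using LIMSEQ_unique[OF tendsto_const] by metis
  qed
qed

text \<open>Let E be the set where \<open>g\<close> is positive and enclose it in an open set U with
  U - E of small measure. As the integral over U vanishes, the integral over E equals, up to sign,
  the one over U - E, which Cauchy-Schwarz makes arbitrarily small.\<close>

lemma AE_le_0_if_integral_open:
  fixes g :: "real^'n::finite \<Rightarrow> real"
  assumes O: "open \<Omega>" and g: "g \<in> sqint (L \<Omega>)" and gi: "integrable (L \<Omega>) g"
    and z: "\<And>U. open U \<Longrightarrow> U \<subseteq> \<Omega> \<Longrightarrow> (LINT x|L \<Omega>. g x * indicator U x) = 0"
  shows "AE x in L \<Omega>. g x \<le> 0"
proof -
  define E where "E = {x\<in>\<Omega>. g x > 0}"
  have gm: "g \<in> borel_measurable (L \<Omega>)" by (rule sqintD[OF g])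
  have Om: "\<Omega> \<in> sets lebesgue" using O by auto
  have "{x\<in>space (L \<Omega>). g x > 0} \<in> sets (L \<Omega>)" using gm by measurable
  then have ESL: "E \<in> sets (L \<Omega>)" by (simp add: E_def)
  then have ES: "E \<in> sets lebesgue"
    using Om by (auto simp: sets_restrict_space)
  have im: "(\<lambda>x. indicator A x :: real) \<in> borel_measurable (L \<Omega>)" if "A \<in> sets lebesgue" for A
    by (rule measurable_restrict_space1) (use that in auto)
  have iE: "integrable (L \<Omega>) (\<lambda>x. g x * indicator E x)"
    by (rule Bochner_Integration.integrable_bound[OF gi])
      (use gm im[OF ES] in \<open>auto simp: indicator_def\<close>)
  have bound: "\<bar>LINT x|L \<Omega>. g x * indicator E x\<bar> \<le> l2n (L \<Omega>) g * sqrt e" if e: "e > 0" for e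
  proof -
    obtain T where T: "open T" "E \<subseteq> T" "T - E \<in> lmeasurable" "emeasure lebesgue (T - E) < ennreal e"
      using sets_lebesgue_outer_open[OF ES e] by metis
    define U where "U = T \<inter> \<Omega>"
    define D where "D = U - E"
    have U: "open U" "U \<subseteq> \<Omega>" "E \<subseteq> U" using T O by (auto simp: U_def E_def)
    have DS: "D \<in> sets lebesgue" using ES U(1) by (auto simp: D_def)
    have Dsub: "D \<subseteq> T - E" by (auto simp: D_def U_def)
    have eD: "emeasure lebesgue D \<le> ennreal e"
      using emeasure_mono[OF Dsub, of lebesgue] T(3,4) by (auto simp: fmeasurable_def)
    have eDL: "emeasure (L \<Omega>) D = emeasure lebesgue D"
      by (rule emeasure_restrict_space) (use Om U in \<open>auto simp: D_def\<close>)
    have DSL: "D \<in> sets (L \<Omega>)" using DS U Om by (auto simp: sets_restrict_space_iff D_def)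
    have Dint: "integrable (L \<Omega>) (indicator D :: _ \<Rightarrow> real)"
      by (rule integrable_real_indicator[OF DSL]) (use eDL eD in \<open>auto simp: less_top[symmetric] top_unique\<close>)
    have sD: "(\<lambda>x. indicator D x :: real) \<in> sqint (L \<Omega>)"
    proof -
      have "(\<lambda>x. (norm (indicator D x :: real))^2) = (indicator D :: _ \<Rightarrow> real)"
        by (auto simp: indicator_def)
      then show ?thesis using Dint by (simp add: sqint_def)
    qed
    have lD: "l2n (L \<Omega>) (\<lambda>x. indicator D x :: real) \<le> sqrt e"
    proof -
      have "(\<lambda>x. (norm (indicator D x :: real))^2) = (indicator D :: _ \<Rightarrow> real)"
        by (auto simp: indicator_def)
      then have "l2n (L \<Omega>) (\<lambda>x. indicator D x :: real) = sqrt (measure (L \<Omega>) D)"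
        using DSL sets.sets_into_space[OF DSL] by (simp add: l2n_def Int_absorb2)
      moreover have "measure (L \<Omega>) D \<le> e"
        unfolding measure_def using eD eDL e by (metis enn2real_mono enn2real_ennreal ennreal_less_top less_imp_le)
      ultimately show ?thesis by simp
    qed
    have sU: "integrable (L \<Omega>) (\<lambda>x. g x * indicator D x)" by (rule sqint_mult[OF g sD])
    have eq: "g x * indicator U x = g x * indicator E x + g x * indicator D x" for x
      using U by (auto simp: D_def indicator_def)
    have "0 = (LINT x|L \<Omega>. g x * indicator E x) + (LINT x|L \<Omega>. g x * indicator D x)"
      using z[OF U(1,2)] iE sU by (simp add: eq)
    then have "\<bar>LINT x|L \<Omega>. g x * indicator E x\<bar> = \<bar>LINT x|L \<Omega>. g x * indicator D x\<bar>" by linarith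
    also have "\<dots> \<le> l2n (L \<Omega>) g * l2n (L \<Omega>) (\<lambda>x. indicator D x :: real)"
      by (rule l2n_Cauchy_Schwarz_real[OF g sD])
    also have "\<dots> \<le> l2n (L \<Omega>) g * sqrt e" by (intro mult_left_mono lD) simp
    finally show ?thesis .
  qed
  have "(LINT x|L \<Omega>. g x * indicator E x) = 0"
  proof (rule ccontr)
    assume n: "(LINT x|L \<Omega>. g x * indicator E x) \<noteq> 0"
    define c where "c = \<bar>LINT x|L \<Omega>. g x * indicator E x\<bar>"
    have c: "c > 0" using n by (simp add: c_def)
    define A where "A = l2n (L \<Omega>) g + 1"
    have A: "A > 0" by (simp add: A_def add_nonneg_pos)
    \<comment> \<open>The excess measure is chosen so that its square root is
      \<open>c / (2*A)\<close>, which gives the contradiction \<open>c \<le> c/2\<close>; the 1 in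
      \<open>A\<close> keeps the quotient defined.\<close>
    have "c \<le> l2n (L \<Omega>) g * sqrt ((c / (2*A))^2)"
      unfolding c_def by (rule bound) (use c A in \<open>simp add: c_def\<close>)
    also have "\<dots> = l2n (L \<Omega>) g * (c / (2*A))" using c A by simp
    also have "\<dots> \<le> A * (c / (2*A))" using c A by (intro mult_right_mono) (auto simp: A_def)
    also have "\<dots> = c / 2" using A by simp
    finally show False using c by simp
  qed
  moreover have "g x * indicator E x \<ge> 0" for x by (auto simp: E_def indicator_def)
  ultimately have "AE x in L \<Omega>. g x * indicator E x = 0"
    using integral_nonneg_eq_0_iff_AE[OF iE] by simp
  moreover have "AE x in L \<Omega>. x \<in> \<Omega>" by (rule AE_I2) simp
  ultimately show ?thesis
    by eventually_elim (auto simp: E_def indicator_def not_less split: if_splits)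
qed

lemma AE_zero_if_orthogonal_test_fun:
  fixes g :: "real^'n::finite \<Rightarrow> real"
  assumes O: "open \<Omega>" and g: "g \<in> sqint (L \<Omega>)" and gi: "integrable (L \<Omega>) g"
    and z: "\<And>\<phi>. test_fun \<Omega> \<phi> \<Longrightarrow> (LINT x|L \<Omega>. g x * \<phi> x) = 0"
  shows "AE x in L \<Omega>. g x = 0"
proof -
  note zU = integral_open_zero[OF O gi z]
  have "AE x in L \<Omega>. g x \<le> 0" by (rule AE_le_0_if_integral_open[OF O g gi zU])
  moreover have "AE x in L \<Omega>. -1 * g x \<le> 0"
    by (rule AE_le_0_if_integral_open[OF O sqint_cmult[OF g]]) (use gi zU in auto)
  ultimately show ?thesis by eventually_elim auto
qed

subsection \<open>The Sobolev space\<close>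

lemma L2_eq_sqint: "L2 \<Omega> = sqint (L \<Omega>)" "L2vec \<Omega> = sqint (L \<Omega>)"
  by (auto simp: L2_def L2vec_def sqint_def)

lemma hnorm_eq_l2n: "hnorm \<Omega> u = l2n (L \<Omega>) (wgrad \<Omega> u)"
  by (simp add: hnorm_def l2n_def)

locale bounded_open =
  fixes \<Omega> :: "(real^'n::finite) set"
  assumes open_dom: "open \<Omega>" and bounded_dom: "bounded \<Omega>"
begin

abbreviation "S2 \<equiv> sqint (L \<Omega>)"
abbreviation "n2 \<equiv> l2n (L \<Omega>)"
abbreviation "hn \<equiv> hnorm \<Omega>"
abbreviation "wg \<equiv> wgrad \<Omega>"

definition ip :: "(real^'n \<Rightarrow> real) \<Rightarrow> (real^'n \<Rightarrow> real) \<Rightarrow> real" where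
  "ip u v = (LINT x|L \<Omega>. wg u x \<bullet> wg v x)"

sublocale finite_measure "L \<Omega>"
  by (rule finite_measure_lebesgue_on[OF lmeasurable_open[OF bounded_dom open_dom]])

lemma dom_lebesgue: "\<Omega> \<in> sets lebesgue"
  using open_dom by auto

lemma S2_const: "(\<lambda>x. c) \<in> S2"
  by (simp add: sqint_def)

lemma S2_integrable:
  fixes F :: "real^'n \<Rightarrow> real"
  assumes "F \<in> S2"
  shows "integrable (L \<Omega>) F"
  using sqint_mult[OF S2_const[of 1] assms] by simp

text \<open>Integration by parts holds for the approximating test functions, and both of its sides
  are continuous under L2 convergence.\<close>

lemma weak_gradient_limit:
  assumes t: "\<And>k. test_fun \<Omega> (\<phi> k)" and u: "u \<in> S2" and G: "G \<in> S2"
    and l: "(\<lambda>k. n2 (\<lambda>x. \<phi> k x - u x)) \<longlonglongrightarrow> 0" "(\<lambda>k. n2 (\<lambda>x. cgrad (\<phi> k) x - G x)) \<longlonglongrightarrow> 0"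
  shows "has_weak_gradient \<Omega> u G"
  unfolding has_weak_gradient_def
proof (intro allI impI)
  fix \<psi> i assume \<psi>: "test_fun \<Omega> \<psi>"
  have p: "pd i \<psi> \<in> S2" "\<psi> \<in> S2"
    by (rule test_fun_sqint[OF test_fun_pd[OF \<psi>] open_dom], rule test_fun_sqint[OF \<psi> open_dom])
  \<comment> \<open>Pairing with a multiple of a basis vector turns a component of the gradient into
    an inner product, so the vector-valued convergence applies directly.\<close>
  define V where "V x = \<psi> x *\<^sub>R (axis i 1 :: real^'n)" for x
  have inner: "H x \<bullet> V x = H x $ i * \<psi> x" for H :: "real^'n \<Rightarrow> real^'n" and x
    by (simp add: V_def inner_axis)
  have V: "V \<in> S2"
  proof -
    have "(\<lambda>x. \<psi> x *\<^sub>R (axis i 1 :: real^'n)) \<in> borel_measurable (L \<Omega>)"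
      using sqintD(1)[OF p(2)] by measurable
    then show ?thesis unfolding V_def
      by (rule sqint_dominated(1)[OF p(2)]) simp
  qed
  have z: "(\<lambda>k::nat. n2 (\<lambda>x. H x - H x)) \<longlonglongrightarrow> 0" for H :: "real^'n \<Rightarrow> 'z::euclidean_space"
    by (simp add: l2n_def)
  have 1: "(\<lambda>k. LINT x|L \<Omega>. \<phi> k x \<bullet> pd i \<psi> x) \<longlonglongrightarrow> (LINT x|L \<Omega>. u x \<bullet> pd i \<psi> x)"
    by (rule l2n_inner_tendsto[OF test_fun_sqint(1)[OF t open_dom] u l(1) p(1) p(1) z])
  have 2: "(\<lambda>k. LINT x|L \<Omega>. cgrad (\<phi> k) x \<bullet> V x) \<longlonglongrightarrow> (LINT x|L \<Omega>. G x \<bullet> V x)"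
    by (rule l2n_inner_tendsto[OF test_fun_sqint(2)[OF t open_dom] G l(2) V V z])
  have "(LINT x|L \<Omega>. \<phi> k x \<bullet> pd i \<psi> x) = - (LINT x|L \<Omega>. cgrad (\<phi> k) x \<bullet> V x)" for k
    using test_fun_weak_gradient[OF t[of k] open_dom] \<psi>
    by (simp add: has_weak_gradient_def inner)
  with 1 have "(\<lambda>k. - (LINT x|L \<Omega>. cgrad (\<phi> k) x \<bullet> V x)) \<longlonglongrightarrow> (LINT x|L \<Omega>. u x \<bullet> pd i \<psi> x)" by simp
  with tendsto_minus[OF 2] have "(LINT x|L \<Omega>. u x \<bullet> pd i \<psi> x) = - (LINT x|L \<Omega>. G x \<bullet> V x)"
    using LIMSEQ_unique by blast
  then show "integrable (L \<Omega>) (\<lambda>x. u x * pd i \<psi> x) \<and> integrable (L \<Omega>) (\<lambda>x. G x $ i * \<psi> x) \<and>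
      (LINT x|L \<Omega>. u x * pd i \<psi> x) = - (LINT x|L \<Omega>. G x $ i * \<psi> x)"
    using sqint_inner[OF u p(1)] sqint_inner[OF G V] by (simp add: inner)
qed

text \<open>\<open>wgrad\<close> is picked by \<open>SOME\<close>; this lemma makes the choice
  irrelevant up to null sets. The componentwise difference annihilates all test functions.\<close>

lemma weak_gradient_unique:
  assumes G: "G \<in> S2" "has_weak_gradient \<Omega> u G" and H: "H \<in> S2" "has_weak_gradient \<Omega> u H"
  shows "AE x in L \<Omega>. G x = H x"
proof -
  have "AE x in L \<Omega>. G x $ i - H x $ i = 0" for i
  proof (rule AE_zero_if_orthogonal_test_fun[OF open_dom])
    have D: "(\<lambda>x. G x - H x) \<in> S2" by (rule sqint_diff[OF G(1) H(1)])
    have "(\<lambda>x. (G x - H x) \<bullet> axis i 1) \<in> borel_measurable (L \<Omega>)"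
      using sqintD(1)[OF D] by measurable
    then have m: "(\<lambda>x. G x $ i - H x $ i) \<in> borel_measurable (L \<Omega>)"
      by (simp add: inner_axis)
    show S: "(\<lambda>x. G x $ i - H x $ i) \<in> S2"
    proof (rule sqint_dominated(1)[OF D m], rule AE_I2)
      fix x show "norm (G x $ i - H x $ i) \<le> norm (G x - H x)"
        using component_le_norm_cart[of "G x - H x" i] by simp
    qed
    show "integrable (L \<Omega>) (\<lambda>x. G x $ i - H x $ i)" by (rule S2_integrable[OF S])
    fix \<phi> assume \<phi>: "test_fun \<Omega> \<phi>"
    have "(\<lambda>x. (G x $ i - H x $ i) * \<phi> x) = (\<lambda>x. G x $ i * \<phi> x - H x $ i * \<phi> x)"
      by (simp add: algebra_simps)
    then show "(LINT x|L \<Omega>. (G x $ i - H x $ i) * \<phi> x) = 0"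
      using G(2) H(2) \<phi> unfolding has_weak_gradient_def by fastforce
  qed
  then have "AE x in L \<Omega>. \<forall>i\<in>UNIV. G x $ i - H x $ i = 0"
    by (intro AE_finite_allI) auto
  then show ?thesis by eventually_elim (simp add: vec_eq_iff)
qed

lemma H01_S2: "u \<in> H01 \<Omega> \<Longrightarrow> u \<in> S2"
  by (simp add: H01_def L2_eq_sqint)

lemma wgrad_spec:
  assumes "u \<in> H01 \<Omega>"
  shows "wg u \<in> S2" "has_weak_gradient \<Omega> u (wg u)"
proof -
  have "\<exists>G. G \<in> L2vec \<Omega> \<and> has_weak_gradient \<Omega> u G"
    using assms by (auto simp: H01_def)
  then have "wg u \<in> L2vec \<Omega> \<and> has_weak_gradient \<Omega> u (wg u)"
    unfolding wgrad_def by (rule someI_ex)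
  then show "wg u \<in> S2" "has_weak_gradient \<Omega> u (wg u)" by (auto simp: L2_eq_sqint)
qed

text \<open>The common way into the space: an approximating sequence yields membership and at the
  same time identifies the chosen gradient.\<close>

lemma H01I:
  assumes t: "\<And>k. test_fun \<Omega> (\<phi> k)" and u: "u \<in> S2" and G: "G \<in> S2"
    and l: "(\<lambda>k. n2 (\<lambda>x. \<phi> k x - u x)) \<longlonglongrightarrow> 0" "(\<lambda>k. n2 (\<lambda>x. cgrad (\<phi> k) x - G x)) \<longlonglongrightarrow> 0"
  shows "u \<in> H01 \<Omega>" "AE x in L \<Omega>. wg u x = G x"
proof -
  have w: "has_weak_gradient \<Omega> u G" by (rule weak_gradient_limit[OF assms])
  show H: "u \<in> H01 \<Omega>"
    using assms w l[unfolded l2n_tendsto_iff] by (auto simp: H01_def L2_eq_sqint)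
  show "AE x in L \<Omega>. wg u x = G x"
    by (rule weak_gradient_unique[OF wgrad_spec[OF H] G w])
qed

lemma n2_cong_right:
  fixes F G H :: "real^'n \<Rightarrow> 'b::euclidean_space"
  assumes "G \<in> borel_measurable (L \<Omega>)" "H \<in> borel_measurable (L \<Omega>)" "F \<in> borel_measurable (L \<Omega>)" "AE x in L \<Omega>. G x = H x"
  shows "n2 (\<lambda>x. F x - G x) = n2 (\<lambda>x. F x - H x)"
  by (rule l2n_AE_cong) (use assms in auto)

lemma H01_approx:
  assumes "u \<in> H01 \<Omega>"
  obtains \<phi> where "\<And>k. test_fun \<Omega> (\<phi> k)" "(\<lambda>k. n2 (\<lambda>x. \<phi> k x - u x)) \<longlonglongrightarrow> 0"
    "(\<lambda>k. n2 (\<lambda>x. cgrad (\<phi> k) x - wg u x)) \<longlonglongrightarrow> 0"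
proof -
  obtain G \<phi> where G: "G \<in> S2" "has_weak_gradient \<Omega> u G" and \<phi>: "\<And>k::nat. test_fun \<Omega> (\<phi> k)"
    "(\<lambda>k. LINT x|L \<Omega>. (\<phi> k x - u x)^2) \<longlonglongrightarrow> 0"
    "(\<lambda>k. LINT x|L \<Omega>. (norm (cgrad (\<phi> k) x - G x))^2) \<longlonglongrightarrow> 0"
    using assms by (auto simp: H01_def L2_eq_sqint)
  have AE: "AE x in L \<Omega>. G x = wg u x"
    by (rule weak_gradient_unique[OF G wgrad_spec[OF assms]])
  have "n2 (\<lambda>x. cgrad (\<phi> k) x - G x) = n2 (\<lambda>x. cgrad (\<phi> k) x - wg u x)" for k
    by (rule n2_cong_right[OF sqintD(1)[OF G(1)] sqintD(1)[OF wgrad_spec(1)[OF assms]]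
          sqintD(1)[OF test_fun_sqint(2)[OF \<phi>(1) open_dom]] AE])
  with \<phi> show ?thesis
    by (intro that[of \<phi>]) (auto simp: l2n_tendsto_iff[symmetric] l2n_tendsto_iff[where F = "\<lambda>k x. \<phi> k x - u x"])
qed

lemma H01_test_fun:
  assumes "test_fun \<Omega> \<phi>"
  shows "\<phi> \<in> H01 \<Omega>" "AE x in L \<Omega>. wg \<phi> x = cgrad \<phi> x"
proof -
  have z: "(\<lambda>k::nat. n2 (\<lambda>x. H x - H x)) \<longlonglongrightarrow> 0" for H :: "real^'n \<Rightarrow> 'z::euclidean_space"
    by (simp add: l2n_def)
  show "\<phi> \<in> H01 \<Omega>" "AE x in L \<Omega>. wg \<phi> x = cgrad \<phi> x"
    by (rule H01I[where \<phi> = "\<lambda>k. \<phi>", OF assms test_fun_sqint[OF assms open_dom] z z])+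
qed

lemma hn_test_fun: "test_fun \<Omega> \<phi> \<Longrightarrow> hn \<phi> = n2 (cgrad \<phi>)"
  unfolding hnorm_eq_l2n
  by (rule l2n_AE_cong[OF sqintD(1)[OF test_fun_sqint(2)[OF _ open_dom]] sqintD(1)[OF wgrad_spec(1)[OF H01_test_fun(1)]]
        H01_test_fun(2)])

text \<open>Linearity of the gradient can hold only almost everywhere because of the choice inside
  \<open>wgrad\<close>. The linear combination of the approximating sequences serves as
  witness.\<close>

lemma H01_lin:
  assumes u: "u \<in> H01 \<Omega>" and v: "v \<in> H01 \<Omega>"
  shows "(\<lambda>x. a * u x + b * v x) \<in> H01 \<Omega>"
    "AE x in L \<Omega>. wg (\<lambda>x. a * u x + b * v x) x = a *\<^sub>R wg u x + b *\<^sub>R wg v x"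
proof -
  obtain \<phi> where \<phi>: "\<And>k. test_fun \<Omega> (\<phi> k)" "(\<lambda>k. n2 (\<lambda>x. \<phi> k x - u x)) \<longlonglongrightarrow> 0"
    "(\<lambda>k. n2 (\<lambda>x. cgrad (\<phi> k) x - wg u x)) \<longlonglongrightarrow> 0" by (rule H01_approx[OF u], rule that)
  obtain \<psi> where \<psi>: "\<And>k. test_fun \<Omega> (\<psi> k)" "(\<lambda>k. n2 (\<lambda>x. \<psi> k x - v x)) \<longlonglongrightarrow> 0"
    "(\<lambda>k. n2 (\<lambda>x. cgrad (\<psi> k) x - wg v x)) \<longlonglongrightarrow> 0" by (rule H01_approx[OF v], rule that)
  have t: "test_fun \<Omega> (\<lambda>x. a * \<phi> k x + b * \<psi> k x)" for k
    by (rule test_fun_add[OF test_fun_cmult[OF \<phi>(1)] test_fun_cmult[OF \<psi>(1)]])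
  have g: "cgrad (\<lambda>x. a * \<phi> k x + b * \<psi> k x) x = a *\<^sub>R cgrad (\<phi> k) x + b *\<^sub>R cgrad (\<psi> k) x" for k x
  proof -
    have D: "((\<lambda>t::real. c * t) has_real_derivative c) (at t)" for c t
      using DERIV_cmult_Id by blast
    show ?thesis
      unfolding cgrad_add[OF smooth_cmult[OF test_funD(1)[OF \<phi>(1)[of k]], of a] smooth_cmult[OF test_funD(1)[OF \<psi>(1)[of k]], of b]]
        cgrad_chain[OF test_funD(1)[OF \<phi>(1)] D] cgrad_chain[OF test_funD(1)[OF \<psi>(1)] D] by simp
  qed
  have comb: "(\<lambda>k. n2 (\<lambda>x. (a *\<^sub>R F k x + b *\<^sub>R G k x) - (a *\<^sub>R F' x + b *\<^sub>R G' x))) \<longlonglongrightarrow> 0"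
    if "(\<lambda>k. n2 (\<lambda>x. F k x - F' x)) \<longlonglongrightarrow> 0" "(\<lambda>k. n2 (\<lambda>x. G k x - G' x)) \<longlonglongrightarrow> 0"
      and S: "\<And>k. F k \<in> S2" "\<And>k. G k \<in> S2" "F' \<in> S2" "G' \<in> S2"
    for F G :: "nat \<Rightarrow> real^'n \<Rightarrow> 'z::euclidean_space" and F' G'
  proof (rule Lim_null_comparison)
    show "(\<lambda>k. \<bar>a\<bar> * n2 (\<lambda>x. F k x - F' x) + \<bar>b\<bar> * n2 (\<lambda>x. G k x - G' x)) \<longlonglongrightarrow> 0"
      using tendsto_add[OF tendsto_mult_left[OF that(1), of "\<bar>a\<bar>"] tendsto_mult_left[OF that(2), of "\<bar>b\<bar>"]] by simp
    show "\<forall>\<^sub>F k in sequentially. norm (n2 (\<lambda>x. (a *\<^sub>R F k x + b *\<^sub>R G k x) - (a *\<^sub>R F' x + b *\<^sub>R G' x)))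
        \<le> \<bar>a\<bar> * n2 (\<lambda>x. F k x - F' x) + \<bar>b\<bar> * n2 (\<lambda>x. G k x - G' x)"
    proof (rule always_eventually, rule allI)
      fix k
      have "(\<lambda>x. (a *\<^sub>R F k x + b *\<^sub>R G k x) - (a *\<^sub>R F' x + b *\<^sub>R G' x))
          = (\<lambda>x. a *\<^sub>R (F k x - F' x) + b *\<^sub>R (G k x - G' x))"
        by (simp add: algebra_simps)
      then show "norm (n2 (\<lambda>x. (a *\<^sub>R F k x + b *\<^sub>R G k x) - (a *\<^sub>R F' x + b *\<^sub>R G' x)))
        \<le> \<bar>a\<bar> * n2 (\<lambda>x. F k x - F' x) + \<bar>b\<bar> * n2 (\<lambda>x. G k x - G' x)"
        using l2n_triangle[OF sqint_scaleR[OF sqint_diff[OF S(1,3)], of a] sqint_scaleR[OF sqint_diff[OF S(2,4)], of b], of k k]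
        by (simp add: l2n_scaleR)
    qed
  qed
  note sp = test_fun_sqint[OF \<phi>(1) open_dom] and sq = test_fun_sqint[OF \<psi>(1) open_dom]
  note uS = H01_S2[OF u] and vS = H01_S2[OF v]
  have S1: "(\<lambda>x. a * u x + b * v x) \<in> S2" by (rule sqint_add[OF sqint_cmult[OF uS] sqint_cmult[OF vS]])
  have S2: "(\<lambda>x. a *\<^sub>R wg u x + b *\<^sub>R wg v x) \<in> S2"
    by (rule sqint_add[OF sqint_scaleR[OF wgrad_spec(1)[OF u]] sqint_scaleR[OF wgrad_spec(1)[OF v]]])
  have L1: "(\<lambda>k. n2 (\<lambda>x. (a * \<phi> k x + b * \<psi> k x) - (a * u x + b * v x))) \<longlonglongrightarrow> 0"
    using comb[OF \<phi>(2) \<psi>(2) sp(1) sq(1) uS vS] by simp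
  have L2: "(\<lambda>k. n2 (\<lambda>x. cgrad (\<lambda>x. a * \<phi> k x + b * \<psi> k x) x - (a *\<^sub>R wg u x + b *\<^sub>R wg v x))) \<longlonglongrightarrow> 0"
    unfolding g by (rule comb[OF \<phi>(3) \<psi>(3) sp(2) sq(2) wgrad_spec(1)[OF u] wgrad_spec(1)[OF v]])
  show "(\<lambda>x. a * u x + b * v x) \<in> H01 \<Omega>"
    "AE x in L \<Omega>. wg (\<lambda>x. a * u x + b * v x) x = a *\<^sub>R wg u x + b *\<^sub>R wg v x"
    by (rule H01I[OF t S1 S2 L1 L2])+
qed

lemma H01_add: "u \<in> H01 \<Omega> \<Longrightarrow> v \<in> H01 \<Omega> \<Longrightarrow> (\<lambda>x. u x + v x) \<in> H01 \<Omega>"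
  and H01_diff: "u \<in> H01 \<Omega> \<Longrightarrow> v \<in> H01 \<Omega> \<Longrightarrow> (\<lambda>x. u x - v x) \<in> H01 \<Omega>"
  and H01_cmult: "u \<in> H01 \<Omega> \<Longrightarrow> (\<lambda>x. c * u x) \<in> H01 \<Omega>"
  using H01_lin(1)[of u v 1 1] H01_lin(1)[of u v 1 "-1"] H01_lin(1)[of u u c 0] by simp_all

lemma H01_zero: "(\<lambda>x. 0) \<in> H01 \<Omega>"
  by (rule H01_test_fun[OF test_fun_zero])

section \<open>The Dirichlet inner product and its norm\<close>

lemma ip_commute: "ip u v = ip v u"
  by (simp add: ip_def inner_commute)

lemma ip_self: "ip u u = (hn u)^2"
  by (simp add: ip_def hnorm_eq_l2n l2n_power2 power2_norm_eq_inner)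

lemma ip_lin:
  assumes u: "u \<in> H01 \<Omega>" and v: "v \<in> H01 \<Omega>" and w: "w \<in> H01 \<Omega>"
  shows "ip (\<lambda>x. a * u x + b * v x) w = a * ip u w + b * ip v w"
proof -
  note i = sqint_inner[OF wgrad_spec(1)[OF u] wgrad_spec(1)[OF w]] sqint_inner[OF wgrad_spec(1)[OF v] wgrad_spec(1)[OF w]]
  have "ip (\<lambda>x. a * u x + b * v x) w = (LINT x|L \<Omega>. (a *\<^sub>R wg u x + b *\<^sub>R wg v x) \<bullet> wg w x)"
    unfolding ip_def
  proof (rule integral_cong_AE)
    note m = sqintD(1)[OF wgrad_spec(1)[OF H01_lin(1)[OF u v, of a b]]] sqintD(1)[OF wgrad_spec(1)[OF u]]
      sqintD(1)[OF wgrad_spec(1)[OF v]] sqintD(1)[OF wgrad_spec(1)[OF w]]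
    show "(\<lambda>x. wg (\<lambda>x. a * u x + b * v x) x \<bullet> wg w x) \<in> borel_measurable (L \<Omega>)"
      by (rule borel_measurable_inner[OF m(1,4)])
    show "(\<lambda>x. (a *\<^sub>R wg u x + b *\<^sub>R wg v x) \<bullet> wg w x) \<in> borel_measurable (L \<Omega>)"
      using m by measurable
    show "AE x in L \<Omega>. wg (\<lambda>x. a * u x + b * v x) x \<bullet> wg w x = (a *\<^sub>R wg u x + b *\<^sub>R wg v x) \<bullet> wg w x"
      using H01_lin(2)[OF u v, of a b] by eventually_elim simp
  qed
  also have "\<dots> = a * ip u w + b * ip v w"
    using i by (simp add: ip_def inner_add_left)
  finally show ?thesis .
qed

lemma ip_add_left: "u \<in> H01 \<Omega> \<Longrightarrow> v \<in> H01 \<Omega> \<Longrightarrow> w \<in> H01 \<Omega> \<Longrightarrow> ip (\<lambda>x. u x + v x) w = ip u w + ip v w"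
  and ip_diff_left: "u \<in> H01 \<Omega> \<Longrightarrow> v \<in> H01 \<Omega> \<Longrightarrow> w \<in> H01 \<Omega> \<Longrightarrow> ip (\<lambda>x. u x - v x) w = ip u w - ip v w"
  and ip_cmult_left: "u \<in> H01 \<Omega> \<Longrightarrow> w \<in> H01 \<Omega> \<Longrightarrow> ip (\<lambda>x. c * u x) w = c * ip u w"
  using ip_lin[of u v w 1 1] ip_lin[of u v w 1 "-1"] ip_lin[of u u w c 0] by simp_all

lemma ip_add_right: "u \<in> H01 \<Omega> \<Longrightarrow> v \<in> H01 \<Omega> \<Longrightarrow> w \<in> H01 \<Omega> \<Longrightarrow> ip w (\<lambda>x. u x + v x) = ip w u + ip w v"
  and ip_diff_right: "u \<in> H01 \<Omega> \<Longrightarrow> v \<in> H01 \<Omega> \<Longrightarrow> w \<in> H01 \<Omega> \<Longrightarrow> ip w (\<lambda>x. u x - v x) = ip w u - ip w v"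
  and ip_cmult_right: "u \<in> H01 \<Omega> \<Longrightarrow> w \<in> H01 \<Omega> \<Longrightarrow> ip w (\<lambda>x. c * u x) = c * ip w u"
  using ip_add_left[of u v w] ip_diff_left[of u v w] ip_cmult_left[of u w c] by (simp_all add: ip_commute)

lemma ip_Cauchy_Schwarz: "u \<in> H01 \<Omega> \<Longrightarrow> v \<in> H01 \<Omega> \<Longrightarrow> \<bar>ip u v\<bar> \<le> hn u * hn v"
  unfolding ip_def hnorm_eq_l2n by (rule l2n_Cauchy_Schwarz[OF wgrad_spec(1) wgrad_spec(1)])

lemma hn_nonneg [simp]: "0 \<le> hn u"
  by (simp add: hnorm_eq_l2n)

lemma hn_add_sq: "u \<in> H01 \<Omega> \<Longrightarrow> v \<in> H01 \<Omega> \<Longrightarrow> (hn (\<lambda>x. u x + v x))^2 = (hn u)^2 + 2 * ip u v + (hn v)^2"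
  by (simp add: ip_self[symmetric] ip_add_left ip_add_right H01_add ip_commute[of v u])

lemma hn_diff_sq: "u \<in> H01 \<Omega> \<Longrightarrow> v \<in> H01 \<Omega> \<Longrightarrow> (hn (\<lambda>x. u x - v x))^2 = (hn u)^2 - 2 * ip u v + (hn v)^2"
  by (simp add: ip_self[symmetric] ip_diff_left ip_diff_right H01_diff ip_commute[of v u])

lemma hn_cmult: "u \<in> H01 \<Omega> \<Longrightarrow> hn (\<lambda>x. c * u x) = \<bar>c\<bar> * hn u"
proof (rule power2_eq_imp_eq)
  assume u: "u \<in> H01 \<Omega>"
  have "(hn (\<lambda>x. c * u x))^2 = c * (c * (hn u)^2)"
    by (simp only: ip_self[symmetric] ip_cmult_left[OF u H01_cmult[OF u]] ip_cmult_right[OF u u])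
  then show "(hn (\<lambda>x. c * u x))^2 = (\<bar>c\<bar> * hn u)^2"
    by (simp add: power_mult_distrib power2_eq_square)
qed simp_all

lemma hn_triangle: "u \<in> H01 \<Omega> \<Longrightarrow> v \<in> H01 \<Omega> \<Longrightarrow> hn (\<lambda>x. u x + v x) \<le> hn u + hn v"
  by (rule power2_le_imp_le) (use ip_Cauchy_Schwarz[of u v] in \<open>simp_all add: hn_add_sq power2_sum\<close>)

lemma hn_minus_commute: "u \<in> H01 \<Omega> \<Longrightarrow> v \<in> H01 \<Omega> \<Longrightarrow> hn (\<lambda>x. u x - v x) = hn (\<lambda>x. v x - u x)"
  using hn_cmult[OF H01_diff[of u v], of "-1"] by simp

lemma hn_le_add_diff: "u \<in> H01 \<Omega> \<Longrightarrow> v \<in> H01 \<Omega> \<Longrightarrow> hn u \<le> hn v + hn (\<lambda>x. u x - v x)"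
  using hn_triangle[of v "\<lambda>x. u x - v x"] H01_diff[of u v] by simp

lemma hn_tendsto:
  assumes "\<And>k. u k \<in> H01 \<Omega>" "v \<in> H01 \<Omega>" "(\<lambda>k. hn (\<lambda>x. u k x - v x)) \<longlonglongrightarrow> 0"
  shows "(\<lambda>k. hn (u k)) \<longlonglongrightarrow> hn v"
proof (rule LIM_zero_cancel, rule Lim_null_comparison[OF _ assms(3)], rule always_eventually, rule allI)
  fix k
  show "norm (hn (u k) - hn v) \<le> hn (\<lambda>x. u k x - v x)"
    using hn_le_add_diff[OF assms(1)[of k] assms(2)] hn_le_add_diff[OF assms(2) assms(1)[of k]]
      hn_minus_commute[OF assms(1)[of k] assms(2)] by (simp add: abs_le_iff)
qed

text \<open>Elements of the space are functions rather than classes, so invariance under changes on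
  null sets has to be established for membership, gradient and norm.\<close>

lemma H01_AE_cong:
  assumes u: "u \<in> H01 \<Omega>" and v: "v \<in> borel_measurable (L \<Omega>)" and AE: "AE x in L \<Omega>. v x = u x"
  shows "v \<in> H01 \<Omega>" "AE x in L \<Omega>. wg v x = wg u x" "hn v = hn u"
proof -
  obtain \<phi> where \<phi>: "\<And>k. test_fun \<Omega> (\<phi> k)" "(\<lambda>k. n2 (\<lambda>x. \<phi> k x - u x)) \<longlonglongrightarrow> 0"
    "(\<lambda>k. n2 (\<lambda>x. cgrad (\<phi> k) x - wg u x)) \<longlonglongrightarrow> 0" by (rule H01_approx[OF u], rule that)
  have vS: "v \<in> S2" by (rule sqint_AE_cong[OF H01_S2[OF u] v AE])
  have "n2 (\<lambda>x. \<phi> k x - v x) = n2 (\<lambda>x. \<phi> k x - u x)" for k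
    by (rule n2_cong_right[OF v sqintD(1)[OF H01_S2[OF u]] sqintD(1)[OF test_fun_sqint(1)[OF \<phi>(1) open_dom]] AE])
  then have l: "(\<lambda>k. n2 (\<lambda>x. \<phi> k x - v x)) \<longlonglongrightarrow> 0" using \<phi>(2) by simp
  show H: "v \<in> H01 \<Omega>" and W: "AE x in L \<Omega>. wg v x = wg u x"
    by (rule H01I[OF \<phi>(1) vS wgrad_spec(1)[OF u] l \<phi>(3)])+
  show "hn v = hn u" unfolding hnorm_eq_l2n
    by (rule l2n_AE_cong[OF sqintD(1)[OF wgrad_spec(1)[OF u]] sqintD(1)[OF wgrad_spec(1)[OF H]] W])
qed

section \<open>The Poincare inequality and completeness\<close>

lemma Poincare: obtains C where "C > 0" "\<And>u. u \<in> H01 \<Omega> \<Longrightarrow> n2 u \<le> C * hn u"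
proof -
  obtain R where R: "R > 0" "\<And>x. x \<in> \<Omega> \<Longrightarrow> norm x \<le> R" using bounded_dom by (auto simp: bounded_pos)
  have "n2 u \<le> (2 * R) * hn u" if u: "u \<in> H01 \<Omega>" for u
  proof -
    obtain \<phi> where \<phi>: "\<And>k. test_fun \<Omega> (\<phi> k)" "(\<lambda>k. n2 (\<lambda>x. \<phi> k x - u x)) \<longlonglongrightarrow> 0"
      "(\<lambda>k. n2 (\<lambda>x. cgrad (\<phi> k) x - wg u x)) \<longlonglongrightarrow> 0" by (rule H01_approx[OF u], rule that)
    have 1: "(\<lambda>k. n2 (\<phi> k)) \<longlonglongrightarrow> n2 u"
      by (rule l2n_tendsto[OF test_fun_sqint(1)[OF \<phi>(1) open_dom] H01_S2[OF u] \<phi>(2)])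
    have "(\<lambda>k. n2 (cgrad (\<phi> k))) \<longlonglongrightarrow> n2 (wg u)"
      by (rule l2n_tendsto[OF test_fun_sqint(2)[OF \<phi>(1) open_dom] wgrad_spec(1)[OF u] \<phi>(3)])
    then have 2: "(\<lambda>k. 2 * R * n2 (cgrad (\<phi> k))) \<longlonglongrightarrow> 2 * R * hn u"
      unfolding hnorm_eq_l2n by (rule tendsto_mult_left)
    show ?thesis
      by (rule LIMSEQ_le[OF 1 2]) (use Poincare_test_fun[OF \<phi>(1) open_dom R(2)] R(1) in auto)
  qed
  then show ?thesis using R(1) by (intro that[of "2 * R"]) auto
qed

lemma hn_conv_imp_n2_conv:
  assumes "\<And>k. u k \<in> H01 \<Omega>" "v \<in> H01 \<Omega>" "(\<lambda>k. hn (\<lambda>x. u k x - v x)) \<longlonglongrightarrow> 0"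
  shows "(\<lambda>k. n2 (\<lambda>x. u k x - v x)) \<longlonglongrightarrow> 0"
proof -
  obtain C where C: "C > 0" "\<And>u. u \<in> H01 \<Omega> \<Longrightarrow> n2 u \<le> C * hn u" using Poincare by blast
  show ?thesis
  proof (rule Lim_null_comparison)
    show "(\<lambda>k. C * hn (\<lambda>x. u k x - v x)) \<longlonglongrightarrow> 0"
      using tendsto_mult_left[OF assms(3), of C] by simp
    show "\<forall>\<^sub>F k in sequentially. norm (n2 (\<lambda>x. u k x - v x)) \<le> C * hn (\<lambda>x. u k x - v x)"
      using C(2)[OF H01_diff[OF assms(1,2)]] by simp
  qed
qed

lemma hn_eq_0_iff:
  assumes "u \<in> H01 \<Omega>"
  shows "hn u = 0 \<longleftrightarrow> is_zero \<Omega> u"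
proof
  assume "hn u = 0"
  then have "n2 u = 0" using Poincare assms l2n_nonneg[of "L \<Omega>" u] by (metis mult_zero_right order_antisym)
  then show "is_zero \<Omega> u" using l2n_eq_0_iff[OF H01_S2[OF assms]] by (simp add: is_zero_def)
next
  assume "is_zero \<Omega> u"
  then have "AE x in L \<Omega>. u x = 0" by (simp add: is_zero_def)
  then have "hn u = hn (\<lambda>x. 0)"
    by (intro H01_AE_cong(3)[OF H01_zero]) (use sqintD(1)[OF H01_S2[OF assms]] in auto)
  also have "hn (\<lambda>x. 0) = 0" using hn_cmult[OF H01_zero, of 0] by simp
  finally show "hn u = 0" .
qed

lemma ip_bounded_imp_approx:
  assumes "u \<in> H01 \<Omega>" "e > 0"
  obtains \<phi> where "test_fun \<Omega> \<phi>" "n2 (\<lambda>x. \<phi> x - u x) < e" "n2 (\<lambda>x. cgrad \<phi> x - wg u x) < e"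
proof -
  obtain \<phi> where \<phi>: "\<And>k. test_fun \<Omega> (\<phi> k)" "(\<lambda>k. n2 (\<lambda>x. \<phi> k x - u x)) \<longlonglongrightarrow> 0"
    "(\<lambda>k. n2 (\<lambda>x. cgrad (\<phi> k) x - wg u x)) \<longlonglongrightarrow> 0" by (rule H01_approx[OF assms(1)], rule that)
  have "\<forall>\<^sub>F k in sequentially. n2 (\<lambda>x. \<phi> k x - u x) < e \<and> n2 (\<lambda>x. cgrad (\<phi> k) x - wg u x) < e"
    using order_tendstoD(2)[OF \<phi>(2) assms(2)] order_tendstoD(2)[OF \<phi>(3) assms(2)] by eventually_elim simp
  then obtain k where "n2 (\<lambda>x. \<phi> k x - u x) < e \<and> n2 (\<lambda>x. cgrad (\<phi> k) x - wg u x) < e"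
    by (auto simp: eventually_sequentially)
  then show ?thesis using that \<phi>(1) by blast
qed

text \<open>The functions and their gradients converge separately in L2. Replacing
  \<open>u k\<close> by a test function within 1/(k+1) in both norms shows that the limit is again a
  limit of test functions, as the definition of the space demands.\<close>

lemma H01_complete:
  assumes u: "\<And>k. u k \<in> H01 \<Omega>"
    and C: "\<And>e. e > 0 \<Longrightarrow> \<exists>N. \<forall>m\<ge>N. \<forall>n\<ge>N. hn (\<lambda>x. u m x - u n x) < e"
  obtains v where "v \<in> H01 \<Omega>" "(\<lambda>k. hn (\<lambda>x. u k x - v x)) \<longlonglongrightarrow> 0"
proof -
  obtain P where P: "P > 0" "\<And>u. u \<in> H01 \<Omega> \<Longrightarrow> n2 u \<le> P * hn u" using Poincare by blast
  obtain v where v: "v \<in> S2" "(\<lambda>k. n2 (\<lambda>x. u k x - v x)) \<longlonglongrightarrow> 0"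
  proof (rule l2_complete[OF H01_S2[OF u]])
    fix e :: real assume "e > 0"
    then obtain N where N: "\<forall>m\<ge>N. \<forall>n\<ge>N. hn (\<lambda>x. u m x - u n x) < e / P" using C[of "e / P"] P by auto
    have "n2 (\<lambda>x. u m x - u n x) < e" if "m \<ge> N" "n \<ge> N" for m n
    proof -
      have "n2 (\<lambda>x. u m x - u n x) \<le> P * hn (\<lambda>x. u m x - u n x)" by (rule P(2)[OF H01_diff[OF u u]])
      also have "\<dots> < P * (e / P)" using N that P by (intro mult_strict_left_mono) auto
      finally show ?thesis using P by simp
    qed
    then show "\<exists>N. \<forall>m\<ge>N. \<forall>n\<ge>N. n2 (\<lambda>x. u m x - u n x) < e" by blast
  qed
  have hd: "hn (\<lambda>x. u m x - u n x) = n2 (\<lambda>x. wg (u m) x - wg (u n) x)" for m n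
    unfolding hnorm_eq_l2n
  proof (rule l2n_AE_cong)
    show "(\<lambda>x. wg (u m) x - wg (u n) x) \<in> borel_measurable (L \<Omega>)"
      by (rule sqintD(1)[OF sqint_diff[OF wgrad_spec(1)[OF u] wgrad_spec(1)[OF u]]])
    show "wg (\<lambda>x. u m x - u n x) \<in> borel_measurable (L \<Omega>)"
      by (rule sqintD(1)[OF wgrad_spec(1)[OF H01_diff[OF u u]]])
    show "AE x in L \<Omega>. wg (\<lambda>x. u m x - u n x) x = wg (u m) x - wg (u n) x"
      using H01_lin(2)[OF u[of m] u[of n], of 1 "-1"] by simp
  qed
  obtain G where G: "G \<in> S2" "(\<lambda>k. n2 (\<lambda>x. wg (u k) x - G x)) \<longlonglongrightarrow> 0"
  proof (rule l2_complete[where F = "\<lambda>k. wg (u k)"])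
    show "wg (u k) \<in> S2" for k by (rule wgrad_spec(1)[OF u])
    show "\<exists>N. \<forall>m\<ge>N. \<forall>n\<ge>N. n2 (\<lambda>x. wg (u m) x - wg (u n) x) < e" if "e > 0" for e
      using C[OF that] unfolding hd .
  qed
  have "\<exists>\<phi>. test_fun \<Omega> \<phi> \<and> n2 (\<lambda>x. \<phi> x - u k x) < inverse (real (Suc k)) \<and> n2 (\<lambda>x. cgrad \<phi> x - wg (u k) x) < inverse (real (Suc k))" for k
  proof -
    have p: "inverse (real (Suc k)) > 0" by simp
    obtain \<phi> where "test_fun \<Omega> \<phi>" "n2 (\<lambda>x. \<phi> x - u k x) < inverse (real (Suc k))"
      "n2 (\<lambda>x. cgrad \<phi> x - wg (u k) x) < inverse (real (Suc k))"
      by (rule ip_bounded_imp_approx[OF u[of k] p], rule that)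
    then show ?thesis by blast
  qed
  from choice[OF allI[OF this]] obtain \<phi> where
    all: "\<forall>k. test_fun \<Omega> (\<phi> k) \<and> n2 (\<lambda>x. \<phi> k x - u k x) < inverse (real (Suc k))
      \<and> n2 (\<lambda>x. cgrad (\<phi> k) x - wg (u k) x) < inverse (real (Suc k))"
    by (rule exE)
  have \<phi>: "test_fun \<Omega> (\<phi> k)" "n2 (\<lambda>x. \<phi> k x - u k x) < inverse (real (Suc k))"
    "n2 (\<lambda>x. cgrad (\<phi> k) x - wg (u k) x) < inverse (real (Suc k))" for k
    using all[rule_format, of k] by simp_all
  have lim: "(\<lambda>k. n2 (\<lambda>x. F k x - H x)) \<longlonglongrightarrow> 0"
    if "\<And>k. F k \<in> S2" "\<And>k. U k \<in> S2" "H \<in> S2" "\<And>k. n2 (\<lambda>x. F k x - U k x) < inverse (real (Suc k))"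
      "(\<lambda>k. n2 (\<lambda>x. U k x - H x)) \<longlonglongrightarrow> 0" for F U H
  proof (rule Lim_null_comparison)
    show "(\<lambda>k. inverse (real (Suc k)) + n2 (\<lambda>x. U k x - H x)) \<longlonglongrightarrow> 0"
      using tendsto_add[OF LIMSEQ_inverse_real_of_nat that(5)] by simp
    have "norm (n2 (\<lambda>x. F k x - H x)) \<le> inverse (real (Suc k)) + n2 (\<lambda>x. U k x - H x)" for k
      using l2n_triangle_diff[OF that(1)[of k] that(2)[of k] that(3)] that(4)[of k] by simp
    then show "\<forall>\<^sub>F k in sequentially. norm (n2 (\<lambda>x. F k x - H x)) \<le> inverse (real (Suc k)) + n2 (\<lambda>x. U k x - H x)"
      by simp
  qed
  have l1: "(\<lambda>k. n2 (\<lambda>x. \<phi> k x - v x)) \<longlonglongrightarrow> 0"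
    by (rule lim[OF test_fun_sqint(1)[OF \<phi>(1) open_dom] H01_S2[OF u] v(1) \<phi>(2) v(2)])
  have l2: "(\<lambda>k. n2 (\<lambda>x. cgrad (\<phi> k) x - G x)) \<longlonglongrightarrow> 0"
    by (rule lim[OF test_fun_sqint(2)[OF \<phi>(1) open_dom] wgrad_spec(1)[OF u] G(1) \<phi>(3) G(2)])
  have vH: "v \<in> H01 \<Omega>" and vW: "AE x in L \<Omega>. wg v x = G x" by (rule H01I[OF \<phi>(1) v(1) G(1) l1 l2])+
  have "hn (\<lambda>x. u k x - v x) = n2 (\<lambda>x. wg (u k) x - G x)" for k
    unfolding hnorm_eq_l2n
  proof (rule l2n_AE_cong)
    show "(\<lambda>x. wg (u k) x - G x) \<in> borel_measurable (L \<Omega>)"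
      by (rule sqintD(1)[OF sqint_diff[OF wgrad_spec(1)[OF u] G(1)]])
    show "wg (\<lambda>x. u k x - v x) \<in> borel_measurable (L \<Omega>)"
      by (rule sqintD(1)[OF wgrad_spec(1)[OF H01_diff[OF u vH]]])
    show "AE x in L \<Omega>. wg (\<lambda>x. u k x - v x) x = wg (u k) x - G x"
      using H01_lin(2)[OF u[of k] vH, of 1 "-1"] vW by eventually_elim simp
  qed
  then have "(\<lambda>k. hn (\<lambda>x. u k x - v x)) \<longlonglongrightarrow> 0" using G(2) by simp
  with vH show ?thesis by (rule that)
qed

subsection \<open>Lower semicontinuity of the norm and truncation\<close>

lemma hn_parallelogram:
  assumes u: "u \<in> H01 \<Omega>" and v: "v \<in> H01 \<Omega>"
  shows "(hn (\<lambda>x. u x - v x))^2 = 2 * (hn u)^2 + 2 * (hn v)^2 - 4 * (hn (\<lambda>x. (1/2) * u x + (1/2) * v x))^2"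
proof -
  have "(\<lambda>x. (1/2) * u x + (1/2) * v x) = (\<lambda>x. (1/2) * (u x + v x))"
    by (rule ext) (simp add: add_divide_distrib)
  then have "hn (\<lambda>x. (1/2) * u x + (1/2) * v x) = 1/2 * hn (\<lambda>x. u x + v x)"
    using hn_cmult[OF H01_add[OF u v], of "1/2"] by simp
  then have "4 * (hn (\<lambda>x. (1/2) * u x + (1/2) * v x))^2 = (hn (\<lambda>x. u x + v x))^2"
    by (simp only: power_mult_distrib) (simp add: power2_eq_square)
  then show ?thesis
    unfolding hn_add_sq[OF u v] hn_diff_sq[OF u v] by linarith
qed

lemma n2_midpoint:
  fixes u v w :: "real^'n \<Rightarrow> real"
  assumes u: "u \<in> S2" and v: "v \<in> S2" and w: "w \<in> S2"
  shows "n2 (\<lambda>x. ((1/2) * u x + (1/2) * v x) - w x) \<le> (1/2) * n2 (\<lambda>x. u x - w x) + (1/2) * n2 (\<lambda>x. v x - w x)"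
proof -
  have "(\<lambda>x. ((1/2) * u x + (1/2) * v x) - w x) = (\<lambda>x. (1/2) * (u x - w x) + (1/2) * (v x - w x))"
    by (rule ext) (simp add: add_divide_distrib diff_divide_distrib)
  then show ?thesis
    using l2n_triangle[OF sqint_cmult[OF sqint_diff[OF u w], of "1/2"] sqint_cmult[OF sqint_diff[OF v w], of "1/2"]]
      l2n_cmult[of "L \<Omega>" "1/2" "\<lambda>x. u x - w x"] l2n_cmult[of "L \<Omega>" "1/2" "\<lambda>x. v x - w x"] by simp
qed

text \<open>No weak compactness is needed: almost minimisers of the norm over the convex sets
  \<open>{y. |y - u|\<^sub>2 \<le> 1/(k+1)}\<close> form a Cauchy sequence by the parallelogram law.\<close>

lemma hn_lsc_bound:
  assumes u: "\<And>n. u n \<in> H01 \<Omega>" and v: "v \<in> S2" and l: "(\<lambda>n. n2 (\<lambda>x. u n x - v x)) \<longlonglongrightarrow> 0"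
    and B: "\<And>n. hn (u n) \<le> B"
  shows "v \<in> H01 \<Omega>" "hn v \<le> B"
proof -
  define r where "r k = inverse (real (Suc k))" for k
  have r0: "r k > 0" for k by (simp add: r_def)
  have r_lim: "r \<longlonglongrightarrow> 0" unfolding r_def by (rule LIMSEQ_inverse_real_of_nat)
  have r_mono: "r n \<le> r m" if "m \<le> n" for m n using that by (simp add: r_def)
  \<comment> \<open>Only the L2 distance to \<open>v\<close> may appear here, since \<open>v\<close>
    is not yet known to have a gradient. Convexity is used through midpoints.\<close>
  define D where "D k = {y \<in> H01 \<Omega>. n2 (\<lambda>x. y x - v x) \<le> r k}" for k
  have D_mono: "D n \<subseteq> D m" if "m \<le> n" for m n
    using r_mono[OF that] by (auto simp: D_def)
  have D_mid: "(\<lambda>x. (1/2) * y x + (1/2) * z x) \<in> D k" if "y \<in> D k" "z \<in> D k" for y z k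
  proof -
    have "n2 (\<lambda>x. ((1/2) * y x + (1/2) * z x) - v x) \<le> r k"
      using n2_midpoint[OF H01_S2 H01_S2 v, of y z] that by (simp add: D_def)
    then show ?thesis using that H01_lin(1)[of y z "1/2" "1/2"] by (simp add: D_def)
  qed
  have Du: "\<exists>n. u n \<in> D k" for k
  proof -
    have "\<forall>\<^sub>F n in sequentially. n2 (\<lambda>x. u n x - v x) < r k" by (rule order_tendstoD(2)[OF l r0])
    then obtain n where "n2 (\<lambda>x. u n x - v x) < r k" by (auto simp: eventually_sequentially)
    then have "u n \<in> D k" using u by (simp add: D_def)
    then show ?thesis by blast
  qed
  define d where "d k = Inf (hn ` D k)" for k
  have bdd: "bdd_below (hn ` D k)" for k by (rule bdd_belowI[of _ 0]) auto
  have d_le: "d k \<le> hn y" if "y \<in> D k" for y k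
    unfolding d_def by (rule cInf_lower[OF _ bdd]) (use that in auto)
  have d0: "d k \<ge> 0" for k unfolding d_def by (rule cInf_greatest) (use Du in auto)
  have dB: "d k \<le> B" for k
  proof -
    obtain n where "u n \<in> D k" using Du by blast
    from d_le[OF this] B[of n] show ?thesis by linarith
  qed
  have d_mono: "incseq d"
  proof (rule incseq_SucI)
    fix k show "d k \<le> d (Suc k)"
      unfolding d_def by (rule cInf_superset_mono[OF _ bdd]) (use Du D_mono[of k "Suc k"] in auto)
  qed
  have "\<forall>k. d k \<le> B" using dB by simp
  then obtain dl where "d \<longlonglongrightarrow> dl" and "\<forall>k. d k \<le> dl"
    by (rule incseq_convergent[OF d_mono])
  then have dl: "d \<longlonglongrightarrow> dl" "d k \<le> dl" for k by simp_all
  have dlB: "dl \<le> B" by (rule LIMSEQ_le_const2[OF dl(1)]) (use dB in auto)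
  have "\<exists>y. y \<in> D k \<and> hn y < d k + r k" for k
  proof -
    have "Inf (hn ` D k) < d k + r k" using r0[of k] by (simp add: d_def)
    then show ?thesis using cInf_lessD[of "hn ` D k"] Du by blast
  qed
  from choice[OF allI[OF this]] obtain y where "\<forall>k. y k \<in> D k \<and> hn (y k) < d k + r k" by (rule exE)
  then have y: "y k \<in> D k" "hn (y k) < d k + r k" for k by auto
  have yH: "y k \<in> H01 \<Omega>" for k using y(1)[of k] by (simp add: D_def)
  \<comment> \<open>For \<open>n \<ge> m\<close> both almost minimisers lie in \<open>D m\<close>,
    hence so does their midpoint, and its norm is at least \<open>d m\<close>. Both norms are at
    most \<open>dl + r m\<close>; the parallelogram law combines these bounds into
    \<open>c m\<close>.\<close>
  define c where "c m = 4 * (dl + r m)^2 - 4 * (d m)^2" for m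
  have c_lim: "c \<longlonglongrightarrow> 0"
  proof -
    have "c \<longlonglongrightarrow> 4 * (dl + 0)^2 - 4 * dl^2"
      unfolding c_def by (intro tendsto_intros r_lim dl)
    then show ?thesis by simp
  qed
  have yc: "(hn (\<lambda>x. y n x - y m x))^2 \<le> c m" if "n \<ge> m" for n m
  proof -
    have "d m \<le> hn (\<lambda>x. (1/2) * y n x + (1/2) * y m x)"
      by (rule d_le[OF D_mid]) (use y(1)[of n] y(1)[of m] D_mono[OF that] in auto)
    then have 1: "(d m)^2 \<le> (hn (\<lambda>x. (1/2) * y n x + (1/2) * y m x))^2"
      using d0 by (intro power_mono) auto
    have 2: "(hn (y k))^2 \<le> (dl + r m)^2" if "k \<ge> m" for k
    proof (rule power_mono)
      show "hn (y k) \<le> dl + r m" using y(2)[of k] dl(2)[of k] r_mono[OF that] by linarith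
    qed simp
    show ?thesis
      using hn_parallelogram[OF yH[of n] yH[of m]] 1 2[OF that] 2[OF order_refl] by (simp add: c_def)
  qed
  obtain w where w: "w \<in> H01 \<Omega>" "(\<lambda>k. hn (\<lambda>x. y k x - w x)) \<longlonglongrightarrow> 0"
  proof (rule H01_complete[OF yH])
    fix e :: real assume e: "e > 0"
    have "\<forall>\<^sub>F m in sequentially. c m < (e/2)^2" by (rule order_tendstoD(2)[OF c_lim]) (use e in simp)
    then obtain N where N: "c N < (e/2)^2" by (auto simp: eventually_sequentially)
    have b: "hn (\<lambda>x. y m x - y N x) < e/2" if "m \<ge> N" for m
      by (rule power2_less_imp_less) (use yc[OF that] N e in auto)
    have "hn (\<lambda>x. y m x - y n x) < e" if "m \<ge> N" "n \<ge> N" for m n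
      using hn_triangle[OF H01_diff[OF yH[of m] yH[of N]] H01_diff[OF yH[of N] yH[of n]]] b[OF that(1)] b[OF that(2)]
        hn_minus_commute[OF yH[of n] yH[of N]] by simp
    then show "\<exists>N. \<forall>m\<ge>N. \<forall>n\<ge>N. hn (\<lambda>x. y m x - y n x) < e" by blast
  qed
  have l1: "(\<lambda>k. n2 (\<lambda>x. y k x - w x)) \<longlonglongrightarrow> 0" by (rule hn_conv_imp_n2_conv[OF yH w])
  have le: "n2 (\<lambda>x. w x - v x) \<le> n2 (\<lambda>x. y k x - w x) + r k" for k
  proof -
    have "n2 (\<lambda>x. y k x - v x) \<le> r k" using y(1)[of k] by (simp add: D_def)
    then show ?thesis
      using l2n_triangle_diff[OF H01_S2[OF w(1)] H01_S2[OF yH[of k]] v] l2n_minus_commute[of "L \<Omega>" "y k" w] by simp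
  qed
  have "n2 (\<lambda>x. w x - v x) \<le> 0 + 0"
    by (rule LIMSEQ_le_const[OF tendsto_add[OF l1 r_lim]]) (use le in auto)
  then have "n2 (\<lambda>x. w x - v x) = 0" using l2n_nonneg[of "L \<Omega>" "\<lambda>x. w x - v x"] by linarith
  then have "AE x in L \<Omega>. w x - v x = 0"
    using l2n_eq_0_iff[OF sqint_diff[OF H01_S2[OF w(1)] v]] by simp
  then have AE: "AE x in L \<Omega>. v x = w x" by eventually_elim simp
  show "v \<in> H01 \<Omega>" by (rule H01_AE_cong(1)[OF w(1) sqintD(1)[OF v] AE])
  have yb: "hn (y k) \<le> dl + r k" for k using y(2)[of k] dl(2)[of k] by linarith
  have "hn v = hn w" by (rule H01_AE_cong(3)[OF w(1) sqintD(1)[OF v] AE])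
  also have "hn w \<le> dl + 0"
    by (rule LIMSEQ_le[OF hn_tendsto[OF yH w] tendsto_add[OF tendsto_const r_lim]])
      (use yb in blast)
  finally show "hn v \<le> B" using dlB by simp
qed

lemma n2_conv_subseq: "strict_mono r \<Longrightarrow> f \<longlonglongrightarrow> (a::real) \<Longrightarrow> (\<lambda>n. f (r n)) \<longlonglongrightarrow> a"
  using LIMSEQ_subseq_LIMSEQ[of f a r] by (simp add: o_def)

lemma hn_lsc:
  assumes u: "\<And>n. u n \<in> H01 \<Omega>" and v: "v \<in> S2" and l: "(\<lambda>n. n2 (\<lambda>x. u n x - v x)) \<longlonglongrightarrow> 0"
    and B: "\<And>n. hn (u n) \<le> b n" "b \<longlonglongrightarrow> B"
  shows "v \<in> H01 \<Omega>" "hn v \<le> B"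
proof -
  have *: "v \<in> H01 \<Omega> \<and> hn v \<le> B + e" if "e > 0" for e
  proof -
    have "\<forall>\<^sub>F n in sequentially. b n < B + e" by (rule order_tendstoD(2)[OF B(2)]) (use that in simp)
    then obtain N where N: "\<And>n. n \<ge> N \<Longrightarrow> b n < B + e" by (auto simp: eventually_sequentially)
    have b': "hn (u (n + N)) \<le> B + e" for n using N[of "n + N"] B(1)[of "n + N"] by simp
    have l': "(\<lambda>n. n2 (\<lambda>x. u (n + N) x - v x)) \<longlonglongrightarrow> 0" by (rule LIMSEQ_ignore_initial_segment[OF l])
    show ?thesis using hn_lsc_bound[OF u v l' b'] by simp
  qed
  show "v \<in> H01 \<Omega>" using *[of 1] by simp
  show "hn v \<le> B" by (rule field_le_epsilon) (use * in simp)
qed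

lemma hn_lsc_eventually:
  assumes u: "\<And>n. u n \<in> H01 \<Omega>" and v: "v \<in> S2" and l: "(\<lambda>n. n2 (\<lambda>x. u n x - v x)) \<longlonglongrightarrow> 0"
    and c: "c < hn v"
  shows "\<forall>\<^sub>F n in sequentially. c < hn (u n)"
proof (rule ccontr)
  assume "\<not> ?thesis"
  then obtain r :: "nat \<Rightarrow> nat" where r: "strict_mono r" "\<And>n. \<not> c < hn (u (r n))"
    using not_eventually_sequentiallyD[of "\<lambda>n. c < hn (u n)"] by blast
  have "hn v \<le> c"
    by (rule hn_lsc_bound(2)[OF u v n2_conv_subseq[OF r(1) l]]) (use r(2) in \<open>simp add: not_less\<close>)
  then show False using c by simp
qed

text \<open>The midpoint of \<open>u n\<close> and \<open>v\<close> also tends to \<open>v\<close>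
  in L2, so by lower semicontinuity its norm is asymptotically at least that of \<open>v\<close>.
  With the norms of \<open>u n\<close> bounded by a sequence tending to that of \<open>v\<close>,
  the parallelogram law leaves nothing for the difference.\<close>

lemma strong_convergence:
  assumes u: "\<And>n. u n \<in> H01 \<Omega>" and v: "v \<in> H01 \<Omega>" and l: "(\<lambda>n. n2 (\<lambda>x. u n x - v x)) \<longlonglongrightarrow> 0"
    and b: "\<And>n. hn (u n) \<le> b n" "b \<longlonglongrightarrow> hn v"
  shows "(\<lambda>n. hn (\<lambda>x. u n x - v x)) \<longlonglongrightarrow> 0"
proof -
  define w where "w n = (\<lambda>x. (1/2) * u n x + (1/2) * v x)" for n
  have wH: "w n \<in> H01 \<Omega>" for n unfolding w_def by (rule H01_lin(1)[OF u v])
  have vS: "v \<in> S2" by (rule H01_S2[OF v])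
  have wl: "(\<lambda>n. n2 (\<lambda>x. w n x - v x)) \<longlonglongrightarrow> 0"
  proof (rule Lim_null_comparison)
    show "(\<lambda>n. (1/2) * n2 (\<lambda>x. u n x - v x)) \<longlonglongrightarrow> 0" using tendsto_mult_left[OF l, of "1/2"] by simp
    have "n2 (\<lambda>x. w n x - v x) \<le> (1/2) * n2 (\<lambda>x. u n x - v x)" for n
      using n2_midpoint[OF H01_S2[OF u] vS vS, of n] by (simp add: w_def l2n_def)
    then show "\<forall>\<^sub>F n in sequentially. norm (n2 (\<lambda>x. w n x - v x)) \<le> (1/2) * n2 (\<lambda>x. u n x - v x)" by simp
  qed
  \<comment> \<open>Capping at \<open>hn v\<close> supplies the upper bound, so that lower
    semicontinuity alone makes \<open>s\<close> converge.\<close>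
  define s where "s n = min (hn (w n)) (hn v)" for n
  have sl: "s \<longlonglongrightarrow> hn v"
  proof (rule order_tendstoI)
    fix a assume "a < hn v"
    then show "\<forall>\<^sub>F n in sequentially. a < s n"
      using hn_lsc_eventually[OF wH vS wl] by (auto simp: s_def elim: eventually_mono)
  next
    fix a assume "hn v < a"
    then show "\<forall>\<^sub>F n in sequentially. s n < a" by (simp add: s_def min_less_iff_disj)
  qed
  have sq: "(\<lambda>n. (hn (\<lambda>x. u n x - v x))^2) \<longlonglongrightarrow> 0"
  proof (rule Lim_null_comparison)
    have "(\<lambda>n. 2 * (b n)^2 + 2 * (hn v)^2 - 4 * (s n)^2) \<longlonglongrightarrow> 2 * (hn v)^2 + 2 * (hn v)^2 - 4 * (hn v)^2"
      by (intro tendsto_intros b sl)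
    then show "(\<lambda>n. 2 * (b n)^2 + 2 * (hn v)^2 - 4 * (s n)^2) \<longlonglongrightarrow> 0" by simp
    have "(hn (\<lambda>x. u n x - v x))^2 \<le> 2 * (b n)^2 + 2 * (hn v)^2 - 4 * (s n)^2" for n
    proof -
      have "(s n)^2 \<le> (hn (w n))^2" by (rule power_mono) (auto simp: s_def)
      moreover have "(hn (u n))^2 \<le> (b n)^2" by (rule power_mono[OF b(1)]) simp
      ultimately show ?thesis
        using hn_parallelogram[OF u[of n] v] unfolding w_def by linarith
    qed
    then show "\<forall>\<^sub>F n in sequentially. norm ((hn (\<lambda>x. u n x - v x))^2) \<le> 2 * (b n)^2 + 2 * (hn v)^2 - 4 * (s n)^2" by simp
  qed
  from tendsto_real_sqrt[OF sq] show ?thesis by simp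
qed

section \<open>Smooth approximation of the absolute value\<close>

text \<open>Subtracting the offset makes the function vanish at 0, which preserves compact supports;
  its slope is at most 1 in modulus, so composing with it does not enlarge gradients.\<close>

definition smooth_abs :: "nat \<Rightarrow> real \<Rightarrow> real" where
  "smooth_abs k t = sqrt (t^2 + (inverse (real (Suc k)))^2) - inverse (real (Suc k))"

lemma smooth_abs_bounds: "0 \<le> smooth_abs k t" "\<bar>smooth_abs k t - \<bar>t\<bar>\<bar> \<le> inverse (real (Suc k))"
proof -
  define e where "e = inverse (real (Suc k))"
  have e: "e > 0" by (simp add: e_def)
  have 1: "e \<le> sqrt (t^2 + e^2)" by (rule real_le_rsqrt) simp
  have 2: "\<bar>t\<bar> \<le> sqrt (t^2 + e^2)" by (rule real_le_rsqrt) simp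
  have 3: "sqrt (t^2 + e^2) \<le> \<bar>t\<bar> + e"
    by (rule real_le_lsqrt) (use e in \<open>auto simp: power2_sum\<close>)
  show "0 \<le> smooth_abs k t" "\<bar>smooth_abs k t - \<bar>t\<bar>\<bar> \<le> inverse (real (Suc k))"
    using 1 2 3 e unfolding smooth_abs_def e_def[symmetric] by (simp, linarith)
qed

lemma smooth_abs_DERIV:
  "(smooth_abs k has_real_derivative t / sqrt (t^2 + (inverse (real (Suc k)))^2)) (at t)"
proof -
  define e where "e = inverse (real (Suc k))"
  have pos: "t^2 + e^2 > 0" by (simp add: e_def add_nonneg_pos)
  have d: "((\<lambda>t. t^2 + e^2) has_real_derivative 2 * t) (at t)"
    by (auto intro!: derivative_eq_intros)
  have alg: "inverse S / 2 * (2 * t) = t / S" for S :: real by (simp add: inverse_eq_divide)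
  have "((\<lambda>t. sqrt (t^2 + e^2)) has_real_derivative t / sqrt (t^2 + e^2)) (at t)"
    by (rule DERIV_chain2[where f = sqrt and g = "\<lambda>t. t^2 + e^2", OF DERIV_real_sqrt[OF pos] d, unfolded alg])
  from DERIV_diff[OF this DERIV_const[of e]]
  show ?thesis unfolding smooth_abs_def[abs_def] e_def[symmetric] by simp
qed

lemma test_fun_smooth_abs:
  assumes \<phi>: "test_fun \<Omega> \<phi>"
  shows "test_fun \<Omega> (\<lambda>x. smooth_abs k (\<phi> x))" "norm (cgrad (\<lambda>x. smooth_abs k (\<phi> x)) x) \<le> norm (cgrad \<phi> x)"
proof -
  define e where "e = inverse (real (Suc k))"
  have e: "e > 0" by (simp add: e_def)
  note s = test_funD(1)[OF \<phi>]
  show "test_fun \<Omega> (\<lambda>x. smooth_abs k (\<phi> x))"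
  proof (rule test_fun_support_mono[OF \<phi>])
    have "smooth_on UNIV (\<lambda>x. \<phi> x * \<phi> x + e^2)"
      by (rule smooth_add[OF smooth_mult[OF s s] smooth_const])
    then have "smooth_on UNIV (\<lambda>x. sqrt (\<phi> x * \<phi> x + e^2))"
      by (rule smooth_sqrt) (use e in \<open>simp add: add_nonneg_pos\<close>)
    from smooth_diff[OF this smooth_const[of e]]
    show "smooth_on UNIV (\<lambda>x. smooth_abs k (\<phi> x))"
      by (simp add: smooth_abs_def e_def power2_eq_square)
    show "smooth_abs k (\<phi> x) = 0" if "\<phi> x = 0" for x
      using that by (simp add: smooth_abs_def)
  qed
  have q: "\<bar>t / sqrt (t^2 + e^2)\<bar> \<le> 1" for t
  proof -
    have "\<bar>t\<bar> \<le> sqrt (t^2 + e^2)" by (rule real_le_rsqrt) simp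
    moreover have "sqrt (t^2 + e^2) > 0" using e by (simp add: add_nonneg_pos)
    ultimately show ?thesis by (simp add: abs_divide)
  qed
  show "norm (cgrad (\<lambda>x. smooth_abs k (\<phi> x)) x) \<le> norm (cgrad \<phi> x)"
    unfolding cgrad_chain[OF s smooth_abs_DERIV] e_def[symmetric]
    using mult_right_mono[OF q[of "\<phi> x"] norm_ge_zero[of "cgrad \<phi> x"]] by simp
qed

text \<open>The norms are controlled by a sequence tending to \<open>hn u\<close> instead of being
  shown to converge. Lower semicontinuity and \<open>strong_convergence\<close> ask for exactly
  this.\<close>

lemma abs_approx:
  assumes u: "u \<in> H01 \<Omega>"
  obtains \<psi> where "\<And>k. test_fun \<Omega> (\<psi> k)" "\<And>k x. \<psi> k x \<ge> 0"
    "(\<lambda>k. n2 (\<lambda>x. \<psi> k x - \<bar>u x\<bar>)) \<longlonglongrightarrow> 0" "\<exists>b. (\<forall>k. hn (\<psi> k) \<le> b k) \<and> b \<longlonglongrightarrow> hn u"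
proof -
  obtain \<phi> where \<phi>: "\<And>k. test_fun \<Omega> (\<phi> k)" "(\<lambda>k. n2 (\<lambda>x. \<phi> k x - u x)) \<longlonglongrightarrow> 0"
    "(\<lambda>k. n2 (\<lambda>x. cgrad (\<phi> k) x - wg u x)) \<longlonglongrightarrow> 0"
    by (rule H01_approx[OF u], rule that)
  define \<psi> where "\<psi> k x = smooth_abs k (\<phi> k x)" for k x
  have \<psi>t: "test_fun \<Omega> (\<psi> k)" for k
    unfolding \<psi>_def[abs_def] by (rule test_fun_smooth_abs(1)[OF \<phi>(1)])
  note \<phi>S = test_fun_sqint[OF \<phi>(1) open_dom] and \<psi>S = test_fun_sqint[OF \<psi>t open_dom]
  have uS: "u \<in> S2" by (rule H01_S2[OF u])
  have auS: "(\<lambda>x. \<bar>u x\<bar>) \<in> S2"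
    using sqintD(1)[OF uS] by (intro sqint_dominated(1)[OF uS]) auto
  have h: "hn (\<psi> k) \<le> n2 (cgrad (\<phi> k))" for k
    unfolding hn_test_fun[OF \<psi>t]
    by (rule sqint_dominated(2)[OF \<phi>S(2) sqintD(1)[OF \<psi>S(2)] AE_I2])
      (unfold \<psi>_def[abs_def], rule test_fun_smooth_abs(2)[OF \<phi>(1)])
  have hl: "(\<lambda>k. n2 (cgrad (\<phi> k))) \<longlonglongrightarrow> hn u"
    unfolding hnorm_eq_l2n by (rule l2n_tendsto[OF \<phi>S(2) wgrad_spec(1)[OF u] \<phi>(3)])
  have l: "(\<lambda>k. n2 (\<lambda>x. \<psi> k x - \<bar>u x\<bar>)) \<longlonglongrightarrow> 0"
  proof (rule Lim_null_comparison)
    have "(\<lambda>k. n2 (\<lambda>x. \<phi> k x - u x) + inverse (real (Suc k)) * n2 (\<lambda>x. 1::real)) \<longlonglongrightarrow> 0 + 0 * n2 (\<lambda>x. 1::real)"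
      by (intro tendsto_add tendsto_mult tendsto_const \<phi> LIMSEQ_inverse_real_of_nat)
    then show "(\<lambda>k. n2 (\<lambda>x. \<phi> k x - u x) + inverse (real (Suc k)) * n2 (\<lambda>x. 1::real)) \<longlonglongrightarrow> 0" by simp
    have "n2 (\<lambda>x. \<psi> k x - \<bar>u x\<bar>) \<le> n2 (\<lambda>x. \<phi> k x - u x) + inverse (real (Suc k)) * n2 (\<lambda>x. 1::real)" for k
    proof -
      define e where "e = inverse (real (Suc k))"
      have e: "e > 0" by (simp add: e_def)
      have aS: "(\<lambda>x. \<bar>\<phi> k x - u x\<bar>) \<in> S2"
        using sqintD(1)[OF uS] sqintD(1)[OF \<phi>S(1)[of k]] by (intro sqint_dominated(1)[OF sqint_diff[OF \<phi>S(1) uS]]) auto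
      have S: "(\<lambda>x. \<bar>\<phi> k x - u x\<bar> + e * 1) \<in> S2" by (rule sqint_add[OF aS sqint_cmult[OF S2_const]])
      have p: "norm (\<psi> k x - \<bar>u x\<bar>) \<le> norm (\<bar>\<phi> k x - u x\<bar> + e * 1)" for x
        using smooth_abs_bounds(2)[of k "\<phi> k x"] e unfolding \<psi>_def e_def[symmetric] by simp
      have "n2 (\<lambda>x. \<psi> k x - \<bar>u x\<bar>) \<le> n2 (\<lambda>x. \<bar>\<phi> k x - u x\<bar> + e * 1)"
        by (rule sqint_dominated(2)[OF S sqintD(1)[OF sqint_diff[OF \<psi>S(1) auS]] AE_I2]) (rule p)
      also have "\<dots> \<le> n2 (\<lambda>x. \<bar>\<phi> k x - u x\<bar>) + n2 (\<lambda>x. e * 1)"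
        by (rule l2n_triangle[OF aS sqint_cmult[OF S2_const]])
      also have "n2 (\<lambda>x. \<bar>\<phi> k x - u x\<bar>) = n2 (\<lambda>x. \<phi> k x - u x)" by (simp add: l2n_def)
      also have "n2 (\<lambda>x. e * 1) = e * n2 (\<lambda>x. 1::real)"
        using l2n_cmult[of "L \<Omega>" e "\<lambda>x. 1"] e by simp
      finally show ?thesis by (simp add: e_def)
    qed
    then show "\<forall>\<^sub>F k in sequentially. norm (n2 (\<lambda>x. \<psi> k x - \<bar>u x\<bar>)) \<le> n2 (\<lambda>x. \<phi> k x - u x) + inverse (real (Suc k)) * n2 (\<lambda>x. 1::real)"
      by simp
  qed
  show ?thesis
  proof (rule that[of \<psi>, OF \<psi>t _ l])
    show "0 \<le> \<psi> k x" for k x unfolding \<psi>_def by (rule smooth_abs_bounds(1))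
    show "\<exists>b. (\<forall>k. hn (\<psi> k) \<le> b k) \<and> b \<longlonglongrightarrow> hn u"
      by (rule exI[of _ "\<lambda>k. n2 (cgrad (\<phi> k))"]) (use h hl in simp)
  qed
qed

text \<open>Lower semicontinuity takes the place of a chain rule for |u|, which is why the norm is
  compared by an inequality only.\<close>

lemma H01_abs:
  assumes u: "u \<in> H01 \<Omega>"
  shows "(\<lambda>x. \<bar>u x\<bar>) \<in> H01 \<Omega>" "hn (\<lambda>x. \<bar>u x\<bar>) \<le> hn u"
proof -
  obtain \<psi> where \<psi>: "\<And>k. test_fun \<Omega> (\<psi> k)" "\<And>k x. \<psi> k x \<ge> 0"
    "(\<lambda>k. n2 (\<lambda>x. \<psi> k x - \<bar>u x\<bar>)) \<longlonglongrightarrow> 0" and b: "\<exists>b. (\<forall>k. hn (\<psi> k) \<le> b k) \<and> b \<longlonglongrightarrow> hn u"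
    by (rule abs_approx[OF u], rule that)
  obtain b where b: "\<And>k. hn (\<psi> k) \<le> b k" "b \<longlonglongrightarrow> hn u" using b by blast
  have "(\<lambda>x. \<bar>u x\<bar>) \<in> S2"
    using sqintD(1)[OF H01_S2[OF u]] by (intro sqint_dominated(1)[OF H01_S2[OF u]]) auto
  from hn_lsc[OF H01_test_fun(1)[OF \<psi>(1)] this \<psi>(3) b]
  show "(\<lambda>x. \<bar>u x\<bar>) \<in> H01 \<Omega>" "hn (\<lambda>x. \<bar>u x\<bar>) \<le> hn u" by auto
qed

text \<open>For nonnegative \<open>u\<close> the limit in \<open>abs_approx\<close> is
  \<open>u\<close> itself and the norm bounds tend to its own norm, so the convergence becomes
  strong. Nonnegative approximants are what the logarithmic test functions of the maximum principle
  are built from.\<close>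

lemma nonneg_approx:
  assumes u: "u \<in> H01 \<Omega>" and nn: "AE x in L \<Omega>. u x \<ge> 0"
  obtains \<psi> where "\<And>k. test_fun \<Omega> (\<psi> k)" "\<And>k x. \<psi> k x \<ge> 0" "(\<lambda>k. hn (\<lambda>x. \<psi> k x - u x)) \<longlonglongrightarrow> 0"
proof -
  obtain \<psi> where \<psi>: "\<And>k. test_fun \<Omega> (\<psi> k)" "\<And>k x. \<psi> k x \<ge> 0"
    "(\<lambda>k. n2 (\<lambda>x. \<psi> k x - \<bar>u x\<bar>)) \<longlonglongrightarrow> 0" and b: "\<exists>b. (\<forall>k. hn (\<psi> k) \<le> b k) \<and> b \<longlonglongrightarrow> hn u"
    by (rule abs_approx[OF u], rule that)
  obtain b where b: "\<And>k. hn (\<psi> k) \<le> b k" "b \<longlonglongrightarrow> hn u" using b by blast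
  have m: "(\<lambda>x. \<bar>u x\<bar>) \<in> borel_measurable (L \<Omega>)" using sqintD(1)[OF H01_S2[OF u]] by measurable
  have AE: "AE x in L \<Omega>. \<bar>u x\<bar> = u x" using nn by eventually_elim simp
  have "n2 (\<lambda>x. \<psi> k x - \<bar>u x\<bar>) = n2 (\<lambda>x. \<psi> k x - u x)" for k
    by (rule n2_cong_right[OF m sqintD(1)[OF H01_S2[OF u]] sqintD(1)[OF test_fun_sqint(1)[OF \<psi>(1) open_dom]] AE])
  then have l: "(\<lambda>k. n2 (\<lambda>x. \<psi> k x - u x)) \<longlonglongrightarrow> 0" using \<psi>(3) by simp
  show ?thesis
    by (rule that[OF \<psi>(1,2) strong_convergence[OF H01_test_fun(1)[OF \<psi>(1)] u l b]])
qed

end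

subsection \<open>Compactness of the embedding into square integrable functions\<close>

text \<open>The increment is the integral over [0,1] of the directional derivative, and
  Cauchy-Schwarz on this interval of length 1 bounds its square.\<close>

lemma square_increment_le:
  fixes g :: "real^'n::finite \<Rightarrow> real" and G :: "real^'n \<Rightarrow> real^'n"
  assumes D: "\<And>x. (g has_derivative (\<lambda>h. G x \<bullet> h)) (at x)" and G: "continuous_on UNIV G"
  shows "ennreal ((g (x + y) - g x)^2)
    \<le> (\<integral>\<^sup>+s. ennreal ((norm y)^2 * (norm (G (x + s *\<^sub>R y)))^2) * indicator {0..1} s \<partial>lborel)"
proof -
  define k where "k s = G (x + s *\<^sub>R y) \<bullet> y" for s
  define c where "c = g (x + y) - g x"
  have kc: "continuous_on {0..1} k"
    unfolding k_def by (intro continuous_intros continuous_on_compose2[OF G]) auto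
  have "(k has_integral g (x + 1 *\<^sub>R y) - g (x + 0 *\<^sub>R y)) {0..1}"
  proof (rule fundamental_theorem_of_calculus)
    fix s :: real assume "s \<in> {0..1}"
    have "((\<lambda>s. x + s *\<^sub>R y) has_derivative (\<lambda>h. h *\<^sub>R y)) (at s within {0..1})"
      by (auto intro!: derivative_eq_intros)
    from has_derivative_compose[OF this D]
    show "((\<lambda>s. g (x + s *\<^sub>R y)) has_vector_derivative k s) (at s within {0..1})"
      by (simp add: has_vector_derivative_def k_def)
  qed simp
  then have k1: "(k has_integral c) {0..1}" by (simp add: c_def)
  have "(\<lambda>s. (k s)^2) integrable_on {0..1}"
    by (rule integrable_continuous_interval) (intro continuous_intros kc)
  then obtain J where J: "((\<lambda>s. (k s)^2) has_integral J) {0..1}" by (auto simp: integrable_on_def)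
  have one: "((\<lambda>s. c^2) has_integral c^2) {0..1::real}"
    using has_integral_const_real[of "c^2" 0 1] by simp
  \<comment> \<open>Integrating the square of \<open>k s - c\<close>, where \<open>c\<close> is the
    mean of \<open>k\<close>, proves Cauchy-Schwarz directly.\<close>
  have "((\<lambda>s. ((k s)^2 - (2 * c) * k s) + c^2) has_integral (J - (2 * c) * c) + c^2) {0..1}"
    by (intro has_integral_add has_integral_diff J has_integral_mult_right k1 one)
  then have "0 \<le> (J - (2 * c) * c) + c^2"
  proof (rule has_integral_nonneg)
    fix s
    have "((k s)^2 - (2 * c) * k s) + c^2 = (k s - c)^2" by (simp add: power2_diff)
    then show "0 \<le> ((k s)^2 - (2 * c) * k s) + c^2" by simp
  qed
  then have cJ: "c^2 \<le> J" by (simp add: power2_eq_square)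
  have "ennreal (c^2) \<le> ennreal J" by (rule ennreal_leI[OF cJ])
  also have "\<dots> = (\<integral>\<^sup>+s. ennreal ((k s)^2) * indicator {0..1} s \<partial>lborel)"
    using nn_integral_has_integral_lebesgue'[OF _ J] by simp
  also have "\<dots> \<le> (\<integral>\<^sup>+s. ennreal ((norm y)^2 * (norm (G (x + s *\<^sub>R y)))^2) * indicator {0..1} s \<partial>lborel)"
  proof (intro nn_integral_mono mult_right_mono ennreal_leI)
    fix s
    have "\<bar>k s\<bar> \<le> norm (G (x + s *\<^sub>R y)) * norm y" unfolding k_def by (rule Cauchy_Schwarz_ineq2)
    then have "\<bar>k s\<bar>^2 \<le> (norm (G (x + s *\<^sub>R y)) * norm y)^2" by (rule power_mono) simp
    then show "(k s)^2 \<le> (norm y)^2 * (norm (G (x + s *\<^sub>R y)))^2" by (simp add: power_mult_distrib mult.commute)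
  qed simp
  finally show ?thesis by (simp add: c_def)
qed

text \<open>After integration in x the order of integration is exchanged, and each translate by
  \<open>s *\<^sub>R y\<close> contributes at most the integral over \<open>B\<close>. The sets
  \<open>A\<close> and \<open>B\<close> allow a local use: with both equal to \<open>UNIV\<close>
  this serves the compact embedding, and on concentric balls it is applied to logarithms.\<close>

lemma shift_estimate:
  fixes g :: "real^'n::finite \<Rightarrow> real" and G :: "real^'n \<Rightarrow> real^'n"
  assumes D: "\<And>x. (g has_derivative (\<lambda>h. G x \<bullet> h)) (at x)" and G: "continuous_on UNIV G"
    and A: "A \<in> sets borel" and B: "B \<in> sets borel"
    and AB: "\<And>x s. x \<in> A \<Longrightarrow> 0 \<le> s \<Longrightarrow> s \<le> 1 \<Longrightarrow> x + s *\<^sub>R y \<in> B"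
  shows "(\<integral>\<^sup>+x. ennreal ((g (x + y) - g x)^2) * indicator A x \<partial>lborel)
    \<le> ennreal ((norm y)^2) * (\<integral>\<^sup>+x. ennreal ((norm (G x))^2) * indicator B x \<partial>lborel)"
proof -
  have [measurable]: "G \<in> borel_measurable borel" by (rule borel_measurable_continuous_onI[OF G])
  note [measurable] = A B
  let ?N = "ennreal ((norm y)^2)"
  have "(\<integral>\<^sup>+x. ennreal ((g (x + y) - g x)^2) * indicator A x \<partial>lborel)
    \<le> (\<integral>\<^sup>+x. (\<integral>\<^sup>+s. ?N * (ennreal ((norm (G (x + s *\<^sub>R y)))^2) * indicator B (x + s *\<^sub>R y)) * indicator {0..1} s \<partial>(lborel::real measure)) \<partial>lborel)"
  proof (rule nn_integral_mono)
    fix x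
    show "ennreal ((g (x + y) - g x)^2) * indicator A x
      \<le> (\<integral>\<^sup>+s. ?N * (ennreal ((norm (G (x + s *\<^sub>R y)))^2) * indicator B (x + s *\<^sub>R y)) * indicator {0..1} s \<partial>lborel)"
    proof (cases "x \<in> A")
      case True
      have "ennreal ((g (x + y) - g x)^2) \<le> (\<integral>\<^sup>+s. ennreal ((norm y)^2 * (norm (G (x + s *\<^sub>R y)))^2) * indicator {0..1} s \<partial>lborel)"
        by (rule square_increment_le[OF D G])
      also have "\<dots> = (\<integral>\<^sup>+s. ?N * (ennreal ((norm (G (x + s *\<^sub>R y)))^2) * indicator B (x + s *\<^sub>R y)) * indicator {0..1} s \<partial>lborel)"
        by (intro nn_integral_cong) (use AB[OF True] in \<open>auto simp: indicator_def ennreal_mult\<close>)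
      finally show ?thesis using True by simp
    qed simp
  qed
  also have "\<dots> = (\<integral>\<^sup>+s. (\<integral>\<^sup>+x. ?N * (ennreal ((norm (G (x + s *\<^sub>R y)))^2) * indicator B (x + s *\<^sub>R y)) * indicator {0..1} s \<partial>lborel) \<partial>(lborel::real measure))"
    by (rule lborel_pair.Fubini'[symmetric]) measurable
  also have "\<dots> = (\<integral>\<^sup>+s. ?N * (\<integral>\<^sup>+x. ennreal ((norm (G x))^2) * indicator B x \<partial>lborel) * indicator {0..1} s \<partial>(lborel::real measure))"
  proof (rule nn_integral_cong)
    fix s :: real
    have "(\<integral>\<^sup>+x. ?N * (ennreal ((norm (G (x + s *\<^sub>R y)))^2) * indicator B (x + s *\<^sub>R y)) * indicator {0..1} s \<partial>lborel)
       = ?N * (\<integral>\<^sup>+x. ennreal ((norm (G (x + s *\<^sub>R y)))^2) * indicator B (x + s *\<^sub>R y) \<partial>lborel) * indicator {0..1} s"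
      by (subst nn_integral_multc, measurable, subst nn_integral_cmult, measurable)
    also have "(\<integral>\<^sup>+x. ennreal ((norm (G (x + s *\<^sub>R y)))^2) * indicator B (x + s *\<^sub>R y) \<partial>lborel)
       = (\<integral>\<^sup>+x. ennreal ((norm (G x))^2) * indicator B x \<partial>lborel)"
      by (rule nn_integral_lborel_shift[where f = "\<lambda>x. ennreal ((norm (G x))^2) * indicator B x"]) measurable
    finally show "(\<integral>\<^sup>+x. ?N * (ennreal ((norm (G (x + s *\<^sub>R y)))^2) * indicator B (x + s *\<^sub>R y)) * indicator {0..1} s \<partial>lborel)
      = ?N * (\<integral>\<^sup>+x. ennreal ((norm (G x))^2) * indicator B x \<partial>lborel) * indicator {0..1} s" .
  qed
  also have "\<dots> = ?N * (\<integral>\<^sup>+x. ennreal ((norm (G x))^2) * indicator B x \<partial>lborel)"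
    by (subst nn_integral_cmult) (auto simp: )
  finally show ?thesis .
qed

section \<open>Averages over balls\<close>

definition ballM :: "real \<Rightarrow> (real^'n::finite) measure" where
  "ballM h = restrict_space lborel (ball 0 h)"

text \<open>This is convolution with the normalised indicator of a ball, a mollifier just regular
  enough to give uniform Lipschitz bounds.\<close>

definition ball_avg :: "real \<Rightarrow> (real^'n::finite \<Rightarrow> real) \<Rightarrow> real^'n \<Rightarrow> real" where
  "ball_avg h \<phi> x = (LINT y|ballM h. \<phi> (x + y)) / measure lborel (ball (0::real^'n) h)"

lemma finite_measure_ballM: "finite_measure (ballM h :: (real^'n::finite) measure)"
  unfolding ballM_def
  by (rule finite_measureI)
    (use emeasure_lborel_ball_finite[of "0::real^'n" h] in \<open>auto simp: emeasure_restrict_space space_restrict_space\<close>)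

lemma space_ballM: "space (ballM h) = ball 0 h"
  by (simp add: ballM_def space_restrict_space)

lemma measure_ballM: "measure (ballM h) (space (ballM h :: (real^'n) measure)) = measure lborel (ball (0::real^'n::finite) h)"
  unfolding space_ballM by (simp add: ballM_def measure_restrict_space)

lemma borel_measurable_ballM: "f \<in> borel_measurable borel \<Longrightarrow> f \<in> borel_measurable (ballM h)"
  unfolding ballM_def by (rule measurable_restrict_space1) simp

lemma nn_integral_ballM:
  "f \<in> borel_measurable borel \<Longrightarrow> (\<integral>\<^sup>+x. f x \<partial>ballM h) = (\<integral>\<^sup>+x. f x * indicator (ball 0 h) x \<partial>lborel)"
  unfolding ballM_def by (rule nn_integral_restrict_space) simp

lemma sqint_ballM:
  fixes f :: "real^'n::finite \<Rightarrow> real"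
  assumes "f \<in> borel_measurable borel" "\<And>x. \<bar>f x\<bar> \<le> C"
  shows "f \<in> sqint (ballM h)"
proof -
  interpret B: finite_measure "ballM h :: (real^'n) measure" by (rule finite_measure_ballM)
  have c: "(\<lambda>x::real^'n. C) \<in> sqint (ballM h)" by (simp add: sqint_def)
  show ?thesis
    by (rule sqint_dominated(1)[OF c borel_measurable_ballM[OF assms(1)] AE_I2])
      (use assms(2) order_trans[OF assms(2) abs_ge_self] in auto)
qed

lemma integral_ballM_sq_le:
  fixes f :: "real^'n::finite \<Rightarrow> real"
  assumes "f \<in> sqint (ballM h)"
  shows "(LINT y|ballM h. f y)^2 \<le> measure lborel (ball (0::real^'n) h) * (LINT y|ballM h. (f y)^2)"
proof -
  interpret B: finite_measure "ballM h :: (real^'n) measure" by (rule finite_measure_ballM)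
  have c: "(\<lambda>x::real^'n. 1::real) \<in> sqint (ballM h)" by (simp add: sqint_def)
  have "\<bar>LINT y|ballM h. 1 * f y\<bar>^2 \<le> (l2n (ballM h) (\<lambda>x::real^'n. 1::real) * l2n (ballM h) f)^2"
    by (rule power_mono[OF l2n_Cauchy_Schwarz_real[OF c assms]]) simp
  then show ?thesis by (simp add: power_mult_distrib l2n_power2 measure_ballM)
qed

lemma l2n_nn_integral:
  fixes f :: "'a \<Rightarrow> 'b::euclidean_space"
  assumes "f \<in> sqint M"
  shows "(\<integral>\<^sup>+x. ennreal ((norm (f x))^2) \<partial>M) = ennreal ((l2n M f)^2)"
  unfolding l2n_power2 by (rule nn_integral_eq_integral[OF sqintD(2)[OF assms]]) simp

lemma l2n_le_nn_integral:
  fixes f :: "'a \<Rightarrow> 'b::euclidean_space"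
  assumes "f \<in> borel_measurable M" "(\<integral>\<^sup>+x. ennreal ((norm (f x))^2) \<partial>M) \<le> ennreal (C^2)" "C \<ge> 0"
  shows "f \<in> sqint M" "l2n M f \<le> C"
proof -
  have i: "integrable M (\<lambda>x. (norm (f x))^2)"
    by (rule integrableI_bounded) (use assms in \<open>auto simp: less_top[symmetric] top_unique\<close>)
  then show S: "f \<in> sqint M" using assms by (simp add: sqint_def)
  have "(l2n M f)^2 \<le> C^2" using assms(2) l2n_nn_integral[OF S] by simp
  then show "l2n M f \<le> C" by (rule power2_le_imp_le[OF _ assms(3)])
qed

lemma sqrt_mult_divide_square:
  assumes "V > 0"
  shows "(sqrt V * \<bar>a / V\<bar>)^2 = a^2 / (V::real)"
proof -
  have "(sqrt V * \<bar>a / V\<bar>)^2 = V * (a / V)^2"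
    using assms by (simp add: power_mult_distrib power_divide)
  then show ?thesis using assms by (simp add: power2_eq_square)
qed

locale smooth_compact =
  fixes \<phi> :: "real^'n::finite \<Rightarrow> real"
  assumes test: "test_fun UNIV \<phi>"
begin

lemma cont: "continuous_on UNIV \<phi>"
  by (rule smooth_continuous[OF test_funD(1)[OF test]])

lemma meas [measurable]: "\<phi> \<in> borel_measurable borel"
  by (rule borel_measurable_continuous_onI[OF cont])

lemma bounded_values: obtains C where "\<And>x. \<bar>\<phi> x\<bar> \<le> C"
proof -
  let ?K = "closure {x. \<phi> x \<noteq> 0}"
  have "bounded (\<phi> ` ?K)"
    by (rule compact_imp_bounded[OF compact_continuous_image[OF continuous_on_subset[OF cont] test_funD(2)[OF test]]]) simp
  then obtain C where C: "C > 0" "\<And>x. x \<in> ?K \<Longrightarrow> \<bar>\<phi> x\<bar> \<le> C" by (auto simp: bounded_pos)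
  have "\<bar>\<phi> x\<bar> \<le> C" for x
  proof (cases "x \<in> ?K")
    case False
    then have "\<phi> x = 0" using closure_subset[of "{x. \<phi> x \<noteq> 0}"] by auto
    then show ?thesis using C(1) by simp
  qed (use C in simp)
  then show ?thesis by (rule that)
qed

lemma sq: "\<phi> \<in> sqint lborel" "cgrad \<phi> \<in> sqint lborel"
proof -
  have "\<phi> \<in> sqint (L UNIV)" "cgrad \<phi> \<in> sqint (L UNIV)" by (rule test_fun_sqint[OF test open_UNIV])+
  moreover have "cgrad \<phi> \<in> borel_measurable borel"
    by (rule borel_measurable_continuous_onI[OF cgrad_continuous[OF test_funD(1)[OF test]]])
  ultimately show "\<phi> \<in> sqint lborel" "cgrad \<phi> \<in> sqint lborel"
    using lebesgue_on_integral_borel(1)[OF _ open_UNIV, of "\<lambda>x. (norm (\<phi> x))^2"]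
      lebesgue_on_integral_borel(1)[OF _ open_UNIV, of "\<lambda>x. (norm (cgrad \<phi> x))^2"]
    by (simp_all add: sqint_def)
qed

lemma shift_sqint: "(\<lambda>y. \<phi> (y + a) - \<phi> y) \<in> sqint lborel"
  and shift_l2n: "l2n lborel (\<lambda>y. \<phi> (y + a) - \<phi> y) \<le> norm a * l2n lborel (cgrad \<phi>)"
proof -
  have "(\<integral>\<^sup>+x. ennreal ((norm (\<phi> (x + a) - \<phi> x))^2) \<partial>lborel)
     \<le> ennreal ((norm a)^2) * (\<integral>\<^sup>+x. ennreal ((norm (cgrad \<phi> x))^2) \<partial>lborel)"
    using shift_estimate[of \<phi> "cgrad \<phi>" UNIV UNIV a, OF smooth_has_derivative[OF test_funD(1)[OF test]]
        cgrad_continuous[OF test_funD(1)[OF test]]] by simp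
  also have "\<dots> = ennreal ((norm a * l2n lborel (cgrad \<phi>))^2)"
    by (simp add: l2n_nn_integral[OF sq(2)] power_mult_distrib ennreal_mult)
  finally have le: "(\<integral>\<^sup>+x. ennreal ((norm (\<phi> (x + a) - \<phi> x))^2) \<partial>lborel)
     \<le> ennreal ((norm a * l2n lborel (cgrad \<phi>))^2)" .
  have m: "(\<lambda>y. \<phi> (y + a) - \<phi> y) \<in> borel_measurable lborel" by measurable
  show "(\<lambda>y. \<phi> (y + a) - \<phi> y) \<in> sqint lborel"
    "l2n lborel (\<lambda>y. \<phi> (y + a) - \<phi> y) \<le> norm a * l2n lborel (cgrad \<phi>)"
    using l2n_le_nn_integral[OF m le] by simp_all
qed

lemma vol_pos: "h > 0 \<Longrightarrow> measure lborel (ball (0::real^'n) h) > 0"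
  by (rule content_ball_pos)

lemma sqint_ball_shift: "(\<lambda>y. \<phi> (x + y)) \<in> sqint (ballM h)"
proof -
  obtain C where C: "\<And>x. \<bar>\<phi> x\<bar> \<le> C" using bounded_values by blast
  show ?thesis by (rule sqint_ballM[of _ C]) (use C in simp_all)
qed

lemma ball_le_lborel:
  fixes f :: "real^'n \<Rightarrow> real"
  assumes "f \<in> sqint lborel" "f \<in> borel_measurable borel" "f \<in> sqint (ballM h)"
  shows "(LINT y|ballM h. (f y)^2) \<le> (l2n lborel f)^2"
proof -
  have "ennreal (LINT y|ballM h. (f y)^2) = (\<integral>\<^sup>+y. ennreal ((f y)^2) \<partial>ballM h)"
    using nn_integral_eq_integral[OF sqintD(2)[OF assms(3)]] by simp
  also have "\<dots> = (\<integral>\<^sup>+y. ennreal ((f y)^2) * indicator (ball 0 h) y \<partial>lborel)"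
    by (rule nn_integral_ballM) (use assms(2) in measurable)
  also have "\<dots> \<le> (\<integral>\<^sup>+y. ennreal ((norm (f y))^2) \<partial>lborel)"
    by (rule nn_integral_mono) (simp add: indicator_def)
  also have "\<dots> = ennreal ((l2n lborel f)^2)" by (rule l2n_nn_integral[OF assms(1)])
  finally show ?thesis by (simp add: ennreal_le_iff)
qed

lemma l2n_shift: "(\<lambda>y. \<phi> (y + a)) \<in> sqint lborel" "l2n lborel (\<lambda>y. \<phi> (y + a)) = l2n lborel \<phi>"
proof -
  have m: "(\<lambda>y. (\<phi> y)^2) \<in> borel_measurable borel" by measurable
  show "(\<lambda>y. \<phi> (y + a)) \<in> sqint lborel"
    using integral_lborel_shift(2)[OF m, of a] sq(1) by (simp add: sqint_def)
  show "l2n lborel (\<lambda>y. \<phi> (y + a)) = l2n lborel \<phi>"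
    using integral_lborel_shift(1)[OF m, of a] by (simp add: l2n_def)
qed

lemma ball_avg_bound:
  assumes "h > 0"
  shows "sqrt (measure lborel (ball (0::real^'n) h)) * \<bar>ball_avg h \<phi> x\<bar> \<le> l2n lborel \<phi>"
proof (rule power2_le_imp_le)
  let ?V = "measure lborel (ball (0::real^'n) h)"
  have V: "?V > 0" by (rule vol_pos[OF assms])
  have "(LINT y|ballM h. \<phi> (x + y))^2 \<le> ?V * (LINT y|ballM h. (\<phi> (x + y))^2)"
    by (rule integral_ballM_sq_le[OF sqint_ball_shift])
  also have "\<dots> \<le> ?V * (l2n lborel \<phi>)^2"
    using ball_le_lborel[of "\<lambda>y. \<phi> (x + y)" h] l2n_shift[of x] sqint_ball_shift[of x h] V
    by (intro mult_left_mono) (simp_all add: add.commute)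
  finally have "(LINT y|ballM h. \<phi> (x + y))^2 / ?V \<le> (l2n lborel \<phi>)^2"
    using V by (simp add: field_simps)
  moreover have "(sqrt ?V * \<bar>ball_avg h \<phi> x\<bar>)^2 = (LINT y|ballM h. \<phi> (x + y))^2 / ?V"
    unfolding ball_avg_def by (rule sqrt_mult_divide_square[OF V])
  ultimately show "(sqrt ?V * \<bar>ball_avg h \<phi> x\<bar>)^2 \<le> (l2n lborel \<phi>)^2" by simp
qed simp

text \<open>Cauchy-Schwarz on the ball reduces the difference to an L2 increment by
  \<open>x - z\<close>. For fixed \<open>h\<close> the constant depends on the function only through
  the L2 norm of its gradient, so a family with bounded gradients becomes equicontinuous.\<close>

lemma ball_avg_Lipschitz:
  assumes "h > 0"
  shows "sqrt (measure lborel (ball (0::real^'n) h)) * \<bar>ball_avg h \<phi> x - ball_avg h \<phi> z\<bar> \<le> norm (x - z) * l2n lborel (cgrad \<phi>)"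
proof (rule power2_le_imp_le)
  let ?V = "measure lborel (ball (0::real^'n) h)"
  interpret B: finite_measure "ballM h :: (real^'n) measure" by (rule finite_measure_ballM)
  have V: "?V > 0" by (rule vol_pos[OF assms])
  define f where "f y = \<phi> (x + y) - \<phi> (z + y)" for y
  have fS: "f \<in> sqint (ballM h)" unfolding f_def by (rule sqint_diff[OF sqint_ball_shift sqint_ball_shift])
  have fm: "f \<in> borel_measurable borel" unfolding f_def by measurable
  have int: "integrable (ballM h) (\<lambda>y. \<phi> (x + y))" for x
    using sqint_mult[of "\<lambda>x. 1" "ballM h", OF _ sqint_ball_shift] by (simp add: sqint_def)
  \<comment> \<open>Translating by \<open>z\<close> turns the difference of two shifts into one
    increment by the fixed vector \<open>x - z\<close>.\<close>
  define q where "q y = \<phi> (y + (x - z)) - \<phi> y" for y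
  have qm: "(\<lambda>y. (q y)^2) \<in> borel_measurable borel" unfolding q_def by measurable
  have fq: "f y = q (y + z)" for y by (simp add: f_def q_def algebra_simps)
  have qS: "q \<in> sqint lborel" "l2n lborel q \<le> norm (x - z) * l2n lborel (cgrad \<phi>)"
    unfolding q_def[abs_def] by (rule shift_sqint, rule shift_l2n)
  have fL: "f \<in> sqint lborel"
    using integral_lborel_shift(2)[OF qm, of z] qS fm by (simp add: sqint_def fq)
  have fl: "l2n lborel f = l2n lborel q"
    using integral_lborel_shift(1)[OF qm, of z] by (simp add: l2n_def fq)
  have "(LINT y|ballM h. f y)^2 \<le> ?V * (LINT y|ballM h. (f y)^2)"
    by (rule integral_ballM_sq_le[OF fS])
  also have "\<dots> \<le> ?V * (l2n lborel f)^2"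
    using ball_le_lborel[OF fL fm fS] V by (intro mult_left_mono) simp_all
  also have "\<dots> \<le> ?V * (norm (x - z) * l2n lborel (cgrad \<phi>))^2"
    unfolding fl using V qS(2) by (intro mult_left_mono power_mono) simp_all
  finally have "(LINT y|ballM h. f y)^2 / ?V \<le> (norm (x - z) * l2n lborel (cgrad \<phi>))^2"
    using V by (simp add: field_simps)
  moreover have "ball_avg h \<phi> x - ball_avg h \<phi> z = (LINT y|ballM h. f y) / ?V"
    unfolding ball_avg_def f_def using int by (simp add: diff_divide_distrib)
  then have "(sqrt ?V * \<bar>ball_avg h \<phi> x - ball_avg h \<phi> z\<bar>)^2 = (LINT y|ballM h. f y)^2 / ?V"
    using sqrt_mult_divide_square[OF V] by simp
  ultimately show "(sqrt ?V * \<bar>ball_avg h \<phi> x - ball_avg h \<phi> z\<bar>)^2 \<le> (norm (x - z) * l2n lborel (cgrad \<phi>))^2" by simp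
qed simp

lemma ball_avg_continuous:
  assumes "h > 0"
  shows "continuous_on UNIV (ball_avg h \<phi>)"
proof -
  let ?V = "sqrt (measure lborel (ball (0::real^'n) h))"
  have V: "?V > 0" using vol_pos[OF assms] by simp
  have "(l2n lborel (cgrad \<phi>) / ?V)-lipschitz_on UNIV (ball_avg h \<phi>)"
  proof (rule lipschitz_onI)
    fix x y
    show "dist (ball_avg h \<phi> x) (ball_avg h \<phi> y) \<le> l2n lborel (cgrad \<phi>) / ?V * dist x y"
      using ball_avg_Lipschitz[OF assms, of x y] V by (simp add: dist_norm field_simps)
  qed (use V in simp)
  then show ?thesis by (rule lipschitz_on_continuous_on)
qed

text \<open>The squared error is at most the average over the ball of the squared increments.
  Exchanging integrals leaves an average of squared L2 norms of shifts, each at most (h |grad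
  \<phi>|)^2.\<close>

lemma ball_avg_approx:
  assumes h: "h > 0"
  shows "(\<lambda>x. \<phi> x - ball_avg h \<phi> x) \<in> sqint lborel"
    "l2n lborel (\<lambda>x. \<phi> x - ball_avg h \<phi> x) \<le> h * l2n lborel (cgrad \<phi>)"
proof -
  let ?V = "measure lborel (ball (0::real^'n) h)"
  let ?g = "l2n lborel (cgrad \<phi>)"
  interpret B: finite_measure "ballM h :: (real^'n) measure" by (rule finite_measure_ballM)
  have V: "?V > 0" by (rule vol_pos[OF h])
  have [measurable]: "ball (0::real^'n) h \<in> sets borel" by simp
  have am: "ball_avg h \<phi> \<in> borel_measurable borel" by (rule borel_measurable_continuous_onI[OF ball_avg_continuous[OF h]])
  have int: "integrable (ballM h) (\<lambda>y. \<phi> (x + y))" for x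
    using sqint_mult[of "\<lambda>x. 1" "ballM h", OF _ sqint_ball_shift] by (simp add: sqint_def)
  have pt: "ennreal ((\<phi> x - ball_avg h \<phi> x)^2) \<le> ennreal (1 / ?V) * (\<integral>\<^sup>+y. ennreal ((\<phi> (x + y) - \<phi> x)^2) * indicator (ball 0 h) y \<partial>lborel)" for x
  proof -
    define f where "f y = \<phi> (x + y) - \<phi> x" for y
    have c: "(\<lambda>y::real^'n. \<phi> x) \<in> sqint (ballM h)" by (simp add: sqint_def)
    have fS: "f \<in> sqint (ballM h)" unfolding f_def by (rule sqint_diff[OF sqint_ball_shift c])
    have fm: "f \<in> borel_measurable borel" unfolding f_def by measurable
    have "(LINT y|ballM h. f y) = (LINT y|ballM h. \<phi> (x + y)) - ?V * \<phi> x"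
      unfolding f_def using int by (simp add: measure_ballM)
    then have "(LINT y|ballM h. f y) / ?V = ball_avg h \<phi> x - \<phi> x"
      using V by (simp add: ball_avg_def diff_divide_distrib)
    then have "\<phi> x - ball_avg h \<phi> x = - (LINT y|ballM h. f y) / ?V" by simp
    then have "(\<phi> x - ball_avg h \<phi> x)^2 = (LINT y|ballM h. f y)^2 / (?V * ?V)"
      by (simp add: power_divide power2_eq_square)
    also have "\<dots> \<le> (?V * (LINT y|ballM h. (f y)^2)) / (?V * ?V)"
      using V integral_ballM_sq_le[OF fS] by (intro divide_right_mono) simp_all
    also have "\<dots> = (1 / ?V) * (LINT y|ballM h. (f y)^2)" using V by simp
    finally have "ennreal ((\<phi> x - ball_avg h \<phi> x)^2) \<le> ennreal ((1 / ?V) * (LINT y|ballM h. (f y)^2))"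
      by (rule ennreal_leI)
    also have "\<dots> = ennreal (1 / ?V) * ennreal (LINT y|ballM h. (f y)^2)"
      using V by (intro ennreal_mult) simp_all
    also have "ennreal (LINT y|ballM h. (f y)^2) = (\<integral>\<^sup>+y. ennreal ((f y)^2) \<partial>ballM h)"
      using nn_integral_eq_integral[OF sqintD(2)[OF fS]] by simp
    also have "\<dots> = (\<integral>\<^sup>+y. ennreal ((f y)^2) * indicator (ball 0 h) y \<partial>lborel)"
      by (rule nn_integral_ballM) (use fm in measurable)
    finally show ?thesis by (simp add: f_def)
  qed
  have "(\<integral>\<^sup>+x. ennreal ((norm (\<phi> x - ball_avg h \<phi> x))^2) \<partial>lborel)
     \<le> (\<integral>\<^sup>+x. ennreal (1 / ?V) * (\<integral>\<^sup>+y. ennreal ((\<phi> (x + y) - \<phi> x)^2) * indicator (ball 0 h) y \<partial>lborel) \<partial>lborel)"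
    by (rule nn_integral_mono) (use pt in simp)
  also have "\<dots> = ennreal (1 / ?V) * (\<integral>\<^sup>+x. (\<integral>\<^sup>+y. ennreal ((\<phi> (x + y) - \<phi> x)^2) * indicator (ball 0 h) y \<partial>lborel) \<partial>lborel)"
    by (rule nn_integral_cmult) measurable
  also have "(\<integral>\<^sup>+x. (\<integral>\<^sup>+y. ennreal ((\<phi> (x + y) - \<phi> x)^2) * indicator (ball 0 h) y \<partial>lborel) \<partial>lborel)
     = (\<integral>\<^sup>+y. (\<integral>\<^sup>+x. ennreal ((\<phi> (x + y) - \<phi> x)^2) * indicator (ball 0 h) y \<partial>lborel) \<partial>lborel)"
    by (rule lborel_pair.Fubini'[symmetric]) measurable
  also have "\<dots> \<le> (\<integral>\<^sup>+y. ennreal ((h * ?g)^2) * indicator (ball (0::real^'n) h) y \<partial>lborel)"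
  proof (rule nn_integral_mono)
    fix y :: "real^'n"
    show "(\<integral>\<^sup>+x. ennreal ((\<phi> (x + y) - \<phi> x)^2) * indicator (ball 0 h) y \<partial>lborel) \<le> ennreal ((h * ?g)^2) * indicator (ball 0 h) y"
    proof (cases "y \<in> ball 0 h")
      case True
      have "(\<integral>\<^sup>+x. ennreal ((\<phi> (x + y) - \<phi> x)^2) \<partial>lborel) = ennreal ((l2n lborel (\<lambda>x. \<phi> (x + y) - \<phi> x))^2)"
        using l2n_nn_integral[OF shift_sqint] by simp
      also have "\<dots> \<le> ennreal ((h * ?g)^2)"
      proof (intro ennreal_leI power_mono)
        have "norm y * ?g \<le> h * ?g" using True by (intro mult_right_mono) simp_all
        then show "l2n lborel (\<lambda>x. \<phi> (x + y) - \<phi> x) \<le> h * ?g" using shift_l2n[of y] by linarith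
      qed simp
      finally show ?thesis using True by simp
    qed simp
  qed
  also have "\<dots> = ennreal ((h * ?g)^2) * emeasure lborel (ball (0::real^'n) h)"
    by (subst nn_integral_cmult_indicator) simp_all
  also have "emeasure lborel (ball (0::real^'n) h) = ennreal ?V"
    using emeasure_lborel_ball_finite[of "0::real^'n" h] by (intro emeasure_eq_ennreal_measure) auto
  also have "ennreal (1 / ?V) * (ennreal ((h * ?g)^2) * ennreal ?V) = ennreal ((h * ?g)^2)"
  proof -
    have "ennreal (1 / ?V) * (ennreal ((h * ?g)^2) * ennreal ?V) = ennreal ((1 / ?V) * ((h * ?g)^2 * ?V))"
      using V by (simp only: ennreal_mult[symmetric] zero_le_power2 mult_nonneg_nonneg zero_le_divide_1_iff less_imp_le)
    then show ?thesis using V by simp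
  qed
  finally have le: "(\<integral>\<^sup>+x. ennreal ((norm (\<phi> x - ball_avg h \<phi> x))^2) \<partial>lborel) \<le> ennreal ((h * ?g)^2)"
    by (simp add: mult_left_mono)
  have m: "(\<lambda>x. \<phi> x - ball_avg h \<phi> x) \<in> borel_measurable lborel" using am by measurable
  show "(\<lambda>x. \<phi> x - ball_avg h \<phi> x) \<in> sqint lborel" "l2n lborel (\<lambda>x. \<phi> x - ball_avg h \<phi> x) \<le> h * ?g"
    using l2n_le_nn_integral[OF m le] h by simp_all
qed

end

section \<open>Rellich's theorem\<close>

context bounded_open
begin

lemma n2_le_l2n_lborel:
  fixes f :: "real^'n \<Rightarrow> real"
  assumes f: "f \<in> sqint lborel" and m: "f \<in> borel_measurable borel"
  shows "f \<in> S2" "n2 f \<le> l2n lborel f"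
proof -
  have mL: "f \<in> borel_measurable (L \<Omega>)"
    by (rule measurable_restrict_space1, rule measurable_completion) (use m in simp)
  have "(\<integral>\<^sup>+x. ennreal ((norm (f x))^2) \<partial>L \<Omega>) = (\<integral>\<^sup>+x. ennreal ((norm (f x))^2) * indicator \<Omega> x \<partial>lebesgue)"
    by (rule nn_integral_restrict_space) (use open_dom in auto)
  also have "\<dots> \<le> (\<integral>\<^sup>+x. ennreal ((norm (f x))^2) \<partial>lborel)"
    unfolding nn_integral_completion by (rule nn_integral_mono) (simp add: indicator_def)
  also have "\<dots> = ennreal ((l2n lborel f)^2)" by (rule l2n_nn_integral[OF f])
  finally have le: "(\<integral>\<^sup>+x. ennreal ((norm (f x))^2) \<partial>L \<Omega>) \<le> ennreal ((l2n lborel f)^2)" .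
  show "f \<in> S2" "n2 f \<le> l2n lborel f" using l2n_le_nn_integral[OF mL le] by simp_all
qed

lemma l2n_lborel_test_fun:
  assumes "test_fun \<Omega> \<phi>"
  shows "l2n lborel \<phi> = n2 \<phi>" "l2n lborel (cgrad \<phi>) = n2 (cgrad \<phi>)"
proof -
  note s = test_funD(1)[OF assms]
  have "\<phi> \<in> borel_measurable borel" "cgrad \<phi> \<in> borel_measurable borel"
    by (rule borel_measurable_continuous_onI[OF smooth_continuous[OF s]],
        rule borel_measurable_continuous_onI[OF cgrad_continuous[OF s]])
  then have m: "(\<lambda>x. (norm (\<phi> x))^2) \<in> borel_measurable borel" "(\<lambda>x. (norm (cgrad \<phi> x))^2) \<in> borel_measurable borel"
    by measurable
  have z1: "\<phi> x = 0" if "x \<notin> \<Omega>" for x using test_fun_outside[OF assms that] .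
  have "pd i \<phi> x = 0" if "x \<notin> \<Omega>" for x i using test_fun_outside[OF test_fun_pd[OF assms] that] .
  then have z2: "cgrad \<phi> x = 0" if "x \<notin> \<Omega>" for x using that by (simp add: cgrad_def vec_eq_iff)
  show "l2n lborel \<phi> = n2 \<phi>"
    using lebesgue_on_integral_borel(2)[OF m(1) open_dom] z1 by (simp add: l2n_def)
  show "l2n lborel (cgrad \<phi>) = n2 (cgrad \<phi>)"
    using lebesgue_on_integral_borel(2)[OF m(2) open_dom] z2 by (simp add: l2n_def)
qed

text \<open>Arzela-Ascoli for the averages: one diagonal subsequence converges for every radius
  1/(j+1) at every point of a countable dense set, hence everywhere by equicontinuity and in L2 by
  domination. The averaging error is at most \<open>h j * B\<close> uniformly in the sequence, so
  the functions themselves are Cauchy.\<close>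

lemma Rellich_test_fun:
  fixes \<phi> :: "nat \<Rightarrow> real^'n \<Rightarrow> real"
  assumes \<phi>: "\<And>n. test_fun \<Omega> (\<phi> n)" and B: "\<And>n. n2 (\<phi> n) \<le> B" "\<And>n. n2 (cgrad (\<phi> n)) \<le> B"
  obtains r :: "nat \<Rightarrow> nat" where "strict_mono r" "\<And>e. e > 0 \<Longrightarrow> \<exists>N. \<forall>m\<ge>N. \<forall>n\<ge>N. n2 (\<lambda>x. \<phi> (r m) x - \<phi> (r n) x) < e"
proof -
  have sc: "smooth_compact (\<phi> n)" for n by unfold_locales (rule test_fun_mono[OF \<phi> subset_UNIV])
  have lB: "l2n lborel (\<phi> n) \<le> B" "l2n lborel (cgrad (\<phi> n)) \<le> B" for n
    unfolding l2n_lborel_test_fun[OF \<phi>] by (rule B)+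
  have B0: "B \<ge> 0" using B(1)[of 0] l2n_nonneg[of "L \<Omega>" "\<phi> 0"] by linarith
  have cancel: "x / (4 * c) * c = x / 4" if "c \<noteq> 0" for x c :: real using that by simp
  have BB: "x / (4 * (B + 1)) * (B + 1) = x / 4" for x by (rule cancel) (use B0 in simp)
  define h where "h j = inverse (real (Suc j))" for j
  have h0: "h j > 0" for j by (simp add: h_def)
  define V where "V j = sqrt (measure lborel (ball (0::real^'n) (h j)))" for j
  have V0: "V j > 0" for j unfolding V_def using content_ball_pos[OF h0[of j], of "0::real^'n"] by simp
  \<comment> \<open>The factor \<open>V\<close> removes the dependence of the sup bound on the
    radius; a single bound \<open>B\<close> for all pairs (radius, point) is needed for one diagonal
    extraction.\<close>
  define f where "f n p = V (fst p) * ball_avg (h (fst p)) (\<phi> n) (snd p)" for n and p :: "nat \<times> (real^'n)"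
  have fB: "norm (f n p) \<le> B" for n p
    using smooth_compact.ball_avg_bound[OF sc h0, of "fst p" n "snd p"] lB(1)[of n] V0[of "fst p"]
    by (simp add: f_def abs_mult V_def)
  have fL: "\<bar>f n (j, x) - f n (j, z)\<bar> \<le> norm (x - z) * B" for n j x z
  proof -
    have "\<bar>f n (j, x) - f n (j, z)\<bar> = V j * \<bar>ball_avg (h j) (\<phi> n) x - ball_avg (h j) (\<phi> n) z\<bar>"
      using V0[of j] by (simp add: f_def right_diff_distrib[symmetric] abs_mult)
    also have "\<dots> \<le> norm (x - z) * l2n lborel (cgrad (\<phi> n))"
      unfolding V_def by (rule smooth_compact.ball_avg_Lipschitz[OF sc h0])
    also have "\<dots> \<le> norm (x - z) * B" by (intro mult_left_mono lB) simp
    finally show ?thesis .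
  qed
  obtain D :: "(real^'n) set" where D: "countable D" "\<And>X. open X \<Longrightarrow> X \<noteq> {} \<Longrightarrow> \<exists>d\<in>D. d \<in> X"
    by (rule countable_dense_setE, rule that)
  have cS: "countable (UNIV \<times> D :: (nat \<times> (real^'n)) set)" using D(1) by (intro countable_SIGMA) auto
  obtain r :: "nat \<Rightarrow> nat" where r: "strict_mono r"
    and rl: "\<And>p. p \<in> UNIV \<times> D \<Longrightarrow> \<exists>l. (\<lambda>n. f (r n) p) \<longlonglongrightarrow> l"
    by (rule function_convergent_subsequence[OF cS, of f B], rule fB, rule that)
  have conv: "convergent (\<lambda>n. f (r n) (j, x))" for j x
  proof (rule Cauchy_convergent, rule metric_CauchyI)
    fix e :: real assume e: "e > 0"
    \<comment> \<open>Two Lipschitz errors of at most e/4 surround the e/2 from the dense point;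
      \<open>B + 1\<close> avoids division by zero.\<close>
    define d where "d = e / (4 * (B + 1))"
    have d: "d > 0" using e B0 by (simp add: d_def)
    have "\<exists>q\<in>D. q \<in> ball x d" by (rule D(2)) (use d in auto)
    then obtain q where q: "q \<in> D" "norm (x - q) < d" by (auto simp: dist_norm)
    have dB: "norm (x - q) * B \<le> e / 4"
    proof -
      have "norm (x - q) * B \<le> d * (B + 1)" using q(2) B0 d by (intro mult_mono) auto
      also have "\<dots> = e / 4" unfolding d_def by (rule BB)
      finally show ?thesis .
    qed
    obtain l where "(\<lambda>n. f (r n) (j, q)) \<longlonglongrightarrow> l" using rl[of "(j, q)"] q by auto
    then have "Cauchy (\<lambda>n. f (r n) (j, q))" by (rule LIMSEQ_imp_Cauchy)
    then obtain N where N: "\<And>m n. m \<ge> N \<Longrightarrow> n \<ge> N \<Longrightarrow> dist (f (r m) (j, q)) (f (r n) (j, q)) < e / 2"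
      using metric_CauchyD[of "\<lambda>n. f (r n) (j, q)" "e / 2"] e by auto
    have "dist (f (r m) (j, x)) (f (r n) (j, x)) < e" if "m \<ge> N" "n \<ge> N" for m n
      using N[OF that] fL[of "r m" j x q] fL[of "r n" j x q] dB unfolding dist_real_def by linarith
    then show "\<exists>M. \<forall>m\<ge>M. \<forall>n\<ge>M. dist (f (r m) (j, x)) (f (r n) (j, x)) < e" by blast
  qed
  define a where "a j x = lim (\<lambda>n. f (r n) (j, x))" for j x
  have al: "(\<lambda>n. f (r n) (j, x)) \<longlonglongrightarrow> a j x" for j x
    unfolding a_def using conv by (simp add: convergent_LIMSEQ_iff)
  have aB: "\<bar>a j x\<bar> \<le> B" for j x
    by (rule LIMSEQ_le_const2[OF tendsto_rabs[OF al]]) (use fB in auto)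
  have fc: "continuous_on UNIV (\<lambda>x. f n (j, x))" for n j
    unfolding f_def fst_conv snd_conv by (intro continuous_intros smooth_compact.ball_avg_continuous[OF sc h0])
  have fm: "(\<lambda>x. f n (j, x)) \<in> borel_measurable (L \<Omega>)" for n j
    by (rule measurable_restrict_space1, rule measurable_completion)
      (use borel_measurable_continuous_onI[OF fc[of n j]] in simp)
  have am: "a j \<in> borel_measurable (L \<Omega>)" for j
    by (rule borel_measurable_LIMSEQ_metric[OF fm al])
  have fS: "(\<lambda>x. f n (j, x)) \<in> S2" for n j
    by (rule sqint_dominated(1)[OF S2_const[of B] fm AE_I2]) (use fB B0 in auto)
  have aS: "a j \<in> S2" for j
    by (rule sqint_dominated(1)[OF S2_const[of B] am AE_I2]) (use aB B0 in auto)
  have n2l: "(\<lambda>n. n2 (\<lambda>x. f (r n) (j, x) - a j x)) \<longlonglongrightarrow> 0" for j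
    unfolding l2n_tendsto_iff
  proof -
    have "(\<lambda>n. LINT x|L \<Omega>. (norm (f (r n) (j, x) - a j x))^2) \<longlonglongrightarrow> (LINT x|L \<Omega>. 0)"
    proof (rule integral_dominated_convergence[where w = "\<lambda>x. (2 * B)^2"])
      show "(\<lambda>x. (norm (f (r n) (j, x) - a j x))^2) \<in> borel_measurable (L \<Omega>)" for n
        using fm[of "r n" j] am[of j] by measurable
      show "AE x in L \<Omega>. (\<lambda>n. (norm (f (r n) (j, x) - a j x))^2) \<longlonglongrightarrow> 0"
      proof (rule AE_I2)
        fix x
        have "(\<lambda>n. (norm (f (r n) (j, x) - a j x))^2) \<longlonglongrightarrow> (norm (a j x - a j x))^2"
          by (intro tendsto_intros al)
        then show "(\<lambda>n. (norm (f (r n) (j, x) - a j x))^2) \<longlonglongrightarrow> 0" by simp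
      qed
      show "AE x in L \<Omega>. norm ((norm (f (r n) (j, x) - a j x))^2) \<le> (2 * B)^2" for n
      proof (rule AE_I2)
        fix x
        have "norm (f (r n) (j, x) - a j x) \<le> 2 * B" using fB[of "r n" "(j, x)"] aB[of j x] by simp
        then have "(norm (f (r n) (j, x) - a j x))^2 \<le> (2 * B)^2" by (rule power_mono) simp
        then show "norm ((norm (f (r n) (j, x) - a j x))^2) \<le> (2 * B)^2" by simp
      qed
    qed simp_all
    then show "(\<lambda>n. LINT x|L \<Omega>. (norm (f (r n) (j, x) - a j x))^2) \<longlonglongrightarrow> 0" by simp
  qed
  have apx: "n2 (\<lambda>x. \<phi> n x - inverse (V j) * f n (j, x)) \<le> h j * B" for n j
  proof -
    have e: "inverse (V j) * f n (j, x) = ball_avg (h j) (\<phi> n) x" for x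
      using V0[of j] by (simp add: f_def)
    have m: "(\<lambda>x. \<phi> n x - ball_avg (h j) (\<phi> n) x) \<in> borel_measurable borel"
      using smooth_compact.meas[OF sc, of n]
        borel_measurable_continuous_onI[OF smooth_compact.ball_avg_continuous[OF sc h0], of j n] by measurable
    have "n2 (\<lambda>x. \<phi> n x - ball_avg (h j) (\<phi> n) x) \<le> l2n lborel (\<lambda>x. \<phi> n x - ball_avg (h j) (\<phi> n) x)"
      by (rule n2_le_l2n_lborel(2)[OF smooth_compact.ball_avg_approx(1)[OF sc h0] m])
    also have "\<dots> \<le> h j * l2n lborel (cgrad (\<phi> n))" by (rule smooth_compact.ball_avg_approx(2)[OF sc h0])
    also have "\<dots> \<le> h j * B" by (intro mult_left_mono lB less_imp_le h0)
    finally show ?thesis by (simp add: e)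
  qed
  have cauchy: "\<exists>N. \<forall>m\<ge>N. \<forall>n\<ge>N. n2 (\<lambda>x. \<phi> (r m) x - \<phi> (r n) x) < e" if e: "e > 0" for e
  proof -
    obtain j where j: "h j < e / (4 * (B + 1))"
      using reals_Archimedean[of "e / (4 * (B + 1))"] e B0 by (auto simp: h_def)
    have hB: "h j * B \<le> e / 4"
    proof -
      have "h j * B \<le> e / (4 * (B + 1)) * (B + 1)" using j B0 h0[of j] e by (intro mult_mono) auto
      also have "\<dots> = e / 4" by (rule BB)
      finally show ?thesis .
    qed
    define W where "W = inverse (V j)"
    have W: "W > 0" using V0 by (simp add: W_def)
    have "\<forall>\<^sub>F n in sequentially. n2 (\<lambda>x. f (r n) (j, x) - a j x) < e / (4 * W)"
      by (rule order_tendstoD(2)[OF n2l]) (use e W in simp)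
    then obtain N where N: "\<And>n. n \<ge> N \<Longrightarrow> n2 (\<lambda>x. f (r n) (j, x) - a j x) < e / (4 * W)"
      by (auto simp: eventually_sequentially)
    have WS: "(\<lambda>x. W * f n (j, x)) \<in> S2" for n by (rule sqint_cmult[OF fS])
    have WaS: "(\<lambda>x. W * a j x) \<in> S2" by (rule sqint_cmult[OF aS])
    note \<phi>S = test_fun_sqint(1)[OF \<phi> open_dom]
    have b: "n2 (\<lambda>x. \<phi> (r n) x - W * a j x) < e / 2" if n: "n \<ge> N" for n
    proof -
      have "n2 (\<lambda>x. \<phi> (r n) x - W * a j x)
          \<le> n2 (\<lambda>x. \<phi> (r n) x - W * f (r n) (j, x)) + n2 (\<lambda>x. W * f (r n) (j, x) - W * a j x)"
        by (rule l2n_triangle_diff[OF \<phi>S WS WaS])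
      moreover have "n2 (\<lambda>x. W * f (r n) (j, x) - W * a j x) = W * n2 (\<lambda>x. f (r n) (j, x) - a j x)"
        using l2n_cmult[of "L \<Omega>" W "\<lambda>x. f (r n) (j, x) - a j x"] W by (simp add: right_diff_distrib)
      moreover have "W * n2 (\<lambda>x. f (r n) (j, x) - a j x) < W * (e / (4 * W))"
        by (rule mult_strict_left_mono[OF N[OF n] W])
      moreover have "W * (e / (4 * W)) = e / 4" using W by simp
      ultimately show ?thesis using apx[of "r n" j] hB unfolding W_def by linarith
    qed
    have "n2 (\<lambda>x. \<phi> (r m) x - \<phi> (r n) x) < e" if "m \<ge> N" "n \<ge> N" for m n
      using l2n_triangle_diff[OF \<phi>S[of "r m"] WaS \<phi>S[of "r n"]] b[OF that(1)] b[OF that(2)]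
        l2n_minus_commute[of "L \<Omega>" "\<phi> (r n)" "\<lambda>x. W * a j x"] by linarith
    then show ?thesis by blast
  qed
  show ?thesis by (rule that[OF r cauchy])
qed

text \<open>Test functions within 1/(k+1) of \<open>u k\<close> carry the compactness over. The
  bound on the limit's norm comes from lower semicontinuity.\<close>

lemma Rellich:
  assumes u: "\<And>n. u n \<in> H01 \<Omega>" and B: "\<And>n. hn (u n) \<le> B"
  obtains r :: "nat \<Rightarrow> nat" and v where "strict_mono r" "v \<in> H01 \<Omega>" "hn v \<le> B"
    "(\<lambda>n. n2 (\<lambda>x. u (r n) x - v x)) \<longlonglongrightarrow> 0"
proof -
  obtain P where P: "P > 0" "\<And>u. u \<in> H01 \<Omega> \<Longrightarrow> n2 u \<le> P * hn u" by (rule Poincare, rule that)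
  define e where "e k = inverse (real (Suc k))" for k
  have e: "e k > 0" "e k \<le> 1" for k by (simp_all add: e_def inverse_le_1_iff)
  have "\<exists>\<phi>. test_fun \<Omega> \<phi> \<and> n2 (\<lambda>x. \<phi> x - u k x) < e k \<and> n2 (\<lambda>x. cgrad \<phi> x - wg (u k) x) < e k" for k
  proof -
    obtain \<phi> where "test_fun \<Omega> \<phi>" "n2 (\<lambda>x. \<phi> x - u k x) < e k" "n2 (\<lambda>x. cgrad \<phi> x - wg (u k) x) < e k"
      by (rule ip_bounded_imp_approx[OF u[of k] e(1)[of k]], rule that)
    then show ?thesis by blast
  qed
  from choice[OF allI[OF this]] obtain \<phi> where
    "\<forall>k. test_fun \<Omega> (\<phi> k) \<and> n2 (\<lambda>x. \<phi> k x - u k x) < e k \<and> n2 (\<lambda>x. cgrad (\<phi> k) x - wg (u k) x) < e k"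
    by (rule exE)
  then have \<phi>: "test_fun \<Omega> (\<phi> k)" "n2 (\<lambda>x. \<phi> k x - u k x) < e k" "n2 (\<lambda>x. cgrad (\<phi> k) x - wg (u k) x) < e k" for k
    by simp_all
  note \<phi>S = test_fun_sqint[OF \<phi>(1) open_dom]
  have g: "n2 (cgrad (\<phi> k)) \<le> B + 1" for k
    using l2n_le_add_diff[OF \<phi>S(2)[of k] wgrad_spec(1)[OF u[of k]]] \<phi>(3)[of k] e(2)[of k] B[of k]
    unfolding hnorm_eq_l2n by linarith
  have p: "n2 (\<phi> k) \<le> P * (B + 1)" for k
  proof -
    have "n2 (\<phi> k) \<le> P * n2 (cgrad (\<phi> k))" using P(2)[OF H01_test_fun(1)[OF \<phi>(1)]] hn_test_fun[OF \<phi>(1)] by simp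
    also have "\<dots> \<le> P * (B + 1)" using g P by (intro mult_left_mono) simp_all
    finally show ?thesis .
  qed
  define C where "C = max (P * (B + 1)) (B + 1)"
  have C: "n2 (\<phi> k) \<le> C" "n2 (cgrad (\<phi> k)) \<le> C" for k using g[of k] p[of k] by (simp_all add: C_def)
  obtain r :: "nat \<Rightarrow> nat" where r: "strict_mono r"
    and rc: "\<And>e. e > 0 \<Longrightarrow> \<exists>N. \<forall>m\<ge>N. \<forall>n\<ge>N. n2 (\<lambda>x. \<phi> (r m) x - \<phi> (r n) x) < e"
    by (rule Rellich_test_fun[OF \<phi>(1) C], rule that)
  obtain v where v: "v \<in> S2" "(\<lambda>n. n2 (\<lambda>x. \<phi> (r n) x - v x)) \<longlonglongrightarrow> 0"
  proof (rule l2_complete[where F = "\<lambda>n. \<phi> (r n)"])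
    show "\<phi> (r n) \<in> S2" for n by (rule \<phi>S(1))
    show "\<exists>N. \<forall>m\<ge>N. \<forall>n\<ge>N. n2 (\<lambda>x. \<phi> (r m) x - \<phi> (r n) x) < e" if "e > 0" for e
      by (rule rc[OF that])
  qed
  have el: "(\<lambda>n. e (r n)) \<longlonglongrightarrow> 0"
    by (rule n2_conv_subseq[OF r]) (unfold e_def, rule LIMSEQ_inverse_real_of_nat)
  have l: "(\<lambda>n. n2 (\<lambda>x. u (r n) x - v x)) \<longlonglongrightarrow> 0"
  proof (rule Lim_null_comparison)
    show "(\<lambda>n. e (r n) + n2 (\<lambda>x. \<phi> (r n) x - v x)) \<longlonglongrightarrow> 0"
      using tendsto_add[OF el v(2)] by simp
    have "n2 (\<lambda>x. u (r n) x - v x) \<le> e (r n) + n2 (\<lambda>x. \<phi> (r n) x - v x)" for n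
      using l2n_triangle_diff[OF H01_S2[OF u[of "r n"]] \<phi>S(1)[of "r n"] v(1)] \<phi>(2)[of "r n"]
        l2n_minus_commute[of "L \<Omega>" "\<phi> (r n)" "u (r n)"] by linarith
    then show "\<forall>\<^sub>F n in sequentially. norm (n2 (\<lambda>x. u (r n) x - v x)) \<le> e (r n) + n2 (\<lambda>x. \<phi> (r n) x - v x)" by simp
  qed
  show ?thesis
    by (rule that[OF r hn_lsc_bound[OF u v(1) l B] l])
qed

subsection \<open>Weighted quadratic forms and eigenvalues\<close>

definition wform :: "(real^'n \<Rightarrow> real) \<Rightarrow> (real^'n \<Rightarrow> real) \<Rightarrow> (real^'n \<Rightarrow> real) \<Rightarrow> real" where
  "wform \<theta> u v = (LINT x|L \<Omega>. \<theta> x * u x * v x)"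

lemma LinfE:
  assumes "\<theta> \<in> Linf \<Omega>"
  obtains C where "C > 0" "AE x in L \<Omega>. \<bar>\<theta> x\<bar> \<le> C" "\<theta> \<in> borel_measurable (L \<Omega>)"
proof -
  obtain C where C: "AE x in L \<Omega>. \<bar>\<theta> x\<bar> \<le> C" and m: "\<theta> \<in> borel_measurable (L \<Omega>)"
    using assms by (auto simp: Linf_def)
  have "AE x in L \<Omega>. \<bar>\<theta> x\<bar> \<le> max C 1" using C by eventually_elim simp
  then show ?thesis using m by (intro that[of "max C 1"]) simp_all
qed

lemma Linf_mult:
  assumes \<theta>: "\<theta> \<in> Linf \<Omega>" and u: "u \<in> S2"
  shows "(\<lambda>x. \<theta> x * u x) \<in> S2"
proof -
  obtain C where C: "AE x in L \<Omega>. \<bar>\<theta> x\<bar> \<le> C" "\<theta> \<in> borel_measurable (L \<Omega>)"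
    by (rule LinfE[OF \<theta>], rule that)
  show ?thesis using sqint_bounded_mult[OF u C(2,1)] by simp
qed

lemma Linf_mult_tendsto:
  assumes \<theta>: "\<theta> \<in> Linf \<Omega>" and u: "\<And>k. u k \<in> S2" and v: "v \<in> S2"
    and l: "(\<lambda>k. n2 (\<lambda>x. u k x - v x)) \<longlonglongrightarrow> 0"
  shows "(\<lambda>k. n2 (\<lambda>x. \<theta> x * u k x - \<theta> x * v x)) \<longlonglongrightarrow> 0"
proof -
  obtain C where C: "C > 0" "AE x in L \<Omega>. \<bar>\<theta> x\<bar> \<le> C" "\<theta> \<in> borel_measurable (L \<Omega>)"
    by (rule LinfE[OF \<theta>], rule that)
  have "n2 (\<lambda>x. \<theta> x * u k x - \<theta> x * v x) \<le> C * n2 (\<lambda>x. u k x - v x)" for k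
  proof -
    have "n2 (\<lambda>x. \<theta> x * u k x - \<theta> x * v x) \<le> n2 (\<lambda>x. C * (u k x - v x))"
    proof (rule sqint_dominated(2)[OF sqint_cmult[OF sqint_diff[OF u v]]
          sqintD(1)[OF sqint_diff[OF Linf_mult[OF \<theta> u] Linf_mult[OF \<theta> v]]]])
      show "AE x in L \<Omega>. norm (\<theta> x * u k x - \<theta> x * v x) \<le> norm (C * (u k x - v x))"
        using C(2)
      proof eventually_elim
        case (elim x)
        have "norm (\<theta> x * u k x - \<theta> x * v x) = \<bar>\<theta> x\<bar> * \<bar>u k x - v x\<bar>"
          by (simp add: right_diff_distrib[symmetric] abs_mult)
        also have "\<dots> \<le> C * \<bar>u k x - v x\<bar>" by (rule mult_right_mono[OF elim]) simp
        finally show ?case using C(1) by (simp add: abs_mult)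
      qed
    qed
    also have "\<dots> = C * n2 (\<lambda>x. u k x - v x)" using l2n_cmult[of "L \<Omega>" C "\<lambda>x. u k x - v x"] C(1) by simp
    finally show ?thesis .
  qed
  then show ?thesis
    by (intro Lim_null_comparison[OF _ tendsto_mult_right_zero[OF l, of C]] always_eventually) simp
qed

lemma wform_integrable:
  "\<theta> \<in> Linf \<Omega> \<Longrightarrow> u \<in> S2 \<Longrightarrow> v \<in> S2 \<Longrightarrow> integrable (L \<Omega>) (\<lambda>x. \<theta> x * u x * v x)"
  by (rule sqint_mult[OF Linf_mult])

lemma wform_tendsto:
  assumes \<theta>: "\<theta> \<in> Linf \<Omega>" and u: "\<And>k. u k \<in> S2" and v: "v \<in> S2"
    and l: "(\<lambda>k. n2 (\<lambda>x. u k x - v x)) \<longlonglongrightarrow> 0"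
  shows "(\<lambda>k. wform \<theta> (u k) (u k)) \<longlonglongrightarrow> wform \<theta> v v"
  using l2n_inner_tendsto[OF Linf_mult[OF \<theta> u] Linf_mult[OF \<theta> v] Linf_mult_tendsto[OF \<theta> u v l] u v l]
  by (simp add: wform_def)

lemma wform_add_scaled:
  assumes \<theta>: "\<theta> \<in> Linf \<Omega>" and u: "u \<in> S2" and v: "v \<in> S2"
  shows "wform \<theta> (\<lambda>x. u x + t * v x) (\<lambda>x. u x + t * v x) = wform \<theta> u u + 2 * t * wform \<theta> u v + t^2 * wform \<theta> v v"
proof -
  note i = wform_integrable[OF \<theta> u u] wform_integrable[OF \<theta> u v] wform_integrable[OF \<theta> v v]
  have "(\<lambda>x. \<theta> x * (u x + t * v x) * (u x + t * v x))
      = (\<lambda>x. \<theta> x * u x * u x + 2 * t * (\<theta> x * u x * v x) + t^2 * (\<theta> x * v x * v x))"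
    by (rule ext) algebra
  then have "wform \<theta> (\<lambda>x. u x + t * v x) (\<lambda>x. u x + t * v x)
      = (LINT x|L \<Omega>. \<theta> x * u x * u x + 2 * t * (\<theta> x * u x * v x) + t^2 * (\<theta> x * v x * v x))"
    by (simp add: wform_def)
  also have "\<dots> = wform \<theta> u u + 2 * t * wform \<theta> u v + t^2 * wform \<theta> v v"
    using i by (simp add: wform_def)
  finally show ?thesis .
qed

lemma wform_cmult: "wform \<theta> (\<lambda>x. c * u x) (\<lambda>x. c * u x) = c^2 * wform \<theta> u u"
proof -
  have "(\<lambda>x. \<theta> x * (c * u x) * (c * u x)) = (\<lambda>x. c^2 * (\<theta> x * u x * u x))"
    by (rule ext) algebra
  then show ?thesis by (simp add: wform_def)
qed

lemma hn_add_scaled: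
  assumes u: "u \<in> H01 \<Omega>" and v: "v \<in> H01 \<Omega>"
  shows "(hn (\<lambda>x. u x + t * v x))^2 = (hn u)^2 + 2 * t * ip u v + t^2 * (hn v)^2"
  using hn_add_sq[OF u H01_cmult[OF v, of t]] by (simp add: ip_cmult_right[OF v u] hn_cmult[OF v] power_mult_distrib)

lemma wform_AE_zero:
  assumes "is_zero \<Omega> u" "\<theta> \<in> Linf \<Omega>" "u \<in> S2"
  shows "wform \<theta> u u = 0"
proof -
  have "wform \<theta> u u = (LINT x|L \<Omega>. 0)"
    unfolding wform_def
    by (rule integral_cong_AE)
      (use assms borel_measurable_integrable[OF wform_integrable[OF assms(2,3,3)]] in \<open>auto simp: is_zero_def\<close>)
  then show ?thesis by simp
qed

text \<open>The form \<open>\<mu> * (hn \<phi>)^2 - wform \<theta> \<phi> \<phi>\<close> is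
  nonnegative and vanishes at \<open>w\<close>. Along w + t\<phi> it is a nonnegative quadratic in t
  with zero constant term, so its linear coefficient vanishes: this is the Euler-Lagrange
  equation.\<close>

lemma pos_form_first_order:
  assumes \<theta>: "\<theta> \<in> Linf \<Omega>" and nn: "\<And>\<phi>. \<phi> \<in> H01 \<Omega> \<Longrightarrow> wform \<theta> \<phi> \<phi> \<le> \<mu> * (hn \<phi>)^2"
    and w: "w \<in> H01 \<Omega>" "\<mu> * (hn w)^2 \<le> wform \<theta> w w" and \<phi>: "\<phi> \<in> H01 \<Omega>"
  shows "\<mu> * ip w \<phi> = wform \<theta> w \<phi>"
proof -
  have "(\<mu> * ip w \<phi> - wform \<theta> w \<phi>)^2 \<le> 0 * (\<mu> * (hn \<phi>)^2 - wform \<theta> \<phi> \<phi>)"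
  proof (rule quadratic_nonneg_discriminant)
    fix t
    have "0 \<le> \<mu> * (hn (\<lambda>x. w x + t * \<phi> x))^2 - wform \<theta> (\<lambda>x. w x + t * \<phi> x) (\<lambda>x. w x + t * \<phi> x)"
      using nn[OF H01_add[OF w(1) H01_cmult[OF \<phi>]], of t] by simp
    also have "\<dots> = (\<mu> * (hn w)^2 - wform \<theta> w w) + 2 * t * (\<mu> * ip w \<phi> - wform \<theta> w \<phi>) + t^2 * (\<mu> * (hn \<phi>)^2 - wform \<theta> \<phi> \<phi>)"
      unfolding hn_add_scaled[OF w(1) \<phi>] wform_add_scaled[OF \<theta> H01_S2[OF w(1)] H01_S2[OF \<phi>]]
      by (simp add: algebra_simps)
    finally show "0 \<le> 0 + 2 * t * (\<mu> * ip w \<phi> - wform \<theta> w \<phi>) + t^2 * (\<mu> * (hn \<phi>)^2 - wform \<theta> \<phi> \<phi>)"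
      using w(2) by linarith
  qed (use nn[OF \<phi>] in simp)
  then show ?thesis by simp
qed

text \<open>If the inequality failed at some \<open>v\<close>, the supremum \<mu> of the weighted
  form over the unit ball would be at least 1. Rellich makes it attained, the maximiser is an
  eigenfunction for 1/\<mu>, and no positive eigenvalue is smaller, so the first one would be at
  most 1.\<close>

lemma eig_1_gt_1_imp:
  assumes \<theta>: "\<theta> \<in> Linf \<Omega>" and e: "1 < eig \<Omega> \<theta> 1" and v: "v \<in> H01 \<Omega>" "\<not> is_zero \<Omega> v"
  shows "wform \<theta> v v < (hn v)^2"
proof (rule ccontr)
  assume "\<not> ?thesis"
  then have vq: "(hn v)^2 \<le> wform \<theta> v v" by simp
  have hv: "hn v > 0" using hn_eq_0_iff[OF v(1)] v(2) hn_nonneg[of v] by linarith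
  obtain C where C: "C > 0" "AE x in L \<Omega>. \<bar>\<theta> x\<bar> \<le> C" by (rule LinfE[OF \<theta>], rule that)
  obtain P where P: "P > 0" "\<And>u. u \<in> H01 \<Omega> \<Longrightarrow> n2 u \<le> P * hn u" by (rule Poincare, rule that)
  \<comment> \<open>The ball rather than the sphere: L2 limits keep only the upper bound on the
    norm. Since \<mu> is positive, the maximiser is still nonzero and extremal.\<close>
  define U where "U = {u \<in> H01 \<Omega>. hn u \<le> 1}"
  define Q where "Q = (\<lambda>u. wform \<theta> u u) ` U"
  have bd: "wform \<theta> u u \<le> C * P^2" if "u \<in> U" for u
  proof -
    have u: "u \<in> H01 \<Omega>" "hn u \<le> 1" using that by (auto simp: U_def)
    have "wform \<theta> u u \<le> (LINT x|L \<Omega>. C * (u x)^2)"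
      unfolding wform_def
    proof (rule integral_mono_AE[OF wform_integrable[OF \<theta> H01_S2[OF u(1)] H01_S2[OF u(1)]]])
      show "integrable (L \<Omega>) (\<lambda>x. C * (u x)^2)" using sqintD(2)[OF H01_S2[OF u(1)]] by simp
      show "AE x in L \<Omega>. \<theta> x * u x * u x \<le> C * (u x)^2"
        using C(2)
      proof eventually_elim
        case (elim x)
        have "\<theta> x * (u x)^2 \<le> C * (u x)^2" by (rule mult_right_mono) (use elim in auto)
        then show ?case by (simp add: power2_eq_square mult.assoc)
      qed
    qed
    also have "\<dots> = C * (n2 u)^2" by (simp add: l2n_power2)
    also have "\<dots> \<le> C * P^2"
    proof (intro mult_left_mono power_mono)
      have "P * hn u \<le> P * 1" using u(2) P(1) by (intro mult_left_mono) simp_all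
      then show "n2 u \<le> P" using P(2)[OF u(1)] by simp
    qed (use C(1) in simp_all)
    finally show ?thesis .
  qed
  have bdd: "bdd_above Q" unfolding Q_def by (rule bdd_aboveI2[of _ _ "C * P^2"]) (rule bd)
  define \<mu> where "\<mu> = Sup Q"
  have up: "wform \<theta> u u \<le> \<mu>" if "u \<in> U" for u
    unfolding \<mu>_def by (rule cSup_upper[OF _ bdd]) (use that in \<open>simp add: Q_def\<close>)
  have scale: "(\<lambda>x. inverse (hn u) * u x) \<in> U" "wform \<theta> (\<lambda>x. inverse (hn u) * u x) (\<lambda>x. inverse (hn u) * u x) = wform \<theta> u u / (hn u)^2"
    if "u \<in> H01 \<Omega>" "hn u > 0" for u
    unfolding wform_cmult using that(2) H01_cmult[OF that(1), of "inverse (hn u)"] hn_cmult[OF that(1), of "inverse (hn u)"]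
    by (simp_all add: U_def power_inverse divide_inverse[of _ "(hn u)\<^sup>2"])
  have \<mu>1: "\<mu> \<ge> 1"
  proof -
    have "1 \<le> wform \<theta> v v / (hn v)^2" using vq hv by simp
    then show ?thesis using up[OF scale(1)[OF v(1) hv]] scale(2)[OF v(1) hv] by simp
  qed
  have Q0: "Q \<noteq> {}" using H01_zero hn_cmult[OF H01_zero, of 0] by (auto simp: Q_def U_def)
  have "\<exists>u. u \<in> U \<and> \<mu> - inverse (real (Suc k)) < wform \<theta> u u" for k
  proof -
    have "\<mu> - inverse (real (Suc k)) < Sup Q" by (simp add: \<mu>_def)
    then obtain q where "q \<in> Q" "\<mu> - inverse (real (Suc k)) < q" using less_cSup_iff[OF Q0 bdd] by blast
    then show ?thesis by (auto simp: Q_def)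
  qed
  from choice[OF allI[OF this]] obtain u where "\<forall>k. u k \<in> U \<and> \<mu> - inverse (real (Suc k)) < wform \<theta> (u k) (u k)"
    by (rule exE)
  then have u: "u k \<in> U" "\<mu> - inverse (real (Suc k)) < wform \<theta> (u k) (u k)" for k by simp_all
  have uH: "u k \<in> H01 \<Omega>" "hn (u k) \<le> 1" for k using u(1)[of k] by (auto simp: U_def)
  obtain r :: "nat \<Rightarrow> nat" and w where r: "strict_mono r" and w: "w \<in> H01 \<Omega>" "hn w \<le> 1"
    and l: "(\<lambda>n. n2 (\<lambda>x. u (r n) x - w x)) \<longlonglongrightarrow> 0"
    by (rule Rellich[OF uH], rule that)
  have ql: "(\<lambda>n. wform \<theta> (u (r n)) (u (r n))) \<longlonglongrightarrow> wform \<theta> w w"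
    by (rule wform_tendsto[OF \<theta> H01_S2[OF uH(1)] H01_S2[OF w(1)] l])
  have "(\<lambda>n. \<mu> - inverse (real (Suc (r n)))) \<longlonglongrightarrow> \<mu> - 0"
    by (intro tendsto_diff tendsto_const n2_conv_subseq[OF r LIMSEQ_inverse_real_of_nat])
  from LIMSEQ_le[OF this ql] have wq: "\<mu> \<le> wform \<theta> w w" using u(2) by (simp add: less_imp_le)
  have wnz: "\<not> is_zero \<Omega> w" using wform_AE_zero[OF _ \<theta> H01_S2[OF w(1)]] wq \<mu>1 by auto
  have hw: "(hn w)^2 \<le> 1" using w(2) power_le_one[of "hn w" 2] by simp
  have q_le: "wform \<theta> \<phi> \<phi> \<le> \<mu> * (hn \<phi>)^2" if "\<phi> \<in> H01 \<Omega>" for \<phi>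
  proof (cases "hn \<phi> = 0")
    case True
    then show ?thesis using hn_eq_0_iff[OF that] wform_AE_zero[OF _ \<theta> H01_S2[OF that]] by simp
  next
    case False
    then have p: "hn \<phi> > 0" using hn_nonneg[of \<phi>] by linarith
    have "wform \<theta> \<phi> \<phi> / (hn \<phi>)^2 \<le> \<mu>" using up[OF scale(1)[OF that p]] scale(2)[OF that p] by simp
    then show ?thesis using p by (simp add: divide_le_eq)
  qed
  have wq2: "\<mu> * (hn w)^2 \<le> wform \<theta> w w"
  proof -
    have "\<mu> * (hn w)^2 \<le> \<mu> * 1" using \<mu>1 hw by (intro mult_left_mono) simp_all
    then show ?thesis using wq by simp
  qed
  have eq: "ip w \<phi> = (1 / \<mu>) * wform \<theta> w \<phi>" if "\<phi> \<in> H01 \<Omega>" for \<phi>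
    using pos_form_first_order[OF \<theta> q_le w(1) wq2 that] \<mu>1 by (simp add: field_simps)
  have mem: "1 / \<mu> \<in> pos_eigs \<Omega> \<theta>"
    unfolding pos_eigs_def using \<mu>1 w(1) wnz eq by (auto simp: ip_def wform_def)
  have least: "1 / \<mu> \<le> \<nu>" if \<nu>: "\<nu> \<in> pos_eigs \<Omega> \<theta>" for \<nu>
  proof -
    obtain z where z: "\<nu> > 0" "z \<in> H01 \<Omega>" "\<not> is_zero \<Omega> z" "ip z z = \<nu> * wform \<theta> z z"
      using \<nu> by (auto simp: pos_eigs_def ip_def wform_def)
    have hz: "(hn z)^2 > 0" using hn_eq_0_iff[OF z(2)] z(3) by simp
    have "(hn z)^2 = \<nu> * wform \<theta> z z" using z(4) by (simp add: ip_self)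
    also have "\<dots> \<le> \<nu> * (\<mu> * (hn z)^2)" using q_le[OF z(2)] z(1) by (intro mult_left_mono) simp_all
    finally have "1 * (hn z)^2 \<le> (\<nu> * \<mu>) * (hn z)^2" by (simp add: mult.assoc)
    then have "1 \<le> \<nu> * \<mu>" using hz by (simp only: mult_le_cancel_right_pos)
    then show ?thesis using \<mu>1 by (simp add: divide_le_eq)
  qed
  \<comment> \<open>Minimality makes the eigenvalues up to 1/\<mu> a singleton, the cardinality by
    which \<open>eig\<close> recognises the first one.\<close>
  have "{\<nu> \<in> pos_eigs \<Omega> \<theta>. \<nu> \<le> 1 / \<mu>} = {1 / \<mu>}" using mem least by (auto intro: antisym)
  then have "ereal (1 / \<mu>) \<in> ereal ` {lam\<in>pos_eigs \<Omega> \<theta>. finite {\<mu>\<in>pos_eigs \<Omega> \<theta>. \<mu> \<le> lam} \<and>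
                                   card {\<mu>\<in>pos_eigs \<Omega> \<theta>. \<mu> \<le> lam} = 1}"
    using mem by (intro imageI) simp
  then have "eig \<Omega> \<theta> 1 \<le> ereal (1 / \<mu>)" unfolding eig_def by (rule Inf_lower)
  also have "\<dots> \<le> 1" using \<mu>1 by simp
  finally show False using e by simp
qed

text \<open>\<open>eig\<close> is an infimum, so a value below 1 exhibits an actual eigenvalue below
  1; testing its equation with the eigenfunction gives the strict inequality.\<close>

lemma eig_lt_1_imp:
  assumes "eig \<Omega> \<theta> m < 1"
  obtains e where "e \<in> H01 \<Omega>" "(hn e)^2 < wform \<theta> e e"
proof -
  obtain lam where lam: "lam \<in> pos_eigs \<Omega> \<theta>" "lam < 1"
    using assms unfolding eig_def Inf_less_iff by auto
  then obtain z where z: "lam > 0" "z \<in> H01 \<Omega>" "\<not> is_zero \<Omega> z" "ip z z = lam * wform \<theta> z z"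
    by (auto simp: pos_eigs_def ip_def wform_def)
  have hz: "(hn z)^2 > 0" using hn_eq_0_iff[OF z(2)] z(3) by simp
  have e: "(hn z)^2 = lam * wform \<theta> z z" using z(4) by (simp add: ip_self)
  then have "wform \<theta> z z > 0" using hz z(1) by (simp add: zero_less_mult_iff)
  then have "lam * wform \<theta> z z < 1 * wform \<theta> z z" using lam(2) by (rule mult_strict_right_mono[rotated])
  then show ?thesis using e z(2) by (intro that[of z]) simp_all
qed

end

subsection \<open>Asymptotically linear nonlinearities\<close>

text \<open>The hypotheses on f at one fixed x, with \<open>P\<close> the primitive of f(x,t).
  Inequalities are proved here for real functions and then hold for almost every x.\<close>

locale asymptotically_linear =
  fixes p P :: "real \<Rightarrow> real" and al et :: real
  assumes cont: "continuous_on UNIV p"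
    and pos: "\<And>s t. 0 < s \<Longrightarrow> s < t \<Longrightarrow> p s / s < p t / t"
    and neg: "\<And>s t. s < t \<Longrightarrow> t < 0 \<Longrightarrow> p s / s > p t / t"
    and lim0: "((\<lambda>t. p t / t) \<longlongrightarrow> al) (at 0)"
    and liminf: "((\<lambda>t. p t / t) \<longlongrightarrow> et) at_infinity"
    and P0: "P 0 = 0" and DP: "\<And>t. (P has_real_derivative p t) (at t)"
begin

lemma p_zero: "p 0 = 0"
proof -
  have "((\<lambda>t. p t / t * t) \<longlongrightarrow> al * 0) (at 0)" by (intro tendsto_mult lim0 tendsto_ident_at)
  moreover have "\<forall>\<^sub>F t in at 0. p t / t * t = p t" by (simp add: eventually_at_filter)
  ultimately have "(p \<longlongrightarrow> al * 0) (at 0)" by (rule Lim_transform_eventually)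
  then have "(p \<longlongrightarrow> 0) (at 0)" by simp
  moreover have "(p \<longlongrightarrow> p 0) (at 0)"
    using cont by (simp add: continuous_on_def)
  ultimately show ?thesis by (rule tendsto_unique[OF at_neq_bot, rotated])
qed

text \<open>Parametrising by positive multiples of \<tau> treats both half-lines at once: moving
  away from 0 always increases p(t)/t.\<close>

lemma ratio_strict_mono:
  assumes "\<tau> \<noteq> 0" "0 < a" "a < b"
  shows "p (a * \<tau>) / (a * \<tau>) < p (b * \<tau>) / (b * \<tau>)"
proof (cases "\<tau> > 0")
  case True
  then show ?thesis using assms by (intro pos mult_strict_right_mono mult_pos_pos)
next
  case False
  then have "\<tau> < 0" using assms by simp
  then show ?thesis using assms by (intro neg mult_strict_right_mono_neg mult_pos_neg)
qed

text \<open>A limit of a monotone ratio gives only weak inequalities; the intermediate points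
  \<tau>/2 and 2\<tau> make them strict.\<close>

lemma ratio_bounds:
  assumes t: "\<tau> \<noteq> 0"
  shows "al < p \<tau> / \<tau>" "p \<tau> / \<tau> < et"
proof -
  have "((\<lambda>s. s * \<tau>) \<longlongrightarrow> 0 * \<tau>) (at_right 0)" by (intro tendsto_intros)
  then have "filterlim (\<lambda>s. s * \<tau>) (at 0) (at_right 0)"
    using t by (simp add: filterlim_at eventually_at_filter)
  from filterlim_compose[OF lim0 this] have l: "((\<lambda>s. p (s * \<tau>) / (s * \<tau>)) \<longlongrightarrow> al) (at_right 0)" .
  have "al \<le> p ((1/2) * \<tau>) / ((1/2) * \<tau>)"
  proof (rule tendsto_upperbound[OF l])
    show "\<forall>\<^sub>F s in at_right 0. p (s * \<tau>) / (s * \<tau>) \<le> p ((1/2) * \<tau>) / ((1/2) * \<tau>)"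
      unfolding eventually_at_right_field
      by (intro exI[of _ "1/2"] conjI allI impI less_imp_le[OF ratio_strict_mono[OF t]]) simp_all
  qed simp
  also have "\<dots> < p (1 * \<tau>) / (1 * \<tau>)" by (rule ratio_strict_mono[OF t]) simp_all
  finally show "al < p \<tau> / \<tau>" by simp
  have "filterlim (\<lambda>s. \<bar>\<tau>\<bar> * s) at_top at_top"
    by (rule filterlim_tendsto_pos_mult_at_top[OF tendsto_const _ filterlim_ident]) (use t in simp)
  then have "filterlim (\<lambda>s. norm (s * \<tau>)) at_top at_top"
    by (rule filterlim_at_top_mono)
      (use eventually_ge_at_top[of 0] in eventually_elim, simp add: abs_mult mult.commute)
  then have "filterlim (\<lambda>s. s * \<tau>) at_infinity at_top"
    by (simp only: filterlim_at_infinity_conv_norm_at_top)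
  from filterlim_compose[OF liminf this] have l2: "((\<lambda>s. p (s * \<tau>) / (s * \<tau>)) \<longlongrightarrow> et) at_top" .
  have "p (1 * \<tau>) / (1 * \<tau>) < p (2 * \<tau>) / (2 * \<tau>)" by (rule ratio_strict_mono[OF t]) simp_all
  also have "p (2 * \<tau>) / (2 * \<tau>) \<le> et"
  proof (rule tendsto_lowerbound[OF l2])
    show "\<forall>\<^sub>F s in at_top. p (2 * \<tau>) / (2 * \<tau>) \<le> p (s * \<tau>) / (s * \<tau>)"
      using eventually_gt_at_top[of 2] by eventually_elim (rule less_imp_le[OF ratio_strict_mono[OF t]], simp_all)
  qed simp
  finally show "p \<tau> / \<tau> < et" by simp
qed

lemma p_times: "p t * t = p t / t * t^2"
  by (cases "t = 0") (simp_all add: power2_eq_square)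

lemma p_times_bounds: "al * t^2 \<le> p t * t" "p t * t \<le> et * t^2"
proof -
  show "al * t^2 \<le> p t * t"
    unfolding p_times using ratio_bounds(1)[of t]
    by (cases "t = 0", simp) (rule mult_right_mono, simp_all only: less_imp_le zero_le_power2 not_False_eq_True)
  show "p t * t \<le> et * t^2"
    unfolding p_times using ratio_bounds(2)[of t]
    by (cases "t = 0", simp) (rule mult_right_mono, simp_all only: less_imp_le zero_le_power2 not_False_eq_True)
qed

lemma p_times_strict: "t \<noteq> 0 \<Longrightarrow> p t * t < et * t^2"
  unfolding p_times using ratio_bounds(2)[of t] by (intro mult_strict_right_mono) simp_all

text \<open>Monotonicity of the ratio multiplied by a b \<tau>^2, a form that also makes sense when
  \<open>a\<close> or \<open>\<tau>\<close> is zero.\<close>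

lemma p_scaled_mono:
  assumes "0 \<le> a" "a \<le> b"
  shows "b * (p (a * \<tau>) * \<tau>) \<le> a * (p (b * \<tau>) * \<tau>)"
proof -
  consider "\<tau> = 0" | "a = 0" | "a = b" | "\<tau> \<noteq> 0" "0 < a" "a < b" using assms by linarith
  then show ?thesis
  proof cases
    case 4
    have "(a * b * \<tau>^2) * (p (a * \<tau>) / (a * \<tau>)) \<le> (a * b * \<tau>^2) * (p (b * \<tau>) / (b * \<tau>))"
      using ratio_strict_mono[OF 4] 4 by (intro mult_left_mono) simp_all
    then have "b * (\<tau> * p (a * \<tau>)) \<le> a * (\<tau> * p (b * \<tau>))"
      using 4 by (simp add: power2_eq_square)
    then show ?thesis by (simp only: mult.commute[of \<tau>])
  qed (use p_zero in simp_all)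
qed

lemma p_abs: "\<bar>p t\<bar> \<le> (\<bar>al\<bar> + \<bar>et\<bar>) * \<bar>t\<bar>"
proof (cases "t = 0")
  case False
  have "\<bar>p t / t\<bar> \<le> \<bar>al\<bar> + \<bar>et\<bar>" using ratio_bounds[OF False] by linarith
  then show ?thesis using False by (simp add: abs_divide divide_le_eq)
qed (simp add: p_zero)

lemma DP_scaled: "((\<lambda>s. P (s * \<tau>)) has_real_derivative \<tau> * p (s * \<tau>)) (at s)"
proof -
  have "((\<lambda>s. s * \<tau>) has_real_derivative \<tau>) (at s)" by (auto intro!: derivative_eq_intros)
  from DERIV_chain2[OF DP this] show ?thesis by (simp add: mult.commute)
qed

text \<open>The function P(s\<tau>) - (s^2/2) p(\<tau>)\<tau> has its minimum over s at 1, because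
  its derivative changes sign there by monotonicity of the ratio. Integrated over \<Omega>, this
  says that I is maximal along a ray at its Nehari point.\<close>

lemma P_scaling:
  assumes "0 \<le> s"
  shows "(s^2 - 1) / 2 * (p \<tau> * \<tau>) \<le> P (s * \<tau>) - P \<tau>"
proof -
  define k where "k s = P (s * \<tau>) - s^2 / 2 * (p \<tau> * \<tau>)" for s
  have D: "(k has_real_derivative p (s * \<tau>) * \<tau> - s * (p \<tau> * \<tau>)) (at s)" for s
    unfolding k_def by (auto intro!: derivative_eq_intros DP_scaled)
  have "k 1 \<le> k s"
  proof (cases "1 \<le> s")
    case True
    show ?thesis
    proof (rule DERIV_nonneg_imp_nondecreasing[OF True])
      fix x assume "1 \<le> x" "x \<le> s"
      then show "\<exists>y. DERIV k x :> y \<and> 0 \<le> y"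
        using D[of x] p_scaled_mono[of 1 x \<tau>] by auto
    qed
  next
    case False
    show ?thesis
    proof (rule DERIV_nonpos_imp_nonincreasing[of s 1 k])
      show "s \<le> 1" using False by simp
    next
      fix x assume "s \<le> x" "x \<le> 1"
      then show "\<exists>y. DERIV k x :> y \<and> y \<le> 0"
        using D[of x] p_scaled_mono[of x 1 \<tau>] assms by auto
    qed
  qed
  then show ?thesis by (simp add: k_def diff_divide_distrib left_diff_distrib)
qed

text \<open>The integrand of I on the Nehari set.\<close>

definition H :: "real \<Rightarrow> real" where "H t = p t * t / 2 - P t"

text \<open>The integrand of I on a resonant ray, where the Dirichlet energy equals the integral of
  \<eta>u^2.\<close>

definition hh :: "real \<Rightarrow> real" where "hh t = et * t^2 / 2 - P t"

text \<open>\<open>P_scaling\<close> based at b\<tau> with factor a/b. Keeping the gap on the right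
  gives monotonicity of \<open>H\<close> and also its strict positivity.\<close>

lemma H_diff:
  assumes "0 \<le> a" "0 < b"
  shows "H (b * \<tau>) - H (a * \<tau>) \<ge> (a / b * (p (b * \<tau>) * (a * \<tau>)) - p (a * \<tau>) * (a * \<tau>)) / 2"
proof -
  have "((a / b)^2 - 1) / 2 * (p (b * \<tau>) * (b * \<tau>)) \<le> P (a / b * (b * \<tau>)) - P (b * \<tau>)"
    by (rule P_scaling) (use assms in simp)
  moreover have "a / b * (b * \<tau>) = a * \<tau>" using assms by simp
  moreover have "((a / b)^2 - 1) / 2 * (p (b * \<tau>) * (b * \<tau>)) = (a / b * (p (b * \<tau>) * (a * \<tau>)) - p (b * \<tau>) * (b * \<tau>)) / 2"
    using assms by (simp add: power2_eq_square field_simps)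
  ultimately have "(a / b * (p (b * \<tau>) * (a * \<tau>)) - p (b * \<tau>) * (b * \<tau>)) / 2 \<le> P (a * \<tau>) - P (b * \<tau>)"
    by (simp only:)
  moreover have "(A - B) / 2 \<le> C / 2 - R - (B / 2 - Q)" if "(A - C) / 2 \<le> Q - R"
    for A B C Q R :: real
    using that by (simp add: diff_divide_distrib)
  ultimately show ?thesis unfolding H_def by (simp only:)
qed

lemma H_mono:
  assumes "0 \<le> a" "a \<le> b"
  shows "H (a * \<tau>) \<le> H (b * \<tau>)"
proof (cases "b = 0")
  case False
  then have b: "b > 0" using assms by simp
  have "a * (b * (p (a * \<tau>) * \<tau>)) \<le> a * (a * (p (b * \<tau>) * \<tau>))"
    by (rule mult_left_mono[OF p_scaled_mono[OF assms] assms(1)])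
  then have "p (a * \<tau>) * (a * \<tau>) \<le> a / b * (p (b * \<tau>) * (a * \<tau>))"
    using b by (simp add: field_simps)
  then show ?thesis using H_diff[OF assms(1) b, of \<tau>] by simp
qed (use assms in simp)

lemma H_zero: "H 0 = 0"
  by (simp add: H_def P0)

lemma H_nonneg: "0 \<le> H t"
  using H_mono[of 0 1 t] H_zero by simp

text \<open>Comparing \<open>t\<close> with \<open>t/2\<close>, where the ratio is strictly smaller,
  gives \<open>H t > H (t/2)\<close>, and the latter is nonnegative.\<close>

lemma H_pos:
  assumes "t \<noteq> 0"
  shows "0 < H t"
proof -
  have "p ((1/2) * t) / ((1/2) * t) < p (1 * t) / (1 * t)" by (rule ratio_strict_mono[OF assms]) simp_all
  then have l: "(t^2 / 4) * (p (t/2) / (t/2)) < (t^2 / 4) * (p t / t)"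
    using assms by (intro mult_strict_left_mono) simp_all
  have e: "(t^2 / 4) * (X / (t/2)) = X * (t/2)" "(t^2 / 4) * (X / t) = 1/2 * (X * (t/2))" for X
    using assms by (simp_all add: power2_eq_square)
  from l have l: "p (t/2) * (t/2) < 1/2 * (p t * (t/2))" unfolding e .
  have "(1/2 * (p t * (t/2)) - p (t/2) * (t/2)) / 2 \<le> H t - H (t/2)"
    using H_diff[of "1/2" 1 t] by (simp only: mult_1_left mult_1_right div_by_1 times_divide_eq_left)
  with l have "H (t/2) < H t" by argo
  then show ?thesis using H_nonneg[of "t/2"] by linarith
qed

text \<open>The derivative along the ray is a nonnegative multiple of the gap between
  \<open>et\<close> and the ratio p(t)/t, which never exceeds \<open>et\<close>.\<close>

lemma hh_mono:
  assumes "0 \<le> a" "a \<le> b"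
  shows "hh (a * \<tau>) \<le> hh (b * \<tau>)"
proof (rule DERIV_nonneg_imp_nondecreasing[OF assms(2), of "\<lambda>s. hh (s * \<tau>)"])
  fix s assume s: "a \<le> s" "s \<le> b"
  have D: "((\<lambda>s. hh (s * \<tau>)) has_real_derivative et * s * \<tau>^2 - \<tau> * p (s * \<tau>)) (at s)"
    unfolding hh_def by (auto intro!: derivative_eq_intros DP_scaled simp: power2_eq_square)
  moreover have "0 \<le> et * s * \<tau>^2 - \<tau> * p (s * \<tau>)"
  proof (cases "s = 0")
    case False
    then have "s > 0" using s assms by simp
    have "p (s * \<tau>) * (s * \<tau>) \<le> et * (s * \<tau>)^2" by (rule p_times_bounds)
    then have "s * (\<tau> * p (s * \<tau>)) \<le> s * (et * s * \<tau>^2)" by (simp add: power2_eq_square algebra_simps)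
    then show ?thesis using \<open>s > 0\<close> by (simp only: mult_le_cancel_left_pos diff_ge_0_iff_ge)
  qed (simp add: p_zero)
  ultimately show "\<exists>y. ((\<lambda>s. hh (s * \<tau>)) has_real_derivative y) (at s) \<and> 0 \<le> y" by blast
qed

lemma hh_zero: "hh 0 = 0"
  by (simp add: hh_def P0)

lemma hh_nonneg: "0 \<le> hh t"
  using hh_mono[of 0 1 t] hh_zero by simp

lemma P_ge: "al * t^2 / 2 \<le> P t"
proof -
  have "0 - al * 0^2 / 2 * t^2 \<le> P (1 * t) - al * 1^2 / 2 * t^2"
  proof -
    have "P (0 * t) - al * 0^2 / 2 * t^2 \<le> P (1 * t) - al * 1^2 / 2 * t^2"
    proof (rule DERIV_nonneg_imp_nondecreasing[of 0 1 "\<lambda>s. P (s * t) - al * s^2 / 2 * t^2"])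
      fix s :: real assume s: "0 \<le> s" "s \<le> 1"
      have D: "((\<lambda>s. P (s * t) - al * s^2 / 2 * t^2) has_real_derivative t * p (s * t) - al * s * t^2) (at s)"
        by (auto intro!: derivative_eq_intros DP_scaled)
      moreover have "0 \<le> t * p (s * t) - al * s * t^2"
      proof (cases "s = 0")
        case False
        then have "s > 0" using s by simp
        have "al * (s * t)^2 \<le> p (s * t) * (s * t)" by (rule p_times_bounds)
        then have "s * (al * s * t^2) \<le> s * (t * p (s * t))" by (simp add: power2_eq_square algebra_simps)
        then show ?thesis using \<open>s > 0\<close> by (simp only: mult_le_cancel_left_pos diff_ge_0_iff_ge)
      qed (simp add: p_zero)
      ultimately show "\<exists>y. ((\<lambda>s. P (s * t) - al * s^2 / 2 * t^2) has_real_derivative y) (at s) \<and> 0 \<le> y" by blast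
    qed simp
    then show ?thesis by (simp add: P0)
  qed
  then show ?thesis by simp
qed

text \<open>Since |\<alpha>| + |\<eta>| is at most K, this caps \<open>hh t\<close> by K t^2/2, and
  K is therefore the amount by which the weight is lowered in
  \<open>no_resonant_escape\<close>.\<close>

lemma hh_le: "hh t \<le> (et - al) * t^2 / 2"
  using P_ge[of t] by (simp add: hh_def left_diff_distrib diff_divide_distrib)

text \<open>Linear growth of \<open>p\<close> and the mean value inequality. This local Lipschitz
  bound is quadratic in its arguments, hence integrable for L2 functions.\<close>

lemma P_diff_le: "\<bar>P a - P b\<bar> \<le> (\<bar>al\<bar> + \<bar>et\<bar>) * max \<bar>a\<bar> \<bar>b\<bar> * \<bar>a - b\<bar>"
proof -
  have "norm (P a - P b) \<le> ((\<bar>al\<bar> + \<bar>et\<bar>) * max \<bar>a\<bar> \<bar>b\<bar>) * norm (a - b)"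
  proof (rule field_differentiable_bound[of "closed_segment a b" P p])
    fix z assume z: "z \<in> closed_segment a b"
    show "(P has_field_derivative p z) (at z within closed_segment a b)"
      by (rule has_field_derivative_at_within[OF DP])
    have "\<bar>z\<bar> \<le> max \<bar>a\<bar> \<bar>b\<bar>" using z by (auto simp: closed_segment_eq_real_ivl split: if_splits)
    then show "norm (p z) \<le> (\<bar>al\<bar> + \<bar>et\<bar>) * max \<bar>a\<bar> \<bar>b\<bar>"
      using p_abs[of z] mult_left_mono[of "\<bar>z\<bar>" "max \<bar>a\<bar> \<bar>b\<bar>" "\<bar>al\<bar> + \<bar>et\<bar>"] by simp
  qed simp_all
  then show ?thesis by simp
qed

end

section \<open>Measurability of superposition operators and primitives\<close>

text \<open>For simple \<open>u\<close> the composition is pieced together from countably many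
  measurable functions; continuity in the second variable carries this to limits.\<close>

lemma Caratheodory_composition:
  fixes g :: "'a \<Rightarrow> real \<Rightarrow> real"
  assumes g: "\<And>t. (\<lambda>x. g x t) \<in> borel_measurable M" and c: "\<And>x. x \<in> space M \<Longrightarrow> continuous_on UNIV (g x)"
    and u: "u \<in> borel_measurable M"
  shows "(\<lambda>x. g x (u x)) \<in> borel_measurable M"
proof -
  from borel_measurable_implies_sequence_metric[OF u, of 0] obtain s where
    s: "\<And>i. simple_function M (s i)" and sl: "\<And>x. x \<in> space M \<Longrightarrow> (\<lambda>i. s i x) \<longlonglongrightarrow> u x" by blast
  have m: "(\<lambda>x. g x (s i x)) \<in> borel_measurable M" for i
  proof (rule measurable_compose_countable'[where f = "\<lambda>c x. g x c" and I = "s i ` space M"])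
    show "s i \<in> measurable M (count_space (s i ` space M))"
      unfolding measurable_count_space_eq2[OF simple_functionD(1)[OF s[of i]]]
      using simple_functionD(2)[OF s[of i]] by simp
    show "countable (s i ` space M)" using simple_functionD(1)[OF s[of i]] by (rule countable_finite)
  qed (rule g)
  show ?thesis
  proof (rule borel_measurable_LIMSEQ_metric[OF m])
    fix x assume x: "x \<in> space M"
    have "isCont (g x) (u x)" using c[OF x] by (simp add: continuous_on_eq_continuous_at)
    then show "(\<lambda>i. g x (s i x)) \<longlonglongrightarrow> g x (u x)" by (rule isCont_tendsto_compose[OF _ sl[OF x]])
  qed
qed

text \<open>Completeness of Lebesgue measure: any modification on a null set stays measurable. It is
  used because continuity of f(x,t) in t holds only for almost every x.\<close>

lemma lebesgue_on_AE_measurable: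
  fixes g h :: "real^'n::finite \<Rightarrow> 'b::topological_space"
  assumes S: "\<Omega> \<in> sets lebesgue" and g: "g \<in> borel_measurable (L \<Omega>)" and AE: "AE x in L \<Omega>. h x = g x"
  shows "h \<in> borel_measurable (L \<Omega>)"
proof (rule measurableI)
  obtain N where N: "{x \<in> space (L \<Omega>). h x \<noteq> g x} \<subseteq> N" "N \<in> null_sets (L \<Omega>)"
    using AE by (auto simp: eventually_ae_filter)
  have NL: "N \<in> null_sets lebesgue" "N \<subseteq> \<Omega>"
    using N(2) null_sets_restrict_space[of \<Omega> lebesgue N] S by auto
  fix U :: "'b set" assume U: "U \<in> sets borel"
  have "h -` U \<inter> N \<in> null_sets lebesgue"
    by (rule complete_measure.complete2[OF completion.complete_measure_axioms _ NL(1)]) auto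
  then have h1: "h -` U \<inter> N \<in> sets (L \<Omega>)" using NL(2) S by (auto simp: sets_restrict_space_iff)
  have "g -` U \<inter> space (L \<Omega>) \<in> sets (L \<Omega>)" by (rule measurable_sets[OF g U])
  then have "(g -` U \<inter> space (L \<Omega>) - N) \<union> (h -` U \<inter> N) \<in> sets (L \<Omega>)"
    using h1 N(2) by auto
  moreover have "h -` U \<inter> space (L \<Omega>) = (g -` U \<inter> space (L \<Omega>) - N) \<union> (h -` U \<inter> N)"
    using N(1) NL(2) by auto
  ultimately show "h -` U \<inter> space (L \<Omega>) \<in> sets (L \<Omega>)" by simp
qed simp

lemma Fprim_DERIV:
  assumes c: "continuous_on UNIV (f x)"
  shows "(Fprim f x has_real_derivative f x t) (at t)"
proof -
  \<comment> \<open>The interval has to contain both 0 and t, with t in its interior.\<close>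
  define b where "b = \<bar>t\<bar> + 1"
  obtain g where g: "\<And>s. s \<in> {-b..b} \<Longrightarrow> (g has_vector_derivative f x s) (at s within {-b..b})"
    by (rule antiderivative_continuous[OF continuous_on_subset[OF c subset_UNIV], of "-b" b], rule that)
  have F: "Fprim f x s = g s - g 0" if s: "s \<in> {-b..b}" for s
  proof -
    have sub: "{min 0 s..max 0 s} \<subseteq> {-b..b}" using s by (auto simp: b_def)
    have "(LBINT r=ereal 0..ereal s. f x r) = g s - g 0"
    proof (rule interval_integral_FTC_finite)
      show "continuous_on {min 0 s..max 0 s} (f x)" by (rule continuous_on_subset[OF c subset_UNIV])
      fix r assume "min 0 s \<le> r" "r \<le> max 0 s"
      then have "r \<in> {-b..b}" using sub by auto
      from has_vector_derivative_within_subset[OF g[OF this] sub]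
      show "(g has_vector_derivative f x r) (at r within {min 0 s..max 0 s})" .
    qed
    then show ?thesis by (simp add: Fprim_def zero_ereal_def)
  qed
  have tb: "t \<in> {-b<..<b}" by (auto simp: b_def)
  have tb': "t \<in> {-b..b}" using tb by auto
  have "(g has_vector_derivative f x t) (at t within {-b<..<b})"
    by (rule has_vector_derivative_within_subset[OF g[OF tb']]) (rule greaterThanLessThan_subseteq_atLeastAtMost_iff[THEN iffD2], simp)
  then have "(g has_vector_derivative f x t) (at t)"
    by (simp only: at_within_open[OF tb open_greaterThanLessThan])
  then have gD: "(g has_real_derivative f x t) (at t)"
    by (simp only: has_real_derivative_iff_has_vector_derivative)
  have D: "((\<lambda>s. g s - g 0) has_real_derivative f x t) (at t)"
    using DERIV_diff[OF gD DERIV_const[of "g 0"]] by (simp only: diff_0_right)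
  show ?thesis
  proof (rule has_field_derivative_transform_within_open[OF D])
    show "open {-b<..<b}" "t \<in> {-b<..<b}" using tb by simp_all
    show "g s - g 0 = Fprim f x s" if "s \<in> {-b<..<b}" for s using F[of s] that by simp
  qed
qed

text \<open>After f is set to zero on a null set it is continuous in t for every x, hence jointly
  measurable, and the partial integral is measurable in x. The sign of t selects one of the two
  orientations of the integral.\<close>

lemma Fprim_measurable:
  assumes S: "\<Omega> \<in> sets lebesgue"
    and f: "caratheodory \<Omega> f"
  shows "(\<lambda>x. Fprim f x t) \<in> borel_measurable (L \<Omega>)"
proof -
  obtain N where N: "{x \<in> space (L \<Omega>). \<not> continuous_on UNIV (f x)} \<subseteq> N" "N \<in> null_sets (L \<Omega>)"
    using f by (auto simp: caratheodory_def eventually_ae_filter)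
  define g where "g x t = (if x \<in> N then 0 else f x t)" for x t
  have gm: "(\<lambda>x. g x t) \<in> borel_measurable (L \<Omega>)" for t
    unfolding g_def using f N(2) by (intro measurable_If_set) (auto simp: caratheodory_def)
  have gc: "continuous_on UNIV (g x)" if "x \<in> space (L \<Omega>)" for x
    using N(1) that by (cases "x \<in> N") (auto simp: g_def[abs_def])
  have joint: "(\<lambda>z. g (fst z) (snd z)) \<in> borel_measurable (L \<Omega> \<Otimes>\<^sub>M lborel)"
  proof (rule Caratheodory_composition[where g = "\<lambda>z. g (fst z)"])
    show "(\<lambda>z. g (fst z) t) \<in> borel_measurable (L \<Omega> \<Otimes>\<^sub>M lborel)" for t
      by (rule measurable_compose[OF measurable_fst gm])
    show "continuous_on UNIV (g (fst z))" if "z \<in> space (L \<Omega> \<Otimes>\<^sub>M lborel)" for z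
      using that by (intro gc) (auto simp: space_pair_measure)
    show "snd \<in> borel_measurable (L \<Omega> \<Otimes>\<^sub>M lborel)"
      using measurable_snd[of "L \<Omega>" lborel] by simp
  qed
  have "(\<lambda>x. LINT s|lborel. indicator A s *\<^sub>R g x s) \<in> borel_measurable (L \<Omega>)" if A: "A \<in> sets borel" for A :: "real set"
  proof (rule lborel.borel_measurable_lebesgue_integral)
    have "(\<lambda>z. indicator A (snd z) *\<^sub>R g (fst z) (snd z)) \<in> borel_measurable (L \<Omega> \<Otimes>\<^sub>M lborel)"
      using joint A by (intro borel_measurable_scaleR borel_measurable_indicator' measurable_compose[OF measurable_snd]) auto
    then show "(\<lambda>(x, s). indicator A s *\<^sub>R g x s) \<in> borel_measurable (L \<Omega> \<Otimes>\<^sub>M lborel)"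
      by (simp add: case_prod_beta')
  qed
  then have "(\<lambda>x. Fprim g x t) \<in> borel_measurable (L \<Omega>)"
    unfolding Fprim_def interval_lebesgue_integral_def set_lebesgue_integral_def
    by (cases "0 \<le> ereal t") simp_all
  moreover have "AE x in L \<Omega>. Fprim f x t = Fprim g x t"
    using AE_not_in[OF N(2)] by eventually_elim (simp add: Fprim_def g_def)
  ultimately show ?thesis by (rule lebesgue_on_AE_measurable[OF S])
qed

lemma lebesgue_on_Caratheodory:
  assumes S: "\<Omega> \<in> sets lebesgue" and f: "caratheodory \<Omega> f" and u: "u \<in> borel_measurable (L \<Omega>)"
  shows "(\<lambda>x. f x (u x)) \<in> borel_measurable (L \<Omega>)"
proof -
  obtain N where N: "{x \<in> space (L \<Omega>). \<not> continuous_on UNIV (f x)} \<subseteq> N" "N \<in> null_sets (L \<Omega>)"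
    using f by (auto simp: caratheodory_def eventually_ae_filter)
  define g where "g x t = (if x \<in> N then 0 else f x t)" for x t
  have "(\<lambda>x. g x (u x)) \<in> borel_measurable (L \<Omega>)"
  proof (rule Caratheodory_composition[OF _ _ u])
    show "(\<lambda>x. g x t) \<in> borel_measurable (L \<Omega>)" for t
      unfolding g_def using f N(2) by (intro measurable_If_set) (auto simp: caratheodory_def)
    show "continuous_on UNIV (g x)" if "x \<in> space (L \<Omega>)" for x
      using N(1) that by (cases "x \<in> N") (auto simp: g_def[abs_def])
  qed
  moreover have "AE x in L \<Omega>. f x (u x) = g x (u x)"
    using AE_not_in[OF N(2)] by eventually_elim (simp add: g_def)
  ultimately show ?thesis by (rule lebesgue_on_AE_measurable[OF S])
qed

lemma caratheodory_Fprim: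
  assumes S: "\<Omega> \<in> sets lebesgue" and f: "caratheodory \<Omega> f"
  shows "caratheodory \<Omega> (Fprim f)"
  unfolding caratheodory_def
proof (intro conjI allI)
  show "(\<lambda>x. Fprim f x t) \<in> borel_measurable (L \<Omega>)" for t by (rule Fprim_measurable[OF assms])
  have "AE x in L \<Omega>. continuous_on UNIV (f x)" using f by (simp add: caratheodory_def)
  then show "AE x in L \<Omega>. continuous_on UNIV (Fprim f x)"
  proof eventually_elim
    case (elim x)
    show ?case
      by (rule DERIV_continuous_on[of _ _ "f x"]) (rule has_field_derivative_at_within[OF Fprim_DERIV[of f x, OF elim]])
  qed
qed

section \<open>Strict scaling and difference quotients\<close>

context asymptotically_linear
begin

lemma p_scaled_strict_mono:
  assumes "\<tau> \<noteq> 0" "0 < a" "a < b"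
  shows "b * (p (a * \<tau>) * \<tau>) < a * (p (b * \<tau>) * \<tau>)"
proof -
  have "(a * b * \<tau>^2) * (p (a * \<tau>) / (a * \<tau>)) < (a * b * \<tau>^2) * (p (b * \<tau>) / (b * \<tau>))"
    using ratio_strict_mono[OF assms] assms by (intro mult_strict_left_mono) simp_all
  then have "b * (\<tau> * p (a * \<tau>)) < a * (\<tau> * p (b * \<tau>))"
    using assms by (simp add: power2_eq_square)
  then show ?thesis by (simp only: mult.commute[of \<tau>])
qed

lemma P_increment:
  obtains \<xi> where "\<bar>\<xi> - a\<bar> \<le> \<bar>d\<bar>" "P (a + d) - P a = d * p \<xi>"
proof -
  consider "d = 0" | "0 < d" | "d < 0" by linarith
  then show ?thesis
  proof cases
    case 1
    then show ?thesis by (intro that[of a]) simp_all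
  next
    case 2
    obtain z where "a < z" "z < a + d" "P (a + d) - P a = (a + d - a) * p z"
      using MVT2[of a "a + d" P p] 2 DP by auto
    then show ?thesis by (intro that[of z]) simp_all
  next
    case 3
    obtain z where "a + d < z" "z < a" "P a - P (a + d) = (a - (a + d)) * p z"
      using MVT2[of "a + d" a P p] 3 DP by auto
    then show ?thesis by (intro that[of z]) (simp_all add: algebra_simps)
  qed
qed

text \<open>The base points move with n because the projections onto the Nehari set rescale;
  continuity of \<open>p\<close> and the mean value theorem suffice.\<close>

lemma P_difference_quotient:
  assumes a: "a \<longlonglongrightarrow> l" and e: "e \<longlonglongrightarrow> 0" "\<And>n. e n \<noteq> 0" and c: "c \<longlonglongrightarrow> m"
  shows "(\<lambda>n. (P (a n + e n * c n) - P (a n)) / e n) \<longlonglongrightarrow> p l * m"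
proof -
  have "\<exists>\<xi>. \<bar>\<xi> - a n\<bar> \<le> \<bar>e n * c n\<bar> \<and> P (a n + e n * c n) - P (a n) = e n * c n * p \<xi>" for n
    by (rule P_increment[of "a n" "e n * c n"]) blast
  from choice[OF allI[OF this]] obtain \<xi> where
    "\<forall>n. \<bar>\<xi> n - a n\<bar> \<le> \<bar>e n * c n\<bar> \<and> P (a n + e n * c n) - P (a n) = e n * c n * p (\<xi> n)" by (rule exE)
  then have \<xi>: "\<bar>\<xi> n - a n\<bar> \<le> \<bar>e n * c n\<bar>" "P (a n + e n * c n) - P (a n) = e n * c n * p (\<xi> n)" for n by simp_all
  have "(\<lambda>n. e n * c n) \<longlonglongrightarrow> 0 * m" by (rule tendsto_mult[OF e(1) c])
  then have "(\<lambda>n. \<bar>e n * c n\<bar>) \<longlonglongrightarrow> 0" by (simp add: tendsto_rabs_zero_iff)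
  then have "(\<lambda>n. \<xi> n - a n) \<longlonglongrightarrow> 0"
    by (rule Lim_null_comparison[rotated]) (use \<xi>(1) in simp)
  from tendsto_add[OF this a] have "\<xi> \<longlonglongrightarrow> l" by simp
  moreover have "isCont p l" using cont by (simp add: continuous_on_eq_continuous_at)
  ultimately have "(\<lambda>n. p (\<xi> n)) \<longlonglongrightarrow> p l" by (rule isCont_tendsto_compose[rotated])
  from tendsto_mult[OF this c] show ?thesis
    unfolding \<xi>(2) using e(2) by (simp add: mult.commute)
qed

end

subsection \<open>The Nehari set\<close>

text \<open>The constant \<open>K\<close> has two uses: it is the linear growth constant of f, and
  it dominates \<eta> - \<alpha>.\<close>

locale nehari_problem = bounded_open \<Omega> for \<Omega> :: "(real^'n::finite) set" +
  fixes f :: "real^'n \<Rightarrow> real \<Rightarrow> real" and \<alpha> \<eta> :: "real^'n \<Rightarrow> real" and K :: real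
  assumes carat: "caratheodory \<Omega> f"
    and AE_al: "AE x in L \<Omega>. asymptotically_linear (f x) (Fprim f x) (\<alpha> x) (\<eta> x)"
    and AE_K: "AE x in L \<Omega>. \<bar>\<alpha> x\<bar> + \<bar>\<eta> x\<bar> \<le> K" and K0: "K > 0"
    and \<alpha>L: "\<alpha> \<in> Linf \<Omega>" and \<eta>L: "\<eta> \<in> Linf \<Omega>"
begin

definition ff :: "(real^'n \<Rightarrow> real) \<Rightarrow> (real^'n \<Rightarrow> real) \<Rightarrow> real" where
  "ff u v = (LINT x|L \<Omega>. f x (u x) * v x)"

definition FF :: "(real^'n \<Rightarrow> real) \<Rightarrow> real" where
  "FF u = (LINT x|L \<Omega>. Fprim f x (u x))"

abbreviation "In \<equiv> Ifun \<Omega> f"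

abbreviation "N \<equiv> Nehari \<Omega> f"

lemma In_eq: "In u = (hn u)^2 / 2 - FF u"
  by (simp add: Ifun_def FF_def)

lemma f_meas: "u \<in> borel_measurable (L \<Omega>) \<Longrightarrow> (\<lambda>x. f x (u x)) \<in> borel_measurable (L \<Omega>)"
  by (rule lebesgue_on_Caratheodory[OF dom_lebesgue carat])

lemma F_meas: "u \<in> borel_measurable (L \<Omega>) \<Longrightarrow> (\<lambda>x. Fprim f x (u x)) \<in> borel_measurable (L \<Omega>)"
  by (rule lebesgue_on_Caratheodory[OF dom_lebesgue caratheodory_Fprim[OF dom_lebesgue carat]])

lemma f_le: "AE x in L \<Omega>. \<forall>t. \<bar>f x t\<bar> \<le> K * \<bar>t\<bar>"
  using AE_al AE_K
proof eventually_elim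
  case (elim x)
  interpret asymptotically_linear "f x" "Fprim f x" "\<alpha> x" "\<eta> x" by (rule elim(1))
  show ?case
  proof
    fix t
    show "\<bar>f x t\<bar> \<le> K * \<bar>t\<bar>" by (rule order_trans[OF p_abs mult_right_mono[OF elim(2)]]) simp
  qed
qed

lemma F_diff_le: "AE x in L \<Omega>. \<forall>a b. \<bar>Fprim f x a - Fprim f x b\<bar> \<le> K * max \<bar>a\<bar> \<bar>b\<bar> * \<bar>a - b\<bar>"
  using AE_al AE_K
proof eventually_elim
  case (elim x)
  interpret asymptotically_linear "f x" "Fprim f x" "\<alpha> x" "\<eta> x" by (rule elim(1))
  show ?case
  proof (intro allI)
    fix a b
    show "\<bar>Fprim f x a - Fprim f x b\<bar> \<le> K * max \<bar>a\<bar> \<bar>b\<bar> * \<bar>a - b\<bar>"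
      by (rule order_trans[OF P_diff_le mult_right_mono[OF mult_right_mono[OF elim(2)]]]) simp_all
  qed
qed

lemma f_S2:
  assumes u: "u \<in> S2"
  shows "(\<lambda>x. f x (u x)) \<in> S2"
  by (rule sqint_dominated(1)[OF sqint_cmult[OF u, of K] f_meas[OF sqintD(1)[OF u]]])
    (use f_le in eventually_elim, use K0 in \<open>simp add: abs_mult\<close>)

lemma ff_integrable: "u \<in> S2 \<Longrightarrow> v \<in> S2 \<Longrightarrow> integrable (L \<Omega>) (\<lambda>x. f x (u x) * v x)"
  by (rule sqint_mult[OF f_S2])

lemma F_integrable:
  assumes u: "u \<in> S2"
  shows "integrable (L \<Omega>) (\<lambda>x. Fprim f x (u x))"
proof (rule Bochner_Integration.integrable_bound)
  show "integrable (L \<Omega>) (\<lambda>x. K * (u x)^2)" using sqintD(2)[OF u] by simp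
  show "(\<lambda>x. Fprim f x (u x)) \<in> borel_measurable (L \<Omega>)" by (rule F_meas[OF sqintD(1)[OF u]])
  show "AE x in L \<Omega>. norm (Fprim f x (u x)) \<le> norm (K * (u x)^2)"
    using F_diff_le AE_al
  proof eventually_elim
    case (elim x)
    interpret asymptotically_linear "f x" "Fprim f x" "\<alpha> x" "\<eta> x" by (rule elim(2))
    have "\<bar>Fprim f x (u x) - Fprim f x 0\<bar> \<le> K * max \<bar>u x\<bar> \<bar>0\<bar> * \<bar>u x - 0\<bar>" using elim(1) by blast
    then have "\<bar>Fprim f x (u x)\<bar> \<le> K * (u x)^2" using P0 by (simp add: mult.assoc flip: power2_eq_square)
    then show ?case using K0 by simp
  qed
qed

text \<open>Cauchy-Schwarz on the pointwise bound. Only L2 norms appear on the right, so Rellich is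
  enough to pass to the limit in the nonlinear part of I.\<close>

lemma FF_diff_le:
  assumes u: "u \<in> S2" and v: "v \<in> S2"
  shows "\<bar>FF u - FF v\<bar> \<le> K * ((n2 u + n2 v) * n2 (\<lambda>x. u x - v x))"
proof -
  have aS: "(\<lambda>x. \<bar>w x\<bar>) \<in> S2" and al: "n2 (\<lambda>x. \<bar>w x\<bar>) = n2 w" if "w \<in> S2" for w :: "real^'n \<Rightarrow> real"
    using sqintD(1)[OF that] by (intro sqint_dominated(1)[OF that]) (simp_all add: l2n_def)
  have sS: "(\<lambda>x. \<bar>u x\<bar> + \<bar>v x\<bar>) \<in> S2" by (rule sqint_add[OF aS[OF u] aS[OF v]])
  have dS: "(\<lambda>x. \<bar>u x - v x\<bar>) \<in> S2" by (rule aS[OF sqint_diff[OF u v]])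
  have "\<bar>FF u - FF v\<bar> = \<bar>LINT x|L \<Omega>. Fprim f x (u x) - Fprim f x (v x)\<bar>"
    by (simp add: FF_def F_integrable[OF u] F_integrable[OF v])
  also have "\<dots> \<le> (LINT x|L \<Omega>. \<bar>Fprim f x (u x) - Fprim f x (v x)\<bar>)"
    by (rule integral_abs_bound)
  also have "\<dots> \<le> (LINT x|L \<Omega>. K * ((\<bar>u x\<bar> + \<bar>v x\<bar>) * \<bar>u x - v x\<bar>))"
  proof (rule integral_mono_AE)
    show "integrable (L \<Omega>) (\<lambda>x. \<bar>Fprim f x (u x) - Fprim f x (v x)\<bar>)"
      using F_integrable[OF u] F_integrable[OF v] by simp
    show "integrable (L \<Omega>) (\<lambda>x. K * ((\<bar>u x\<bar> + \<bar>v x\<bar>) * \<bar>u x - v x\<bar>))"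
      using sqint_mult[OF sS dS] by simp
    show "AE x in L \<Omega>. \<bar>Fprim f x (u x) - Fprim f x (v x)\<bar> \<le> K * ((\<bar>u x\<bar> + \<bar>v x\<bar>) * \<bar>u x - v x\<bar>)"
      using F_diff_le
    proof eventually_elim
      case (elim x)
      have "\<bar>Fprim f x (u x) - Fprim f x (v x)\<bar> \<le> K * max \<bar>u x\<bar> \<bar>v x\<bar> * \<bar>u x - v x\<bar>" using elim by blast
      also have "\<dots> \<le> K * (\<bar>u x\<bar> + \<bar>v x\<bar>) * \<bar>u x - v x\<bar>"
        using K0 by (intro mult_right_mono mult_left_mono) simp_all
      finally show ?case by (simp add: mult.assoc)
    qed
  qed
  also have "\<dots> = K * (LINT x|L \<Omega>. (\<bar>u x\<bar> + \<bar>v x\<bar>) * \<bar>u x - v x\<bar>)" by simp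
  also have "\<dots> \<le> K * (n2 (\<lambda>x. \<bar>u x\<bar> + \<bar>v x\<bar>) * n2 (\<lambda>x. \<bar>u x - v x\<bar>))"
    using l2n_Cauchy_Schwarz_real[OF sS dS] K0 by (intro mult_left_mono) simp_all
  also have "\<dots> \<le> K * ((n2 u + n2 v) * n2 (\<lambda>x. u x - v x))"
    unfolding al[OF sqint_diff[OF u v]] using l2n_triangle[OF aS[OF u] aS[OF v]] K0
    by (intro mult_left_mono mult_right_mono) (simp_all add: al[OF u] al[OF v])
  finally show ?thesis .
qed

lemma FF_tendsto:
  assumes u: "\<And>n. u n \<in> S2" and v: "v \<in> S2" and l: "(\<lambda>n. n2 (\<lambda>x. u n x - v x)) \<longlonglongrightarrow> 0"
  shows "(\<lambda>n. FF (u n)) \<longlonglongrightarrow> FF v"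
proof (rule LIM_zero_cancel, rule Lim_null_comparison)
  have "(\<lambda>n. K * ((n2 (u n) + n2 v) * n2 (\<lambda>x. u n x - v x))) \<longlonglongrightarrow> K * ((n2 v + n2 v) * 0)"
    by (intro tendsto_mult tendsto_add tendsto_const l l2n_tendsto[OF u v l])
  then show "(\<lambda>n. K * ((n2 (u n) + n2 v) * n2 (\<lambda>x. u n x - v x))) \<longlonglongrightarrow> 0" by simp
  show "\<forall>\<^sub>F n in sequentially. norm (FF (u n) - FF v) \<le> K * ((n2 (u n) + n2 v) * n2 (\<lambda>x. u n x - v x))"
    using FF_diff_le[OF u v] by simp
qed

lemma ff_dominated:
  assumes a: "\<And>n. a n \<in> borel_measurable (L \<Omega>)" "a' \<in> borel_measurable (L \<Omega>)"
    and b: "\<And>n. b n \<in> borel_measurable (L \<Omega>)" "b' \<in> borel_measurable (L \<Omega>)" and h: "h \<in> S2"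
    and l: "\<And>x. (\<lambda>n. a n x) \<longlonglongrightarrow> a' x" "\<And>x. (\<lambda>n. b n x) \<longlonglongrightarrow> b' x"
    and d: "\<And>n x. \<bar>a n x\<bar> \<le> h x" "\<And>n x. \<bar>b n x\<bar> \<le> h x"
  shows "(\<lambda>n. ff (a n) (b n)) \<longlonglongrightarrow> ff a' b'"
  unfolding ff_def
proof (rule integral_dominated_convergence[where w = "\<lambda>x. K * (h x)^2"])
  show "(\<lambda>x. f x (a' x) * b' x) \<in> borel_measurable (L \<Omega>)" using f_meas[OF a(2)] b(2) by measurable
  show "(\<lambda>x. f x (a n x) * b n x) \<in> borel_measurable (L \<Omega>)" for n using f_meas[OF a(1)] b(1) by measurable
  show "integrable (L \<Omega>) (\<lambda>x. K * (h x)^2)" using sqintD(2)[OF h] by simp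
  show "AE x in L \<Omega>. (\<lambda>n. f x (a n x) * b n x) \<longlonglongrightarrow> f x (a' x) * b' x"
    using AE_al
  proof eventually_elim
    case (elim x)
    then have "continuous_on UNIV (f x)" by (rule asymptotically_linear.cont)
    then have "isCont (f x) (a' x)" by (simp add: continuous_on_eq_continuous_at)
    then show ?case by (intro tendsto_mult isCont_tendsto_compose[OF _ l(1)] l(2))
  qed
  show "AE x in L \<Omega>. norm (f x (a n x) * b n x) \<le> K * (h x)^2" for n
    using f_le
  proof eventually_elim
    case (elim x)
    have h0: "0 \<le> h x" using d(1)[of n x] by linarith
    have "\<bar>f x (a n x)\<bar> \<le> K * \<bar>a n x\<bar>" using elim by blast
    also have "\<dots> \<le> K * h x" by (rule mult_left_mono[OF d(1)]) (use K0 in simp)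
    finally have "\<bar>f x (a n x)\<bar> * \<bar>b n x\<bar> \<le> (K * h x) * h x"
      by (rule mult_mono[OF _ d(2)]) (use K0 h0 in simp_all)
    then show ?case by (simp add: abs_mult power2_eq_square mult.assoc)
  qed
qed

lemma integral_strict_mono:
  fixes g h u :: "real^'n \<Rightarrow> real"
  assumes g: "integrable (L \<Omega>) g" and h: "integrable (L \<Omega>) h" and le: "AE x in L \<Omega>. g x \<le> h x"
    and lt: "AE x in L \<Omega>. u x \<noteq> 0 \<longrightarrow> g x < h x" and u: "\<not> is_zero \<Omega> u"
  shows "(LINT x|L \<Omega>. g x) < (LINT x|L \<Omega>. h x)"
proof (rule ccontr)
  assume "\<not> ?thesis"
  moreover have "(LINT x|L \<Omega>. g x) \<le> (LINT x|L \<Omega>. h x)" by (rule integral_mono_AE[OF g h le])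
  ultimately have z: "(LINT x|L \<Omega>. h x - g x) = 0" using g h by simp
  have "AE x in L \<Omega>. 0 \<le> h x - g x" using le by eventually_elim simp
  then have "AE x in L \<Omega>. h x - g x = 0"
    using integral_nonneg_eq_0_iff_AE[of "L \<Omega>" "\<lambda>x. h x - g x"] z g h by simp
  then have "AE x in L \<Omega>. u x = 0" using lt by eventually_elim auto
  then show False using u by (simp add: is_zero_def)
qed

lemma ff_scaled_mono:
  assumes u: "u \<in> S2" and ab: "0 \<le> a" "a \<le> b"
  shows "b * ff (\<lambda>x. a * u x) u \<le> a * ff (\<lambda>x. b * u x) u"
proof -
  note i = ff_integrable[OF sqint_cmult[OF u, of a] u] ff_integrable[OF sqint_cmult[OF u, of b] u]
  have "(LINT x|L \<Omega>. b * (f x (a * u x) * u x)) \<le> (LINT x|L \<Omega>. a * (f x (b * u x) * u x))"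
  proof (rule integral_mono_AE)
    show "AE x in L \<Omega>. b * (f x (a * u x) * u x) \<le> a * (f x (b * u x) * u x)"
      using AE_al by eventually_elim (rule asymptotically_linear.p_scaled_mono[OF _ ab])
  qed (use i in simp_all)
  then show ?thesis by (simp add: ff_def)
qed

lemma ff_scaled_strict_mono:
  assumes u: "u \<in> S2" "\<not> is_zero \<Omega> u" and ab: "0 < a" "a < b"
  shows "b * ff (\<lambda>x. a * u x) u < a * ff (\<lambda>x. b * u x) u"
proof -
  note i = ff_integrable[OF sqint_cmult[OF u(1), of a] u(1)] ff_integrable[OF sqint_cmult[OF u(1), of b] u(1)]
  have "(LINT x|L \<Omega>. b * (f x (a * u x) * u x)) < (LINT x|L \<Omega>. a * (f x (b * u x) * u x))"
  proof (rule integral_strict_mono[OF _ _ _ _ u(2)])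
    show "AE x in L \<Omega>. b * (f x (a * u x) * u x) \<le> a * (f x (b * u x) * u x)"
      using AE_al by eventually_elim (rule asymptotically_linear.p_scaled_mono[OF _ less_imp_le[OF ab(1)] less_imp_le[OF ab(2)]])
    show "AE x in L \<Omega>. u x \<noteq> 0 \<longrightarrow> b * (f x (a * u x) * u x) < a * (f x (b * u x) * u x)"
      using AE_al by eventually_elim (rule impI, rule asymptotically_linear.p_scaled_strict_mono[OF _ _ ab])
  qed (use i in simp_all)
  then show ?thesis by (simp add: ff_def)
qed

lemma NehariD:
  assumes "u \<in> N"
  shows "u \<in> H01 \<Omega>" "\<not> is_zero \<Omega> u" "(hn u)^2 = ff u u"
  using assms by (auto simp: Nehari_def ff_def)

lemma NehariI: "u \<in> H01 \<Omega> \<Longrightarrow> \<not> is_zero \<Omega> u \<Longrightarrow> (hn u)^2 = ff u u \<Longrightarrow> u \<in> N"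
  by (simp add: Nehari_def ff_def)

lemma Nehari_scaledI:
  assumes u: "u \<in> H01 \<Omega>" "\<not> is_zero \<Omega> u" and t: "t > 0" "t * (hn u)^2 = ff (\<lambda>x. t * u x) u"
  shows "(\<lambda>x. t * u x) \<in> N"
proof (rule NehariI)
  show "(\<lambda>x. t * u x) \<in> H01 \<Omega>" by (rule H01_cmult[OF u(1)])
  show "\<not> is_zero \<Omega> (\<lambda>x. t * u x)" using u(2) t(1) by (simp add: is_zero_def)
  have "ff (\<lambda>x. t * u x) (\<lambda>x. t * u x) = (LINT x|L \<Omega>. t * (f x (t * u x) * u x))"
    unfolding ff_def by (rule Bochner_Integration.integral_cong) simp_all
  also have "\<dots> = t * ff (\<lambda>x. t * u x) u" by (simp add: ff_def)
  finally show "(hn (\<lambda>x. t * u x))^2 = ff (\<lambda>x. t * u x) (\<lambda>x. t * u x)"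
    using t(2)[symmetric] by (simp add: hn_cmult[OF u(1)] power_mult_distrib power2_eq_square)
qed

text \<open>Formulated for any scales and any limit weight so that it covers both ends of a ray:
  scales tending to 0 give \<alpha>, scales tending to infinity give \<eta>.\<close>

lemma ff_ratio_tendsto:
  assumes u: "u \<in> S2" and r: "\<And>n. r n > 0" and \<theta>: "\<theta> \<in> Linf \<Omega>"
    and l: "AE x in L \<Omega>. \<forall>\<tau>. \<tau> \<noteq> 0 \<longrightarrow> (\<lambda>n. f x (r n * \<tau>) / (r n * \<tau>)) \<longlonglongrightarrow> \<theta> x"
  shows "(\<lambda>n. ff (\<lambda>x. r n * u x) u / r n) \<longlonglongrightarrow> wform \<theta> u u"
proof -
  have "(\<lambda>n. LINT x|L \<Omega>. f x (r n * u x) * u x / r n) \<longlonglongrightarrow> (LINT x|L \<Omega>. \<theta> x * u x * u x)"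
  proof (rule integral_dominated_convergence[where w = "\<lambda>x. K * (u x)^2"])
    show "(\<lambda>x. \<theta> x * u x * u x) \<in> borel_measurable (L \<Omega>)"
      by (rule borel_measurable_integrable[OF wform_integrable[OF \<theta> u u]])
    show "(\<lambda>x. f x (r n * u x) * u x / r n) \<in> borel_measurable (L \<Omega>)" for n
      using borel_measurable_integrable[OF ff_integrable[OF sqint_cmult[OF u] u], of "r n"] by measurable
    show "integrable (L \<Omega>) (\<lambda>x. K * (u x)^2)" using sqintD(2)[OF u] by simp
    show "AE x in L \<Omega>. (\<lambda>n. f x (r n * u x) * u x / r n) \<longlonglongrightarrow> \<theta> x * u x * u x"
      using l
    proof eventually_elim
      case (elim x)
      show ?case
      proof (cases "u x = 0")
        case False
        have "(\<lambda>n. f x (r n * u x) / (r n * u x)) \<longlonglongrightarrow> \<theta> x" using elim False by blast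
        from tendsto_mult_right[OF this, of "u x * u x"]
        have "(\<lambda>n. f x (r n * u x) / (r n * u x) * (u x * u x)) \<longlonglongrightarrow> \<theta> x * (u x * u x)" .
        moreover have "f x (r n * u x) / (r n * u x) * (u x * u x) = f x (r n * u x) * u x / r n" for n
          using False by simp
        ultimately show ?thesis by (simp add: mult.assoc)
      qed simp
    qed
    show "AE x in L \<Omega>. norm (f x (r n * u x) * u x / r n) \<le> K * (u x)^2" for n
      using f_le
    proof eventually_elim
      case (elim x)
      have "\<bar>f x (r n * u x)\<bar> \<le> K * \<bar>r n * u x\<bar>" using elim by blast
      also have "\<dots> = r n * (K * \<bar>u x\<bar>)" using r[of n] by (simp add: abs_mult)
      finally have "\<bar>f x (r n * u x)\<bar> / r n \<le> K * \<bar>u x\<bar>" using r[of n] by (simp add: divide_le_eq mult.commute)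
      then have "\<bar>f x (r n * u x)\<bar> / r n * \<bar>u x\<bar> \<le> K * \<bar>u x\<bar> * \<bar>u x\<bar>" by (rule mult_right_mono) simp
      then show ?case using r[of n] by (simp add: abs_mult power2_eq_square mult.assoc)
    qed
  qed
  then show ?thesis by (simp add: ff_def wform_def)
qed

lemma ff_scaled_continuous:
  assumes u: "u \<in> S2"
  shows "continuous_on {a..b} (\<lambda>s. ff (\<lambda>x. s * u x) u)"
proof (rule continuous_on_sequentiallyI)
  fix s :: "nat \<Rightarrow> real" and s' assume s: "s \<longlonglongrightarrow> s'"
  obtain B where B: "\<And>n. \<bar>s n\<bar> \<le> B"
    using convergent_imp_Bseq[OF convergentI[OF s]] by (auto simp: Bseq_def)
  have m: "u \<in> borel_measurable (L \<Omega>)" by (rule sqintD(1)[OF u])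
  \<comment> \<open>One function has to dominate both \<open>s n * u x\<close> and
    \<open>u x\<close>, hence \<open>B + 1\<close>.\<close>
  have h: "(\<lambda>x. (B + 1) * \<bar>u x\<bar>) \<in> S2"
    using m by (intro sqint_cmult sqint_dominated(1)[OF u]) simp_all
  have B0: "B \<ge> 0" using B[of 0] by linarith
  show "(\<lambda>n. ff (\<lambda>x. s n * u x) u) \<longlonglongrightarrow> ff (\<lambda>x. s' * u x) u"
  proof (rule ff_dominated[OF _ _ m m h])
    show "(\<lambda>x. s n * u x) \<in> borel_measurable (L \<Omega>)" for n using m by measurable
    show "(\<lambda>x. s' * u x) \<in> borel_measurable (L \<Omega>)" using m by measurable
    show "(\<lambda>n. s n * u x) \<longlonglongrightarrow> s' * u x" for x by (intro tendsto_intros s)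
    show "\<bar>s n * u x\<bar> \<le> (B + 1) * \<bar>u x\<bar>" for n x
      unfolding abs_mult using B[of n] by (intro mult_right_mono) simp_all
    show "\<bar>u x\<bar> \<le> (B + 1) * \<bar>u x\<bar>" for x
      using mult_right_mono[of 1 "B + 1" "\<bar>u x\<bar>"] B0 by simp
  qed simp
qed

text \<open>Intermediate value theorem on the ray. The order of \<open>s1\<close> and
  \<open>s2\<close> follows from monotonicity of the ratio, and the strict hypotheses exclude
  \<open>u = 0\<close>. The two-sided location of \<open>t\<close> is what keeps the projections
  bounded in \<open>minimizer_derivative_nonneg\<close>.\<close>

lemma Nehari_crossing:
  assumes u: "u \<in> H01 \<Omega>" and s: "0 < s1" "0 < s2"
    and k: "ff (\<lambda>x. s1 * u x) u < s1 * (hn u)^2" "s2 * (hn u)^2 < ff (\<lambda>x. s2 * u x) u"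
  obtains t where "s1 \<le> t" "t \<le> s2" "(\<lambda>x. t * u x) \<in> N"
proof -
  note uS = H01_S2[OF u]
  have "s1 \<le> s2"
  proof (rule ccontr)
    assume "\<not> s1 \<le> s2"
    then have "s1 * ff (\<lambda>x. s2 * u x) u \<le> s2 * ff (\<lambda>x. s1 * u x) u"
      by (intro ff_scaled_mono[OF uS]) (use s in simp_all)
    also have "\<dots> < s2 * (s1 * (hn u)^2)" by (rule mult_strict_left_mono[OF k(1) s(2)])
    also have "\<dots> = s1 * (s2 * (hn u)^2)" by simp
    also have "\<dots> < s1 * ff (\<lambda>x. s2 * u x) u" by (rule mult_strict_left_mono[OF k(2) s(1)])
    finally show False .
  qed
  have "\<exists>t\<ge>s1. t \<le> s2 \<and> t * (hn u)^2 - ff (\<lambda>x. t * u x) u = 0"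
    by (rule IVT2') (use k \<open>s1 \<le> s2\<close> in \<open>simp_all add: continuous_on_diff continuous_on_mult_right continuous_on_id ff_scaled_continuous[OF uS]\<close>)
  then obtain t where t: "s1 \<le> t" "t \<le> s2" "t * (hn u)^2 = ff (\<lambda>x. t * u x) u" by auto
  have nz: "\<not> is_zero \<Omega> u"
  proof
    assume z: "is_zero \<Omega> u"
    then have "hn u = 0" using hn_eq_0_iff[OF u] by simp
    moreover have "ff (\<lambda>x. s2 * u x) u = (LINT x|L \<Omega>. 0)"
      unfolding ff_def
      by (rule integral_cong_AE)
        (use z borel_measurable_integrable[OF ff_integrable[OF sqint_cmult[OF uS] uS]] in \<open>auto simp: is_zero_def\<close>)
    ultimately show False using k(2) by simp
  qed
  have "(\<lambda>x. t * u x) \<in> N" by (rule Nehari_scaledI[OF u nz _ t(3)]) (use t(1) s(1) in simp)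
  with t(1,2) show ?thesis by (rule that)
qed

text \<open>Divided by the scale, the nonlinear term tends to the \<alpha>-form near 0 and to the
  \<eta>-form near infinity, so the two hypotheses put the Dirichlet energy strictly between the two
  ends.\<close>

lemma Nehari_projection:
  assumes u: "u \<in> H01 \<Omega>" and \<alpha>1: "wform \<alpha> u u < (hn u)^2" and \<eta>1: "(hn u)^2 < wform \<eta> u u"
  obtains t where "t > 0" "(\<lambda>x. t * u x) \<in> N"
proof -
  note uS = H01_S2[OF u]
  have r0: "inverse (real (Suc n)) > 0" "real (Suc n) > 0" for n by simp_all
  have "(\<lambda>n. ff (\<lambda>x. inverse (real (Suc n)) * u x) u / inverse (real (Suc n))) \<longlonglongrightarrow> wform \<alpha> u u"
  proof (rule ff_ratio_tendsto[OF uS r0(1) \<alpha>L])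
    show "AE x in L \<Omega>. \<forall>\<tau>. \<tau> \<noteq> 0 \<longrightarrow> (\<lambda>n. f x (inverse (real (Suc n)) * \<tau>) / (inverse (real (Suc n)) * \<tau>)) \<longlonglongrightarrow> \<alpha> x"
      using AE_al
    proof (eventually_elim, intro allI impI)
      fix x \<tau> :: "real" and y :: "real^'n"
      assume a: "asymptotically_linear (f y) (Fprim f y) (\<alpha> y) (\<eta> y)" and t: "\<tau> \<noteq> 0"
      have "(\<lambda>n. inverse (real (Suc n)) * \<tau>) \<longlonglongrightarrow> 0 * \<tau>" by (intro tendsto_intros LIMSEQ_inverse_real_of_nat)
      then have "filterlim (\<lambda>n. inverse (real (Suc n)) * \<tau>) (at 0) sequentially" using t by (simp add: filterlim_at)
      from filterlim_compose[OF asymptotically_linear.lim0[OF a] this]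
      show "(\<lambda>n. f y (inverse (real (Suc n)) * \<tau>) / (inverse (real (Suc n)) * \<tau>)) \<longlonglongrightarrow> \<alpha> y" .
    qed
  qed
  from order_tendstoD(2)[OF this \<alpha>1] obtain n where "ff (\<lambda>x. inverse (real (Suc n)) * u x) u / inverse (real (Suc n)) < (hn u)^2"
    by (auto simp: eventually_sequentially)
  then have k1: "ff (\<lambda>x. inverse (real (Suc n)) * u x) u < inverse (real (Suc n)) * (hn u)^2"
    using r0(1)[of n] by (simp only: pos_divide_less_eq mult.commute)
  have "(\<lambda>n. ff (\<lambda>x. real (Suc n) * u x) u / real (Suc n)) \<longlonglongrightarrow> wform \<eta> u u"
  proof (rule ff_ratio_tendsto[OF uS r0(2) \<eta>L])
    show "AE x in L \<Omega>. \<forall>\<tau>. \<tau> \<noteq> 0 \<longrightarrow> (\<lambda>n. f x (real (Suc n) * \<tau>) / (real (Suc n) * \<tau>)) \<longlonglongrightarrow> \<eta> x"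
      using AE_al
    proof (eventually_elim, intro allI impI)
      fix x \<tau> :: "real" and y :: "real^'n"
      assume a: "asymptotically_linear (f y) (Fprim f y) (\<alpha> y) (\<eta> y)" and t: "\<tau> \<noteq> 0"
      have F: "filterlim (\<lambda>n. real (Suc n)) at_top sequentially"
        by (rule filterlim_compose[OF filterlim_real_sequentially filterlim_Suc])
      have "filterlim (\<lambda>n. \<bar>\<tau>\<bar> * real (Suc n)) at_top sequentially"
        by (rule filterlim_tendsto_pos_mult_at_top[OF tendsto_const _ F]) (use t in simp)
      then have "filterlim (\<lambda>n. norm (real (Suc n) * \<tau>)) at_top sequentially"
        by (simp add: abs_mult mult.commute)
      then have "filterlim (\<lambda>n. real (Suc n) * \<tau>) at_infinity sequentially"
        by (simp only: filterlim_at_infinity_conv_norm_at_top)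
      from filterlim_compose[OF asymptotically_linear.liminf[OF a] this]
      show "(\<lambda>n. f y (real (Suc n) * \<tau>) / (real (Suc n) * \<tau>)) \<longlonglongrightarrow> \<eta> y" .
    qed
  qed
  from order_tendstoD(1)[OF this \<eta>1] obtain m where "(hn u)^2 < ff (\<lambda>x. real (Suc m) * u x) u / real (Suc m)"
    by (auto simp: eventually_sequentially)
  then have k2: "real (Suc m) * (hn u)^2 < ff (\<lambda>x. real (Suc m) * u x) u"
    using r0(2)[of m] by (simp only: pos_less_divide_eq mult.commute)
  obtain t where t: "inverse (real (Suc n)) \<le> t" "(\<lambda>x. t * u x) \<in> N"
    by (rule Nehari_crossing[OF u r0(1) r0(2) k1 k2], rule that)
  have "t > 0" using t(1) r0(1)[of n] by linarith
  then show ?thesis using t(2) by (rule that)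
qed

section \<open>The functional on the Nehari set\<close>

lemma Nehari_maximal:
  assumes u: "u \<in> N" and s: "s \<ge> 0"
  shows "In (\<lambda>x. s * u x) \<le> In u"
proof -
  note uH = NehariD(1)[OF u]
  note uS = H01_S2[OF uH]
  have "(LINT x|L \<Omega>. (s^2 - 1) / 2 * (f x (u x) * u x)) \<le> (LINT x|L \<Omega>. Fprim f x (s * u x) - Fprim f x (u x))"
  proof (rule integral_mono_AE)
    show "AE x in L \<Omega>. (s^2 - 1) / 2 * (f x (u x) * u x) \<le> Fprim f x (s * u x) - Fprim f x (u x)"
      using AE_al by eventually_elim (rule asymptotically_linear.P_scaling[OF _ s])
  qed (use ff_integrable[OF uS uS] F_integrable[OF uS] F_integrable[OF sqint_cmult[OF uS]] in simp_all)
  then have "(s^2 - 1) / 2 * ff u u \<le> FF (\<lambda>x. s * u x) - FF u"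
    using F_integrable[OF uS] F_integrable[OF sqint_cmult[OF uS, of s]] by (simp only: ff_def FF_def integral_mult_right_zero Bochner_Integration.integral_diff)
  then show ?thesis
    using NehariD(3)[OF u] by (simp add: In_eq hn_cmult[OF uH] power_mult_distrib left_diff_distrib diff_divide_distrib)
qed

lemma In_Nehari:
  assumes u: "u \<in> N"
  shows "In u = (LINT x|L \<Omega>. f x (u x) * u x / 2 - Fprim f x (u x))"
proof -
  note uS = H01_S2[OF NehariD(1)[OF u]]
  show ?thesis
    using NehariD(3)[OF u] ff_integrable[OF uS uS] F_integrable[OF uS] by (simp add: In_eq ff_def FF_def)
qed

lemma In_Nehari_pos:
  assumes u: "u \<in> N"
  shows "0 < In u"
proof -
  note uS = H01_S2[OF NehariD(1)[OF u]]
  have "(LINT x|L \<Omega>. 0) < (LINT x|L \<Omega>. f x (u x) * u x / 2 - Fprim f x (u x))"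
  proof (rule integral_strict_mono[OF _ _ _ _ NehariD(2)[OF u]])
    show "AE x in L \<Omega>. 0 \<le> f x (u x) * u x / 2 - Fprim f x (u x)"
      using AE_al
    proof eventually_elim
      case (elim x)
      interpret asymptotically_linear "f x" "Fprim f x" "\<alpha> x" "\<eta> x" by (rule elim)
      show ?case using H_nonneg[of "u x"] by (simp add: H_def)
    qed
    show "AE x in L \<Omega>. u x \<noteq> 0 \<longrightarrow> 0 < f x (u x) * u x / 2 - Fprim f x (u x)"
      using AE_al
    proof eventually_elim
      case (elim x)
      interpret asymptotically_linear "f x" "Fprim f x" "\<alpha> x" "\<eta> x" by (rule elim)
      show ?case using H_pos[of "u x"] by (simp add: H_def)
    qed
  qed (use ff_integrable[OF uS uS] F_integrable[OF uS] in simp_all)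
  then show ?thesis using In_Nehari[OF u] by simp
qed

text \<open>Combined with the Nehari equation this places every Nehari point in the cone
  \<open>Aset\<close>, so resonant rays contain none.\<close>

lemma ff_less_wform:
  assumes u: "u \<in> S2" "\<not> is_zero \<Omega> u"
  shows "ff u u < wform \<eta> u u"
  unfolding ff_def wform_def
proof (rule integral_strict_mono[OF ff_integrable[OF u(1) u(1)] wform_integrable[OF \<eta>L u(1) u(1)] _ _ u(2)])
  have e: "\<eta> x * u x * u x = \<eta> x * (u x)^2" for x by (simp add: power2_eq_square)
  show "AE x in L \<Omega>. f x (u x) * u x \<le> \<eta> x * u x * u x"
    unfolding e using AE_al by eventually_elim (rule asymptotically_linear.p_times_bounds(2))
  show "AE x in L \<Omega>. u x \<noteq> 0 \<longrightarrow> f x (u x) * u x < \<eta> x * u x * u x"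
    unfolding e using AE_al by eventually_elim (rule impI, rule asymptotically_linear.p_times_strict)
qed

section \<open>First variation at a minimiser\<close>

text \<open>Both arguments are at most 2(|u| + |\<phi>|) in modulus and differ by at most 2 e
  |\<phi>|, so \<open>F_diff_le\<close> dominates the quotients independently of n.\<close>

lemma F_difference_quotient_tendsto:
  assumes u: "u \<in> S2" and \<phi>: "\<phi> \<in> S2" and e: "e \<longlonglongrightarrow> 0" "\<And>n. 0 < e n" "\<And>n. e n \<le> 1"
    and t: "t \<longlonglongrightarrow> 1" "\<And>n. \<bar>t n\<bar> \<le> 2"
  shows "(\<lambda>n. (FF (\<lambda>x. t n * (u x + e n * \<phi> x)) - FF (\<lambda>x. t n * u x)) / e n) \<longlonglongrightarrow> ff u \<phi>"
proof -
  have S: "(\<lambda>x. t n * (u x + e n * \<phi> x)) \<in> S2" "(\<lambda>x. t n * u x) \<in> S2" for n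
    by (intro sqint_cmult sqint_add u \<phi>)+
  have "(\<lambda>n. LINT x|L \<Omega>. (Fprim f x (t n * (u x + e n * \<phi> x)) - Fprim f x (t n * u x)) / e n) \<longlonglongrightarrow> (LINT x|L \<Omega>. f x (u x) * \<phi> x)"
  proof (rule integral_dominated_convergence[where w = "\<lambda>x. K * ((2 * (\<bar>u x\<bar> + \<bar>\<phi> x\<bar>)) * (2 * \<bar>\<phi> x\<bar>))"])
    show "(\<lambda>x. f x (u x) * \<phi> x) \<in> borel_measurable (L \<Omega>)"
      by (rule borel_measurable_integrable[OF ff_integrable[OF u \<phi>]])
    show "(\<lambda>x. (Fprim f x (t n * (u x + e n * \<phi> x)) - Fprim f x (t n * u x)) / e n) \<in> borel_measurable (L \<Omega>)" for n
      using F_meas[OF sqintD(1)[OF S(1)[of n]]] F_meas[OF sqintD(1)[OF S(2)[of n]]] by measurable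
    have a: "(\<lambda>x. \<bar>w x\<bar>) \<in> S2" if "w \<in> S2" for w :: "real^'n \<Rightarrow> real"
      using sqintD(1)[OF that] by (intro sqint_dominated(1)[OF that]) simp_all
    have "integrable (L \<Omega>) (\<lambda>x. (2 * (\<bar>u x\<bar> + \<bar>\<phi> x\<bar>)) * (2 * \<bar>\<phi> x\<bar>))"
      by (rule sqint_mult[OF sqint_cmult[OF sqint_add[OF a[OF u] a[OF \<phi>]]] sqint_cmult[OF a[OF \<phi>]]])
    then show "integrable (L \<Omega>) (\<lambda>x. K * ((2 * (\<bar>u x\<bar> + \<bar>\<phi> x\<bar>)) * (2 * \<bar>\<phi> x\<bar>)))" by (rule integrable_mult_right)
    show "AE x in L \<Omega>. (\<lambda>n. (Fprim f x (t n * (u x + e n * \<phi> x)) - Fprim f x (t n * u x)) / e n) \<longlonglongrightarrow> f x (u x) * \<phi> x"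
      using AE_al
    proof eventually_elim
      case (elim x)
      have e0: "e n \<noteq> 0" for n using e(2)[of n] by simp
      have 1: "(\<lambda>n. t n * u x) \<longlonglongrightarrow> 1 * u x" by (intro tendsto_intros t)
      have 2: "(\<lambda>n. t n * \<phi> x) \<longlonglongrightarrow> 1 * \<phi> x" by (intro tendsto_intros t)
      have 3: "t n * (u x + e n * \<phi> x) = t n * u x + e n * (t n * \<phi> x)" for n by (simp add: algebra_simps)
      show ?case
        unfolding 3 using asymptotically_linear.P_difference_quotient[OF elim 1 e(1) e0 2] by simp
    qed
    show "AE x in L \<Omega>. norm ((Fprim f x (t n * (u x + e n * \<phi> x)) - Fprim f x (t n * u x)) / e n)
        \<le> K * ((2 * (\<bar>u x\<bar> + \<bar>\<phi> x\<bar>)) * (2 * \<bar>\<phi> x\<bar>))" for n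
      using F_diff_le
    proof eventually_elim
      case (elim x)
      let ?a = "t n * (u x + e n * \<phi> x)" and ?b = "t n * u x"
      have m: "\<bar>t n\<bar> * z \<le> 2 * z" if "z \<ge> 0" for z using t(2)[of n] that by (rule mult_right_mono)
      have "\<bar>e n * \<phi> x\<bar> \<le> \<bar>\<phi> x\<bar>"
        using mult_right_mono[OF e(3)[of n] abs_ge_zero[of "\<phi> x"]] e(2)[of n] by (simp add: abs_mult)
      then have "\<bar>u x + e n * \<phi> x\<bar> \<le> \<bar>u x\<bar> + \<bar>\<phi> x\<bar>" by linarith
      then have "\<bar>?a\<bar> \<le> 2 * (\<bar>u x\<bar> + \<bar>\<phi> x\<bar>)" using m[of "\<bar>u x + e n * \<phi> x\<bar>"] by (simp add: abs_mult)
      moreover have "\<bar>?b\<bar> \<le> 2 * (\<bar>u x\<bar> + \<bar>\<phi> x\<bar>)" using m[of "\<bar>u x\<bar>"] by (simp add: abs_mult)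
      ultimately have mx: "max \<bar>?a\<bar> \<bar>?b\<bar> \<le> 2 * (\<bar>u x\<bar> + \<bar>\<phi> x\<bar>)" by simp
      have "?a - ?b = t n * (e n * \<phi> x)" by (simp add: algebra_simps)
      then have df: "\<bar>?a - ?b\<bar> \<le> 2 * (e n * \<bar>\<phi> x\<bar>)" using m[of "e n * \<bar>\<phi> x\<bar>"] e(2)[of n] by (simp add: abs_mult)
      have "\<bar>Fprim f x ?a - Fprim f x ?b\<bar> \<le> K * max \<bar>?a\<bar> \<bar>?b\<bar> * \<bar>?a - ?b\<bar>" using elim by blast
      also have "\<dots> \<le> K * (2 * (\<bar>u x\<bar> + \<bar>\<phi> x\<bar>)) * (2 * (e n * \<bar>\<phi> x\<bar>))"
        using K0 by (intro mult_mono mult_left_mono mx df) simp_all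
      also have "\<dots> = K * ((2 * (\<bar>u x\<bar> + \<bar>\<phi> x\<bar>)) * (2 * \<bar>\<phi> x\<bar>)) * e n" by (simp add: algebra_simps)
      finally show ?case using e(2)[of n] by (simp add: abs_divide divide_le_eq)
    qed
  qed
  then show ?thesis
    using F_integrable[OF S(1)] F_integrable[OF S(2)] by (simp add: FF_def ff_def)
qed

text \<open>Compare \<open>u\<close> with the projections \<open>t\<^sub>n(u + e\<^sub>n\<phi>)\<close> onto the Nehari set; here \<open>t\<^sub>n \<rightarrow> 1\<close>.
  Since \<open>t \<mapsto> I(tu)\<close> is maximal at \<open>1\<close>, no differentiability of \<open>t\<^sub>n\<close> is needed.\<close>

lemma minimizer_derivative_nonneg:
  assumes u: "u \<in> N" and min: "\<And>w. w \<in> N \<Longrightarrow> In u \<le> In w" and \<phi>: "\<phi> \<in> H01 \<Omega>"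
  shows "ff u \<phi> \<le> ip u \<phi>"
proof -
  note uH = NehariD(1)[OF u] and unz = NehariD(2)[OF u] and uN = NehariD(3)[OF u]
  note uS = H01_S2[OF uH] and \<phi>S = H01_S2[OF \<phi>]
  note um = sqintD(1)[OF uS] and \<phi>m = sqintD(1)[OF \<phi>S]
  define e where "e n = inverse (real (Suc n))" for n
  have e: "e \<longlonglongrightarrow> 0" "\<And>n. 0 < e n" "\<And>n. e n \<le> 1"
    unfolding e_def by (rule LIMSEQ_inverse_real_of_nat) (simp_all add: inverse_le_1_iff)
  define w where "w n x = u x + e n * \<phi> x" for n x
  have wH: "w n \<in> H01 \<Omega>" for n unfolding w_def[abs_def] by (rule H01_add[OF uH H01_cmult[OF \<phi>]])
  have wm: "w n \<in> borel_measurable (L \<Omega>)" for n by (rule sqintD(1)[OF H01_S2[OF wH]])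
  have hw: "(hn (w n))^2 = (hn u)^2 + 2 * e n * ip u \<phi> + (e n)^2 * (hn \<phi>)^2" for n
    unfolding w_def[abs_def] by (rule hn_add_scaled[OF uH \<phi>])
  have hwl: "(\<lambda>n. (hn (w n))^2) \<longlonglongrightarrow> (hn u)^2"
  proof -
    have "(\<lambda>n. (hn u)^2 + 2 * e n * ip u \<phi> + (e n)^2 * (hn \<phi>)^2) \<longlonglongrightarrow> (hn u)^2 + 2 * 0 * ip u \<phi> + 0^2 * (hn \<phi>)^2"
      by (intro tendsto_intros e(1))
    then show ?thesis by (simp add: hw)
  qed
  define h where "h x = 2 * (\<bar>u x\<bar> + \<bar>\<phi> x\<bar>)" for x
  have hS: "h \<in> S2"
    unfolding h_def[abs_def] using um \<phi>m
    by (intro sqint_cmult sqint_add sqint_dominated(1)[OF uS] sqint_dominated(1)[OF \<phi>S]) simp_all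
  have wl: "(\<lambda>n. w n x) \<longlonglongrightarrow> u x" for x
  proof -
    have "(\<lambda>n. u x + e n * \<phi> x) \<longlonglongrightarrow> u x + 0 * \<phi> x" by (intro tendsto_intros e(1))
    then show ?thesis by (simp add: w_def)
  qed
  have wb: "\<bar>w n x\<bar> \<le> \<bar>u x\<bar> + \<bar>\<phi> x\<bar>" for n x
  proof -
    have "\<bar>e n * \<phi> x\<bar> \<le> \<bar>\<phi> x\<bar>"
      using mult_right_mono[OF e(3)[of n] abs_ge_zero[of "\<phi> x"]] e(2)[of n] by (simp add: abs_mult)
    then show ?thesis unfolding w_def by linarith
  qed
  have wh: "\<bar>w n x\<bar> \<le> h x" for n x
    using wb[of n x] abs_ge_zero[of "u x"] abs_ge_zero[of "\<phi> x"] unfolding h_def distrib_left by linarith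
  have ffl: "(\<lambda>k. ff (\<lambda>x. s k * w (r k) x) (w (r k))) \<longlonglongrightarrow> ff (\<lambda>x. s' * u x) u"
    if s: "s \<longlonglongrightarrow> s'" "\<And>k. \<bar>s k\<bar> \<le> 2" and r: "strict_mono r" for s :: "nat \<Rightarrow> real" and s' r
  proof (rule ff_dominated[OF _ _ wm um hS])
    show "(\<lambda>x. s k * w (r k) x) \<in> borel_measurable (L \<Omega>)" for k using wm[of "r k"] by measurable
    show "(\<lambda>x. s' * u x) \<in> borel_measurable (L \<Omega>)" using um by measurable
    show l: "(\<lambda>k. w (r k) x) \<longlonglongrightarrow> u x" for x by (rule n2_conv_subseq[OF r wl])
    show "(\<lambda>k. s k * w (r k) x) \<longlonglongrightarrow> s' * u x" for x by (intro tendsto_mult s l)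
    show "\<bar>s k * w (r k) x\<bar> \<le> h x" for k x
    proof -
      have "\<bar>s k\<bar> * \<bar>w (r k) x\<bar> \<le> 2 * (\<bar>u x\<bar> + \<bar>\<phi> x\<bar>)" by (intro mult_mono s wb) simp_all
      then show ?thesis by (simp add: abs_mult h_def)
    qed
    show "\<bar>w (r k) x\<bar> \<le> h x" for k x by (rule wh)
  qed
  have id: "strict_mono (\<lambda>k::nat. k)" by (simp add: strict_mono_def)
  \<comment> \<open>At \<open>u\<close> the strict monotonicity of the ratio puts the scales 1/2 and
    3/2 strictly on opposite sides of the Nehari point; by continuity this persists for
    \<open>w n\<close> with n large.\<close>
  have k1: "\<forall>\<^sub>F n in sequentially. ff (\<lambda>x. (1/2) * w n x) (w n) < (1/2) * (hn (w n))^2"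
  proof -
    have "1 * ff (\<lambda>x. (1/2) * u x) u < (1/2) * ff (\<lambda>x. 1 * u x) u"
      by (rule ff_scaled_strict_mono[OF uS unz]) simp_all
    then have "0 < (1/2) * (hn u)^2 - ff (\<lambda>x. (1/2) * u x) u" using uN by simp
    moreover have "(\<lambda>n. (1/2) * (hn (w n))^2 - ff (\<lambda>x. (1/2) * w n x) (w n)) \<longlonglongrightarrow> (1/2) * (hn u)^2 - ff (\<lambda>x. (1/2) * u x) u"
      by (intro tendsto_diff tendsto_mult tendsto_const hwl ffl[OF tendsto_const _ id]) simp
    ultimately have "\<forall>\<^sub>F n in sequentially. 0 < (1/2) * (hn (w n))^2 - ff (\<lambda>x. (1/2) * w n x) (w n)"
      by (rule order_tendstoD(1)[rotated])
    then show ?thesis by eventually_elim simp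
  qed
  have k2: "\<forall>\<^sub>F n in sequentially. (3/2) * (hn (w n))^2 < ff (\<lambda>x. (3/2) * w n x) (w n)"
  proof -
    have "(3/2) * ff (\<lambda>x. 1 * u x) u < 1 * ff (\<lambda>x. (3/2) * u x) u"
      by (rule ff_scaled_strict_mono[OF uS unz]) simp_all
    then have "(3/2) * (hn u)^2 - ff (\<lambda>x. (3/2) * u x) u < 0" using uN by simp
    moreover have "(\<lambda>n. (3/2) * (hn (w n))^2 - ff (\<lambda>x. (3/2) * w n x) (w n)) \<longlonglongrightarrow> (3/2) * (hn u)^2 - ff (\<lambda>x. (3/2) * u x) u"
      by (intro tendsto_diff tendsto_mult tendsto_const hwl ffl[OF tendsto_const _ id]) simp
    ultimately have "\<forall>\<^sub>F n in sequentially. (3/2) * (hn (w n))^2 - ff (\<lambda>x. (3/2) * w n x) (w n) < 0"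
      by (rule order_tendstoD(2)[rotated])
    then show ?thesis by eventually_elim simp
  qed
  obtain M where M: "\<And>n. n \<ge> M \<Longrightarrow> ff (\<lambda>x. (1/2) * w n x) (w n) < (1/2) * (hn (w n))^2"
    "\<And>n. n \<ge> M \<Longrightarrow> (3/2) * (hn (w n))^2 < ff (\<lambda>x. (3/2) * w n x) (w n)"
    using eventually_conj[OF k1 k2] unfolding eventually_sequentially by blast
  have "\<exists>t. 1/2 \<le> t \<and> t \<le> 3/2 \<and> (\<lambda>x. t * w (n + M) x) \<in> N" for n
  proof -
    obtain t where "1/2 \<le> t" "t \<le> 3/2" "(\<lambda>x. t * w (n + M) x) \<in> N"
    proof (rule Nehari_crossing[OF wH])
      show "ff (\<lambda>x. (1/2) * w (n + M) x) (w (n + M)) < (1/2) * (hn (w (n + M)))^2" by (rule M(1)) simp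
      show "(3/2) * (hn (w (n + M)))^2 < ff (\<lambda>x. (3/2) * w (n + M) x) (w (n + M))" by (rule M(2)) simp
    qed simp_all
    then show ?thesis by blast
  qed
  from choice[OF allI[OF this]] obtain t where
    "\<forall>n. 1/2 \<le> t n \<and> t n \<le> 3/2 \<and> (\<lambda>x. t n * w (n + M) x) \<in> N" by (rule exE)
  then have t: "1/2 \<le> t n" "t n \<le> 3/2" "(\<lambda>x. t n * w (n + M) x) \<in> N" for n by simp_all
  \<comment> \<open>Compactness of the bracket gives a limit scale \<open>l\<close>. It satisfies
    the Nehari equation on the ray of \<open>u\<close>, whose only solution is 1.\<close>
  have "\<forall>n. t n \<in> {1/2..3/2}" using t by simp
  then obtain l and r :: "nat \<Rightarrow> nat" where l: "l \<in> {1/2..3/2}" and r: "strict_mono r" and tl: "(t \<circ> r) \<longlonglongrightarrow> l"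
    using compact_Icc[of "1/2" "3/2::real"] unfolding compact_def by blast
  define r' where "r' k = r k + M" for k
  have r': "strict_mono r'" using r by (simp add: r'_def strict_mono_def)
  define s where "s k = t (r k)" for k
  have s: "s \<longlonglongrightarrow> l" using tl by (simp add: s_def[abs_def] o_def)
  have sb: "1/2 \<le> s k" "s k \<le> 3/2" for k using t[of "r k"] by (simp_all add: s_def)
  have sb2: "\<bar>s k\<bar> \<le> 2" for k using sb[of k] by linarith
  have sN: "(\<lambda>x. s k * w (r' k) x) \<in> N" for k using t(3)[of "r k"] by (simp add: s_def r'_def)
  have sE: "s k * (hn (w (r' k)))^2 = ff (\<lambda>x. s k * w (r' k) x) (w (r' k))" for k
  proof -
    have "ff (\<lambda>x. s k * w (r' k) x) (\<lambda>x. s k * w (r' k) x) = (LINT x|L \<Omega>. s k * (f x (s k * w (r' k) x) * w (r' k) x))"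
      unfolding ff_def by (rule Bochner_Integration.integral_cong) simp_all
    also have "\<dots> = s k * ff (\<lambda>x. s k * w (r' k) x) (w (r' k))" by (simp add: ff_def)
    finally have "(s k)^2 * (hn (w (r' k)))^2 = s k * ff (\<lambda>x. s k * w (r' k) x) (w (r' k))"
      using NehariD(3)[OF sN[of k]] by (simp only: hn_cmult[OF wH] power_mult_distrib power2_abs)
    then have "s k * (s k * (hn (w (r' k)))^2) = s k * ff (\<lambda>x. s k * w (r' k) x) (w (r' k))"
      by (simp only: power2_eq_square[of "s k"] mult.assoc)
    then show ?thesis using sb(1)[of k] by simp
  qed
  have "(\<lambda>k. s k * (hn (w (r' k)))^2) \<longlonglongrightarrow> l * (hn u)^2"
    by (intro tendsto_mult s n2_conv_subseq[OF r' hwl])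
  moreover have "(\<lambda>k. s k * (hn (w (r' k)))^2) \<longlonglongrightarrow> ff (\<lambda>x. l * u x) u"
    unfolding sE by (rule ffl[OF s sb2 r'])
  ultimately have lE: "l * (hn u)^2 = ff (\<lambda>x. l * u x) u" by (rule LIMSEQ_unique)
  have "l = 1"
  proof (rule ccontr)
    assume "l \<noteq> 1"
    then consider "l < 1" | "1 < l" by linarith
    then show False
    proof cases
      case 1
      have "1 * ff (\<lambda>x. l * u x) u < l * ff (\<lambda>x. 1 * u x) u"
        by (rule ff_scaled_strict_mono[OF uS unz]) (use l 1 in simp_all)
      then show False using lE uN by simp
    next
      case 2
      have "l * ff (\<lambda>x. 1 * u x) u < 1 * ff (\<lambda>x. l * u x) u"
        by (rule ff_scaled_strict_mono[OF uS unz]) (use 2 in simp_all)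
      then show False using lE uN by simp
    qed
  qed
  define d where "d k = e (r' k)" for k
  have d: "d \<longlonglongrightarrow> 0" "\<And>k. 0 < d k" "\<And>k. d k \<le> 1"
    unfolding d_def[abs_def] using n2_conv_subseq[OF r' e(1)] e(2,3) by simp_all
  have s1: "s \<longlonglongrightarrow> 1" using s \<open>l = 1\<close> by simp
  have q: "(\<lambda>k. (FF (\<lambda>x. s k * (u x + d k * \<phi> x)) - FF (\<lambda>x. s k * u x)) / d k) \<longlonglongrightarrow> ff u \<phi>"
    by (rule F_difference_quotient_tendsto[OF uS \<phi>S d s1 sb2])
  \<comment> \<open>Maximality of I on the ray of \<open>u\<close> and minimality of
    \<open>u\<close> give I(s u) \<le> I(u) \<le> I(s w). Dropping the middle term compares two
    functions at the same scale, so the difference quotient carries no increment of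
    \<open>s\<close>.\<close>
  have "0 \<le> (s k)^2 * (ip u \<phi> + d k * (hn \<phi>)^2 / 2) - (FF (\<lambda>x. s k * (u x + d k * \<phi> x)) - FF (\<lambda>x. s k * u x)) / d k" for k
  proof -
    have "In (\<lambda>x. s k * u x) \<le> In u" by (rule Nehari_maximal[OF u]) (use sb(1)[of k] in simp)
    also have "\<dots> \<le> In (\<lambda>x. s k * w (r' k) x)" by (rule min[OF sN])
    finally have "FF (\<lambda>x. s k * w (r' k) x) - FF (\<lambda>x. s k * u x) \<le> (s k)^2 * ((hn (w (r' k)))^2 - (hn u)^2) / 2"
      by (simp add: In_eq hn_cmult[OF wH] hn_cmult[OF uH] power_mult_distrib right_diff_distrib diff_divide_distrib)
    also have "\<dots> = (s k)^2 * (ip u \<phi> + d k * (hn \<phi>)^2 / 2) * d k"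
      unfolding hw d_def[symmetric] by (simp add: power2_eq_square algebra_simps)
    finally have "(FF (\<lambda>x. s k * w (r' k) x) - FF (\<lambda>x. s k * u x)) / d k \<le> (s k)^2 * (ip u \<phi> + d k * (hn \<phi>)^2 / 2)"
      using d(2)[of k] by (simp only: pos_divide_le_eq)
    then show ?thesis by (simp add: w_def d_def)
  qed
  moreover have "(\<lambda>k. (s k)^2 * (ip u \<phi> + d k * (hn \<phi>)^2 / 2) - (FF (\<lambda>x. s k * (u x + d k * \<phi> x)) - FF (\<lambda>x. s k * u x)) / d k)
      \<longlonglongrightarrow> 1^2 * (ip u \<phi> + 0 * (hn \<phi>)^2 / 2) - ff u \<phi>"
    by (intro tendsto_diff tendsto_mult tendsto_power tendsto_add tendsto_divide tendsto_const s1 d(1) q) simp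
  ultimately have "0 \<le> 1^2 * (ip u \<phi> + 0 * (hn \<phi>)^2 / 2) - ff u \<phi>"
    by (intro LIMSEQ_le_const) auto
  then show ?thesis by simp
qed

lemma minimizer_weak_solution:
  assumes u: "u \<in> N" and min: "\<And>w. w \<in> N \<Longrightarrow> In u \<le> In w"
  shows "weak_solution \<Omega> f u"
  unfolding weak_solution_def
proof (intro conjI ballI)
  note uH = NehariD(1)[OF u]
  note uS = H01_S2[OF uH]
  show "u \<in> H01 \<Omega>" by (rule uH)
  fix \<phi> assume \<phi>: "\<phi> \<in> H01 \<Omega>"
  show "integrable (L \<Omega>) (\<lambda>x. f x (u x) * \<phi> x)" by (rule ff_integrable[OF uS H01_S2[OF \<phi>]])
  have "ff u (\<lambda>x. -1 * \<phi> x) = - ff u \<phi>" by (simp add: ff_def)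
  then have "- ff u \<phi> \<le> - ip u \<phi>"
    using minimizer_derivative_nonneg[OF u min H01_cmult[OF \<phi>, of "-1"]] ip_cmult_right[OF \<phi> uH, of "-1"] by simp
  then have "ip u \<phi> = ff u \<phi>"
    using minimizer_derivative_nonneg[OF u min \<phi>] by simp
  then show "(LINT x|L \<Omega>. wg u x \<bullet> wg \<phi> x) = (LINT x|L \<Omega>. f x (u x) * \<phi> x)"
    by (simp add: ip_def ff_def)
qed

end

subsection \<open>The strong maximum principle\<close>

context bounded_open
begin

lemma wform_bound:
  assumes \<theta>: "\<theta> \<in> Linf \<Omega>" and C: "AE x in L \<Omega>. \<bar>\<theta> x\<bar> \<le> C" "C \<ge> 0" and u: "u \<in> S2" and w: "w \<in> S2"
  shows "\<bar>wform \<theta> u w\<bar> \<le> C * n2 u * n2 w"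
proof -
  have "\<bar>wform \<theta> u w\<bar> \<le> n2 (\<lambda>x. \<theta> x * u x) * n2 w"
    unfolding wform_def by (rule l2n_Cauchy_Schwarz_real[OF Linf_mult[OF \<theta> u] w])
  also have "\<dots> \<le> (C * n2 u) * n2 w"
  proof (rule mult_right_mono)
    have "n2 (\<lambda>x. \<theta> x * u x) \<le> n2 (\<lambda>x. C * u x)"
      by (rule sqint_dominated(2)[OF sqint_cmult[OF u] sqintD(1)[OF Linf_mult[OF \<theta> u]]])
        (use C(1) in eventually_elim, use C(2) in \<open>simp add: abs_mult mult_right_mono\<close>)
    then show "n2 (\<lambda>x. \<theta> x * u x) \<le> C * n2 u" using l2n_cmult[of "L \<Omega>" C u] C(2) by simp
  qed simp
  finally show ?thesis .
qed

text \<open>Testing \<open>-\<Delta>v = \<theta>v\<close> with \<open>\<zeta>\<^sup>2/(v + \<delta>)\<close> bounds \<open>\<zeta>\<nabla>ln(v + \<delta>)\<close> in \<open>L\<^sup>2\<close> independently of \<open>\<delta>\<close>.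
  Near a point where \<open>v\<close> vanishes on a set of positive measure without vanishing identically,
  the oscillation of \<open>ln(v + \<delta>)\<close> would be unbounded as \<open>\<delta> \<rightarrow> 0\<close>. Here \<open>\<psi>\<close> is a nonnegative test
  function approximating \<open>v\<close>.\<close>

definition logtest :: "(real^'n \<Rightarrow> real) \<Rightarrow> (real^'n \<Rightarrow> real) \<Rightarrow> real \<Rightarrow> real^'n \<Rightarrow> real" where
  "logtest \<psi> \<zeta> \<delta> x = \<zeta> x * inverse (\<psi> x + \<delta>) * \<zeta> x"

definition loggrad :: "(real^'n \<Rightarrow> real) \<Rightarrow> (real^'n \<Rightarrow> real) \<Rightarrow> real \<Rightarrow> real^'n \<Rightarrow> real^'n" where
  "loggrad \<psi> \<zeta> \<delta> x = (\<zeta> x * inverse (\<psi> x + \<delta>)) *\<^sub>R cgrad \<psi> x"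

text \<open>With q = \<zeta>/(\<psi> + \<delta>) and W = \<zeta> grad ln(\<psi> + \<delta>), pairing
  the gradient of the test function with grad \<psi> yields 2 W . grad \<zeta> - |W|^2: the energy
  of the logarithm appears with a sign.\<close>

lemma logtest_props:
  assumes \<psi>: "test_fun \<Omega> \<psi>" "\<And>x. \<psi> x \<ge> 0" and \<zeta>: "test_fun \<Omega> \<zeta>" and \<delta>: "\<delta> > 0"
  shows "test_fun \<Omega> (logtest \<psi> \<zeta> \<delta>)"
    "cgrad (logtest \<psi> \<zeta> \<delta>) x = (2 * (\<zeta> x * inverse (\<psi> x + \<delta>))) *\<^sub>R cgrad \<zeta> x - (\<zeta> x * inverse (\<psi> x + \<delta>)) *\<^sub>R loggrad \<psi> \<zeta> \<delta> x"
    "loggrad \<psi> \<zeta> \<delta> \<in> S2" "continuous_on UNIV (loggrad \<psi> \<zeta> \<delta>)"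
proof -
  note s\<psi> = test_funD(1)[OF \<psi>(1)] and s\<zeta> = test_funD(1)[OF \<zeta>]
  have nz: "\<psi> x + \<delta> \<noteq> 0" for x using \<psi>(2)[of x] \<delta> by linarith
  have si: "smooth_on UNIV (\<lambda>x. inverse (\<psi> x + \<delta>))"
    by (rule smooth_inverse[OF smooth_add[OF s\<psi> smooth_const] nz])
  have sq: "smooth_on UNIV (\<lambda>x. \<zeta> x * inverse (\<psi> x + \<delta>))" by (rule smooth_mult[OF s\<zeta> si])
  show "test_fun \<Omega> (logtest \<psi> \<zeta> \<delta>)"
    unfolding logtest_def[abs_def] by (rule test_fun_mult[OF \<zeta> sq])
  have gi: "cgrad (\<lambda>x. inverse (\<psi> x + \<delta>)) x = (- ((inverse (\<psi> x + \<delta>))^2)) *\<^sub>R cgrad \<psi> x" for x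
  proof (rule cgrad_chain[OF s\<psi>, of "\<lambda>t. inverse (t + \<delta>)"])
    have "((\<lambda>t. t + \<delta>) has_real_derivative 1) (at (\<psi> x))" by (auto intro!: derivative_eq_intros)
    from DERIV_inverse_fun[OF this nz]
    show "((\<lambda>t. inverse (t + \<delta>)) has_real_derivative - ((inverse (\<psi> x + \<delta>))^2)) (at (\<psi> x))"
      by (simp add: power2_eq_square)
  qed
  show "cgrad (logtest \<psi> \<zeta> \<delta>) x = (2 * (\<zeta> x * inverse (\<psi> x + \<delta>))) *\<^sub>R cgrad \<zeta> x - (\<zeta> x * inverse (\<psi> x + \<delta>)) *\<^sub>R loggrad \<psi> \<zeta> \<delta> x"
  proof -
    have alg: "(z * i) *\<^sub>R A + z *\<^sub>R (z *\<^sub>R ((- (i^2)) *\<^sub>R D) + i *\<^sub>R A) = (2 * (z * i)) *\<^sub>R A - (z * i) *\<^sub>R ((z * i) *\<^sub>R D)"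
      for z i :: real and A D :: "real^'n"
      by (simp add: vec_eq_iff power2_eq_square algebra_simps)
    show ?thesis
      unfolding logtest_def[abs_def] cgrad_mult[OF sq s\<zeta>] cgrad_mult[OF s\<zeta> si] gi loggrad_def by (rule alg)
  qed
  show c: "continuous_on UNIV (loggrad \<psi> \<zeta> \<delta>)"
    unfolding loggrad_def[abs_def]
    by (rule continuous_on_scaleR[OF smooth_continuous[OF sq] cgrad_continuous[OF s\<psi>]])
  show "loggrad \<psi> \<zeta> \<delta> \<in> S2"
  proof (rule continuous_compact_support_sqint[OF c test_funD(2,3)[OF \<zeta>] _ open_dom])
    fix x assume "x \<notin> closure {x. \<zeta> x \<noteq> 0}"
    then have "\<zeta> x = 0" using closure_subset[of "{x. \<zeta> x \<noteq> 0}"] by auto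
    then show "loggrad \<psi> \<zeta> \<delta> x = 0" by (simp add: loggrad_def)
  qed
qed

lemma ip_test_fun:
  assumes "test_fun \<Omega> \<psi>" "test_fun \<Omega> \<kappa>"
  shows "ip \<psi> \<kappa> = (LINT x|L \<Omega>. cgrad \<psi> x \<bullet> cgrad \<kappa> x)"
  unfolding ip_def
proof (rule integral_cong_AE)
  note m = sqintD(1)[OF wgrad_spec(1)[OF H01_test_fun(1)[OF assms(1)]]] sqintD(1)[OF wgrad_spec(1)[OF H01_test_fun(1)[OF assms(2)]]]
    sqintD(1)[OF test_fun_sqint(2)[OF assms(1) open_dom]] sqintD(1)[OF test_fun_sqint(2)[OF assms(2) open_dom]]
  show "(\<lambda>x. wg \<psi> x \<bullet> wg \<kappa> x) \<in> borel_measurable (L \<Omega>)" by (rule borel_measurable_inner[OF m(1,2)])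
  show "(\<lambda>x. cgrad \<psi> x \<bullet> cgrad \<kappa> x) \<in> borel_measurable (L \<Omega>)" by (rule borel_measurable_inner[OF m(3,4)])
  show "AE x in L \<Omega>. wg \<psi> x \<bullet> wg \<kappa> x = cgrad \<psi> x \<bullet> cgrad \<kappa> x"
    using H01_test_fun(2)[OF assms(1)] H01_test_fun(2)[OF assms(2)] by eventually_elim simp
qed

text \<open>The equation holds for \<open>v\<close>, whereas the logarithm is taken of the smooth
  \<psi>. Replacing \<open>v\<close> by \<psi> in the tested equation costs the last bracket, which
  vanishes as \<psi> tends to \<open>v\<close> with \<delta> fixed.\<close>

lemma log_energy:
  assumes v: "v \<in> H01 \<Omega>" and eq: "\<And>\<phi>. \<phi> \<in> H01 \<Omega> \<Longrightarrow> ip v \<phi> = wform \<theta> v \<phi>"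
    and \<theta>: "\<theta> \<in> Linf \<Omega>" and C: "AE x in L \<Omega>. \<bar>\<theta> x\<bar> \<le> C" "C \<ge> 0"
    and \<psi>: "test_fun \<Omega> \<psi>" "\<And>x. \<psi> x \<ge> 0" and \<zeta>: "test_fun \<Omega> \<zeta>" and \<delta>: "\<delta> > 0"
  shows "(n2 (loggrad \<psi> \<zeta> \<delta>))^2 \<le> 4 * (n2 (cgrad \<zeta>))^2 + 2 * C * (n2 \<zeta>)^2
     + 2 * (hn (\<lambda>x. \<psi> x - v x) * hn (logtest \<psi> \<zeta> \<delta>) + C * n2 (\<lambda>x. \<psi> x - v x) * n2 (logtest \<psi> \<zeta> \<delta>))"
proof -
  let ?\<kappa> = "logtest \<psi> \<zeta> \<delta>" and ?W = "loggrad \<psi> \<zeta> \<delta>"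
  note p = logtest_props[OF \<psi> \<zeta> \<delta>]
  have H: "\<psi> \<in> H01 \<Omega>" "?\<kappa> \<in> H01 \<Omega>" by (rule H01_test_fun(1)[OF \<psi>(1)], rule H01_test_fun(1)[OF p(1)])
  have dH: "(\<lambda>x. \<psi> x - v x) \<in> H01 \<Omega>" by (rule H01_diff[OF H(1) v])
  note S = H01_S2[OF H(1)] H01_S2[OF H(2)] H01_S2[OF v] H01_S2[OF dH]
  note g\<zeta> = test_fun_sqint(2)[OF \<zeta> open_dom]
  have i1: "ip (\<lambda>x. \<psi> x - v x) ?\<kappa> = ip \<psi> ?\<kappa> - ip v ?\<kappa>" by (rule ip_diff_left[OF H(1) v H(2)])
  have "(\<lambda>x. \<theta> x * (\<psi> x - v x) * ?\<kappa> x) = (\<lambda>x. \<theta> x * \<psi> x * ?\<kappa> x - \<theta> x * v x * ?\<kappa> x)"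
    by (rule ext) (simp add: algebra_simps)
  then have i2: "wform \<theta> (\<lambda>x. \<psi> x - v x) ?\<kappa> = wform \<theta> \<psi> ?\<kappa> - wform \<theta> v ?\<kappa>"
    using wform_integrable[OF \<theta> S(1,2)] wform_integrable[OF \<theta> S(3,2)] by (simp add: wform_def)
  have "ip \<psi> ?\<kappa> = (LINT x|L \<Omega>. 2 * (cgrad \<zeta> x \<bullet> ?W x) - (norm (?W x))^2)"
    unfolding ip_test_fun[OF \<psi>(1) p(1)]
  proof (rule Bochner_Integration.integral_cong[OF refl])
    fix x
    have e: "cgrad \<psi> x \<bullet> ((\<zeta> x * inverse (\<psi> x + \<delta>)) *\<^sub>R z) = ?W x \<bullet> z" for z by (simp add: loggrad_def)
    have "cgrad \<psi> x \<bullet> cgrad ?\<kappa> x = 2 * (?W x \<bullet> cgrad \<zeta> x) - ?W x \<bullet> ?W x"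
      unfolding p(2) inner_diff_right e using e[of "2 *\<^sub>R cgrad \<zeta> x"] by (simp add: mult.commute)
    then show "cgrad \<psi> x \<bullet> cgrad ?\<kappa> x = 2 * (cgrad \<zeta> x \<bullet> ?W x) - (norm (?W x))^2"
      by (simp add: power2_norm_eq_inner inner_commute)
  qed
  also have "\<dots> = 2 * (LINT x|L \<Omega>. cgrad \<zeta> x \<bullet> ?W x) - (n2 ?W)^2"
    using sqint_inner[OF g\<zeta> p(3)] sqintD(2)[OF p(3)] by (simp add: l2n_power2)
  finally have i3: "(n2 ?W)^2 = 2 * (LINT x|L \<Omega>. cgrad \<zeta> x \<bullet> ?W x) - ip \<psi> ?\<kappa>" by simp
  \<comment> \<open>Young's inequality with weights that leave half of |W|^2 to be absorbed on the
    left.\<close>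
  have b1: "2 * (LINT x|L \<Omega>. cgrad \<zeta> x \<bullet> ?W x) \<le> 2 * (n2 (cgrad \<zeta>))^2 + (n2 ?W)^2 / 2"
  proof -
    have "0 \<le> (2 * n2 (cgrad \<zeta>) - n2 ?W)^2" by simp
    then have "2 * (n2 (cgrad \<zeta>) * n2 ?W) \<le> 2 * (n2 (cgrad \<zeta>))^2 + (n2 ?W)^2 / 2"
      by (simp add: power2_diff power_mult_distrib)
    then show ?thesis using l2n_Cauchy_Schwarz[OF g\<zeta> p(3)] by linarith
  qed
  \<comment> \<open>The quotient \<psi>/(\<psi> + \<delta>) is at most 1, so this term is bounded
    independently of \<delta>.\<close>
  have b2: "\<bar>wform \<theta> \<psi> ?\<kappa>\<bar> \<le> C * (n2 \<zeta>)^2"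
  proof -
    have "\<bar>wform \<theta> \<psi> ?\<kappa>\<bar> \<le> (LINT x|L \<Omega>. \<bar>\<theta> x * \<psi> x * ?\<kappa> x\<bar>)"
      unfolding wform_def by (rule integral_abs_bound)
    also have "\<dots> \<le> (LINT x|L \<Omega>. C * (\<zeta> x)^2)"
    proof (rule integral_mono_AE)
      show "integrable (L \<Omega>) (\<lambda>x. \<bar>\<theta> x * \<psi> x * ?\<kappa> x\<bar>)" using wform_integrable[OF \<theta> S(1,2)] by simp
      show "integrable (L \<Omega>) (\<lambda>x. C * (\<zeta> x)^2)" using sqintD(2)[OF test_fun_sqint(1)[OF \<zeta> open_dom]] by simp
      show "AE x in L \<Omega>. \<bar>\<theta> x * \<psi> x * ?\<kappa> x\<bar> \<le> C * (\<zeta> x)^2"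
        using C(1)
      proof eventually_elim
        case (elim x)
        have p0: "\<psi> x + \<delta> > 0" using \<psi>(2)[of x] \<delta> by linarith
        have "\<psi> x * inverse (\<psi> x + \<delta>) \<le> 1" using p0 \<delta> by (simp add: divide_inverse[symmetric])
        then have "(\<psi> x * inverse (\<psi> x + \<delta>)) * (\<zeta> x)^2 \<le> 1 * (\<zeta> x)^2" by (rule mult_right_mono) simp
        moreover have "\<psi> x * ?\<kappa> x = (\<psi> x * inverse (\<psi> x + \<delta>)) * (\<zeta> x)^2" by (simp add: logtest_def power2_eq_square)
        moreover have "0 \<le> (\<psi> x * inverse (\<psi> x + \<delta>)) * (\<zeta> x)^2" using \<psi>(2)[of x] p0 by simp
        ultimately have "\<bar>\<psi> x * ?\<kappa> x\<bar> \<le> (\<zeta> x)^2" by (simp only: abs_of_nonneg mult_1_left)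
        then have "\<bar>\<theta> x\<bar> * \<bar>\<psi> x * ?\<kappa> x\<bar> \<le> C * (\<zeta> x)^2" using elim C(2) by (intro mult_mono) simp_all
        then show ?case by (simp add: abs_mult mult.assoc)
      qed
    qed
    also have "\<dots> = C * (n2 \<zeta>)^2" by (simp add: l2n_power2)
    finally show ?thesis .
  qed
  have b3: "\<bar>wform \<theta> (\<lambda>x. \<psi> x - v x) ?\<kappa>\<bar> \<le> C * n2 (\<lambda>x. \<psi> x - v x) * n2 ?\<kappa>"
    by (rule wform_bound[OF \<theta> C S(4,2)])
  have b4: "\<bar>ip (\<lambda>x. \<psi> x - v x) ?\<kappa>\<bar> \<le> hn (\<lambda>x. \<psi> x - v x) * hn ?\<kappa>"
    by (rule ip_Cauchy_Schwarz[OF dH H(2)])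
  have combine: "w \<le> 4 * g + 2 * C * z + 2 * (h + a)"
    if "d = p - q" "y = r - q" "w = 2 * l - p" "2 * l \<le> 2 * g + w / 2" and ab: "\<bar>r\<bar> \<le> C * z" "\<bar>y\<bar> \<le> a" "\<bar>d\<bar> \<le> h"
    for w g z h a d p q y r l :: real
  proof -
    have "r \<le> C * z" "- r \<le> C * z" "y \<le> a" "- y \<le> a" "d \<le> h" "- d \<le> h" using ab by (simp_all only: abs_le_iff)
    then have "2 * l - p \<le> 2 * g + w / 2 + h + C * z + a" using that(1,2,4) by argo
    then show ?thesis using that(3) by argo
  qed
  show ?thesis
    by (rule combine[OF i1[unfolded eq[OF H(2)]] i2 i3 b1 b2 b3 b4])
qed

text \<open>The bound deteriorates as \<delta> tends to 0 but stays bounded along approximations of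
  \<open>v\<close> for each fixed \<delta>, which is enough for the error terms of
  \<open>log_energy\<close> to vanish.\<close>

lemma hn_logtest:
  assumes \<psi>: "test_fun \<Omega> \<psi>" "\<And>x. \<psi> x \<ge> 0" and \<zeta>: "test_fun \<Omega> \<zeta>" and \<delta>: "\<delta> > 0" and B: "\<And>x. \<bar>\<zeta> x\<bar> \<le> B"
  shows "hn (logtest \<psi> \<zeta> \<delta>) \<le> 2 * (B / \<delta>) * n2 (cgrad \<zeta>) + (B / \<delta>)^2 * hn \<psi>"
proof -
  let ?q = "\<lambda>x. \<zeta> x * inverse (\<psi> x + \<delta>)"
  note p = logtest_props[OF \<psi> \<zeta> \<delta>]
  have B0: "B \<ge> 0" using B[of 0] by linarith
  have q: "\<bar>?q x\<bar> \<le> B / \<delta>" for x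
  proof -
    have "inverse (\<psi> x + \<delta>) \<le> inverse \<delta>" using \<psi>(2)[of x] \<delta> by (intro le_imp_inverse_le) simp_all
    moreover have "0 < inverse (\<psi> x + \<delta>)" using \<psi>(2)[of x] \<delta> by simp
    ultimately have "\<bar>\<zeta> x\<bar> * \<bar>inverse (\<psi> x + \<delta>)\<bar> \<le> B * inverse \<delta>"
      using B[of x] B0 by (intro mult_mono) simp_all
    then show ?thesis by (simp only: abs_mult divide_inverse)
  qed
  have q0: "B / \<delta> \<ge> 0" using B0 \<delta> by simp
  note g\<zeta> = test_fun_sqint(2)[OF \<zeta> open_dom] and g\<psi> = test_fun_sqint(2)[OF \<psi>(1) open_dom] and g\<kappa> = test_fun_sqint(2)[OF p(1) open_dom]
  have aS: "(\<lambda>x. norm (F x)) \<in> S2" "n2 (\<lambda>x. norm (F x)) = n2 F" if "F \<in> S2" for F :: "real^'n \<Rightarrow> real^'n"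
    using that by (auto simp: sqint_def l2n_def)
  have bS: "(\<lambda>x. 2 * (B / \<delta>) * norm (cgrad \<zeta> x)) \<in> S2" "(\<lambda>x. (B / \<delta>)^2 * norm (cgrad \<psi> x)) \<in> S2"
    by (rule sqint_cmult[OF aS(1)[OF g\<zeta>]], rule sqint_cmult[OF aS(1)[OF g\<psi>]])
  have W: "norm (loggrad \<psi> \<zeta> \<delta> x) \<le> (B / \<delta>) * norm (cgrad \<psi> x)" for x
    unfolding loggrad_def norm_scaleR by (rule mult_right_mono[OF q]) simp
  have pt: "norm (cgrad (logtest \<psi> \<zeta> \<delta>) x) \<le> norm (2 * (B / \<delta>) * norm (cgrad \<zeta> x) + (B / \<delta>)^2 * norm (cgrad \<psi> x))" for x
  proof -
    have "norm (cgrad (logtest \<psi> \<zeta> \<delta>) x) \<le> norm ((2 * ?q x) *\<^sub>R cgrad \<zeta> x) + norm (?q x *\<^sub>R loggrad \<psi> \<zeta> \<delta> x)"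
      unfolding p(2) by (rule norm_triangle_ineq4)
    also have "norm ((2 * ?q x) *\<^sub>R cgrad \<zeta> x) \<le> 2 * (B / \<delta>) * norm (cgrad \<zeta> x)"
    proof -
      have "\<bar>2 * ?q x\<bar> \<le> 2 * (B / \<delta>)" using q[of x] by linarith
      then show ?thesis unfolding norm_scaleR by (rule mult_right_mono) simp
    qed
    also have "norm (?q x *\<^sub>R loggrad \<psi> \<zeta> \<delta> x) \<le> (B / \<delta>) * ((B / \<delta>) * norm (cgrad \<psi> x))"
      unfolding norm_scaleR by (rule mult_mono[OF q W q0]) simp
    finally have "norm (cgrad (logtest \<psi> \<zeta> \<delta>) x) \<le> 2 * (B / \<delta>) * norm (cgrad \<zeta> x) + (B / \<delta>)^2 * norm (cgrad \<psi> x)"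
      by (simp only: power2_eq_square mult.assoc add_left_mono)
    then show ?thesis by simp
  qed
  have "n2 (cgrad (logtest \<psi> \<zeta> \<delta>)) \<le> n2 (\<lambda>x. 2 * (B / \<delta>) * norm (cgrad \<zeta> x) + (B / \<delta>)^2 * norm (cgrad \<psi> x))"
    by (rule sqint_dominated(2)[OF sqint_add[OF bS] sqintD(1)[OF g\<kappa>] AE_I2]) (rule pt)
  also have "\<dots> \<le> n2 (\<lambda>x. 2 * (B / \<delta>) * norm (cgrad \<zeta> x)) + n2 (\<lambda>x. (B / \<delta>)^2 * norm (cgrad \<psi> x))"
    by (rule l2n_triangle[OF bS])
  also have "\<dots> = 2 * (B / \<delta>) * n2 (cgrad \<zeta>) + (B / \<delta>)^2 * n2 (cgrad \<psi>)"
    unfolding l2n_cmult aS(2)[OF g\<zeta>] aS(2)[OF g\<psi>] using q0 by (simp only: abs_mult abs_power2 abs_numeral abs_of_nonneg)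
  finally show ?thesis by (simp add: hn_test_fun[OF p(1)] hn_test_fun[OF \<psi>(1)])
qed

end

lemma AE_lborel_shift:
  fixes P :: "'a::euclidean_space \<Rightarrow> bool"
  assumes "AE x in lborel. P x"
  shows "AE x in lborel. P (x + c)"
proof -
  obtain N where N: "{x \<in> space lborel. \<not> P x} \<subseteq> N" "N \<in> null_sets lborel"
    using assms by (auto simp: eventually_ae_filter)
  have m: "indicator N \<in> borel_measurable (borel :: 'a measure)" using N(2) by auto
  have "(\<integral>\<^sup>+x. indicator N (x + c) \<partial>lborel) = (\<integral>\<^sup>+x. indicator N x \<partial>lborel)"
    by (rule nn_integral_lborel_shift[OF m])
  also have "\<dots> = 0" using nn_integral_indicator[of N lborel] N(2) by (simp add: null_sets_def)
  finally have z: "(\<integral>\<^sup>+x. indicator N (x + c) \<partial>lborel) = 0" .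
  have "(\<lambda>x. indicator N (x + c) :: ennreal) \<in> borel_measurable lborel"
    by (rule measurable_compose[OF _ m]) simp
  from nn_integral_0_iff_AE[OF this] z have "AE x in lborel. indicator N (x + c) = (0::ennreal)" by simp
  then show ?thesis
  proof eventually_elim
    case (elim x)
    then have "x + c \<notin> N" by (auto simp: indicator_def split: if_splits)
    then show ?case using N(1) by auto
  qed
qed

lemma AE_lebesgue_on_iff_lborel:
  assumes "\<Omega> \<in> sets lebesgue"
  shows "(AE x in L \<Omega>. P x) \<longleftrightarrow> (AE x in lborel. x \<in> \<Omega> \<longrightarrow> P x)"
  using assms by (simp add: AE_restrict_space_iff AE_completion_iff)

text \<open>Countably many of the balls already cover the set, by Lindelof, so the exceptional null
  sets add up to a null set.\<close>

lemma AE_open_locally: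
  fixes \<Omega> :: "'a::euclidean_space set"
  assumes "\<And>x. x \<in> \<Omega> \<Longrightarrow> \<exists>\<rho>>0. AE z in lborel. z \<in> ball x \<rho> \<longrightarrow> Q z"
  shows "AE z in lborel. z \<in> \<Omega> \<longrightarrow> Q z"
proof -
  let ?F = "{U. open U \<and> (AE z in lborel. z \<in> U \<longrightarrow> Q z)}"
  obtain F' where F': "F' \<subseteq> ?F" "countable F'" "\<Union>F' = \<Union>?F"
    using Lindelof[of ?F] by auto
  have cover: "\<Omega> \<subseteq> \<Union>F'"
  proof
    fix x assume "x \<in> \<Omega>"
    then obtain \<rho> where "\<rho> > 0" "AE z in lborel. z \<in> ball x \<rho> \<longrightarrow> Q z" using assms by blast
    then have "ball x \<rho> \<in> ?F" "x \<in> ball x \<rho>" by simp_all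
    then show "x \<in> \<Union>F'" unfolding F'(3) by blast
  qed
  have "AE z in lborel. \<forall>U\<in>F'. z \<in> U \<longrightarrow> Q z"
    using F' by (subst AE_ball_countable) auto
  then show ?thesis by eventually_elim (use cover in blast)
qed

lemma log_gap_at_top:
  assumes "b > (0::real)"
  shows "filterlim (\<lambda>n. (ln (b + inverse (real (Suc n))) - ln (0 + inverse (real (Suc n))))^2) at_top sequentially"
proof (rule filterlim_pow_at_top)
  have F: "filterlim (\<lambda>n. ln (real (Suc n))) at_top sequentially"
    by (rule filterlim_compose[OF ln_at_top filterlim_compose[OF filterlim_real_sequentially filterlim_Suc]])
  have "filterlim (\<lambda>n. ln b + ln (real (Suc n))) at_top sequentially"
    by (rule filterlim_tendsto_add_at_top[OF tendsto_const F])
  then show "filterlim (\<lambda>n. ln (b + inverse (real (Suc n))) - ln (0 + inverse (real (Suc n)))) at_top sequentially"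
  proof (rule filterlim_at_top_mono, intro always_eventually allI)
    fix n
    have "ln b \<le> ln (b + inverse (real (Suc n)))" using assms by (intro ln_mono) (simp_all add: add_pos_pos)
    moreover have "ln (0 + inverse (real (Suc n))) = - ln (real (Suc n))" by (simp add: ln_inverse del: of_nat_Suc)
    ultimately show "ln b + ln (real (Suc n)) \<le> ln (b + inverse (real (Suc n))) - ln (0 + inverse (real (Suc n)))" by linarith
  qed
qed simp

section \<open>Local positivity and the maximum principle\<close>

context bounded_open
begin

text \<open>\<open>shift_estimate\<close> for ln(\<psi> + \<delta>): segments that start in the ball
  of radius r stay in the one of radius 2r, where the cutoff is bounded below, so its gradient is
  controlled by \<open>loggrad\<close> up to the factor 1/c.\<close>

lemma log_shift_bound:
  assumes \<psi>: "test_fun \<Omega> \<psi>" "\<And>x. \<psi> x \<ge> 0" and \<zeta>: "test_fun \<Omega> \<zeta>" and \<delta>: "\<delta> > 0"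
    and c: "c > 0" "\<And>x. x \<in> ball x0 (2 * r) \<Longrightarrow> c \<le> (\<zeta> x)^2" and y: "norm y < r"
  shows "(\<integral>\<^sup>+x. ennreal ((ln (\<psi> (x + y) + \<delta>) - ln (\<psi> x + \<delta>))^2) * indicator (ball x0 r) x \<partial>lborel)
    \<le> ennreal (r^2 * (inverse c * (n2 (loggrad \<psi> \<zeta> \<delta>))^2))"
proof -
  note s\<psi> = test_funD(1)[OF \<psi>(1)]
  note p = logtest_props[OF \<psi> \<zeta> \<delta>]
  have pos: "\<psi> x + \<delta> > 0" for x using \<psi>(2)[of x] \<delta> by linarith
  have nz: "\<psi> x + \<delta> \<noteq> 0" for x using pos[of x] by simp
  define G where "G x = inverse (\<psi> x + \<delta>) *\<^sub>R cgrad \<psi> x" for x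
  have D: "((\<lambda>x. ln (\<psi> x + \<delta>)) has_derivative (\<lambda>h. G x \<bullet> h)) (at x)" for x
  proof -
    have "((\<lambda>t. t + \<delta>) has_real_derivative 1) (at (\<psi> x))" by (auto intro!: derivative_eq_intros)
    from DERIV_chain2[OF DERIV_ln[OF pos] this]
    have "((\<lambda>t. ln (t + \<delta>)) has_derivative (\<lambda>h. inverse (\<psi> x + \<delta>) * h)) (at (\<psi> x))"
      by (simp add: has_field_derivative_def)
    from has_derivative_compose[OF smooth_has_derivative[OF s\<psi>] this]
    show ?thesis by (simp add: G_def)
  qed
  have Gc: "continuous_on UNIV G"
    unfolding G_def[abs_def]
    by (intro continuous_on_scaleR continuous_on_inverse continuous_on_add continuous_on_const smooth_continuous[OF s\<psi>] cgrad_continuous[OF s\<psi>])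
      (use nz in blast)
  have Wm: "loggrad \<psi> \<zeta> \<delta> \<in> borel_measurable borel" by (rule borel_measurable_continuous_onI[OF p(4)])
  have Wz: "loggrad \<psi> \<zeta> \<delta> x = 0" if "x \<notin> \<Omega>" for x
    using test_fun_outside[OF \<zeta> that] by (simp add: loggrad_def)
  have WL: "loggrad \<psi> \<zeta> \<delta> \<in> sqint lborel" "l2n lborel (loggrad \<psi> \<zeta> \<delta>) = n2 (loggrad \<psi> \<zeta> \<delta>)"
  proof -
    have m: "(\<lambda>x. (norm (loggrad \<psi> \<zeta> \<delta> x))^2) \<in> borel_measurable borel" using Wm by measurable
    have z: "(norm (loggrad \<psi> \<zeta> \<delta> x))^2 = 0" if "x \<notin> \<Omega>" for x using Wz[OF that] by simp
    show "loggrad \<psi> \<zeta> \<delta> \<in> sqint lborel"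
      using lebesgue_on_integral_borel(1)[OF m open_dom z] p(3) Wm by (simp add: sqint_def)
    show "l2n lborel (loggrad \<psi> \<zeta> \<delta>) = n2 (loggrad \<psi> \<zeta> \<delta>)"
      using lebesgue_on_integral_borel(2)[OF m open_dom z] by (simp add: l2n_def)
  qed
  have "(\<integral>\<^sup>+x. ennreal ((ln (\<psi> (x + y) + \<delta>) - ln (\<psi> x + \<delta>))^2) * indicator (ball x0 r) x \<partial>lborel)
    \<le> ennreal ((norm y)^2) * (\<integral>\<^sup>+x. ennreal ((norm (G x))^2) * indicator (ball x0 (2 * r)) x \<partial>lborel)"
  proof (rule shift_estimate[OF D Gc])
    fix x and s :: real assume x: "x \<in> ball x0 r" and s: "0 \<le> s" "s \<le> 1"
    have "norm (s *\<^sub>R y) \<le> norm y" using s by (simp add: mult_left_le_one_le)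
    then have "dist x0 (x + s *\<^sub>R y) < r + r"
      using x y norm_triangle_ineq4[of "x0 - x" "s *\<^sub>R y"] by (simp add: dist_norm diff_diff_eq)
    then show "x + s *\<^sub>R y \<in> ball x0 (2 * r)" by simp
  qed simp_all
  also have "(\<integral>\<^sup>+x. ennreal ((norm (G x))^2) * indicator (ball x0 (2 * r)) x \<partial>lborel)
      \<le> (\<integral>\<^sup>+x. ennreal (inverse c) * ennreal ((norm (loggrad \<psi> \<zeta> \<delta> x))^2) \<partial>lborel)"
  proof (rule nn_integral_mono)
    fix x
    show "ennreal ((norm (G x))^2) * indicator (ball x0 (2 * r)) x \<le> ennreal (inverse c) * ennreal ((norm (loggrad \<psi> \<zeta> \<delta> x))^2)"
    proof (cases "x \<in> ball x0 (2 * r)")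
      case True
      have "loggrad \<psi> \<zeta> \<delta> x = \<zeta> x *\<^sub>R G x" by (simp add: loggrad_def G_def)
      then have "(norm (loggrad \<psi> \<zeta> \<delta> x))^2 = (\<zeta> x)^2 * (norm (G x))^2" by (simp add: power_mult_distrib)
      moreover have "c * (norm (G x))^2 \<le> (\<zeta> x)^2 * (norm (G x))^2" by (rule mult_right_mono[OF c(2)[OF True]]) simp
      ultimately have "c * (norm (G x))^2 \<le> (norm (loggrad \<psi> \<zeta> \<delta> x))^2" by simp
      then have "inverse c * (c * (norm (G x))^2) \<le> inverse c * (norm (loggrad \<psi> \<zeta> \<delta> x))^2"
        using c(1) by (intro mult_left_mono) simp_all
      moreover have "inverse c * (c * (norm (G x))^2) = (norm (G x))^2" using c(1) by simp
      ultimately have "(norm (G x))^2 \<le> inverse c * (norm (loggrad \<psi> \<zeta> \<delta> x))^2" by (simp only:)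
      then have "ennreal ((norm (G x))^2) \<le> ennreal (inverse c * (norm (loggrad \<psi> \<zeta> \<delta> x))^2)" by (rule ennreal_leI)
      then show ?thesis using True c(1) by (simp add: ennreal_mult)
    qed simp
  qed
  also have "\<dots> = ennreal (inverse c) * ennreal ((n2 (loggrad \<psi> \<zeta> \<delta>))^2)"
    using Wm l2n_nn_integral[OF WL(1)] unfolding WL(2) by (subst nn_integral_cmult) simp_all
  also have "ennreal ((norm y)^2) * (ennreal (inverse c) * ennreal ((n2 (loggrad \<psi> \<zeta> \<delta>))^2))
      \<le> ennreal (r^2) * (ennreal (inverse c) * ennreal ((n2 (loggrad \<psi> \<zeta> \<delta>))^2))"
    using y by (intro mult_right_mono ennreal_leI power_mono) simp_all
  also have "\<dots> = ennreal (r^2 * (inverse c * (n2 (loggrad \<psi> \<zeta> \<delta>))^2))"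
    using c(1) by (simp add: ennreal_mult)
  finally show ?thesis by (simp add: mult_left_mono)
qed

text \<open>The order of limits matters: for fixed \<delta> the approximation is refined until the
  error drops below 1, and the resulting bound contains no \<delta>, which may then tend to
  0.\<close>

lemma log_energy_eventually:
  assumes v: "v \<in> H01 \<Omega>" and eq: "\<And>\<phi>. \<phi> \<in> H01 \<Omega> \<Longrightarrow> ip v \<phi> = wform \<theta> v \<phi>"
    and \<theta>: "\<theta> \<in> Linf \<Omega>" and C: "AE x in L \<Omega>. \<bar>\<theta> x\<bar> \<le> C" "C \<ge> 0"
    and \<psi>: "\<And>k. test_fun \<Omega> (\<psi> k)" "\<And>k x. \<psi> k x \<ge> 0" "(\<lambda>k. hn (\<lambda>x. \<psi> k x - v x)) \<longlonglongrightarrow> 0"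
    and \<zeta>: "test_fun \<Omega> \<zeta>" and \<delta>: "\<delta> > 0"
  shows "\<forall>\<^sub>F k in sequentially. (n2 (loggrad (\<psi> k) \<zeta> \<delta>))^2 \<le> 4 * (n2 (cgrad \<zeta>))^2 + 2 * C * (n2 \<zeta>)^2 + 1"
proof -
  obtain B where B: "\<And>x. \<bar>\<zeta> x\<bar> \<le> B"
    by (rule smooth_compact.bounded_values[OF smooth_compact.intro[OF test_fun_mono[OF \<zeta> subset_UNIV]]], rule that)
  obtain P where P: "P > 0" "\<And>u. u \<in> H01 \<Omega> \<Longrightarrow> n2 u \<le> P * hn u" by (rule Poincare, rule that)
  have \<psi>H: "\<psi> k \<in> H01 \<Omega>" for k by (rule H01_test_fun(1)[OF \<psi>(1)])
  have hl: "(\<lambda>k. hn (\<psi> k)) \<longlonglongrightarrow> hn v" by (rule hn_tendsto[OF \<psi>H v \<psi>(3)])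
  have nl: "(\<lambda>k. n2 (\<lambda>x. \<psi> k x - v x)) \<longlonglongrightarrow> 0" by (rule hn_conv_imp_n2_conv[OF \<psi>H v \<psi>(3)])
  define M where "M k = 2 * (B / \<delta>) * n2 (cgrad \<zeta>) + (B / \<delta>)^2 * hn (\<psi> k)" for k
  have Ml: "M \<longlonglongrightarrow> 2 * (B / \<delta>) * n2 (cgrad \<zeta>) + (B / \<delta>)^2 * hn v"
    unfolding M_def[abs_def] by (intro tendsto_add tendsto_mult tendsto_const hl)
  define R where "R k = hn (\<lambda>x. \<psi> k x - v x) * M k + C * n2 (\<lambda>x. \<psi> k x - v x) * (P * M k)" for k
  have "R \<longlonglongrightarrow> 0 * (2 * (B / \<delta>) * n2 (cgrad \<zeta>) + (B / \<delta>)^2 * hn v) + C * 0 * (P * (2 * (B / \<delta>) * n2 (cgrad \<zeta>) + (B / \<delta>)^2 * hn v))"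
    unfolding R_def[abs_def] by (intro tendsto_add tendsto_mult tendsto_const \<psi>(3) nl Ml)
  then have "R \<longlonglongrightarrow> 0" by simp
  then have "\<forall>\<^sub>F k in sequentially. R k < 1/2" by (rule order_tendstoD(2)) simp
  then show ?thesis
  proof eventually_elim
    case (elim k)
    have 1: "hn (logtest (\<psi> k) \<zeta> \<delta>) \<le> M k" unfolding M_def by (rule hn_logtest[OF \<psi>(1,2) \<zeta> \<delta> B])
    have "n2 (logtest (\<psi> k) \<zeta> \<delta>) \<le> P * hn (logtest (\<psi> k) \<zeta> \<delta>)"
      by (rule P(2)[OF H01_test_fun(1)[OF logtest_props(1)[OF \<psi>(1,2) \<zeta> \<delta>]]])
    also have "\<dots> \<le> P * M k" using 1 P(1) by (intro mult_left_mono) simp_all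
    finally have 2: "n2 (logtest (\<psi> k) \<zeta> \<delta>) \<le> P * M k" .
    have 3: "hn (\<lambda>x. \<psi> k x - v x) * hn (logtest (\<psi> k) \<zeta> \<delta>) \<le> hn (\<lambda>x. \<psi> k x - v x) * M k"
      by (rule mult_left_mono[OF 1 hn_nonneg])
    have 4: "C * n2 (\<lambda>x. \<psi> k x - v x) * n2 (logtest (\<psi> k) \<zeta> \<delta>) \<le> C * n2 (\<lambda>x. \<psi> k x - v x) * (P * M k)"
      by (rule mult_left_mono[OF 2 mult_nonneg_nonneg[OF C(2) l2n_nonneg]])
    have 5: "(n2 (loggrad (\<psi> k) \<zeta> \<delta>))^2 \<le> 4 * (n2 (cgrad \<zeta>))^2 + 2 * C * (n2 \<zeta>)^2
      + 2 * (hn (\<lambda>x. \<psi> k x - v x) * hn (logtest (\<psi> k) \<zeta> \<delta>) + C * n2 (\<lambda>x. \<psi> k x - v x) * n2 (logtest (\<psi> k) \<zeta> \<delta>))"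
      by (rule log_energy[OF v eq \<theta> C \<psi>(1,2) \<zeta> \<delta>])
    have "w \<le> a + 1" if "w \<le> a + 2 * (x + y)" "x \<le> x'" "y \<le> y'" "x' + y' < 1/2" for w a x y x' y' :: real
      using that by argo
    from this[OF 5 3 4 elim[unfolded R_def]] show ?case .
  qed
qed

text \<open>If w vanishes at x and is positive at x + y, the gap between the logarithms there tends
  to infinity as \<delta> tends to 0, against the uniform bound on their L2 increments. Hence near
  any point almost no such pairs exist, and one typical zero forces w to vanish almost everywhere
  nearby.\<close>

lemma local_positivity_dichotomy:
  assumes v: "v \<in> H01 \<Omega>" and eq: "\<And>\<phi>. \<phi> \<in> H01 \<Omega> \<Longrightarrow> ip v \<phi> = wform \<theta> v \<phi>"
    and \<theta>: "\<theta> \<in> Linf \<Omega>" and nn: "AE x in L \<Omega>. v x \<ge> 0"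
  shows "\<exists>w. (AE x in L \<Omega>. w x = v x) \<and> (\<forall>x0\<in>\<Omega>. \<exists>\<rho>>0.
    (AE z in lborel. z \<in> ball x0 \<rho> \<longrightarrow> w z = 0) \<or> (AE z in lborel. z \<in> ball x0 \<rho> \<longrightarrow> w z > (0::real)))"
proof -
  obtain C where C: "C > 0" "AE x in L \<Omega>. \<bar>\<theta> x\<bar> \<le> C" by (rule LinfE[OF \<theta>], rule that)
  obtain \<psi>' where \<psi>': "\<And>k. test_fun \<Omega> (\<psi>' k)" "\<And>k x. \<psi>' k x \<ge> 0" "(\<lambda>k. hn (\<lambda>x. \<psi>' k x - v x)) \<longlonglongrightarrow> 0"
    by (rule nonneg_approx[OF v nn], rule that)
  have n': "(\<lambda>k. n2 (\<lambda>x. \<psi>' k x - v x)) \<longlonglongrightarrow> 0"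
    by (rule hn_conv_imp_n2_conv[OF H01_test_fun(1)[OF \<psi>'(1)] v \<psi>'(3)])
  obtain q where q: "strict_mono q" "AE x in L \<Omega>. (\<lambda>k. \<psi>' (q k) x) \<longlonglongrightarrow> v x"
    by (rule l2_convergence_AE_subseq[OF test_fun_sqint(1)[OF \<psi>'(1) open_dom] H01_S2[OF v] n'], rule that)
  define \<psi> where "\<psi> k = \<psi>' (q k)" for k
  have \<psi>: "test_fun \<Omega> (\<psi> k)" "\<psi> k x \<ge> 0" for k x unfolding \<psi>_def by (rule \<psi>')+
  have \<psi>l: "(\<lambda>k. hn (\<lambda>x. \<psi> k x - v x)) \<longlonglongrightarrow> 0"
    unfolding \<psi>_def by (rule n2_conv_subseq[OF q(1) \<psi>'(3)])
  have \<psi>m: "\<psi> k \<in> borel_measurable borel" for k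
    by (rule borel_measurable_continuous_onI[OF smooth_continuous[OF test_funD(1)[OF \<psi>(1)]]])
  \<comment> \<open>A Borel representative, since the argument evaluates w at x + y as a function on
    the product space and under translations.\<close>
  define w where "w x = lim (\<lambda>k. \<psi> k x)" for x
  have wm: "w \<in> borel_measurable borel" unfolding w_def[abs_def] by (rule borel_measurable_lim_metric[OF \<psi>m])
  have wv: "AE x in L \<Omega>. w x = v x"
    using q(2) unfolding w_def \<psi>_def by eventually_elim (rule limI)
  have "AE x in L \<Omega>. (\<lambda>k. \<psi> k x) \<longlonglongrightarrow> w x"
    using q(2) wv by eventually_elim (simp add: \<psi>_def)
  then have conv: "AE x in lborel. x \<in> \<Omega> \<longrightarrow> (\<lambda>k. \<psi> k x) \<longlonglongrightarrow> w x"
    by (simp only: AE_lebesgue_on_iff_lborel[OF dom_lebesgue])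
  have w0: "0 \<le> w x" if "(\<lambda>k. \<psi> k x) \<longlonglongrightarrow> w x" for x
    by (rule LIMSEQ_le_const[OF that]) (use \<psi>(2) in blast)
  have main: "\<exists>\<rho>>0. (AE z in lborel. z \<in> ball x0 \<rho> \<longrightarrow> w z = 0) \<or> (AE z in lborel. z \<in> ball x0 \<rho> \<longrightarrow> w z > 0)"
    if x0: "x0 \<in> \<Omega>" for x0
  proof -
    obtain a b where ab: "x0 \<in> box a b" "cbox a b \<subseteq> \<Omega>"
      using open_contains_cbox[THEN iffD1, OF open_dom] x0 by metis
    define \<zeta> where "\<zeta> = box_bump a b"
    have \<zeta>: "test_fun \<Omega> \<zeta>" unfolding \<zeta>_def by (rule test_fun_box_bump[OF ab(2)])
    have \<zeta>0: "\<zeta> x0 > 0" using ab(1) box_bump_pos[of a b x0] by (simp add: \<zeta>_def)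
    have "isCont \<zeta> x0"
      using smooth_continuous[OF test_funD(1)[OF \<zeta>]] by (simp add: continuous_on_eq_continuous_at)
    then obtain s where s: "s > 0" "\<And>x. dist x x0 < s \<Longrightarrow> dist (\<zeta> x) (\<zeta> x0) < \<zeta> x0 / 2"
      using \<zeta>0 unfolding continuous_at_eps_delta by (metis half_gt_zero)
    have \<zeta>lb: "\<zeta> x0 / 2 < \<zeta> x" if "x \<in> ball x0 s" for x
    proof -
      have "\<bar>\<zeta> x - \<zeta> x0\<bar> < \<zeta> x0 / 2"
        using s(2)[of x] that by (simp add: dist_commute[of x0] dist_real_def[of "\<zeta> x"])
      then show ?thesis by linarith
    qed
    \<comment> \<open>A point within r of \<open>x0\<close>, moved by less than r, must stay in the
      ball of radius s, where the cutoff is bounded below.\<close>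
    define r where "r = s / 3"
    have r: "r > 0" "3 * r = s" using s(1) by (simp_all add: r_def)
    have sub: "ball x0 s \<subseteq> \<Omega>"
    proof
      fix x assume "x \<in> ball x0 s"
      then have "\<zeta> x > 0" using \<zeta>lb[of x] \<zeta>0 by linarith
      then have "x \<in> box a b" using box_bump_pos[of a b x] by (simp add: \<zeta>_def)
      then show "x \<in> \<Omega>" using ab(2) box_subset_cbox by blast
    qed
    define c where "c = (\<zeta> x0 / 2)^2"
    have c: "c > 0" "c \<le> (\<zeta> x)^2" if "x \<in> ball x0 (2 * r)" for x
    proof -
      show "c > 0" using \<zeta>0 by (simp add: c_def)
      have "x \<in> ball x0 s" using that r by auto
      then show "c \<le> (\<zeta> x)^2" unfolding c_def using \<zeta>lb[of x] \<zeta>0 by (intro power_mono) simp_all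
    qed
    have c0: "c > 0" using \<zeta>0 by (simp add: c_def)
    define E where "E = 4 * (n2 (cgrad \<zeta>))^2 + 2 * C * (n2 \<zeta>)^2 + 1"
    define T where "T = r^2 * (inverse c * E)"
    let ?A = "ball x0 r"
    have [measurable]: "?A \<in> sets borel" "ball 0 r \<in> sets (borel :: (real^'n) measure)" by simp_all
    have wm' [measurable]: "w \<in> borel_measurable borel" by (rule wm)
    have bound: "(\<integral>\<^sup>+x. ennreal ((ln (w (x + y) + \<delta>) - ln (w x + \<delta>))^2) * indicator ?A x \<partial>lborel) \<le> ennreal T"
      if y: "norm y < r" and \<delta>: "\<delta> > 0" for y \<delta>
    proof -
      have "(\<integral>\<^sup>+x. ennreal ((ln (w (x + y) + \<delta>) - ln (w x + \<delta>))^2) * indicator ?A x \<partial>lborel)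
          = (\<integral>\<^sup>+x. liminf (\<lambda>k. ennreal ((ln (\<psi> k (x + y) + \<delta>) - ln (\<psi> k x + \<delta>))^2) * indicator ?A x) \<partial>lborel)"
      proof (rule nn_integral_cong_AE, use conv AE_lborel_shift[OF conv, of y] in eventually_elim)
        case (elim x)
        show ?case
        proof (cases "x \<in> ?A")
          case True
          have "x \<in> ball x0 s" "x + y \<in> ball x0 s"
          proof -
            show "x \<in> ball x0 s" using True r by auto
            have "dist x0 (x + y) < r + r"
              using True y norm_triangle_ineq4[of "x0 - x" y] by (simp add: dist_norm diff_diff_eq)
            then show "x + y \<in> ball x0 s" using r by simp
          qed
          then have l: "(\<lambda>k. \<psi> k x) \<longlonglongrightarrow> w x" "(\<lambda>k. \<psi> k (x + y)) \<longlonglongrightarrow> w (x + y)" using elim sub by blast+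
          have p: "w x + \<delta> \<noteq> 0" "w (x + y) + \<delta> \<noteq> 0" using w0[OF l(1)] w0[OF l(2)] \<delta> by linarith+
          have "(\<lambda>k. ennreal ((ln (\<psi> k (x + y) + \<delta>) - ln (\<psi> k x + \<delta>))^2)) \<longlonglongrightarrow> ennreal ((ln (w (x + y) + \<delta>) - ln (w x + \<delta>))^2)"
            by (intro tendsto_ennrealI tendsto_power tendsto_diff tendsto_ln tendsto_add tendsto_const l p)
          from lim_imp_Liminf[OF _ this] True show ?thesis by simp
        next
          case False
          have "liminf (\<lambda>k::nat. 0::ennreal) = 0" by (rule lim_imp_Liminf[OF _ tendsto_const]) simp
          then show ?thesis using False by simp
        qed
      qed
      also have "\<dots> \<le> liminf (\<lambda>k. \<integral>\<^sup>+x. ennreal ((ln (\<psi> k (x + y) + \<delta>) - ln (\<psi> k x + \<delta>))^2) * indicator ?A x \<partial>lborel)"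
        by (rule nn_integral_liminf) (use \<psi>m in measurable)
      also have "\<dots> \<le> ennreal T"
      proof (rule Liminf_le)
        have ev: "\<forall>\<^sub>F k in sequentially. (n2 (loggrad (\<psi> k) \<zeta> \<delta>))^2 \<le> E"
          unfolding E_def by (rule log_energy_eventually[OF v eq \<theta> C(2) less_imp_le[OF C(1)] \<psi>(1,2) \<psi>l \<zeta> \<delta>])
        show "\<forall>\<^sub>F k in sequentially. (\<integral>\<^sup>+x. ennreal ((ln (\<psi> k (x + y) + \<delta>) - ln (\<psi> k x + \<delta>))^2) * indicator ?A x \<partial>lborel) \<le> ennreal T"
          using ev
        proof eventually_elim
          case (elim k)
          have "(\<integral>\<^sup>+x. ennreal ((ln (\<psi> k (x + y) + \<delta>) - ln (\<psi> k x + \<delta>))^2) * indicator ?A x \<partial>lborel)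
              \<le> ennreal (r^2 * (inverse c * (n2 (loggrad (\<psi> k) \<zeta> \<delta>))^2))"
            by (rule log_shift_bound[OF \<psi>(1,2) \<zeta> \<delta> c0 c(2) y])
          also have "\<dots> \<le> ennreal T"
            unfolding T_def using elim c0 by (intro ennreal_leI mult_left_mono) simp_all
          finally show ?case .
        qed
      qed simp
      finally show ?thesis .
    qed
    \<comment> \<open>Fatou along \<delta> = 1/(n+1): on bad points the integrand tends to infinity
      while the integrals stay below \<open>T\<close>.\<close>
    have nobad: "AE x in lborel. \<not> (x \<in> ?A \<and> w x = 0 \<and> w (x + y) > 0)" if y: "norm y < r" for y
    proof -
      let ?h = "\<lambda>n x. ennreal ((ln (w (x + y) + inverse (real (Suc n))) - ln (w x + inverse (real (Suc n))))^2) * indicator ?A x"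
      have "(\<integral>\<^sup>+x. liminf (\<lambda>n. ?h n x) \<partial>lborel) \<le> liminf (\<lambda>n. \<integral>\<^sup>+x. ?h n x \<partial>lborel)"
        by (rule nn_integral_liminf) measurable
      also have "\<dots> \<le> ennreal T"
        by (rule Liminf_le) (use bound[OF y] in \<open>auto intro!: always_eventually\<close>)
      finally have "(\<integral>\<^sup>+x. liminf (\<lambda>n. ?h n x) \<partial>lborel) \<noteq> \<infinity>" by (auto simp: top_unique)
      then have "AE x in lborel. liminf (\<lambda>n. ?h n x) \<noteq> \<infinity>"
        by (intro nn_integral_PInf_AE) measurable
      then show ?thesis
      proof eventually_elim
        case (elim x)
        show ?case
        proof
          assume b: "x \<in> ?A \<and> w x = 0 \<and> w (x + y) > 0"
          have "(\<lambda>n. ennreal ((ln (w (x + y) + inverse (real (Suc n))) - ln (0 + inverse (real (Suc n))))^2)) \<longlonglongrightarrow> \<infinity>"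
            unfolding infinity_ennreal_def ennreal_tendsto_top_eq_at_top by (rule log_gap_at_top) (use b in blast)
          then have "(\<lambda>n. ?h n x) \<longlonglongrightarrow> \<infinity>" using b by simp
          from lim_imp_Liminf[OF _ this] elim show False by simp
        qed
      qed
    qed
    \<comment> \<open>The indicator of bad pairs. Exchanging the integrals turns "for every y,
      almost no x" into "for almost every x, almost no y".\<close>
    define J where "J x y = (indicator ?A x * indicator {0} (w x) * (indicator (ball 0 r) y * indicator {0<..} (w (x + y))) :: ennreal)" for x y
    have Jm: "case_prod J \<in> borel_measurable (lborel \<Otimes>\<^sub>M lborel)"
      unfolding J_def[abs_def] by measurable
    have "(\<integral>\<^sup>+x. (\<integral>\<^sup>+y. J x y \<partial>lborel) \<partial>lborel) = (\<integral>\<^sup>+y. (\<integral>\<^sup>+x. J x y \<partial>lborel) \<partial>lborel)"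
      by (rule lborel_pair.Fubini'[symmetric, OF Jm])
    also have "\<dots> = (\<integral>\<^sup>+y. 0 \<partial>(lborel :: (real^'n) measure))"
    proof (rule nn_integral_cong)
      fix y :: "real^'n"
      show "(\<integral>\<^sup>+x. J x y \<partial>lborel) = 0"
      proof (cases "norm y < r")
        case True
        have "(\<integral>\<^sup>+x. J x y \<partial>lborel) = (\<integral>\<^sup>+x. 0 \<partial>(lborel :: (real^'n) measure))"
          by (rule nn_integral_cong_AE, use nobad[OF True] in eventually_elim) (auto simp: J_def indicator_def)
        then show ?thesis by simp
      next
        case False
        then show ?thesis by (simp add: J_def)
      qed
    qed
    finally have z: "(\<integral>\<^sup>+x. (\<integral>\<^sup>+y. J x y \<partial>lborel) \<partial>lborel) = 0" by simp
    have m1: "(\<lambda>x. \<integral>\<^sup>+y. J x y \<partial>lborel) \<in> borel_measurable lborel"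
      by (rule lborel.borel_measurable_nn_integral[OF Jm])
    from nn_integral_0_iff_AE[OF m1] z have AEJ: "AE x in lborel. (\<integral>\<^sup>+y. J x y \<partial>lborel) = 0" by simp
    show ?thesis
    proof (cases "AE z in lborel. z \<in> ball x0 (r/2) \<longrightarrow> w z \<noteq> 0")
      case True
      have "AE z in lborel. z \<in> ball x0 (r/2) \<longrightarrow> w z > 0"
        using True conv
      proof eventually_elim
        case (elim z)
        show ?case
        proof
          assume zb: "z \<in> ball x0 (r/2)"
          then have "z \<in> ball x0 s" using r by auto
          then have "0 \<le> w z" using elim(2) sub w0 by blast
          then show "w z > 0" using elim(1) zb by simp
        qed
      qed
      then show ?thesis using r(1) by (intro exI[of _ "r/2"]) simp
    next
      case False
      \<comment> \<open>Either w is nonzero almost everywhere on the half ball or some zero avoids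
        the exceptional null set. Two points of the half ball differ by less than r, so that zero
        reaches the whole half ball.\<close>
      have "\<exists>x. x \<in> ball x0 (r/2) \<and> w x = 0 \<and> (\<integral>\<^sup>+y. J x y \<partial>lborel) = 0"
      proof (rule ccontr)
        assume n: "\<not> ?thesis"
        have "AE z in lborel. z \<in> ball x0 (r/2) \<longrightarrow> w z \<noteq> 0"
          using AEJ by eventually_elim (use n in blast)
        then show False using False by simp
      qed
      then obtain x where x: "x \<in> ball x0 (r/2)" "w x = 0" "(\<integral>\<^sup>+y. J x y \<partial>lborel) = 0" by blast
      have xA: "x \<in> ?A" using x(1) r(1) by auto
      have m2: "(\<lambda>y. J x y) \<in> borel_measurable lborel" unfolding J_def by measurable
      have "AE y in lborel. J x y = 0" using nn_integral_0_iff_AE[OF m2] x(3) by simp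
      from AE_lborel_shift[OF this, of "- x"]
      have "AE z in lborel. J x (z + - x) = 0" .
      then have "AE z in lborel. z \<in> ball x0 (r/2) \<longrightarrow> w z = 0"
        using conv
      proof eventually_elim
        case (elim z)
        show ?case
        proof
          assume zb: "z \<in> ball x0 (r/2)"
          have "dist z x < r/2 + r/2"
            using zb x(1) dist_triangle_less_add[of z x0 "r/2" x "r/2"] by (simp add: dist_commute)
          then have "z - x \<in> ball 0 r" by (simp add: dist_norm norm_minus_commute)
          then have "\<not> w z > 0" using elim(1) xA x(2) by (auto simp: J_def)
          moreover have "z \<in> ball x0 s" using zb r by auto
          then have "0 \<le> w z" using elim(2) sub w0 by blast
          ultimately show "w z = 0" by simp
        qed
      qed
      then show ?thesis using r(1) by (intro exI[of _ "r/2"]) simp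
    qed
  qed
  show ?thesis using wv main by blast
qed

text \<open>The points near which w vanishes and those near which it is positive form two open sets
  covering \<Omega>. They are disjoint because balls have positive measure, so connectedness leaves
  only one of them.\<close>

lemma strong_maximum_principle:
  assumes con: "connected \<Omega>"
    and v: "v \<in> H01 \<Omega>" and eq: "\<And>\<phi>. \<phi> \<in> H01 \<Omega> \<Longrightarrow> ip v \<phi> = wform \<theta> v \<phi>"
    and \<theta>: "\<theta> \<in> Linf \<Omega>" and nn: "AE x in L \<Omega>. v x \<ge> 0" and nz: "\<not> is_zero \<Omega> v"
  shows "AE x in L \<Omega>. v x > 0"
proof -
  obtain w where wv: "AE x in L \<Omega>. w x = v x"
    and loc: "\<And>x0. x0 \<in> \<Omega> \<Longrightarrow> \<exists>\<rho>>0. (AE z in lborel. z \<in> ball x0 \<rho> \<longrightarrow> w z = 0) \<or> (AE z in lborel. z \<in> ball x0 \<rho> \<longrightarrow> w z > (0::real))"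
    using local_positivity_dichotomy[OF v eq \<theta> nn] by blast
  define U where "U Q = {x \<in> \<Omega>. \<exists>\<rho>>0. AE z in lborel. z \<in> ball x \<rho> \<longrightarrow> Q (w z)}" for Q :: "real \<Rightarrow> bool"
  have oU: "open (U Q)" for Q
    unfolding open_contains_ball
  proof
    fix x assume "x \<in> U Q"
    then obtain \<rho> where \<rho>: "x \<in> \<Omega>" "\<rho> > 0" "AE z in lborel. z \<in> ball x \<rho> \<longrightarrow> Q (w z)" by (auto simp: U_def)
    obtain e where e: "e > 0" "ball x e \<subseteq> \<Omega>" using open_dom \<rho>(1) by (auto simp: open_contains_ball)
    have "ball x (min e (\<rho>/2)) \<subseteq> U Q"
    proof
      fix x' assume x': "x' \<in> ball x (min e (\<rho>/2))"
      have sub: "ball x' (\<rho>/2) \<subseteq> ball x \<rho>"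
      proof
        fix z assume "z \<in> ball x' (\<rho>/2)"
        then have "dist x z < \<rho>/2 + \<rho>/2" using x' dist_triangle_less_add[of x x' "\<rho>/2" z "\<rho>/2"] by (simp add: dist_commute)
        then show "z \<in> ball x \<rho>" by simp
      qed
      have "AE z in lborel. z \<in> ball x' (\<rho>/2) \<longrightarrow> Q (w z)"
        using \<rho>(3) by eventually_elim (use sub in blast)
      moreover have "x' \<in> \<Omega>" using x' e(2) by auto
      ultimately show "x' \<in> U Q" using \<rho>(2) unfolding U_def by (auto intro!: exI[of _ "\<rho>/2"])
    qed
    then show "\<exists>e>0. ball x e \<subseteq> U Q" using e(1) \<rho>(2) by (intro exI[of _ "min e (\<rho>/2)"]) simp
  qed
  let ?Z = "U (\<lambda>t. t = 0)" and ?P = "U (\<lambda>t. t > 0)"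
  have cover: "\<Omega> \<subseteq> ?Z \<union> ?P"
  proof
    fix x assume x: "x \<in> \<Omega>"
    from loc[OF x] show "x \<in> ?Z \<union> ?P" unfolding U_def using x by blast
  qed
  have disj: "?Z \<inter> ?P \<inter> \<Omega> = {}"
  proof (rule ccontr)
    assume "?Z \<inter> ?P \<inter> \<Omega> \<noteq> {}"
    then obtain x \<rho>1 \<rho>2 where \<rho>: "\<rho>1 > 0" "\<rho>2 > 0" "AE z in lborel. z \<in> ball x \<rho>1 \<longrightarrow> w z = 0" "AE z in lborel. z \<in> ball x \<rho>2 \<longrightarrow> w z > 0"
      by (auto simp: U_def)
    have "AE z in lborel. z \<notin> ball x (min \<rho>1 \<rho>2)"
      using \<rho>(3,4) by eventually_elim auto
    then have "ball x (min \<rho>1 \<rho>2) \<in> null_sets lborel"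
      using AE_iff_null_sets[of "ball x (min \<rho>1 \<rho>2)" lborel] by simp
    then have "emeasure lborel (ball x (min \<rho>1 \<rho>2)) = 0" by auto
    then have "measure lborel (ball x (min \<rho>1 \<rho>2)) = 0" by (simp add: measure_def)
    then show False using content_ball_pos[of "min \<rho>1 \<rho>2" x] \<rho>(1,2) by simp
  qed
  have "?Z \<inter> \<Omega> = {} \<or> ?P \<inter> \<Omega> = {}"
    by (rule connectedD[OF con oU oU disj cover])
  then show ?thesis
  proof
    assume "?Z \<inter> \<Omega> = {}"
    then have "\<Omega> \<subseteq> ?P" using cover by blast
    then have "AE z in lborel. z \<in> \<Omega> \<longrightarrow> w z > 0"
      by (intro AE_open_locally) (auto simp: U_def)
    then have "AE z in L \<Omega>. w z > 0" by (simp only: AE_lebesgue_on_iff_lborel[OF dom_lebesgue])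
    then show ?thesis using wv by eventually_elim simp
  next
    assume "?P \<inter> \<Omega> = {}"
    then have "\<Omega> \<subseteq> ?Z" using cover by blast
    then have "AE z in lborel. z \<in> \<Omega> \<longrightarrow> w z = 0"
      by (intro AE_open_locally) (auto simp: U_def)
    then have "AE z in L \<Omega>. w z = 0" by (simp only: AE_lebesgue_on_iff_lborel[OF dom_lebesgue])
    then have "AE x in L \<Omega>. v x = 0" using wv by eventually_elim simp
    then show ?thesis using nz by (simp add: is_zero_def)
  qed
qed

end

subsection \<open>Attainment of the minimal level\<close>

lemma (in asymptotically_linear) hh_same_sign_mono:
  assumes "\<sigma> = 1 \<or> \<sigma> = -1" "0 \<le> a" "a \<le> b"
  shows "hh (\<sigma> * a) \<le> hh (\<sigma> * b)"
  using hh_mono[OF assms(2,3), of \<sigma>] by (simp add: mult.commute)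

section \<open>Positive and negative parts\<close>

context bounded_open
begin

text \<open>Written as a combination of |u| and u so that membership in the space follows from
  \<open>H01_abs\<close> and \<open>H01_lin\<close>; \<open>pospart_eq\<close> recovers the usual
  form.\<close>

definition pospart :: "(real^'n \<Rightarrow> real) \<Rightarrow> real^'n \<Rightarrow> real" where
  "pospart u x = (1/2) * \<bar>u x\<bar> + (1/2) * u x"

definition negpart :: "(real^'n \<Rightarrow> real) \<Rightarrow> real^'n \<Rightarrow> real" where
  "negpart u x = (1/2) * \<bar>u x\<bar> + (-1/2) * u x"

lemma pospart_eq: "pospart u x = (if u x \<ge> 0 then u x else 0)"
  and negpart_eq: "negpart u x = (if u x \<ge> 0 then 0 else - u x)"
  by (simp_all add: pospart_def negpart_def)

text \<open>The squared norms of the parts add up to half the sum of those of |u| and u, so all that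
  is used is that |u| has norm at most that of u. Inequalities suffice for every later
  application.\<close>

lemma parts_H01:
  assumes u: "u \<in> H01 \<Omega>"
  shows "pospart u \<in> H01 \<Omega>" "negpart u \<in> H01 \<Omega>"
    "(hn (pospart u))^2 + (hn (negpart u))^2 \<le> (hn u)^2" "(hn (pospart u))^2 \<le> ip u (pospart u)"
proof -
  note a = H01_abs[OF u]
  show P: "pospart u \<in> H01 \<Omega>" unfolding pospart_def[abs_def] by (rule H01_lin(1)[OF a(1) u])
  show N: "negpart u \<in> H01 \<Omega>" unfolding negpart_def[abs_def] by (rule H01_lin(1)[OF a(1) u])
  let ?a = "\<lambda>x. \<bar>u x\<bar>"
  have A: "(hn ?a)^2 \<le> (hn u)^2" by (rule power_mono[OF a(2)]) simp
  have l: "ip (pospart u) w = (1/2) * ip ?a w + (1/2) * ip u w" "ip (negpart u) w = (1/2) * ip ?a w + (-1/2) * ip u w"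
    if "w \<in> H01 \<Omega>" for w
    unfolding pospart_def[abs_def] negpart_def[abs_def] by (rule ip_lin[OF a(1) u that])+
  have p1: "ip ?a (pospart u) = (1/2) * (hn ?a)^2 + (1/2) * ip ?a u"
    unfolding ip_commute[of ?a "pospart u"] l(1)[OF a(1)] ip_self ip_commute[of u ?a] ..
  have p2: "ip u (pospart u) = (1/2) * ip ?a u + (1/2) * (hn u)^2"
    unfolding ip_commute[of u "pospart u"] l(1)[OF u] ip_self ..
  have n1: "ip ?a (negpart u) = (1/2) * (hn ?a)^2 + (-1/2) * ip ?a u"
    unfolding ip_commute[of ?a "negpart u"] l(2)[OF a(1)] ip_self ip_commute[of u ?a] ..
  have n2: "ip u (negpart u) = (1/2) * ip ?a u + (-1/2) * (hn u)^2"
    unfolding ip_commute[of u "negpart u"] l(2)[OF u] ip_self ..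
  have hp: "(hn (pospart u))^2 = (1/2) * ip ?a (pospart u) + (1/2) * ip u (pospart u)"
    unfolding ip_self[symmetric, of "pospart u"] by (rule l(1)[OF P])
  have hm: "(hn (negpart u))^2 = (1/2) * ip ?a (negpart u) + (-1/2) * ip u (negpart u)"
    unfolding ip_self[symmetric, of "negpart u"] by (rule l(2)[OF N])
  show "(hn (pospart u))^2 + (hn (negpart u))^2 \<le> (hn u)^2"
    unfolding hp hm p1 p2 n1 n2 using A by argo
  show "(hn (pospart u))^2 \<le> ip u (pospart u)"
    unfolding hp p1 p2 using A by argo
qed

lemma wform_square: "wform \<theta> u u = (LINT x|L \<Omega>. \<theta> x * (u x)^2)"
  by (simp add: wform_def power2_eq_square mult.assoc)

lemma wform_parts:
  assumes \<theta>: "\<theta> \<in> Linf \<Omega>" and u: "u \<in> H01 \<Omega>"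
  shows "wform \<theta> u u = wform \<theta> (pospart u) (pospart u) + wform \<theta> (negpart u) (negpart u)"
proof -
  note S = H01_S2[OF parts_H01(1)[OF u]] H01_S2[OF parts_H01(2)[OF u]]
  have "\<theta> x * u x * u x = \<theta> x * pospart u x * pospart u x + \<theta> x * negpart u x * negpart u x" for x
    by (simp add: pospart_eq negpart_eq)
  then show ?thesis
    using wform_integrable[OF \<theta> S(1) S(1)] wform_integrable[OF \<theta> S(2) S(2)] by (simp add: wform_def)
qed

end

section \<open>Resonant rays\<close>

context nehari_problem
begin

text \<open>What remains of I when the Dirichlet energy equals the \<eta>-form; see
  \<open>In_hI\<close>.\<close>

definition hI :: "(real^'n \<Rightarrow> real) \<Rightarrow> real" where
  "hI u = (LINT x|L \<Omega>. \<eta> x * (u x)^2 / 2 - Fprim f x (u x))"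

lemma hI_integrable:
  assumes u: "u \<in> S2"
  shows "integrable (L \<Omega>) (\<lambda>x. \<eta> x * (u x)^2 / 2 - Fprim f x (u x))"
  using wform_integrable[OF \<eta>L u u] F_integrable[OF u] by (simp add: power2_eq_square mult.assoc)

lemma In_hI:
  assumes u: "u \<in> S2"
  shows "In u = ((hn u)^2 - wform \<eta> u u) / 2 + hI u"
proof -
  have "integrable (L \<Omega>) (\<lambda>x. \<eta> x * (u x)^2 / 2)"
    using wform_integrable[OF \<eta>L u u] by (simp add: power2_eq_square mult.assoc)
  then have "hI u = (LINT x|L \<Omega>. \<eta> x * (u x)^2 / 2) - FF u"
    unfolding hI_def FF_def using F_integrable[OF u] by (rule Bochner_Integration.integral_diff)
  also have "(LINT x|L \<Omega>. \<eta> x * (u x)^2 / 2) = wform \<eta> u u / 2"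
    unfolding wform_square by (rule integral_divide_zero)
  finally show ?thesis by (simp add: In_eq diff_divide_distrib)
qed

text \<open>The integrand is nonnegative and vanishes at 0, so cutting a function off on a set
  cannot increase the integral.\<close>

lemma hI_mono:
  assumes u: "u \<in> S2" and v: "v \<in> S2" and le: "AE x in L \<Omega>. u x = v x \<or> u x = 0"
  shows "hI u \<le> hI v"
  unfolding hI_def
proof (rule integral_mono_AE[OF hI_integrable[OF u] hI_integrable[OF v]])
  show "AE x in L \<Omega>. \<eta> x * (u x)^2 / 2 - Fprim f x (u x) \<le> \<eta> x * (v x)^2 / 2 - Fprim f x (v x)"
    using le AE_al
  proof eventually_elim
    case (elim x)
    interpret asymptotically_linear "f x" "Fprim f x" "\<alpha> x" "\<eta> x" by (rule elim(2))
    show ?case using elim(1) hh_nonneg[of "v x"] hh_zero by (auto simp: hh_def)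
  qed
qed

text \<open>Where \<open>v\<close> is positive, \<open>n v\<close> eventually exceeds \<open>w\<close>, and the integrand of \<open>hI\<close> increases along rays.\<close>

lemma hI_ray_comparison:
  assumes \<sigma>: "\<sigma> = 1 \<or> \<sigma> = -1" and v: "v \<in> S2" and w: "w \<in> S2"
    and nn: "AE x in L \<Omega>. v x \<ge> 0" "AE x in L \<Omega>. w x \<ge> 0"
    and le: "\<And>n::nat. hI (\<lambda>x. \<sigma> * (real n * v x)) \<le> c"
  shows "(LINT x|L \<Omega>. indicator {x. v x > 0} x * (\<eta> x * (\<sigma> * w x)^2 / 2 - Fprim f x (\<sigma> * w x))) \<le> c"
proof -
  define g where "g u x = \<eta> x * (u x)^2 / 2 - Fprim f x (u x)" for u x
  let ?W = "\<lambda>x. \<sigma> * w x" and ?V = "\<lambda>n x. \<sigma> * (real n * v x)"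
  have S: "?W \<in> S2" "?V n \<in> S2" for n
    by (rule sqint_cmult[OF w], rule sqint_cmult[OF sqint_cmult[OF v]])
  have gi: "integrable (L \<Omega>) (g u)" if "u \<in> S2" for u
    unfolding g_def[abs_def] by (rule hI_integrable[OF that])
  have g0: "AE x in L \<Omega>. \<forall>t. 0 \<le> \<eta> x * t^2 / 2 - Fprim f x t"
    using AE_al
  proof eventually_elim
    case (elim x)
    interpret asymptotically_linear "f x" "Fprim f x" "\<alpha> x" "\<eta> x" by (rule elim)
    show ?case using hh_nonneg by (simp add: hh_def)
  qed
  have [measurable]: "v \<in> borel_measurable (L \<Omega>)" by (rule sqintD(1)[OF v])
  have ind: "(\<lambda>x. indicator {x. v x > 0} x :: real) \<in> borel_measurable (L \<Omega>)"
  proof -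
    have "(\<lambda>x. indicator {0<..} (v x) :: real) \<in> borel_measurable (L \<Omega>)" by measurable
    moreover have "(\<lambda>x. indicator {0<..} (v x) :: real) = (\<lambda>x. indicator {x. v x > 0} x)" by (auto simp: indicator_def fun_eq_iff)
    ultimately show ?thesis by simp
  qed
  note gm = borel_measurable_integrable[OF gi]
  have mm: "(\<lambda>x. indicator {x. v x > 0} x * min (g (?V n) x) (g ?W x)) \<in> borel_measurable (L \<Omega>)" for n
    using gm[OF S(2), of n] gm[OF S(1)] by (intro borel_measurable_times borel_measurable_min ind)
  \<comment> \<open>Taking the minimum with the competitor's integrand supplies a dominating
    function while the ray itself grows without bound; where v is positive the minimum is eventually
    the competitor's value.\<close>
  have "(\<lambda>n. LINT x|L \<Omega>. indicator {x. v x > 0} x * min (g (?V n) x) (g ?W x)) \<longlonglongrightarrow> (LINT x|L \<Omega>. indicator {x. v x > 0} x * g ?W x)"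
  proof (rule integral_dominated_convergence[where w = "g ?W"])
    show "(\<lambda>x. indicator {x. v x > 0} x * g ?W x) \<in> borel_measurable (L \<Omega>)"
      by (rule borel_measurable_times[OF ind gm[OF S(1)]])
    show "(\<lambda>x. indicator {x. v x > 0} x * min (g (?V n) x) (g ?W x)) \<in> borel_measurable (L \<Omega>)" for n
      by (rule mm)
    show "integrable (L \<Omega>) (g ?W)" by (rule gi[OF S(1)])
    show "AE x in L \<Omega>. (\<lambda>n. indicator {x. v x > 0} x * min (g (?V n) x) (g ?W x)) \<longlonglongrightarrow> indicator {x. v x > 0} x * g ?W x"
      using AE_al nn(2)
    proof eventually_elim
      case (elim x)
      interpret asymptotically_linear "f x" "Fprim f x" "\<alpha> x" "\<eta> x" by (rule elim(1))
      show ?case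
      proof (cases "v x > 0")
        case True
        obtain n0 :: nat where n0: "w x < real n0 * v x" using reals_Archimedean3[OF True] by blast
        have "min (g (?V n) x) (g ?W x) = g ?W x" if "n \<ge> n0" for n
        proof -
          have "real n0 * v x \<le> real n * v x" using that True by (intro mult_right_mono) simp_all
          then have "hh (\<sigma> * w x) \<le> hh (\<sigma> * (real n * v x))" using n0 by (intro hh_same_sign_mono[OF \<sigma> elim(2)]) linarith
          then show ?thesis by (simp add: g_def hh_def)
        qed
        then have "\<forall>\<^sub>F n in sequentially. min (g (?V n) x) (g ?W x) = g ?W x" by (auto simp: eventually_sequentially)
        then have "\<forall>\<^sub>F n in sequentially. indicator {x. v x > 0} x * min (g (?V n) x) (g ?W x) = indicator {x. v x > 0} x * g ?W x"
          by eventually_elim simp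
        then show ?thesis by (rule tendsto_eventually)
      qed simp
    qed
    show "AE x in L \<Omega>. norm (indicator {x. v x > 0} x * min (g (?V n) x) (g ?W x)) \<le> g ?W x" for n
      using g0
    proof eventually_elim
      case (elim x)
      have "0 \<le> g (?V n) x" "0 \<le> g ?W x" using elim unfolding g_def by blast+
      then show ?case by (simp add: indicator_def)
    qed
  qed
  moreover have "(LINT x|L \<Omega>. indicator {x. v x > 0} x * min (g (?V n) x) (g ?W x)) \<le> c" for n
  proof -
    have "(LINT x|L \<Omega>. indicator {x. v x > 0} x * min (g (?V n) x) (g ?W x)) \<le> (LINT x|L \<Omega>. g (?V n) x)"
    proof (rule integral_mono_AE[OF _ gi[OF S(2)]])
      show "integrable (L \<Omega>) (\<lambda>x. indicator {x. v x > 0} x * min (g (?V n) x) (g ?W x))"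
      proof (rule Bochner_Integration.integrable_bound[OF gi[OF S(1)]])
        show "(\<lambda>x. indicator {x. v x > 0} x * min (g (?V n) x) (g ?W x)) \<in> borel_measurable (L \<Omega>)"
          by (rule mm)
        show "AE x in L \<Omega>. norm (indicator {x. v x > 0} x * min (g (?V n) x) (g ?W x)) \<le> norm (g ?W x)"
          using g0
        proof eventually_elim
          case (elim x)
          have "0 \<le> g (?V n) x" "0 \<le> g ?W x" using elim unfolding g_def by blast+
          then show ?case by (simp add: indicator_def)
        qed
      qed
      show "AE x in L \<Omega>. indicator {x. v x > 0} x * min (g (?V n) x) (g ?W x) \<le> g (?V n) x"
        using g0
      proof eventually_elim
        case (elim x)
        have "0 \<le> g (?V n) x" using elim unfolding g_def by blast
        then show ?case by (simp add: indicator_def)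
      qed
    qed
    also have "\<dots> \<le> c" using le[of n] by (simp add: hI_def g_def)
    finally show ?thesis .
  qed
  ultimately have "(LINT x|L \<Omega>. indicator {x. v x > 0} x * g ?W x) \<le> c"
    by (intro LIMSEQ_le_const2) auto
  then show ?thesis by (simp add: g_def)
qed

text \<open>If \<open>v \<ge> 0\<close> were resonant with \<open>I(tv) \<le> c\<close> along its ray, the ray comparison would force
  \<open>wform \<theta> w w \<le> |w|\<^sup>2\<close> for the weight \<open>\<theta>\<close> that equals \<open>\<eta>\<close> where \<open>v > 0\<close> and \<open>\<eta> - K\<close> elsewhere. Then
  \<open>v\<close> is an extremal of this form, hence positive by the strong maximum principle, so \<open>\<theta> = \<eta>\<close>
  and the form is indefinite after all.\<close>

lemma no_resonant_escape:
  assumes con: "connected \<Omega>" and \<sigma>: "\<sigma> = 1 \<or> \<sigma> = -1"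
    and \<alpha>1: "\<And>u. u \<in> H01 \<Omega> \<Longrightarrow> \<not> is_zero \<Omega> u \<Longrightarrow> wform \<alpha> u u < (hn u)^2"
    and e: "e \<in> H01 \<Omega>" "(hn e)^2 < wform \<eta> e e"
    and c: "\<And>u. u \<in> N \<Longrightarrow> c \<le> In u"
    and v: "v \<in> H01 \<Omega>" "AE x in L \<Omega>. v x \<ge> 0" "\<not> is_zero \<Omega> v" "(hn v)^2 = wform \<eta> v v"
    and le: "\<And>t. t \<ge> 0 \<Longrightarrow> In (\<lambda>x. t * (\<sigma> * v x)) \<le> c"
  shows False
proof -
  note vS = H01_S2[OF v(1)] and vm = sqintD(1)[OF H01_S2[OF v(1)]]
  have \<sigma>2: "\<sigma>^2 = 1" "\<bar>\<sigma>\<bar> = 1" using \<sigma> by auto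
  define \<theta> where "\<theta> x = \<eta> x - K * indicator {x. v x \<le> 0} x" for x
  have \<theta>m: "\<theta> \<in> borel_measurable (L \<Omega>)"
  proof -
    have [measurable]: "\<eta> \<in> borel_measurable (L \<Omega>)" "v \<in> borel_measurable (L \<Omega>)"
      using \<eta>L vm by (simp_all add: Linf_def)
    have "(\<lambda>x. \<eta> x - K * indicator {..0} (v x)) \<in> borel_measurable (L \<Omega>)"
      by measurable
    moreover have "(\<lambda>x. \<eta> x - K * indicator {..0} (v x)) = \<theta>" by (auto simp: \<theta>_def indicator_def fun_eq_iff)
    ultimately show ?thesis by simp
  qed
  have \<theta>b: "AE x in L \<Omega>. \<bar>\<theta> x\<bar> \<le> K + K"
    using AE_K
  proof eventually_elim
    case (elim x)
    then have "\<bar>\<eta> x\<bar> \<le> K" by linarith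
    moreover have "\<bar>K * indicator {x. v x \<le> 0} x\<bar> \<le> K" using K0 by (simp add: indicator_def)
    ultimately show ?case unfolding \<theta>_def using abs_triangle_ineq4[of "\<eta> x" "K * indicator {x. v x \<le> 0} x"] by linarith
  qed
  have \<theta>L: "\<theta> \<in> Linf \<Omega>" using \<theta>m \<theta>b by (auto simp: Linf_def)
  have hIv: "hI (\<lambda>x. \<sigma> * (real n * v x)) \<le> c" for n :: nat
  proof -
    have S: "(\<lambda>x. real n * (\<sigma> * v x)) \<in> S2" by (intro sqint_cmult vS)
    have "In (\<lambda>x. real n * (\<sigma> * v x)) = hI (\<lambda>x. real n * (\<sigma> * v x))"
      unfolding In_hI[OF S] wform_cmult hn_cmult[OF H01_cmult[OF v(1)]] hn_cmult[OF v(1)]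
      by (simp add: power_mult_distrib \<sigma>2 v(4))
    then show ?thesis using le[of "real n"] by (simp add: mult.left_commute)
  qed
  \<comment> \<open>If the form at \<open>w\<close> exceeded the energy, the ray of \<open>w\<close>
    would meet the Nehari set, because \<theta> is at most \<eta>. Its level there is at most c plus
    t^2/2 times the negative number |w|^2 - \<open>wform \<theta> w w\<close>, hence below
    c.\<close>
  have Q_nonneg: "wform \<theta> w w \<le> (hn w)^2" if w: "w \<in> H01 \<Omega>" "AE x in L \<Omega>. w x \<ge> 0" for w
  proof (rule ccontr)
    assume "\<not> ?thesis"
    then have neg: "(hn w)^2 < wform \<theta> w w" by simp
    note wS = H01_S2[OF w(1)]
    have \<theta>\<eta>: "wform \<theta> w w \<le> wform \<eta> w w"
      unfolding wform_square
    proof (rule integral_mono)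
      show "integrable (L \<Omega>) (\<lambda>x. \<theta> x * (w x)^2)" "integrable (L \<Omega>) (\<lambda>x. \<eta> x * (w x)^2)"
        using wform_integrable[OF \<theta>L wS wS] wform_integrable[OF \<eta>L wS wS] by (simp_all add: power2_eq_square mult.assoc)
      show "\<theta> x * (w x)^2 \<le> \<eta> x * (w x)^2" for x
        using K0 by (intro mult_right_mono) (simp_all add: \<theta>_def indicator_def)
    qed
    have wnz: "\<not> is_zero \<Omega> w"
      using wform_AE_zero[OF _ \<theta>L wS] neg by auto
    let ?w = "\<lambda>x. \<sigma> * w x"
    have wH: "?w \<in> H01 \<Omega>" by (rule H01_cmult[OF w(1)])
    have e1: "(hn ?w)^2 = (hn w)^2" "wform \<eta> ?w ?w = wform \<eta> w w" "wform \<alpha> ?w ?w = wform \<alpha> w w"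
      by (simp_all add: hn_cmult[OF w(1)] wform_cmult \<sigma>2)
    obtain t where t: "t > 0" "(\<lambda>x. t * (\<sigma> * w x)) \<in> N"
      by (rule Nehari_projection[OF wH]) (use \<alpha>1[OF w(1) wnz] neg \<theta>\<eta> in \<open>simp_all add: e1\<close>)
    have tS: "(\<lambda>x. t * (\<sigma> * w x)) \<in> S2" by (intro sqint_cmult wS)
    have twS: "(\<lambda>x. t * w x) \<in> S2" by (rule sqint_cmult[OF wS])
    have twn: "AE x in L \<Omega>. 0 \<le> t * w x" using w(2) by eventually_elim (use t(1) in simp)
    let ?g = "\<lambda>x. \<eta> x * (\<sigma> * (t * w x))^2 / 2 - Fprim f x (\<sigma> * (t * w x))"
    have gi: "integrable (L \<Omega>) ?g" using hI_integrable[OF tS] unfolding mult.left_commute[of t \<sigma>] .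
    have C1: "(LINT x|L \<Omega>. indicator {x. v x > 0} x * ?g x) \<le> c"
      by (rule hI_ray_comparison[OF \<sigma> vS twS v(2) twn hIv])
    have i1: "integrable (L \<Omega>) (\<lambda>x. indicator {x. v x > 0} x * ?g x)"
    proof (rule Bochner_Integration.integrable_bound[OF gi])
      have "(\<lambda>x. indicator {0<..} (v x) * ?g x) \<in> borel_measurable (L \<Omega>)"
        by (intro borel_measurable_times borel_measurable_integrable[OF gi] measurable_compose[OF vm]) simp
      moreover have "(\<lambda>x. indicator {0<..} (v x) * ?g x) = (\<lambda>x. indicator {x. v x > 0} x * ?g x)" by (auto simp: indicator_def fun_eq_iff)
      ultimately show "(\<lambda>x. indicator {x. v x > 0} x * ?g x) \<in> borel_measurable (L \<Omega>)" by simp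
    qed (simp add: indicator_def)
    have i2: "integrable (L \<Omega>) (\<lambda>x. (\<eta> x - \<theta> x) * (w x)^2)"
      using wform_integrable[OF \<theta>L wS wS] wform_integrable[OF \<eta>L wS wS] by (simp add: power2_eq_square mult.assoc left_diff_distrib)
    \<comment> \<open>Where v is not positive, \<eta> - \<theta> equals \<open>K\<close>, which
      bounds \<eta> - \<alpha>, so \<open>hh_le\<close> pays for the missing part of the
      integrand.\<close>
    have "hI (\<lambda>x. t * (\<sigma> * w x)) \<le> (LINT x|L \<Omega>. indicator {x. v x > 0} x * ?g x + t^2 / 2 * ((\<eta> x - \<theta> x) * (w x)^2))"
      unfolding hI_def mult.left_commute[of t \<sigma>]
    proof (rule integral_mono_AE[OF gi])
      show "integrable (L \<Omega>) (\<lambda>x. indicator {x. v x > 0} x * ?g x + t^2 / 2 * ((\<eta> x - \<theta> x) * (w x)^2))"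
        by (intro Bochner_Integration.integrable_add i1 integrable_mult_right i2)
      show "AE x in L \<Omega>. ?g x \<le> indicator {x. v x > 0} x * ?g x + t^2 / 2 * ((\<eta> x - \<theta> x) * (w x)^2)"
        using AE_al AE_K
      proof eventually_elim
        case (elim x)
        interpret asymptotically_linear "f x" "Fprim f x" "\<alpha> x" "\<eta> x" by (rule elim(1))
        show ?case
        proof (cases "v x > 0")
          case True
          then show ?thesis by (simp add: \<theta>_def)
        next
          case False
          have "?g x \<le> (\<eta> x - \<alpha> x) * (\<sigma> * (t * w x))^2 / 2" using hh_le by (simp add: hh_def)
          also have "\<dots> \<le> K * (\<sigma> * (t * w x))^2 / 2"
          proof -
            have "\<eta> x - \<alpha> x \<le> K" using elim(2) by linarith
            then show ?thesis by (intro divide_right_mono mult_right_mono) simp_all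
          qed
          also have "\<dots> = t^2 / 2 * (K * (w x)^2)" by (simp add: power_mult_distrib \<sigma>2)
          finally show ?thesis using False by (simp add: \<theta>_def)
        qed
      qed
    qed
    also have "\<dots> = (LINT x|L \<Omega>. indicator {x. v x > 0} x * ?g x) + t^2 / 2 * (LINT x|L \<Omega>. (\<eta> x - \<theta> x) * (w x)^2)"
      using i1 integrable_mult_right[OF i2, of "t^2 / 2"] by (simp only: Bochner_Integration.integral_add integral_mult_right_zero)
    also have "(LINT x|L \<Omega>. (\<eta> x - \<theta> x) * (w x)^2) = wform \<eta> w w - wform \<theta> w w"
      using wform_integrable[OF \<theta>L wS wS] wform_integrable[OF \<eta>L wS wS]
      by (simp add: wform_square power2_eq_square mult.assoc left_diff_distrib)
    finally have h: "hI (\<lambda>x. t * (\<sigma> * w x)) \<le> c + t^2 / 2 * (wform \<eta> w w - wform \<theta> w w)" using C1 by linarith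
    have "c \<le> In (\<lambda>x. t * (\<sigma> * w x))" by (rule c[OF t(2)])
    also have "\<dots> = t^2 / 2 * ((hn w)^2 - wform \<eta> w w) + hI (\<lambda>x. t * (\<sigma> * w x))"
      unfolding In_hI[OF tS] wform_cmult hn_cmult[OF wH] hn_cmult[OF w(1)]
      by (simp add: power_mult_distrib \<sigma>2 right_diff_distrib)
    also have "\<dots> \<le> t^2 / 2 * ((hn w)^2 - wform \<eta> w w) + (c + t^2 / 2 * (wform \<eta> w w - wform \<theta> w w))" using h by simp
    also have "\<dots> = c + t^2 / 2 * ((hn w)^2 - wform \<theta> w w)" by (simp add: right_diff_distrib)
    finally have "0 \<le> t^2 / 2 * ((hn w)^2 - wform \<theta> w w)" by simp
    moreover have "t^2 / 2 * ((hn w)^2 - wform \<theta> w w) < 0" using t(1) neg by (intro mult_pos_neg) simp_all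
    ultimately show False by simp
  qed
  \<comment> \<open>The form sees only |w|, and passing to |w| does not raise the energy, so
    nonnegative functions suffice.\<close>
  have Q: "wform \<theta> w w \<le> 1 * (hn w)^2" if w: "w \<in> H01 \<Omega>" for w
  proof -
    have "wform \<theta> w w = wform \<theta> (\<lambda>x. \<bar>w x\<bar>) (\<lambda>x. \<bar>w x\<bar>)" by (simp add: wform_square)
    also have "\<dots> \<le> (hn (\<lambda>x. \<bar>w x\<bar>))^2" by (rule Q_nonneg[OF H01_abs(1)[OF w]]) simp
    also have "\<dots> \<le> (hn w)^2" by (rule power_mono[OF H01_abs(2)[OF w]]) simp
    finally show ?thesis by simp
  qed
  have "wform \<theta> v v = wform \<eta> v v"
    unfolding wform_def
  proof (rule integral_cong_AE)
    show "(\<lambda>x. \<theta> x * v x * v x) \<in> borel_measurable (L \<Omega>)" "(\<lambda>x. \<eta> x * v x * v x) \<in> borel_measurable (L \<Omega>)"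
      using wform_integrable[OF \<theta>L vS vS] wform_integrable[OF \<eta>L vS vS] by simp_all
    show "AE x in L \<Omega>. \<theta> x * v x * v x = \<eta> x * v x * v x"
      using v(2) by eventually_elim (auto simp: \<theta>_def indicator_def)
  qed
  then have "1 * (hn v)^2 \<le> wform \<theta> v v" using v(4) by simp
  then have eq: "ip v \<phi> = wform \<theta> v \<phi>" if "\<phi> \<in> H01 \<Omega>" for \<phi>
    using pos_form_first_order[OF \<theta>L Q v(1) _ that] by simp
  have "AE x in L \<Omega>. v x > 0" by (rule strong_maximum_principle[OF con v(1) eq \<theta>L v(2,3)])
  then have "AE x in L \<Omega>. \<theta> x * e x * e x = \<eta> x * e x * e x" by eventually_elim (simp add: \<theta>_def)
  then have "wform \<theta> e e = wform \<eta> e e"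
    unfolding wform_def
    by (intro integral_cong_AE)
      (use wform_integrable[OF \<theta>L H01_S2[OF e(1)] H01_S2[OF e(1)]] wform_integrable[OF \<eta>L H01_S2[OF e(1)] H01_S2[OF e(1)]] in simp_all)
  then show False using Q[OF e(1)] e(2) by simp
qed

end

section \<open>Existence, sign and level of the minimiser\<close>

text \<open>The eigenvalue conditions enter only through these two inequalities between quadratic
  forms.\<close>

locale nehari_gap = nehari_problem \<Omega> f \<alpha> \<eta> K
  for \<Omega> :: "(real^'n::finite) set" and f \<alpha> \<eta> K +
  assumes con: "connected \<Omega>"
    and \<alpha>_gap: "\<And>u. u \<in> H01 \<Omega> \<Longrightarrow> \<not> is_zero \<Omega> u \<Longrightarrow> wform \<alpha> u u < (hn u)^2"
    and \<eta>_gap: "\<exists>e\<in>H01 \<Omega>. (hn e)^2 < wform \<eta> e e"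
begin

lemma Nehari_projection_gap:
  assumes u: "u \<in> H01 \<Omega>" "(hn u)^2 < wform \<eta> u u"
  obtains t where "t > 0" "(\<lambda>x. t * u x) \<in> N"
proof -
  have "\<not> is_zero \<Omega> u" using wform_AE_zero[OF _ \<eta>L H01_S2[OF u(1)]] u(2) by auto
  from Nehari_projection[OF u(1) \<alpha>_gap[OF u(1) this] u(2)] that show ?thesis by blast
qed

lemma Nehari_normalized:
  assumes u: "u \<in> N"
  shows "0 < hn u" "(\<lambda>x. inverse (hn u) * u x) \<in> SA \<Omega> \<eta>"
proof -
  note uH = NehariD(1)[OF u]
  show h: "0 < hn u" using hn_eq_0_iff[OF uH] NehariD(2)[OF u] hn_nonneg[of u] by linarith
  have lt: "(hn u)^2 < wform \<eta> u u" using NehariD(3)[OF u] ff_less_wform[OF H01_S2[OF uH] NehariD(2)[OF u]] by simp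
  have h1: "hn (\<lambda>x. inverse (hn u) * u x) = 1" using h by (simp add: hn_cmult[OF uH])
  have "(inverse (hn u))^2 * (hn u)^2 < (inverse (hn u))^2 * wform \<eta> u u"
    using h lt by (intro mult_strict_left_mono) simp_all
  moreover have "(inverse (hn u))^2 * (hn u)^2 = 1" using h by (simp add: power_inverse)
  ultimately have "1 < wform \<eta> (\<lambda>x. inverse (hn u) * u x) (\<lambda>x. inverse (hn u) * u x)" by (simp add: wform_cmult)
  then show "(\<lambda>x. inverse (hn u) * u x) \<in> SA \<Omega> \<eta>"
    unfolding SA_def Aset_def wform_square using H01_cmult[OF uH] h1 by simp
qed

lemma SA_props:
  assumes "v \<in> SA \<Omega> \<eta>"
  shows "v \<in> H01 \<Omega>" "hn v = 1" "(hn v)^2 < wform \<eta> v v"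
  using assms unfolding SA_def Aset_def wform_square by auto

lemma Nehari_nonempty: "N \<noteq> {}"
proof -
  obtain e where e: "e \<in> H01 \<Omega>" "(hn e)^2 < wform \<eta> e e" using \<eta>_gap by blast
  obtain t where "t > 0" "(\<lambda>x. t * e x) \<in> N" by (rule Nehari_projection_gap[OF e], rule that)
  then show ?thesis by blast
qed

lemma Inf_le_In: "u \<in> N \<Longrightarrow> Inf (In ` N) \<le> In u"
  by (rule cInf_lower) (auto intro!: bdd_belowI[of _ 0] less_imp_le[OF In_Nehari_pos])

text \<open>The minimising sequence may be unbounded, so its normalisations are followed instead.
  Maximality on rays bounds I(s w_n) by I(u_n) for every s, and on the unit sphere this value is
  s^2/2 minus an L2-continuous term. A loss of norm in the limit only lowers I. The strict form
  inequality weakens to 1 \<le> \<open>wform \<eta> v v\<close>, which still keeps \<open>v\<close>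
  nonzero.\<close>

lemma weak_limit_of_minimizing_sequence:
  obtains v where "v \<in> H01 \<Omega>" "(hn v)^2 \<le> wform \<eta> v v" "1 \<le> wform \<eta> v v"
    "\<And>s. s \<ge> 0 \<Longrightarrow> In (\<lambda>x. s * v x) \<le> Inf (In ` N)"
proof -
  define c where "c = Inf (In ` N)"
  have "\<exists>u. u \<in> N \<and> In u < c + inverse (real (Suc n))" for n
  proof -
    have "Inf (In ` N) < c + inverse (real (Suc n))" by (simp add: c_def)
    from cInf_lessD[OF _ this] Nehari_nonempty show ?thesis by auto
  qed
  from choice[OF allI[OF this]] obtain u where u: "\<forall>n. u n \<in> N \<and> In (u n) < c + inverse (real (Suc n))" by (rule exE)
  then have uN: "u n \<in> N" and ul: "In (u n) < c + inverse (real (Suc n))" for n by blast+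
  define w where "w n = (\<lambda>x. inverse (hn (u n)) * u n x)" for n
  have wSA: "w n \<in> SA \<Omega> \<eta>" for n unfolding w_def by (rule Nehari_normalized(2)[OF uN])
  note wH = SA_props(1)[OF wSA] and w1 = SA_props(2)[OF wSA]
  note wS = H01_S2[OF wH]
  have w1': "hn (w n) \<le> 1" for n using w1[of n] by simp
  obtain r v where r: "strict_mono r" and v: "v \<in> H01 \<Omega>" "hn v \<le> 1" and l: "(\<lambda>n. n2 (\<lambda>x. w (r n) x - v x)) \<longlonglongrightarrow> 0"
    by (rule Rellich[OF wH w1'], rule that)
  note vS = H01_S2[OF v(1)]
  have v1: "1 \<le> wform \<eta> v v"
  proof (rule LIMSEQ_le_const[OF wform_tendsto[OF \<eta>L wS vS l]], intro exI allI impI)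
    fix n show "1 \<le> wform \<eta> (w (r n)) (w (r n))" using SA_props(2,3)[OF wSA, of "r n"] by simp
  qed
  have hv: "(hn v)^2 \<le> 1" using power_mono[OF v(2) hn_nonneg, of 2] by simp
  have "In (\<lambda>x. s * v x) \<le> c" if s: "s \<ge> 0" for s
  proof -
    have wsS: "(\<lambda>x. s * w (r n) x) \<in> S2" for n by (rule sqint_cmult[OF wS])
    have vsS: "(\<lambda>x. s * v x) \<in> S2" by (rule sqint_cmult[OF vS])
    have eq: "n2 (\<lambda>x. s * w (r n) x - s * v x) = \<bar>s\<bar> * n2 (\<lambda>x. w (r n) x - v x)" for n
      using l2n_cmult[of "L \<Omega>" s "\<lambda>x. w (r n) x - v x"] by (simp add: right_diff_distrib)
    have "(\<lambda>n. n2 (\<lambda>x. s * w (r n) x - s * v x)) \<longlonglongrightarrow> 0"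
      unfolding eq by (rule tendsto_mult_right_zero[OF l])
    from FF_tendsto[OF wsS vsS this]
    have 1: "(\<lambda>n. s^2 / 2 - FF (\<lambda>x. s * w (r n) x)) \<longlonglongrightarrow> s^2 / 2 - FF (\<lambda>x. s * v x)"
      by (rule tendsto_diff[OF tendsto_const])
    have "(\<lambda>n. c + inverse (real (Suc n))) \<longlonglongrightarrow> c + 0"
      by (rule tendsto_add[OF tendsto_const LIMSEQ_inverse_real_of_nat])
    from n2_conv_subseq[OF r this] have 2: "(\<lambda>n. c + inverse (real (Suc (r n)))) \<longlonglongrightarrow> c" by simp
    have 3: "s^2 / 2 - FF (\<lambda>x. s * w (r n) x) \<le> c + inverse (real (Suc (r n)))" for n
    proof -
      have "s^2 / 2 - FF (\<lambda>x. s * w (r n) x) = In (\<lambda>x. s * w (r n) x)"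
        by (simp add: In_eq hn_cmult[OF wH] w1)
      also have "\<dots> = In (\<lambda>x. (s * inverse (hn (u (r n)))) * u (r n) x)"
        by (simp add: w_def mult.assoc)
      also have "\<dots> \<le> In (u (r n))"
        by (rule Nehari_maximal[OF uN mult_nonneg_nonneg[OF s]]) (simp add: hn_nonneg)
      also have "\<dots> \<le> c + inverse (real (Suc (r n)))" by (rule less_imp_le[OF ul])
      finally show ?thesis .
    qed
    have "s^2 / 2 - FF (\<lambda>x. s * v x) \<le> c"
      by (rule LIMSEQ_le[OF 1 2]) (use 3 in blast)
    moreover have "s^2 * (hn v)^2 \<le> s^2 * 1" by (rule mult_left_mono[OF hv]) simp
    ultimately show ?thesis by (simp add: In_eq hn_cmult[OF v(1)] power_mult_distrib)
  qed
  then show thesis using that[OF v(1) _ v1] hv v1 unfolding c_def by simp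
qed

text \<open>In the resonant case the positive and negative parts of the limit are resonant as well, since otherwise
  cutting one of them off would produce an element of the Nehari set below its minimal level.\<close>

lemma minimizer_exists:
  obtains u where "u \<in> N" "In u = Inf (In ` N)"
proof -
  obtain v where v: "v \<in> H01 \<Omega>" "(hn v)^2 \<le> wform \<eta> v v" "1 \<le> wform \<eta> v v"
    and le: "\<And>s. s \<ge> 0 \<Longrightarrow> In (\<lambda>x. s * v x) \<le> Inf (In ` N)"
    by (rule weak_limit_of_minimizing_sequence, rule that)
  show thesis
  proof (cases "(hn v)^2 < wform \<eta> v v")
    case True
    obtain t where t: "t > 0" "(\<lambda>x. t * v x) \<in> N" by (rule Nehari_projection_gap[OF v(1) True], rule that)
    have "In (\<lambda>x. t * v x) = Inf (In ` N)"
      by (rule antisym[OF le[OF less_imp_le[OF t(1)]] Inf_le_In[OF t(2)]])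
    then show thesis by (rule that[OF t(2)])
  next
    case False
    then have res: "(hn v)^2 = wform \<eta> v v" using v(2) by simp
    note vS = H01_S2[OF v(1)]
    have hIv: "hI (\<lambda>x. t * v x) \<le> Inf (In ` N)" if "t \<ge> 0" for t
      using le[OF that] In_hI[OF sqint_cmult[OF vS, of t]]
      by (simp add: hn_cmult[OF v(1)] wform_cmult power_mult_distrib res)
    have hIw: "hI (\<lambda>x. t * w x) \<le> Inf (In ` N)"
      if w: "w \<in> H01 \<Omega>" "\<And>x. w x = v x \<or> w x = 0" and t: "t \<ge> 0" for w t
    proof (rule order_trans[OF hI_mono hIv[OF t]])
      show "(\<lambda>x. t * w x) \<in> S2" by (rule sqint_cmult[OF H01_S2[OF w(1)]])
      show "(\<lambda>x. t * v x) \<in> S2" by (rule sqint_cmult[OF vS])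
      show "AE x in L \<Omega>. t * w x = t * v x \<or> t * w x = 0"
      proof (intro always_eventually allI)
        fix x show "t * w x = t * v x \<or> t * w x = 0" using w(2)[of x] by auto
      qed
    qed
    \<comment> \<open>A cut-off \<open>w\<close> inside the open cone would have a Nehari point on
      its ray whose level is \<open>hI\<close>, at most the infimum, plus a strictly negative
      quadratic term.\<close>
    have cut: "wform \<eta> w w \<le> (hn w)^2" if w: "w \<in> H01 \<Omega>" "\<And>x. w x = v x \<or> w x = 0" for w
    proof (rule ccontr)
      assume "\<not> ?thesis"
      then have lt: "(hn w)^2 < wform \<eta> w w" by simp
      obtain t where t: "t > 0" "(\<lambda>x. t * w x) \<in> N" by (rule Nehari_projection_gap[OF w(1) lt], rule that)
      have "In (\<lambda>x. t * w x) = t^2 * ((hn w)^2 - wform \<eta> w w) / 2 + hI (\<lambda>x. t * w x)"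
        unfolding In_hI[OF sqint_cmult[OF H01_S2[OF w(1)]]] hn_cmult[OF w(1)] wform_cmult
        by (simp add: power_mult_distrib right_diff_distrib)
      moreover have "t^2 * ((hn w)^2 - wform \<eta> w w) < 0" using t(1) lt by (intro mult_pos_neg) simp_all
      ultimately show False using Inf_le_In[OF t(2)] hIw[OF w less_imp_le[OF t(1)]] by linarith
    qed
    note P = parts_H01[OF v(1)]
    have nH: "(\<lambda>x. -1 * negpart v x) \<in> H01 \<Omega>" by (rule H01_cmult[OF P(2)])
    have pc: "pospart v x = v x \<or> pospart v x = 0" and nc: "-1 * negpart v x = v x \<or> -1 * negpart v x = 0" for x
      by (simp_all add: pospart_eq negpart_eq)
    have 1: "wform \<eta> (pospart v) (pospart v) \<le> (hn (pospart v))^2" by (rule cut[OF P(1) pc])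
    have 2: "wform \<eta> (negpart v) (negpart v) \<le> (hn (negpart v))^2"
      using cut[OF nH nc] unfolding hn_cmult[OF P(2)] wform_cmult by simp
    \<comment> \<open>The energies of the parts sum to at most that of \<open>v\<close>, their forms
      sum exactly to that of \<open>v\<close>, and \<open>v\<close> is resonant; the two
      inequalities \<open>1\<close> and \<open>2\<close> must therefore be equalities.\<close>
    have "(hn (pospart v))^2 = wform \<eta> (pospart v) (pospart v)" "(hn (negpart v))^2 = wform \<eta> (negpart v) (negpart v)"
      using 1 2 P(3) res wform_parts[OF \<eta>L v(1)] by linarith+
    note req = this
    obtain e where e: "e \<in> H01 \<Omega>" "(hn e)^2 < wform \<eta> e e" using \<eta>_gap by blast
    \<comment> \<open>The sign \<sigma> lets one argument serve for the positive part and for the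
      negative part, which is stored as a nonnegative function.\<close>
    have escape: False
      if \<sigma>: "\<sigma> = 1 \<or> \<sigma> = -1" and w: "w \<in> H01 \<Omega>" "\<And>x. w x \<ge> 0" "\<not> is_zero \<Omega> w" "(hn w)^2 = wform \<eta> w w"
        and cw: "\<And>x. \<sigma> * w x = v x \<or> \<sigma> * w x = 0" for \<sigma> w
    proof (rule no_resonant_escape[OF con \<sigma> \<alpha>_gap e Inf_le_In w(1) _ w(3,4)])
      show "AE x in L \<Omega>. 0 \<le> w x" using w(2) by simp
      fix t :: real assume t: "t \<ge> 0"
      note sH = H01_cmult[OF w(1), of \<sigma>]
      have "\<sigma>^2 = 1" using \<sigma> by auto
      then have "In (\<lambda>x. t * (\<sigma> * w x)) = hI (\<lambda>x. t * (\<sigma> * w x))"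
        unfolding In_hI[OF sqint_cmult[OF H01_S2[OF sH]]] wform_cmult hn_cmult[OF sH] hn_cmult[OF w(1)]
        by (simp add: power_mult_distrib w(4))
      also have "\<dots> \<le> Inf (In ` N)" by (rule hIw[OF sH cw t])
      finally show "In (\<lambda>x. t * (\<sigma> * w x)) \<le> Inf (In ` N)" .
    qed
    have "is_zero \<Omega> (pospart v)"
    proof (rule ccontr)
      assume nz: "\<not> is_zero \<Omega> (pospart v)"
      show False by (rule escape[of 1, OF _ P(1) _ nz req(1)]) (simp_all add: pospart_eq)
    qed
    moreover have "is_zero \<Omega> (negpart v)"
    proof (rule ccontr)
      assume nz: "\<not> is_zero \<Omega> (negpart v)"
      show False by (rule escape[of "-1", OF _ P(2) _ nz req(2)]) (simp_all add: negpart_eq)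
    qed
    ultimately have "wform \<eta> v v = 0"
      unfolding wform_parts[OF \<eta>L v(1)] using wform_AE_zero[OF _ \<eta>L H01_S2[OF P(1)]] wform_AE_zero[OF _ \<eta>L H01_S2[OF P(2)]] by simp
    then show thesis using v(3) by simp
  qed
qed

text \<open>Testing the equation of \<open>u\<close> with its positive part p gives |p|^2 \<le>
  \<open>ff p p\<close>, so the Nehari point on the ray of p has factor at most 1. On the Nehari set
  I is the integral of \<open>H\<close>, which increases along rays and is positive where u < 0; the
  level would drop strictly if both parts were nonzero.\<close>

lemma minimizer_sign:
  assumes u: "u \<in> N" and min: "In u = Inf (In ` N)"
  shows "(AE x in L \<Omega>. u x \<ge> 0) \<or> (AE x in L \<Omega>. u x \<le> 0)"
proof (cases "is_zero \<Omega> (pospart u)")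
  case True
  then have "AE x in L \<Omega>. u x \<le> 0"
    unfolding is_zero_def by eventually_elim (auto simp: pospart_eq split: if_splits)
  then show ?thesis ..
next
  case pnz: False
  show ?thesis
  proof (cases "is_zero \<Omega> (negpart u)")
    case True
    then have "AE x in L \<Omega>. u x \<ge> 0"
      unfolding is_zero_def by eventually_elim (auto simp: negpart_eq split: if_splits)
    then show ?thesis ..
  next
    case nnz: False
    note uH = NehariD(1)[OF u]
    note P = parts_H01[OF uH]
    let ?p = "pospart u"
    note pS = H01_S2[OF P(1)] and uS = H01_S2[OF uH]
    have ws: "weak_solution \<Omega> f u"
      by (rule minimizer_weak_solution[OF u]) (use Inf_le_In min in simp)
    have "ip u ?p = ff u ?p" using ws P(1) by (simp add: weak_solution_def ip_def ff_def)
    also have "\<dots> = ff ?p ?p" unfolding ff_def by (rule Bochner_Integration.integral_cong) (simp_all add: pospart_eq)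
    finally have le: "(hn ?p)^2 \<le> ff ?p ?p" using P(4) by simp
    then have lt: "(hn ?p)^2 < wform \<eta> ?p ?p" using ff_less_wform[OF pS pnz] by simp
    obtain t where t: "t > 0" "(\<lambda>x. t * ?p x) \<in> N" by (rule Nehari_projection_gap[OF P(1) lt], rule that)
    have tff: "t * (hn ?p)^2 = ff (\<lambda>x. t * ?p x) ?p"
    proof -
      have "ff (\<lambda>x. t * ?p x) (\<lambda>x. t * ?p x) = t * ff (\<lambda>x. t * ?p x) ?p"
        unfolding ff_def by (simp add: mult.left_commute)
      then have "t^2 * (hn ?p)^2 = t * ff (\<lambda>x. t * ?p x) ?p"
        using NehariD(3)[OF t(2)] by (simp add: hn_cmult[OF P(1)] power_mult_distrib)
      then have "t * (t * (hn ?p)^2) = t * ff (\<lambda>x. t * ?p x) ?p"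
        unfolding power2_eq_square[of t] mult.assoc .
      then show ?thesis using t(1) by simp
    qed
    have t1: "t \<le> 1"
    proof (rule ccontr)
      assume "\<not> t \<le> 1"
      then have "t * ff (\<lambda>x. 1 * ?p x) ?p < 1 * ff (\<lambda>x. t * ?p x) ?p"
        by (intro ff_scaled_strict_mono[OF pS pnz]) simp_all
      then have "t * ff ?p ?p < t * (hn ?p)^2" using tff by simp
      then show False using le t(1) by simp
    qed
    have Hi: "integrable (L \<Omega>) (\<lambda>x. f x (w x) * w x / 2 - Fprim f x (w x))" if "w \<in> S2" for w
      using ff_integrable[OF that that] F_integrable[OF that] by simp
    have "In (\<lambda>x. t * ?p x) < In u"
      unfolding In_Nehari[OF t(2)] In_Nehari[OF u]
    proof (rule integral_strict_mono[OF Hi[OF sqint_cmult[OF pS]] Hi[OF uS] _ _ nnz])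
      show "AE x in L \<Omega>. f x (t * ?p x) * (t * ?p x) / 2 - Fprim f x (t * ?p x) \<le> f x (u x) * u x / 2 - Fprim f x (u x)"
        using AE_al
      proof eventually_elim
        case (elim x)
        interpret asymptotically_linear "f x" "Fprim f x" "\<alpha> x" "\<eta> x" by (rule elim)
        show ?case using H_mono[of t 1 "u x"] t(1) t1 H_nonneg[of "u x"] H_zero by (auto simp: H_def pospart_eq)
      qed
      show "AE x in L \<Omega>. negpart u x \<noteq> 0 \<longrightarrow> f x (t * ?p x) * (t * ?p x) / 2 - Fprim f x (t * ?p x) < f x (u x) * u x / 2 - Fprim f x (u x)"
        using AE_al
      proof eventually_elim
        case (elim x)
        interpret asymptotically_linear "f x" "Fprim f x" "\<alpha> x" "\<eta> x" by (rule elim)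
        show ?case using H_pos[of "u x"] H_zero by (auto simp: H_def pospart_eq negpart_eq)
      qed
    qed
    then show ?thesis using Inf_le_In[OF t(2)] min by simp
  qed
qed

text \<open>Each ray through \<open>SA\<close> meets the Nehari set at a point where I attains its
  maximum along the ray, and each Nehari point arises in this way. Hence the two sets of values
  coincide, not merely their infima.\<close>

lemma Nehari_level_minimax:
  "Inf (In ` N) = Inf ((\<lambda>v. Sup ((\<lambda>t. In (\<lambda>x. t * v x)) ` {0<..})) ` SA \<Omega> \<eta>)"
proof -
  have Sup_eq: "Sup ((\<lambda>t. In (\<lambda>x. t * v x)) ` {0<..}) = In (\<lambda>x. s * v x)"
    if s: "s > 0" "(\<lambda>x. s * v x) \<in> N" for s v
  proof (rule cSup_eq_maximum)
    show "In (\<lambda>x. s * v x) \<in> (\<lambda>t. In (\<lambda>x. t * v x)) ` {0<..}" using s(1) by simp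
    fix y assume "y \<in> (\<lambda>t. In (\<lambda>x. t * v x)) ` {0<..}"
    then obtain t where t: "t > 0" "y = In (\<lambda>x. t * v x)" by auto
    have "In (\<lambda>x. (t / s) * (s * v x)) \<le> In (\<lambda>x. s * v x)" by (rule Nehari_maximal[OF s(2)]) (use s(1) t(1) in simp)
    then show "y \<le> In (\<lambda>x. s * v x)" using s(1) t(2) by simp
  qed
  have "In ` N = (\<lambda>v. Sup ((\<lambda>t. In (\<lambda>x. t * v x)) ` {0<..})) ` SA \<Omega> \<eta>"
  proof (intro equalityI image_subsetI)
    fix u assume u: "u \<in> N"
    let ?v = "\<lambda>x. inverse (hn u) * u x"
    note h = Nehari_normalized[OF u]
    have "hn u * ?v x = u x" for x using h(1) by simp
    then have e: "(\<lambda>x. hn u * ?v x) = u" by (rule ext)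
    have "In u = Sup ((\<lambda>t. In (\<lambda>x. t * ?v x)) ` {0<..})"
      using Sup_eq[OF h(1), of ?v] u unfolding e by simp
    then show "In u \<in> (\<lambda>v. Sup ((\<lambda>t. In (\<lambda>x. t * v x)) ` {0<..})) ` SA \<Omega> \<eta>" by (rule image_eqI[OF _ h(2)])
  next
    fix v assume v: "v \<in> SA \<Omega> \<eta>"
    obtain s where s: "s > 0" "(\<lambda>x. s * v x) \<in> N" by (rule Nehari_projection_gap[OF SA_props(1,3)[OF v]], rule that)
    show "Sup ((\<lambda>t. In (\<lambda>x. t * v x)) ` {0<..}) \<in> In ` N"
      unfolding Sup_eq[OF s] using s(2) by (rule imageI)
  qed
  then show ?thesis by (rule arg_cong)
qed

end

theorem theorem1p1:
  fixes \<Omega> :: "(real^'n::finite) set"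
    and f :: "real^'n \<Rightarrow> real \<Rightarrow> real"
    and \<alpha> \<eta> :: "real^'n \<Rightarrow> real"
    and m :: nat
  assumes N3: "CARD('n) \<ge> 3"
    and dom: "smooth_bounded_domain \<Omega>"
    and carat: "caratheodory \<Omega> f"
    and f1_mono: "AE x in L \<Omega>.
          (\<forall>s t. 0 < s \<and> s < t \<longrightarrow> f x s / s < f x t / t) \<and>
          (\<forall>s t. s < t \<and> t < 0 \<longrightarrow> f x s / s > f x t / t)"
    and f1_lim0: "AE x in L \<Omega>. ((\<lambda>t. f x t / t) \<longlongrightarrow> \<alpha> x) (at 0)"
    and f1_liminf: "AE x in L \<Omega>. ((\<lambda>t. f x t / t) \<longlongrightarrow> \<eta> x) at_infinity"
    and alpha_nonneg: "AE x in L \<Omega>. \<alpha> x \<ge> 0"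
    and alpha_Linf: "\<alpha> \<in> Linf \<Omega>"
    and eta_Linf: "\<eta> \<in> Linf \<Omega>"
    and m_pos: "m \<ge> 1"
    and f2: "eig \<Omega> \<eta> m < 1" "1 < eig \<Omega> \<alpha> 1"
    and beta_cond: "ess_inf_ereal \<Omega> (beta f) >
          ereal (Linf_norm \<Omega> \<eta> * (Inf (t_of \<Omega> f ` SA \<Omega> \<eta>))^2) /
          (2 * eig \<Omega> (\<lambda>x. \<eta> x - \<alpha> x) 1 * ereal (sobolev_S \<Omega> powr (real CARD('n) / 2)))"
  shows "\<exists>u. weak_solution \<Omega> f u \<and> u \<in> Nehari \<Omega> f \<and>
             Ifun \<Omega> f u = Inf (Ifun \<Omega> f ` Nehari \<Omega> f) \<and>
             Inf (Ifun \<Omega> f ` Nehari \<Omega> f) =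
               Inf ((\<lambda>v. Sup ((\<lambda>t. Ifun \<Omega> f (\<lambda>x. t * v x)) ` {0<..})) ` SA \<Omega> \<eta>) \<and>
             ((AE x in L \<Omega>. u x \<ge> 0) \<or> (AE x in L \<Omega>. u x \<le> 0))"
proof -
  have dom': "open \<Omega>" "bounded \<Omega>" "connected \<Omega>" using dom by (simp_all add: smooth_bounded_domain_def)
  interpret bounded_open \<Omega> by unfold_locales (rule dom')+
  obtain A where A: "A > 0" "AE x in L \<Omega>. \<bar>\<alpha> x\<bar> \<le> A" by (rule LinfE[OF alpha_Linf], rule that)
  obtain B where B: "B > 0" "AE x in L \<Omega>. \<bar>\<eta> x\<bar> \<le> B" by (rule LinfE[OF eta_Linf], rule that)
  have cont: "AE x in L \<Omega>. continuous_on UNIV (f x)" using carat by (simp add: caratheodory_def)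
  interpret nehari_problem \<Omega> f \<alpha> \<eta> "A + B"
  proof unfold_locales
    show "AE x in L \<Omega>. asymptotically_linear (f x) (Fprim f x) (\<alpha> x) (\<eta> x)"
      using cont f1_mono f1_lim0 f1_liminf
    proof eventually_elim
      case (elim x)
      show ?case
      proof
        show "continuous_on UNIV (f x)" by (rule elim(1))
        show "f x s / s < f x t / t" if "0 < s" "s < t" for s t using elim(2) that by blast
        show "f x s / s > f x t / t" if "s < t" "t < 0" for s t using elim(2) that by blast
        show "((\<lambda>t. f x t / t) \<longlongrightarrow> \<alpha> x) (at 0)" by (rule elim(3))
        show "((\<lambda>t. f x t / t) \<longlongrightarrow> \<eta> x) at_infinity" by (rule elim(4))
        show "Fprim f x 0 = 0" by (simp add: Fprim_def zero_ereal_def)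
        show "(Fprim f x has_real_derivative f x t) (at t)" for t by (rule Fprim_DERIV[of f x, OF elim(1)])
      qed
    qed
    show "AE x in L \<Omega>. \<bar>\<alpha> x\<bar> + \<bar>\<eta> x\<bar> \<le> A + B" using A(2) B(2) by eventually_elim simp
    show "A + B > 0" using A(1) B(1) by simp
  qed (fact carat alpha_Linf eta_Linf)+
  interpret nehari_gap \<Omega> f \<alpha> \<eta> "A + B"
  proof unfold_locales
    show "connected \<Omega>" by (rule dom'(3))
    show "wform \<alpha> u u < (hn u)^2" if "u \<in> H01 \<Omega>" "\<not> is_zero \<Omega> u" for u
      by (rule eig_1_gt_1_imp[OF alpha_Linf f2(2) that])
    obtain e where "e \<in> H01 \<Omega>" "(hn e)^2 < wform \<eta> e e" by (rule eig_lt_1_imp[OF f2(1)], rule that)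
    then show "\<exists>e\<in>H01 \<Omega>. (hn e)^2 < wform \<eta> e e" by blast
  qed
  obtain u where u: "u \<in> N" "In u = Inf (In ` N)" by (rule minimizer_exists, rule that)
  have "weak_solution \<Omega> f u" by (rule minimizer_weak_solution[OF u(1)]) (use Inf_le_In u(2) in simp)
  then show ?thesis using u Nehari_level_minimax minimizer_sign[OF u] by blast
qed

end
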